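(* Let $A$ be a finite dimensional Hopf algebra over a field $k$ with invertible antipode, let $T=T_1\cup\cdots\cup T_n$ be an $n$-component framed ordered tangle and let $D$ be a diagram of $T$. Let $J(T)$ be the universal quantum invariant of $T$ associated to the ribbon Hopf algebra $D(A)^{\theta}$, let $\phi\colon D(A)^{\theta}\to (H(A)\otimes H(A)^{\mathrm{op}})^{\bar\theta}$ be Kashaev's homomorphism, and let $J''(D)=\bigl(\prod_i\bar\theta_i^{\,d(D_i)}\bigr)J'(D_{(\leftarrow)})$ be the element built from the Heisenberg double. Then $$\phi^{\otimes n}\bigl(J(T)\bigr)=J''(D)\quad\in\ \bigotimes_{i=1}^n \bigl(H(A)\otimes H(A)^{\mathrm{op}}\bigr)^{\bar\theta}_i .$$
   Context: **Algebra.** $A$ has antipode $\gamma$, $\bar\gamma=\gamma^{-1}$, Sweedler notation $\Delta(x)=\sum x'\otimes x''$, etc.; $A^*$ is the dual Hopf algebra (structure maps the transposes of those of $A$); $\bar\gamma^*$ is the transpose of $\bar\gamma$. $\{e_a\}$ is a basis of $A$, $\{e^a\}$ the dual basis of $A^*$. In formulas "?" is the place of the variable of a functional. Drinfeld double $D(A)=A^*\otimes A$: product $(f\otimes a)(g\otimes b)=\sum f\,g(\bar\gamma(a''')\,?\,a')\otimes a''b$, unit $1\otimes 1$, $\Delta(f\otimes a)=\sum (f''\otimes a')\otimes(f'\otimes a'')$, counit $f(1)\varepsilon(a)$, antipode $\gamma(f\otimes a)=(1\otimes\gamma(a))(\bar\gamma^*(f)\otimes 1)$, universal $R$-matrix $R=\sum_a(1\otimes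 e_a)\otimes(e^a\otimes 1)=\sum\alpha\otimes\beta$; write $R^{-1}=\sum\alpha^-\otimes\beta^-$. Put $u=\sum\gamma(\beta)\alpha$. $D(A)^\theta=D(A)[\theta]/(\theta^2-u\gamma(u))$ is the ribbon Hopf algebra with ribbon element $\theta$ (so $\theta$ is central and invertible, $\gamma(\theta)=\theta$, $\varepsilon(\theta)=1$, $\Delta(\theta)=(R_{21}R)^{-1}(\theta\otimes\theta)$). Heisenberg double $H(A)=A^*\otimes A$: product $(f\otimes a)(g\otimes b)=\sum f\,g(?\,a')\otimes a''b$, unit $1\otimes 1$. We write $x$ for $1\otimes x$ and $f$ for $f\otimes 1$ ($x\in A$, $f\in A^*$). $H(A)^{\mathrm{op}}$ is the opposite algebra. $\phi\colon D(A)\to H(A)\otimes H(A)^{\mathrm{op}}$ is the algebra homomorphism $\phi(f\otimes x)=\sum\langle f',x'''\rangle\,(f'''\otimes x')\otimes(\bar\gamma^*(f'')\otimes\gamma(x''))$. Put $(H(A)\otimes H(A)^{\mathrm{op}})^{\bar\theta}=(H(A)\otimes H(A)^{\mathrm{op}})[\bar\theta]/(\bar\theta^2-\phi(u\gamma(u)))$ and extend $\phi$ to $D(A)^\theta$ by $\phi(\theta)=\bar\theta$. For an algebra $B$ let $N_B=\mathrm{Span}_k\{ab-ba\}$. For a tangle $T$, put $B_i=B$ if $\partial T_i\neq\emptyset$ and $B_i=B/N_B$ if $\partial T_i=\emptyset$. This defines $(H(A)\otimes H(A)^{\mathrm{op}})^{\bar\theta}_i$ and the target $\bigotimes_i D(A)^\theta_i$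 of $J$; $\phi^{\otimes n}$ denotes the induced map. $\bar\theta_i$ is $\bar\theta$ placed in the $i$th tensorand. **Tangles and diagrams.** A tangle is a proper embedding in $[0,1]^3$ of a compact oriented 1-manifold with boundary on $[0,1]\times\{0,1\}\times\{1/2\}$; diagrams are obtained by projecting to the $(x,y)$-plane ($y$ is the vertical direction), with blackboard framing. Diagrams are obtained by pasting horizontally and vertically copies of: a vertical strand, the crossing $X_+$ (over-strand joining upper right to lower left), the crossing $X_-$ (over-strand joining upper left to lower right), local maxima and local minima, with arbitrary orientations. **Definition of $J$.** Put labels on the diagram: at $X_+$ put $\sum\gamma'(\alpha)$ on the under-strand and $\gamma'(\beta)$ on the over-strand; at $X_-$ put $\sum\gamma'(\alpha^-)$ on the under-strand and $\gamma'(\beta^-)$ on the over-strand, where $\gamma'$ is $\gamma$ if the strand is oriented upwards and the identity otherwise; put $u\theta^{-1}$ on each minimum oriented left to right, $u^{-1}\theta$ on each maximum oriented left to right; no label elsewhere. The $i$th tensorand of $J(T)$ is the product of the labels on the $i$th component, read along the component against its orientation and written from left to right (from an arbitrary base point if the component is closed). $J(T)$ is an isotopy invariant of framed tangles. **Definition of $J'$.** Let $\tilde e_a=\gamma(e_a)$, $\tilde e^a=\bar\gamma^*(e^a)$ and $S=\sum e_a\otimes e^a\in H(A)\otimes H(A)$, $S'=\sum\tilde e_a\otimes e^a\in H(A)^{\mathrm{op}}\otimes H(A)$, $S''=\sum e_a\otimes\tilde e^a\in H(A)\otimes H(A)^{\mathrm{op}}$, $\tilde S=\sum\tilde e_a\otimes\tilde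 e^a\in H(A)^{\mathrm{op}}\otimes H(A)^{\mathrm{op}}$. Their inverses are $S^{-1}=\sum\gamma(e_a)\otimes e^a$, $(S')^{-1}=\sum\gamma(\tilde e_a)\otimes e^a$, $(S'')^{-1}=\sum\gamma(e_a)\otimes\tilde e^a$, $\tilde S^{-1}=\sum\gamma(\tilde e_a)\otimes\tilde e^a$. For a tangle diagram $D$, $\zeta(D)$ is obtained by replacing each strand of $D$ by two parallel (blackboard) copies with the same orientation, the copy on the left-hand side with respect to the orientation being called thick and the other thin. At each crossing of $\zeta(D)$ put labels: let $Y=S,S',S'',\tilde S$ according to whether (under-strand, over-strand) is (thin, thin), (thick, thin), (thin, thick), (thick, thick). At an $X_+$ put $(\gamma'\otimes(\bar\gamma^* )')(Y)$, at an $X_-$ put $(\gamma'\otimes(\bar\gamma^* )')(Y^{-1})$, with the first tensor factor (in $A$) on the under-strand and the second (in $A^*$) on the over-strand; $\gamma'$ (resp. $(\bar\gamma^* )'$) is $\gamma$ (resp. $\bar\gamma^*$) if the strand concerned is oriented upwards and the identity otherwise. No other labels. Then $J'(D)\in\bigotimes_i(H(A)\otimes H(A)^{\mathrm{op}})^{\bar\theta}_i$ has as $(2i-1)$st (resp. $2i$th) tensorand the product in $H(A)$ (resp. in $H(A)^{\mathrm{op}}$) of the labels on the thin (resp. thick) copy of the $i$th component, read against the orientation and written from left to right; for a closed component both copies are read starting from the two copies of one chosen point. **$D_{(\leftarrow)}$, $d$ and $J''$.** $D_{(\leftarrow)}$ is obtained from $D$ by replacing each maximum oriented left to right by a curl having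 one positive crossing and one maximum, oriented right to left (the strand goes up from lower left to upper right, turns right-to-left, and goes down from upper left to lower right, passing over), and each minimum oriented left to right by a curl having one negative crossing and one minimum, oriented right to left (the strand goes down from upper left to lower right, turns right-to-left, and goes up from lower left to upper right, passing over). $D_i$ is the part of $D$ corresponding to $T_i$, and $d(D_i)$ is the number of left-to-right maxima minus the number of left-to-right minima of $D_i$. $J''(D)=\bigl(\prod_i\bar\theta_i^{\,d(D_i)}\bigr)J'(D_{(\leftarrow)})$. *)

theory Defs
  imports "HOL-Analysis.Analysis" "HOL-Library.Poly_Mapping"
begin

section \<open>Finite-dimensional algebras in coordinates\<close>

text \<open>The standard basis of \<^typ>\<open>'k^'m\<close> consists of the vectors \<^term>\<open>axis p 1\<close>. The tensor
  product of \<^typ>\<open>'k^'m\<close> and \<^typ>\<open>'k^'n\<close> is \<^typ>\<open>'k^('m \<times> 'n)\<close>.\<close>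

definition tens :: "'k::field ^ 'm::finite \<Rightarrow> 'k ^ 'n::finite \<Rightarrow> 'k ^ ('m \<times> 'n)" where
  "tens x y = (\<chi> p. x $ fst p * y $ snd p)"

definition lin :: "('m::finite \<Rightarrow> 'k::field ^ 'l::finite) \<Rightarrow> 'k ^ 'm \<Rightarrow> 'k ^ 'l" where
  "lin f x = (\<Sum>p\<in>UNIV. x $ p *s f p)"

definition bilin ::
  "('m::finite \<Rightarrow> 'n::finite \<Rightarrow> 'k::field ^ 'l::finite) \<Rightarrow> 'k ^ 'm \<Rightarrow> 'k ^ 'n \<Rightarrow> 'k ^ 'l" where
  "bilin f x y = (\<Sum>p\<in>UNIV. \<Sum>q\<in>UNIV. (x $ p * y $ q) *s f p q)"

type_synonym ('k, 'm) mult = "'k ^ 'm \<Rightarrow> 'k ^ 'm \<Rightarrow> 'k ^ 'm"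

definition tensor_mult ::
  "('k::field, 'm::finite) mult \<Rightarrow> ('k, 'n::finite) mult \<Rightarrow> ('k, 'm \<times> 'n) mult" where
  "tensor_mult m1 m2 = bilin (\<lambda>(p, q) (p', q').
     tens (m1 (axis p 1) (axis p' 1)) (m2 (axis q 1) (axis q' 1)))"

definition opp_mult :: "('k::field, 'm::finite) mult \<Rightarrow> ('k, 'm) mult" where
  "opp_mult m x y = m y x"

definition mult_inverse :: "('b \<Rightarrow> 'b \<Rightarrow> 'b) \<Rightarrow> 'b \<Rightarrow> 'b \<Rightarrow> 'b" where
  "mult_inverse m one x = (THE y. m x y = one \<and> m y x = one)"

section \<open>Finite-dimensional Hopf algebras\<close>

text \<open>The ring structure of the Hopf algebra is that of the type \<^typ>\<open>'a\<close>; \<open>basis\<close> is the basis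
  \<open>e\<^sub>a\<close>. The value \<open>comul A x $ (i, j)\<close> is the coefficient of \<open>e\<^sub>i \<otimes> e\<^sub>j\<close> in \<open>\<Delta>(x)\<close>.\<close>

record ('k, 'a, 'i) hopf_data =
  scale :: "'k \<Rightarrow> 'a \<Rightarrow> 'a"
  basis :: "'i \<Rightarrow> 'a"
  comul :: "'a \<Rightarrow> 'k ^ ('i \<times> 'i)"
  counit :: "'a \<Rightarrow> 'k"
  antipode :: "'a \<Rightarrow> 'a"

definition coord :: "('k::field, 'a::ring_1, 'i::finite) hopf_data \<Rightarrow> 'a \<Rightarrow> 'k ^ 'i" where
  "coord A x = (\<chi> i. module.representation (scale A) (range (basis A)) x (basis A i))"

definition hopf_algebra :: "('k::field, 'a::ring_1, 'i::finite) hopf_data \<Rightarrow> bool" where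
  "hopf_algebra A \<longleftrightarrow>
     finite_dimensional_vector_space (scale A) (range (basis A)) \<and> inj (basis A) \<and>
     (\<forall>c x y. scale A c x * y = scale A c (x * y) \<and> x * scale A c y = scale A c (x * y)) \<and>
     Vector_Spaces.linear (scale A) (*s) (comul A) \<and>
     Vector_Spaces.linear (scale A) (*) (counit A) \<and>
     Vector_Spaces.linear (scale A) (scale A) (antipode A) \<and>
     (\<forall>x i j l. (\<Sum>m\<in>UNIV. comul A x $ (m, l) * comul A (basis A m) $ (i, j))
              = (\<Sum>m\<in>UNIV. comul A x $ (i, m) * comul A (basis A m) $ (j, l))) \<and>
     (\<forall>x. (\<Sum>(i, j)\<in>UNIV. scale A (comul A x $ (i, j) * counit A (basis A i)) (basis A j)) = x) \<and>
     (\<forall>x. (\<Sum>(i, j)\<in>UNIV. scale A (comul A x $ (i, j) * counit A (basis A j)) (basis A i)) = x) \<and>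
     (\<forall>x y. comul A (x * y) = (\<Sum>(i, j)\<in>UNIV. \<Sum>(l, m)\<in>UNIV. (comul A x $ (i, j) * comul A y $ (l, m))
         *s tens (coord A (basis A i * basis A l)) (coord A (basis A j * basis A m)))) \<and>
     comul A 1 = tens (coord A 1) (coord A 1) \<and>
     (\<forall>x y. counit A (x * y) = counit A x * counit A y) \<and> counit A 1 = 1 \<and>
     (\<forall>x. (\<Sum>(i, j)\<in>UNIV. scale A (comul A x $ (i, j)) (antipode A (basis A i) * basis A j))
          = scale A (counit A x) 1) \<and>
     (\<forall>x. (\<Sum>(i, j)\<in>UNIV. scale A (comul A x $ (i, j)) (basis A i * antipode A (basis A j)))
          = scale A (counit A x) 1)"

abbreviation antipode_inv :: "('k, 'a, 'i) hopf_data \<Rightarrow> 'a \<Rightarrow> 'a" where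
  "antipode_inv A \<equiv> inv (antipode A)"

text \<open>Coefficients of \<open>\<Sum> x' \<otimes> x'' \<otimes> x'''\<close>.\<close>

definition comul3 :: "('k::field, 'a::ring_1, 'i::finite) hopf_data \<Rightarrow> 'a \<Rightarrow> 'k ^ ('i \<times> 'i \<times> 'i)" where
  "comul3 A x = vec_lambda (\<lambda>(i, j, l).
     \<Sum>m\<in>UNIV. comul A x $ (m, l) * comul A (basis A m) $ (i, j))"

text \<open>Elements of the dual \<open>A\<^sup>*\<close> are (linear) functions \<^typ>\<open>'a \<Rightarrow> 'k\<close>. The transposed structure maps
  are: product \<open>dual_mult\<close>, unit the counit of \<open>A\<close>, coproduct with coefficients
  \<open>f(e\<^sub>i e\<^sub>j)\<close> at \<open>e\<^sup>i \<otimes> e\<^sup>j\<close>, and antipode \<open>f \<mapsto> f \<circ> \<gamma>\<close>.\<close>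

definition dual_basis :: "('k::field, 'a::ring_1, 'i::finite) hopf_data \<Rightarrow> 'i \<Rightarrow> 'a \<Rightarrow> 'k" where
  "dual_basis A i = (\<lambda>x. coord A x $ i)"

definition dual_mult ::
  "('k::field, 'a::ring_1, 'i::finite) hopf_data \<Rightarrow> ('a \<Rightarrow> 'k) \<Rightarrow> ('a \<Rightarrow> 'k) \<Rightarrow> 'a \<Rightarrow> 'k" where
  "dual_mult A f g = (\<lambda>x. \<Sum>(i, j)\<in>UNIV. comul A x $ (i, j) * f (basis A i) * g (basis A j))"

type_synonym ('k, 'i) double = "('k, 'i \<times> 'i) vec"
type_synonym ('k, 'i) double2 = "('k, ('i \<times> 'i) \<times> ('i \<times> 'i)) vec"

text \<open>The element \<open>f \<otimes> a\<close> of \<open>A\<^sup>* \<otimes> A\<close>; the basis vector of index \<open>(i, j)\<close> is \<open>e\<^sup>i \<otimes> e\<^sub>j\<close>.\<close>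

definition dtens ::
  "('k::field, 'a::ring_1, 'i::finite) hopf_data \<Rightarrow> ('a \<Rightarrow> 'k) \<Rightarrow> 'a \<Rightarrow> ('k, 'i) double" where
  "dtens A f a = tens (\<chi> i. f (basis A i)) (coord A a)"

section \<open>Drinfeld double\<close>

definition drinfeld_pure_mult :: "('k::field, 'a::ring_1, 'i::finite) hopf_data \<Rightarrow>
    ('a \<Rightarrow> 'k) \<Rightarrow> 'a \<Rightarrow> ('a \<Rightarrow> 'k) \<Rightarrow> 'a \<Rightarrow> ('k, 'i) double" where
  "drinfeld_pure_mult A f a g b = (\<Sum>(p, q, r)\<in>UNIV. comul3 A a $ (p, q, r) *s
     dtens A (dual_mult A f (\<lambda>x. g (antipode_inv A (basis A r) * x * basis A p))) (basis A q * b))"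

definition drinfeld_mult ::
  "('k::field, 'a::ring_1, 'i::finite) hopf_data \<Rightarrow> ('k, 'i \<times> 'i) mult" where
  "drinfeld_mult A = bilin (\<lambda>(i, j) (l, m).
     drinfeld_pure_mult A (dual_basis A i) (basis A j) (dual_basis A l) (basis A m))"

text \<open>The common unit of the Drinfeld double and the Heisenberg double.\<close>

definition double_one :: "('k::field, 'a::ring_1, 'i::finite) hopf_data \<Rightarrow> ('k, 'i) double" where
  "double_one A = dtens A (counit A) 1"

definition drinfeld_antipode ::
  "('k::field, 'a::ring_1, 'i::finite) hopf_data \<Rightarrow> ('k, 'i) double \<Rightarrow> ('k, 'i) double" where
  "drinfeld_antipode A = lin (\<lambda>(i, j). drinfeld_mult A
     (dtens A (counit A) (antipode A (basis A j)))
     (dtens A (dual_basis A i \<circ> antipode_inv A) 1))"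

definition R_matrix ::
  "('k::field, 'a::ring_1, 'i::finite) hopf_data \<Rightarrow> ('k, 'i) double2" where
  "R_matrix A = (\<Sum>a\<in>UNIV. tens (dtens A (counit A) (basis A a)) (dtens A (dual_basis A a) 1))"

definition R_inverse ::
  "('k::field, 'a::ring_1, 'i::finite) hopf_data \<Rightarrow> ('k, 'i) double2" where
  "R_inverse A = mult_inverse (tensor_mult (drinfeld_mult A) (drinfeld_mult A))
     (tens (double_one A) (double_one A)) (R_matrix A)"

definition drinfeld_u :: "('k::field, 'a::ring_1, 'i::finite) hopf_data \<Rightarrow> ('k, 'i) double" where
  "drinfeld_u A = lin (\<lambda>(x, y).
     drinfeld_mult A (drinfeld_antipode A (axis y 1)) (axis x 1)) (R_matrix A)"

definition theta_square :: "('k::field, 'a::ring_1, 'i::finite) hopf_data \<Rightarrow> ('k, 'i) double" where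
  "theta_square A = drinfeld_mult A (drinfeld_u A) (drinfeld_antipode A (drinfeld_u A))"

section \<open>Heisenberg double and the homomorphism \<open>\<phi>\<close>\<close>

definition heisenberg_pure_mult :: "('k::field, 'a::ring_1, 'i::finite) hopf_data \<Rightarrow>
    ('a \<Rightarrow> 'k) \<Rightarrow> 'a \<Rightarrow> ('a \<Rightarrow> 'k) \<Rightarrow> 'a \<Rightarrow> ('k, 'i) double" where
  "heisenberg_pure_mult A f a g b = (\<Sum>(p, q)\<in>UNIV. comul A a $ (p, q) *s
     dtens A (dual_mult A f (\<lambda>x. g (x * basis A p))) (basis A q * b))"

definition heisenberg_mult ::
  "('k::field, 'a::ring_1, 'i::finite) hopf_data \<Rightarrow> ('k, 'i \<times> 'i) mult" where
  "heisenberg_mult A = bilin (\<lambda>(i, j) (l, m).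
     heisenberg_pure_mult A (dual_basis A i) (basis A j) (dual_basis A l) (basis A m))"

definition HHop_mult :: "('k::field, 'a::ring_1, 'i::finite) hopf_data \<Rightarrow>
    ('k, ('i \<times> 'i) \<times> ('i \<times> 'i)) mult" where
  "HHop_mult A = tensor_mult (heisenberg_mult A) (opp_mult (heisenberg_mult A))"

definition HHop_one :: "('k::field, 'a::ring_1, 'i::finite) hopf_data \<Rightarrow>
    ('k, 'i) double2" where
  "HHop_one A = tens (double_one A) (double_one A)"

text \<open>In the sum, \<open>e\<^sup>a \<otimes> e\<^sup>b \<otimes> e\<^sup>c\<close> stands for \<open>f' \<otimes> f'' \<otimes> f'''\<close> and \<open>e\<^sub>i \<otimes> e\<^sub>j \<otimes> e\<^sub>l\<close> for
  \<open>x' \<otimes> x'' \<otimes> x'''\<close>.\<close>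

definition phi_pure :: "('k::field, 'a::ring_1, 'i::finite) hopf_data \<Rightarrow>
    ('a \<Rightarrow> 'k) \<Rightarrow> 'a \<Rightarrow> ('k, 'i) double2" where
  "phi_pure A f x = (\<Sum>(a, b, c)\<in>UNIV. \<Sum>(i, j, l)\<in>UNIV.
     (f (basis A a * basis A b * basis A c) * comul3 A x $ (i, j, l) * dual_basis A a (basis A l)) *s
     tens (dtens A (dual_basis A c) (basis A i))
          (dtens A (dual_basis A b \<circ> antipode_inv A) (antipode A (basis A j))))"

definition phi :: "('k::field, 'a::ring_1, 'i::finite) hopf_data \<Rightarrow>
    ('k, 'i) double \<Rightarrow> ('k, 'i) double2" where
  "phi A = lin (\<lambda>(i, j). phi_pure A (dual_basis A i) (basis A j))"

section \<open>Adjoining a square root, and tensor products of the resulting algebras\<close>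

datatype 'b letter = Coeff 'b | Theta

type_synonym ('k, 'b) free_algebra = "'b letter list \<Rightarrow>\<^sub>0 'k"

text \<open>The algebra obtained from \<open>B\<close> by adjoining \<open>\<theta>\<close> with \<open>\<theta>\<^sup>2 = w\<close> is presented as a quotient of the
  free algebra on the letters \<open>Coeff b\<close> (\<open>b \<in> B\<close>) and \<open>Theta\<close>, whose elements are the formal linear
  combinations \<^typ>\<open>'b letter list \<Rightarrow>\<^sub>0 'k\<close> of words. The relations in \<open>adjoin_rels\<close> span the
  two-sided ideal that makes \<open>Coeff\<close> an algebra homomorphism, \<open>\<theta>\<^sup>2 = w\<close>, and \<open>\<theta> c = c \<theta>\<close> for \<open>c \<in> C\<close>.
  For \<open>C = B\<close> this is \<open>B[\<theta>]/(\<theta>\<^sup>2 - w)\<close>.\<close>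

definition pm_scale :: "'k::field \<Rightarrow> ('w \<Rightarrow>\<^sub>0 'k) \<Rightarrow> ('w \<Rightarrow>\<^sub>0 'k)" where
  "pm_scale c = Poly_Mapping.map ((*) c)"

definition pm_push :: "('v \<Rightarrow> 'w) \<Rightarrow> ('v \<Rightarrow>\<^sub>0 'k::field) \<Rightarrow> ('w \<Rightarrow>\<^sub>0 'k)" where
  "pm_push g x = (\<Sum>v\<in>Poly_Mapping.keys x. Poly_Mapping.single (g v) (Poly_Mapping.lookup x v))"

abbreviation gen :: "'w \<Rightarrow> ('w \<Rightarrow>\<^sub>0 'k::field)" where
  "gen v \<equiv> Poly_Mapping.single v 1"

definition adjoin_rels :: "('k::field, 'm::finite) mult \<Rightarrow> 'k ^ 'm \<Rightarrow> 'k ^ 'm \<Rightarrow> ('k ^ 'm) set \<Rightarrow>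
    ('k, 'k ^ 'm) free_algebra set" where
  "adjoin_rels m one w C =
     {gen (p @ [Coeff (c *s x + y)] @ q) - pm_scale c (gen (p @ [Coeff x] @ q)) - gen (p @ [Coeff y] @ q)
        | p q c x y. True} \<union>
     {gen (p @ [Coeff x, Coeff y] @ q) - gen (p @ [Coeff (m x y)] @ q) | p q x y. True} \<union>
     {gen (p @ [Coeff one] @ q) - gen (p @ q) | p q. True} \<union>
     {gen (p @ [Theta, Theta] @ q) - gen (p @ [Coeff w] @ q) | p q. True} \<union>
     {gen (p @ [Theta, Coeff x] @ q) - gen (p @ [Coeff x, Theta] @ q) | p q x. x \<in> C}"

text \<open>The commutators of words span the space \<open>N\<^sub>B\<close> of all commutators.\<close>

definition commutators :: "('k::field, 'b) free_algebra set" where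
  "commutators = {gen (p @ q) - gen (q @ p) | p q. True}"

text \<open>For the algebra \<open>B\<close> presented by \<open>rels\<close> and a list \<open>cl\<close> of truth values, \<open>\<Otimes>\<^sub>i B\<^sub>i\<close> with
  \<open>B\<^sub>i = B/N\<^sub>B\<close> if \<open>cl ! i\<close> and \<open>B\<^sub>i = B\<close> otherwise is the quotient of the tensor power of the free algebra,
  which has the lists of \<open>length cl\<close> words as its basis, by the relations in each tensorand. The elements
  of the quotient are the cosets \<open>tensor_class rels cl x\<close>.\<close>

definition tensor_rels :: "('k::field, 'b) free_algebra set \<Rightarrow> bool list \<Rightarrow>
    ('b letter list list \<Rightarrow>\<^sub>0 'k) set" where
  "tensor_rels rels cl = {pm_push (\<lambda>v. ws[i := v]) r | ws i r.
     length ws = length cl \<and> i < length cl \<and> r \<in> rels \<union> (if cl ! i then commutators else {})}"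

definition tensor_class :: "('k::field, 'b) free_algebra set \<Rightarrow> bool list \<Rightarrow>
    ('b letter list list \<Rightarrow>\<^sub>0 'k) \<Rightarrow> ('b letter list list \<Rightarrow>\<^sub>0 'k) set" where
  "tensor_class rels cl x = {y. y - x \<in> module.span pm_scale (tensor_rels rels cl)}"

definition drinfeld_theta_rels :: "('k::field, 'a::ring_1, 'i::finite) hopf_data \<Rightarrow>
    ('k, ('k, 'i) double) free_algebra set" where
  "drinfeld_theta_rels A = adjoin_rels (drinfeld_mult A) (double_one A) (theta_square A) UNIV"

text \<open>The algebra obtained from \<open>H(A) \<otimes> H(A)\<^sup>o\<^sup>p\<close> by adjoining a square root of \<open>\<phi>(u \<gamma>(u))\<close> that commutes
  with the elements of \<open>C\<close>; extending \<open>\<phi>\<close> by \<open>\<theta> \<mapsto> \<theta>\<close> needs \<open>range (phi A) \<subseteq> C\<close>. The choice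
  \<open>C = UNIV\<close> is the quotient of the polynomial ring in a central variable. As \<open>H(A) \<otimes> H(A)\<^sup>o\<^sup>p\<close> is a
  matrix algebra, that quotient is zero unless \<open>\<phi>(u \<gamma>(u))\<close> is a scalar, whereas the one for
  \<open>C = range (phi A)\<close> contains \<open>H(A) \<otimes> H(A)\<^sup>o\<^sup>p\<close>. A smaller \<open>C\<close> gives fewer relations.\<close>

definition HHop_theta_rels :: "('k::field, 'a::ring_1, 'i::finite) hopf_data \<Rightarrow>
    ('k, 'i) double2 set \<Rightarrow>
    ('k, ('k, 'i) double2) free_algebra set" where
  "HHop_theta_rels A C = adjoin_rels (HHop_mult A) (HHop_one A) (phi A (theta_square A)) C"

definition phi_tensor :: "('k::field, 'a::ring_1, 'i::finite) hopf_data \<Rightarrow>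
    ('k, 'i) double2 set \<Rightarrow> bool list \<Rightarrow>
    (('k, 'i) double letter list list \<Rightarrow>\<^sub>0 'k) set \<Rightarrow>
    (('k, 'i) double2 letter list list \<Rightarrow>\<^sub>0 'k) set" where
  "phi_tensor A C cl X = (\<Union>x\<in>X. tensor_class (HHop_theta_rels A C) cl
     (pm_push (map (map (map_letter (phi A)))) x))"

text \<open>\<open>\<theta>\<^sup>-\<^sup>1 = w\<^sup>-\<^sup>1 \<theta>\<close>, as a word, if \<open>winv\<close> is the inverse of \<open>w = \<theta>\<^sup>2\<close>.\<close>

definition theta_power :: "'b \<Rightarrow> int \<Rightarrow> 'b letter list" where
  "theta_power winv d = (if d \<ge> 0 then replicate (nat d) Theta
     else concat (replicate (nat (- d)) [Coeff winv, Theta]))"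

section \<open>Tangle diagrams\<close>

datatype dir = Up | Down
datatype hdir = LeftRight | RightLeft
datatype xing = XPlus | XMinus

text \<open>The parameter \<^typ>\<open>'c\<close> marks strands as thick or thin in doubled diagrams and is \<^typ>\<open>unit\<close> for
  ordinary ones. In \<open>Cross x du cu do co\<close> the under-strand has direction \<open>du\<close> and mark \<open>cu\<close>, the
  over-strand \<open>do\<close> and \<open>co\<close>. The over-strand joins lower left and upper right for \<open>XPlus\<close>, and
  lower right and upper left for \<open>XMinus\<close>, whatever the orientations are.\<close>

datatype 'c piece =
    Vert dir 'c
  | Cross xing dir 'c dir 'c
  | Maximum hdir 'c
  | Minimum hdir 'c

text \<open>A diagram is a list of rows from bottom to top, each row being a list of pieces from left to
  right.\<close>

type_synonym 'c diagram = "'c piece list list"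

fun flip :: "dir \<Rightarrow> dir" where
  "flip Up = Down"
| "flip Down = Up"

text \<open>Direction of the left leg of an extremum.\<close>

fun max_left :: "hdir \<Rightarrow> dir" where
  "max_left LeftRight = Up"
| "max_left RightLeft = Down"

fun min_left :: "hdir \<Rightarrow> dir" where
  "min_left LeftRight = Down"
| "min_left RightLeft = Up"

fun piece_bottom :: "'c piece \<Rightarrow> (dir \<times> 'c) list" where
  "piece_bottom (Vert d c) = [(d, c)]"
| "piece_bottom (Cross XPlus du cu do co) = [(do, co), (du, cu)]"
| "piece_bottom (Cross XMinus du cu do co) = [(du, cu), (do, co)]"
| "piece_bottom (Maximum e c) = [(max_left e, c), (flip (max_left e), c)]"
| "piece_bottom (Minimum e c) = []"

fun piece_top :: "'c piece \<Rightarrow> (dir \<times> 'c) list" where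
  "piece_top (Vert d c) = [(d, c)]"
| "piece_top (Cross XPlus du cu do co) = [(du, cu), (do, co)]"
| "piece_top (Cross XMinus du cu do co) = [(do, co), (du, cu)]"
| "piece_top (Maximum e c) = []"
| "piece_top (Minimum e c) = [(min_left e, c), (flip (min_left e), c)]"

definition is_diagram :: "'c diagram \<Rightarrow> bool" where
  "is_diagram D \<longleftrightarrow> (\<forall>h. Suc h < length D \<longrightarrow>
     concat (map piece_top (D ! h)) = concat (map piece_bottom (D ! Suc h)))"

text \<open>The endpoints on level \<open>h\<close> (the bottom of row \<open>h\<close> and top of row \<open>h - 1\<close>) are the points
  \<open>(h, p)\<close>, with \<open>p\<close> counted from the left. A crossing contributes two arcs, any other piece one;
  \<open>tail\<close> and \<open>head\<close> are with respect to the orientation.\<close>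

type_synonym point = "nat \<times> nat"

record 'c arc =
  tail :: point
  head :: point
  site :: point
  part :: "'c piece"
  over :: bool

definition directed_arc ::
  "dir \<Rightarrow> point \<Rightarrow> point \<Rightarrow> point \<Rightarrow> 'c piece \<Rightarrow> bool \<Rightarrow> 'c arc" where
  "directed_arc d P Q s p ov =
     (if d = Up then \<lparr>tail = P, head = Q, site = s, part = p, over = ov\<rparr>
      else \<lparr>tail = Q, head = P, site = s, part = p, over = ov\<rparr>)"

text \<open>For a piece in row \<open>h\<close> whose leftmost bottom and top points have positions \<open>b\<close> and \<open>t\<close>.\<close>

fun piece_arcs :: "nat \<Rightarrow> nat \<Rightarrow> nat \<Rightarrow> 'c piece \<Rightarrow> 'c arc set" where
  "piece_arcs h b t (Vert d c) =
     {directed_arc d (h, b) (Suc h, t) (h, b) (Vert d c) False}"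
| "piece_arcs h b t (Cross XPlus du cu do co) =
     {directed_arc du (h, Suc b) (Suc h, t) (h, b) (Cross XPlus du cu do co) False,
      directed_arc do (h, b) (Suc h, Suc t) (h, b) (Cross XPlus du cu do co) True}"
| "piece_arcs h b t (Cross XMinus du cu do co) =
     {directed_arc du (h, b) (Suc h, Suc t) (h, b) (Cross XMinus du cu do co) False,
      directed_arc do (h, Suc b) (Suc h, t) (h, b) (Cross XMinus du cu do co) True}"
| "piece_arcs h b t (Maximum e c) =
     {directed_arc (max_left e) (h, b) (h, Suc b) (h, b) (Maximum e c) False}"
| "piece_arcs h b t (Minimum e c) =
     {directed_arc (flip (min_left e)) (Suc h, t) (Suc h, Suc t) (h, b) (Minimum e c) False}"

fun row_arcs :: "nat \<Rightarrow> nat \<Rightarrow> nat \<Rightarrow> 'c piece list \<Rightarrow> 'c arc set" where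
  "row_arcs h b t [] = {}"
| "row_arcs h b t (p # ps) =
     piece_arcs h b t p \<union> row_arcs h (b + length (piece_bottom p)) (t + length (piece_top p)) ps"

definition arcs :: "'c diagram \<Rightarrow> 'c arc set" where
  "arcs D = (\<Union>h<length D. row_arcs h 0 0 (D ! h))"

definition crossings :: "'c diagram \<Rightarrow> xing \<Rightarrow> point set" where
  "crossings D x = {site a | a. a \<in> arcs D \<and> (\<exists>du cu do co. part a = Cross x du cu do co)}"

definition is_closed :: "'c arc list \<Rightarrow> bool" where
  "is_closed c \<longleftrightarrow> head (last c) = tail (hd c)"

text \<open>A component is listed along its orientation; a closed one is listed from a base point
  \<open>tail (hd c)\<close>.\<close>

definition is_component :: "'c diagram \<Rightarrow> 'c arc list \<Rightarrow> bool" where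
  "is_component D c \<longleftrightarrow> c \<noteq> [] \<and> distinct c \<and> set c \<subseteq> arcs D \<and>
     successively (\<lambda>a b. head a = tail b) c \<and>
     (is_closed c \<or>
      (\<forall>a\<in>arcs D. head a \<noteq> tail (hd c) \<and> tail a \<noteq> head (last c)))"

definition ordered_components :: "'c diagram \<Rightarrow> 'c arc list list \<Rightarrow> bool" where
  "ordered_components D cs \<longleftrightarrow>
     (\<forall>c\<in>set cs. is_component D c) \<and> distinct (concat cs) \<and> set (concat cs) = arcs D"

definition component_from :: "'c diagram \<Rightarrow> point \<Rightarrow> 'c arc list" where
  "component_from D P = (THE c. is_component D c \<and> tail (hd c) = P)"

section \<open>The invariant \<open>J\<close>\<close>

text \<open>A state assigns to each crossing a basis vector of \<open>D(A) \<otimes> D(A)\<close>, that is, one term in the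
  expansion of \<open>R\<close> or its inverse in that basis.\<close>

fun J_label :: "('k::field, 'a::ring_1, 'i::finite) hopf_data \<Rightarrow>
    (point \<Rightarrow> ('i \<times> 'i) \<times> ('i \<times> 'i)) \<Rightarrow> point \<Rightarrow> 'c piece \<Rightarrow> bool \<Rightarrow>
    ('k, 'i) double letter list" where
  "J_label A \<sigma> s (Vert d c) ov = []"
| "J_label A \<sigma> s (Cross x du cu do co) False =
     [Coeff ((if du = Up then drinfeld_antipode A else id) (axis (fst (\<sigma> s)) 1))]"
| "J_label A \<sigma> s (Cross x du cu do co) True =
     [Coeff ((if do = Up then drinfeld_antipode A else id) (axis (snd (\<sigma> s)) 1))]"
| "J_label A \<sigma> s (Maximum LeftRight c) ov =
     [Coeff (mult_inverse (drinfeld_mult A) (double_one A) (drinfeld_u A)), Theta]"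
| "J_label A \<sigma> s (Maximum RightLeft c) ov = []"
| "J_label A \<sigma> s (Minimum LeftRight c) ov =
     Coeff (drinfeld_u A) #
     theta_power (mult_inverse (drinfeld_mult A) (double_one A) (theta_square A)) (- 1)"
| "J_label A \<sigma> s (Minimum RightLeft c) ov = []"

definition univ_J :: "('k::field, 'a::ring_1, 'i::finite) hopf_data \<Rightarrow> unit diagram \<Rightarrow>
    unit arc list list \<Rightarrow> (('k, 'i) double letter list list \<Rightarrow>\<^sub>0 'k) set" where
  "univ_J A D cs = tensor_class (drinfeld_theta_rels A) (map is_closed cs)
     (\<Sum>\<sigma> \<in> crossings D XPlus \<union> crossings D XMinus \<rightarrow>\<^sub>E UNIV.
        pm_scale ((\<Prod>s\<in>crossings D XPlus. R_matrix A $ \<sigma> s) * (\<Prod>s\<in>crossings D XMinus. R_inverse A $ \<sigma> s))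
          (gen (map (\<lambda>c. concat (map (\<lambda>a. J_label A \<sigma> (site a) (part a) (over a)) (rev c))) cs)))"

section \<open>Doubled diagrams and \<open>J'\<close>\<close>

text \<open>Replace every row by \<open>n\<close> rows, in which a piece \<open>p\<close> becomes the part \<open>f p\<close>, a list of \<open>n\<close> rows.\<close>

definition refine :: "nat \<Rightarrow> ('b piece \<Rightarrow> 'c diagram) \<Rightarrow> 'b diagram \<Rightarrow> 'c diagram" where
  "refine n f D = concat (map (\<lambda>row. map (\<lambda>k. concat (map (\<lambda>p. f p ! k) row)) [0..<n]) D)"

datatype copy = Thick | Thin

fun left_copy :: "dir \<Rightarrow> copy" where
  "left_copy Up = Thick"
| "left_copy Down = Thin"

fun right_copy :: "dir \<Rightarrow> copy" where
  "right_copy Up = Thin"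
| "right_copy Down = Thick"

fun double_piece :: "unit piece \<Rightarrow> copy diagram" where
  "double_piece (Vert d _) = replicate 3 [Vert d (left_copy d), Vert d (right_copy d)]"
| "double_piece (Cross XPlus du _ do _) =
     [[Vert do (left_copy do), Cross XPlus du (left_copy du) do (right_copy do), Vert du (right_copy du)],
      [Cross XPlus du (left_copy du) do (left_copy do), Cross XPlus du (right_copy du) do (right_copy do)],
      [Vert du (left_copy du), Cross XPlus du (right_copy du) do (left_copy do), Vert do (right_copy do)]]"
| "double_piece (Cross XMinus du _ do _) =
     [[Vert du (left_copy du), Cross XMinus du (right_copy du) do (left_copy do), Vert do (right_copy do)],
      [Cross XMinus du (left_copy du) do (left_copy do), Cross XMinus du (right_copy du) do (right_copy do)],
      [Vert do (left_copy do), Cross XMinus du (left_copy du) do (right_copy do), Vert du (right_copy du)]]"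
| "double_piece (Maximum e _) = (let d = max_left e in
     [[Vert d (left_copy d), Maximum e (right_copy d), Vert (flip d) (left_copy d)],
      [Maximum e (left_copy d)],
      []])"
| "double_piece (Minimum e _) = (let d = min_left e in
     [[],
      [Minimum e (left_copy d)],
      [Vert d (left_copy d), Minimum e (right_copy d), Vert (flip d) (left_copy d)]])"

definition zeta :: "unit diagram \<Rightarrow> copy diagram" where
  "zeta D = refine 3 double_piece D"

text \<open>The level \<open>h\<close> of \<open>D\<close> becomes the level \<open>3 * h\<close> of \<open>zeta D\<close>.\<close>

definition level :: "'c diagram \<Rightarrow> nat \<Rightarrow> (dir \<times> 'c) list" where
  "level D h = (if h < length D then concat (map piece_bottom (D ! h)) else concat (map piece_top (last D)))"

definition copy_point :: "unit diagram \<Rightarrow> copy \<Rightarrow> point \<Rightarrow> point" where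
  "copy_point D k P = (case P of (h, p) \<Rightarrow>
     (3 * h, if left_copy (fst (level D h ! p)) = k then 2 * p else 2 * p + 1))"

text \<open>The term with index \<open>a\<close> in \<open>S\<close>, \<open>S'\<close>, \<open>S''\<close> or \<open>S\<close> with a tilde, according to the marks of
  the under-strand and the over-strand, and in the inverses of these elements.\<close>

fun S_term :: "('k::field, 'a::ring_1, 'i::finite) hopf_data \<Rightarrow> copy \<Rightarrow> copy \<Rightarrow> 'i \<Rightarrow>
    'a \<times> ('a \<Rightarrow> 'k)" where
  "S_term A Thin Thin a = (basis A a, dual_basis A a)"
| "S_term A Thick Thin a = (antipode A (basis A a), dual_basis A a)"
| "S_term A Thin Thick a = (basis A a, dual_basis A a \<circ> antipode_inv A)"
| "S_term A Thick Thick a = (antipode A (basis A a), dual_basis A a \<circ> antipode_inv A)"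

definition S_inv_term :: "('k::field, 'a::ring_1, 'i::finite) hopf_data \<Rightarrow> copy \<Rightarrow> copy \<Rightarrow> 'i \<Rightarrow>
    'a \<times> ('a \<Rightarrow> 'k)" where
  "S_inv_term A cu co a = (antipode A (fst (S_term A cu co a)), snd (S_term A cu co a))"

fun crossing_term :: "('k::field, 'a::ring_1, 'i::finite) hopf_data \<Rightarrow> xing \<Rightarrow> copy \<Rightarrow> copy \<Rightarrow> 'i \<Rightarrow>
    'a \<times> ('a \<Rightarrow> 'k)" where
  "crossing_term A XPlus = S_term A"
| "crossing_term A XMinus = S_inv_term A"

fun J'_label :: "('k::field, 'a::ring_1, 'i::finite) hopf_data \<Rightarrow> (point \<Rightarrow> 'i) \<Rightarrow> point \<Rightarrow>
    copy piece \<Rightarrow> bool \<Rightarrow> ('k, 'i) double" where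
  "J'_label A \<sigma> s (Cross x du cu do co) False =
     dtens A (counit A) ((if du = Up then antipode A else id) (fst (crossing_term A x cu co (\<sigma> s))))"
| "J'_label A \<sigma> s (Cross x du cu do co) True =
     dtens A (let g = snd (crossing_term A x cu co (\<sigma> s)) in if do = Up then g \<circ> antipode_inv A else g) 1"
| "J'_label A \<sigma> s _ _ = double_one A"

definition strand_product :: "('k::field, 'a::ring_1, 'i::finite) hopf_data \<Rightarrow> ('k, 'i \<times> 'i) mult \<Rightarrow>
    (point \<Rightarrow> 'i) \<Rightarrow> copy arc list \<Rightarrow> ('k, 'i) double" where
  "strand_product A m \<sigma> c =
     foldr m (map (\<lambda>a. J'_label A \<sigma> (site a) (part a) (over a)) (rev c)) (double_one A)"

text \<open>A representative of \<open>J'(D)\<close>: a linear combination of lists of one-letter words.\<close>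

definition heis_J' :: "('k::field, 'a::ring_1, 'i::finite) hopf_data \<Rightarrow> unit diagram \<Rightarrow>
    unit arc list list \<Rightarrow> (('k, 'i) double2 letter list list \<Rightarrow>\<^sub>0 'k)" where
  "heis_J' A D cs =
     (\<Sum>\<sigma> \<in> crossings (zeta D) XPlus \<union> crossings (zeta D) XMinus \<rightarrow>\<^sub>E UNIV.
        gen (map (\<lambda>c. let P = tail (hd c) in
          [Coeff (tens
             (strand_product A (heisenberg_mult A) \<sigma> (component_from (zeta D) (copy_point D Thin P)))
             (strand_product A (opp_mult (heisenberg_mult A)) \<sigma>
                (component_from (zeta D) (copy_point D Thick P))))]) cs))"

section \<open>The element \<open>J''\<close>\<close>

fun curl_piece :: "unit piece \<Rightarrow> unit diagram" where
  "curl_piece (Maximum LeftRight c) = [[Cross XMinus Up c Down c], [Maximum RightLeft c]]"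
| "curl_piece (Minimum LeftRight c) = [[Minimum RightLeft c], [Cross XPlus Down c Up c]]"
| "curl_piece p = [[p], map (\<lambda>(d, c). Vert d c) (piece_top p)]"

text \<open>The point \<open>(h, p)\<close> of \<open>D\<close> becomes the point \<open>(2 * h, p)\<close> of \<open>leftward D\<close>.\<close>

definition leftward :: "unit diagram \<Rightarrow> unit diagram" where
  "leftward D = refine 2 curl_piece D"

definition leftward_component :: "unit diagram \<Rightarrow> unit arc list \<Rightarrow> unit arc list" where
  "leftward_component D c =
     component_from (leftward D) (2 * fst (tail (hd c)), snd (tail (hd c)))"

definition rotation_degree :: "unit arc list \<Rightarrow> int" where
  "rotation_degree c =
     int (length (filter (\<lambda>a. part a = Maximum LeftRight ()) c)) -
     int (length (filter (\<lambda>a. part a = Minimum LeftRight ()) c))"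

definition heis_J'' :: "('k::field, 'a::ring_1, 'i::finite) hopf_data \<Rightarrow>
    ('k, 'i) double2 set \<Rightarrow> unit diagram \<Rightarrow> unit arc list list \<Rightarrow>
    (('k, 'i) double2 letter list list \<Rightarrow>\<^sub>0 'k) set" where
  "heis_J'' A C D cs = tensor_class (HHop_theta_rels A C) (map is_closed cs)
     (pm_push (map2 (@) (map (\<lambda>c. theta_power
          (mult_inverse (HHop_mult A) (HHop_one A) (phi A (theta_square A))) (rotation_degree c)) cs))
        (heis_J' A (leftward D) (map (leftward_component D) cs)))"

end

theory Submission
  imports Defs
begin

text \<open>
  Kashaev's map \<open>\<phi>\<close> sends the \<open>R\<close>-matrix to a product of the four elements \<open>S\<close>, \<open>S'\<close>, \<open>S''\<close> and \<open>S\<close> with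
  a tilde, one for each crossing of the doubled crossing; together with \<open>\<phi>\<close> applied to the antipode this
  gives, at each crossing and for each orientation, an identity between the labels of \<open>J\<close> and \<open>J'\<close> that can
  be used inside a state sum. So \<open>\<phi>\<close> takes \<open>J\<close> to \<open>J'\<close> for a diagram without extrema from left to right.
  A curl contributes \<open>\<Sum> \<gamma>(\<beta>) \<alpha> = u\<close> or \<open>\<Sum> \<beta>\<^sup>- \<gamma>(\<alpha>\<^sup>-) = u\<^sup>-\<^sup>1\<close>, and thus replaces the label of a
  left-to-right extremum up to the central factor \<open>\<theta>\<close> or \<open>\<theta>\<^sup>-\<^sup>1\<close>; collecting these factors gives
  \<open>\<theta>\<close> to the power \<open>d\<close> on each component.
\<close>

section \<open>Linear algebra in coordinates\<close>

text \<open>The target is the delicate side. There theta commutes only with the set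
  \<open>C\<close>, which contains the image of \<phi> but possibly not the labels of J', and a
  factor in front of a closed component does not preserve the commutator space. Hence theta is
  handled in the source, where it is central: the base points of \<open>cs\<close> are exchanged for
  those of \<open>cs'\<close>, and the powers of theta are moved to the front of each component,
  before \<phi> is applied. The local identities live in tensor squares, so they apply whether the
  two strands at a crossing belong to one component or to two. They reduce to Sweedler identities,
  since an element of A* \<otimes> A is determined by its pairings. With antipodes on its legs, R or
  its inverse is \<Sum> G(e_a) \<otimes> (e^a \<circ> H), and whether the composite of G and H
  preserves or reverses products and coproducts decides the order of the four factors.\<close>

lemma tens_nth [simp]: "tens x y $ (p, q) = x $ p * y $ q"
  by (simp add: tens_def)

lemma axis_nth': "axis p (1::'k::field) $ q = (if q = p then 1 else 0)"
  by (simp add: axis_def)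

definition klin :: "('k::field ^ 'm::finite \<Rightarrow> 'k ^ 'n::finite) \<Rightarrow> bool" where
  "klin f \<longleftrightarrow> (\<forall>x y. f (x + y) = f x + f y) \<and> (\<forall>c x. f (c *s x) = c *s f x)"

definition kfun :: "('k::field ^ 'm::finite \<Rightarrow> 'k) \<Rightarrow> bool" where
  "kfun f \<longleftrightarrow> (\<forall>x y. f (x + y) = f x + f y) \<and> (\<forall>c x. f (c *s x) = c * f x)"

lemma klin_sum:
  assumes "klin f"
  shows "f (\<Sum>i\<in>I. g i) = (\<Sum>i\<in>I. f (g i))"
proof -
  have z: "f 0 = 0"
    using assms unfolding klin_def by (metis vector_smult_lzero)
  show ?thesis
    by (induction I rule: infinite_finite_induct) (use assms z in \<open>auto simp: klin_def\<close>)
qed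

lemma kfun_sum:
  assumes "kfun f"
  shows "f (\<Sum>i\<in>I. g i) = (\<Sum>i\<in>I. f (g i))"
proof -
  have z: "f 0 = 0"
    using assms unfolding kfun_def by (metis vector_smult_lzero mult_zero_left)
  show ?thesis
    by (induction I rule: infinite_finite_induct) (use assms z in \<open>auto simp: kfun_def\<close>)
qed

lemma klin_scale: "klin f \<Longrightarrow> f (c *s x) = c *s f x" by (simp add: klin_def)
lemma kfun_scale: "kfun f \<Longrightarrow> f (c *s x) = c * f x" by (simp add: kfun_def)

lemma axis_expansion: "(\<Sum>p\<in>UNIV. x $ p *s axis p 1) = (x :: 'k::field ^ 'm::finite)"
  by (rule basis_expansion)

lemma klin_expand: "klin f \<Longrightarrow> f x = (\<Sum>p\<in>UNIV. x $ p *s f (axis p 1))"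
  by (subst axis_expansion[of x, symmetric], subst klin_sum) (auto simp: klin_scale)

lemma kfun_expand: "kfun f \<Longrightarrow> f x = (\<Sum>p\<in>UNIV. x $ p * f (axis p 1))"
  by (subst axis_expansion[of x, symmetric], subst kfun_sum) (auto simp: kfun_scale)

lemma klin_eqI:
  assumes "klin f" "klin g" "\<And>p. f (axis p 1) = g (axis p 1)"
  shows "f x = g x"
  by (subst klin_expand[OF assms(1)], subst klin_expand[OF assms(2)]) (simp add: assms(3))

lemma klin_lin: "klin (lin f)"
  unfolding klin_def lin_def
  by (simp add: vector_sadd_rdistrib sum.distrib vec.scale_sum_right vector_smult_assoc)

lemma lin_axis [simp]: "lin f (axis p 1) = f p"
  unfolding lin_def axis_nth' by (simp add: if_distrib[of "\<lambda>x. x *s _"] cong: if_cong)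

lemma klin_bilin1: "klin (\<lambda>x. bilin f x y)"
  unfolding klin_def bilin_def
  by (simp add: distrib_right vector_sadd_rdistrib sum.distrib vec.scale_sum_right vector_smult_assoc mult.assoc)

lemma klin_bilin2: "klin (bilin f x)"
  unfolding klin_def bilin_def
  by (simp add: distrib_left vector_sadd_rdistrib sum.distrib vec.scale_sum_right vector_smult_assoc mult.left_commute)

lemma bilin_axis [simp]: "bilin f (axis p 1) (axis q 1) = f p q"
proof -
  have "bilin f (axis p 1) (axis q 1) = (\<Sum>p'\<in>UNIV. \<Sum>q'\<in>UNIV. if p' = p then (if q' = q then f p q else 0) else 0)"
    unfolding bilin_def axis_nth' by (intro sum.cong refl) auto
  then show ?thesis by (simp add: sum.If_cases)
qed

lemma klin_id: "klin (\<lambda>x. x)" by (simp add: klin_def)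
lemma klin_comp: "klin f \<Longrightarrow> klin g \<Longrightarrow> klin (\<lambda>x. f (g x))" by (simp add: klin_def)
lemma kfun_comp: "kfun f \<Longrightarrow> klin g \<Longrightarrow> kfun (\<lambda>x. f (g x))" by (simp add: klin_def kfun_def)
lemma kfun_nth: "kfun (\<lambda>x. x $ i)" by (simp add: kfun_def)
lemma kfun_sumI: "(\<And>i. i \<in> I \<Longrightarrow> kfun (f i)) \<Longrightarrow> kfun (\<lambda>x. \<Sum>i\<in>I. f i x)"
  by (simp add: kfun_def sum.distrib sum_distrib_left)
lemma kfun_multc: "kfun f \<Longrightarrow> kfun (\<lambda>x. f x * c)" by (simp add: kfun_def algebra_simps)
lemma klin_tens1: "klin (\<lambda>x. tens x y)" by (simp add: klin_def tens_def vec_eq_iff algebra_simps)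
lemma klin_tens2: "klin (tens x)" by (simp add: klin_def tens_def vec_eq_iff algebra_simps)

text \<open>Coordinates are linear functionals. Applying an unspecified functional turns an identity
  of vectors into one of scalars, to which the Sweedler calculus below applies.\<close>

lemma vec_eq_kfunI: "(\<And>f. kfun f \<Longrightarrow> f x = f y) \<Longrightarrow> x = y"
  unfolding vec_eq_iff using kfun_nth by blast

definition kbil :: "('k::field ^ 'm::finite \<Rightarrow> 'k ^ 'n::finite \<Rightarrow> 'k ^ 'l::finite) \<Rightarrow> bool" where
  "kbil m \<longleftrightarrow> (\<forall>y. klin (\<lambda>x. m x y)) \<and> (\<forall>x. klin (m x))"

lemma kbil_bilin: "kbil (bilin f)" by (simp add: kbil_def klin_bilin1 klin_bilin2)
lemma kbil_tens: "kbil tens" by (simp add: kbil_def klin_tens1 klin_tens2)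
lemma kbil_opp: "kbil m \<Longrightarrow> kbil (opp_mult m)"
  unfolding kbil_def opp_mult_def[abs_def] by simp
lemma kbil_tensor: "kbil (tensor_mult m1 m2)"
  unfolding tensor_mult_def by (rule kbil_bilin)
lemma kbil1: "kbil m \<Longrightarrow> klin (\<lambda>x. m x y)" by (simp add: kbil_def)
lemma kbil2: "kbil m \<Longrightarrow> klin (m x)" by (simp add: kbil_def)
lemma kbil_comp: "kbil m \<Longrightarrow> klin f \<Longrightarrow> klin g \<Longrightarrow> kbil (\<lambda>x y. m (f x) (g y))"
  unfolding kbil_def klin_def by simp
lemma kbil_comp2: "klin f \<Longrightarrow> kbil m \<Longrightarrow> kbil (\<lambda>x y. f (m x y))"
  unfolding kbil_def klin_def by simp

lemma kbil_eqI:
  assumes "kbil f" "kbil g" "\<And>p q. f (axis p 1) (axis q 1) = g (axis p 1) (axis q 1)"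
  shows "f x y = g x y"
proof -
  have "f x (axis q 1) = g x (axis q 1)" for q
    by (rule klin_eqI[OF kbil1[OF assms(1)] kbil1[OF assms(2)] assms(3)])
  then show ?thesis
    by (rule klin_eqI[OF kbil2[OF assms(1)] kbil2[OF assms(2)]])
qed

lemma axis_pair: "axis (p, q) (1::'k::field) = tens (axis p 1) (axis q 1)"
  by (auto simp: vec_eq_iff axis_nth' tens_def)

text \<open>\<open>tensor_mult\<close> is fixed on pairs of basis vectors; linearity in the four
  factors, one at a time, extends the formula to all pure tensors.\<close>

lemma tensor_mult_tens:
  assumes "kbil m1" "kbil m2"
  shows "tensor_mult m1 m2 (tens a b) (tens c d) = tens (m1 a c) (m2 b d)"
proof -
  have ax: "tensor_mult m1 m2 (tens (axis p 1) (axis q 1)) (tens (axis p' 1) (axis q' 1))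
      = tens (m1 (axis p 1) (axis p' 1)) (m2 (axis q 1) (axis q' 1))" for p q p' q'
    unfolding tensor_mult_def axis_pair[symmetric] by simp
  have l: "klin (\<lambda>z. tensor_mult m1 m2 (tens z b) (tens c d))" "klin (\<lambda>z. tensor_mult m1 m2 (tens a z) (tens c d))"
    "klin (\<lambda>z. tensor_mult m1 m2 (tens a b) (tens z d))" "klin (\<lambda>z. tensor_mult m1 m2 (tens a b) (tens c z))" for a b c d
    by (rule klin_comp[OF kbil1[OF kbil_tensor] klin_tens1] klin_comp[OF kbil1[OF kbil_tensor] klin_tens2]
        klin_comp[OF kbil2[OF kbil_tensor] klin_tens1] klin_comp[OF kbil2[OF kbil_tensor] klin_tens2])+
  have r: "klin (\<lambda>z. tens (m1 z c) (m2 b d))" "klin (\<lambda>z. tens (m1 a c) (m2 z d))"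
    "klin (\<lambda>z. tens (m1 a z) (m2 b d))" "klin (\<lambda>z. tens (m1 a c) (m2 b z))" for a b c d
    by (rule klin_comp[OF klin_tens1 kbil1[OF assms(1)]] klin_comp[OF klin_tens2 kbil1[OF assms(2)]]
        klin_comp[OF klin_tens1 kbil2[OF assms(1)]] klin_comp[OF klin_tens2 kbil2[OF assms(2)]])+
  show ?thesis
    apply (rule klin_eqI[OF l(1) r(1)])
    apply (rule klin_eqI[OF l(2) r(2)])
    apply (rule klin_eqI[OF l(3) r(3)])
    apply (rule klin_eqI[OF l(4) r(4)])
    by (rule ax)
qed

lemma klin_tens_eqI:
  assumes "klin f" "klin g" "\<And>a b. f (tens a b) = g (tens a b)"
  shows "f x = g x"
  by (rule klin_eqI[OF assms(1,2)]) (metis assms(3) axis_pair surj_pair)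

lemma tensor_mult_assoc:
  assumes "kbil m1" "kbil m2"
    and a1: "\<And>x y z. m1 (m1 x y) z = m1 x (m1 y z)" and a2: "\<And>x y z. m2 (m2 x y) z = m2 x (m2 y z)"
  shows "tensor_mult m1 m2 (tensor_mult m1 m2 x y) z = tensor_mult m1 m2 x (tensor_mult m1 m2 y z)"
proof -
  let ?m = "tensor_mult m1 m2"
  note b = kbil_tensor[of m1 m2]
  have l: "klin (\<lambda>x. ?m (?m x y) z)" "klin (\<lambda>y. ?m (?m x y) z)" "klin (\<lambda>z. ?m (?m x y) z)"
   "klin (\<lambda>x. ?m x (?m y z))" "klin (\<lambda>y. ?m x (?m y z))" "klin (\<lambda>z. ?m x (?m y z))" for x y z
    by (rule klin_comp[OF kbil1[OF b] kbil1[OF b]] klin_comp[OF kbil1[OF b] kbil2[OF b]] kbil2[OF b]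
        kbil1[OF b] klin_comp[OF kbil2[OF b] kbil1[OF b]] klin_comp[OF kbil2[OF b] kbil2[OF b]])+
  show ?thesis
    apply (rule klin_tens_eqI[OF l(1) l(4)])
    apply (rule klin_tens_eqI[OF l(2) l(5)])
    apply (rule klin_tens_eqI[OF l(3) l(6)])
    by (simp add: tensor_mult_tens assms)
qed

lemma mult_inverse_unique:
  assumes "\<And>x y z. m (m x y) z = m x (m y z)" "\<And>x. m one x = x" "\<And>x. m x one = x"
    and "m x y = one" "m y x = one"
  shows "mult_inverse m one x = y"
  unfolding mult_inverse_def
proof (rule the_equality)
  show "m x y = one \<and> m y x = one" using assms by simp
  fix z assume "m x z = one \<and> m z x = one"
  then have "z = m (m y x) z" using assms by simp
  also have "\<dots> = m y (m x z)" by (rule assms(1))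
  also have "\<dots> = y" using \<open>m x z = one \<and> _\<close> assms by simp
  finally show "z = y" .
qed

lemma sum_pair: "(\<Sum>(i, j)\<in>UNIV. F i j) = (\<Sum>i\<in>UNIV. \<Sum>j\<in>UNIV. F i j)"
  by (simp add: sum.cartesian_product)

lemma sum_pair': "(\<Sum>p\<in>UNIV. F p) = (\<Sum>i\<in>UNIV. \<Sum>j\<in>UNIV. F (i, j))"
  by (simp add: sum.cartesian_product)

lemma sum_swap6:
  fixes G :: "'a::finite \<Rightarrow> 'b::finite \<Rightarrow> 'c::finite \<Rightarrow> 'd::finite \<Rightarrow> 'e::finite \<Rightarrow> 'f::finite \<Rightarrow> 'g::comm_monoid_add"
  shows "(\<Sum>p\<in>UNIV. \<Sum>q\<in>UNIV. \<Sum>i\<in>UNIV. \<Sum>j\<in>UNIV. \<Sum>l\<in>UNIV. \<Sum>m\<in>UNIV. G p q i j l m)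
    = (\<Sum>i\<in>UNIV. \<Sum>j\<in>UNIV. \<Sum>l\<in>UNIV. \<Sum>m\<in>UNIV. \<Sum>p\<in>UNIV. \<Sum>q\<in>UNIV. G p q i j l m)"
  using sum.swap[of "\<lambda>(p, q) (i, j, l, m). G p q i j l m" "UNIV::('c\<times>'d\<times>'e\<times>'f) set" "UNIV::('a\<times>'b) set"]
  by (simp add: sum_pair')

section \<open>Sweedler calculus\<close>

text \<open>\<open>sw A x F\<close> is \<open>\<Sum> F(x', x'')\<close> for a bilinear form \<open>F\<close>; it depends on the chosen basis
  for other \<open>F\<close>.\<close>

definition sw :: "('k::field, 'a::ring_1, 'i::finite) hopf_data \<Rightarrow> 'a \<Rightarrow> ('a \<Rightarrow> 'a \<Rightarrow> 'k) \<Rightarrow> 'k" where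
  "sw A x F = (\<Sum>i\<in>UNIV. \<Sum>j\<in>UNIV. comul A x $ (i, j) * F (basis A i) (basis A j))"

definition lf :: "('k::field, 'a::ring_1, 'i::finite) hopf_data \<Rightarrow> ('a \<Rightarrow> 'k) \<Rightarrow> bool" where
  "lf A f \<longleftrightarrow> (\<forall>x y. f (x + y) = f x + f y) \<and> (\<forall>c x. f (scale A c x) = c * f x)"

definition la :: "('k::field, 'a::ring_1, 'i::finite) hopf_data \<Rightarrow> ('a \<Rightarrow> 'a) \<Rightarrow> bool" where
  "la A f \<longleftrightarrow> (\<forall>x y. f (x + y) = f x + f y) \<and> (\<forall>c x. f (scale A c x) = scale A c (f x))"

section \<open>Linear structure and axioms of the Hopf algebra\<close>

locale hopf =
  fixes A :: "('k::field, 'a::ring_1, 'i::finite) hopf_data"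
  assumes hopf: "hopf_algebra A"
    and bij_antipode: "bij (antipode A)"
begin

abbreviation e where "e \<equiv> basis A"
abbreviation \<epsilon> where "\<epsilon> \<equiv> counit A"
abbreviation \<gamma> where "\<gamma> \<equiv> antipode A"
abbreviation g' where "g' \<equiv> antipode_inv A"
abbreviation cf where "cf \<equiv> coord A"
abbreviation sc where "sc \<equiv> scale A"
abbreviation db where "db \<equiv> dual_basis A"

sublocale V: finite_dimensional_vector_space sc "range e"
  using hopf by (simp add: hopf_algebra_def)

lemma inj_e: "inj e" using hopf by (simp add: hopf_algebra_def)

lemma sc_mult: "sc c x * y = sc c (x * y)" "x * sc c y = sc c (x * y)"
  using hopf unfolding hopf_algebra_def by blast+

lemma lf_add: "lf A f \<Longrightarrow> f (x + y) = f x + f y" by (simp add: lf_def)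
lemma lf_scale: "lf A f \<Longrightarrow> f (sc c x) = c * f x" by (simp add: lf_def)
lemma lf_zero: "lf A f \<Longrightarrow> f 0 = 0"
  by (metis add_cancel_right_left lf_add)
lemma lf_sum: "lf A f \<Longrightarrow> f (\<Sum>i\<in>I. h i) = (\<Sum>i\<in>I. f (h i))"
  by (induction I rule: infinite_finite_induct) (auto simp: lf_zero lf_add)
lemma la_add: "la A f \<Longrightarrow> f (x + y) = f x + f y" by (simp add: la_def)
lemma la_scale: "la A f \<Longrightarrow> f (sc c x) = sc c (f x)" by (simp add: la_def)

lemma lf_cf: "lf A (\<lambda>x. cf x $ i)"
  unfolding lf_def coord_def
  by (simp add: V.representation_add V.representation_scale V.independent_Basis V.span_Basis)

lemma cf_e: "cf (e i) $ j = (if i = j then 1 else 0)"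
proof -
  have "V.representation (range e) (e i) = (\<lambda>v. if v = e i then 1 else 0)"
    by (rule V.representation_basis) (auto simp: V.independent_Basis)
  then show ?thesis using inj_e by (auto simp: coord_def inj_eq)
qed

lemma expand: "x = (\<Sum>i\<in>UNIV. sc (cf x $ i) (e i))"
proof -
  have "(\<Sum>b\<in>range e. sc (V.representation (range e) x b) b) = x"
    by (rule V.sum_representation_eq) (auto simp: V.independent_Basis V.span_Basis V.finite_Basis)
  then show ?thesis using inj_e by (simp add: coord_def sum.reindex inj_on_def inj_def)
qed

lemma lf_expand: "lf A f \<Longrightarrow> (\<Sum>i\<in>UNIV. cf x $ i * f (e i)) = f x"
  by (subst (2) expand) (simp add: lf_sum lf_scale)

lemma eqI: "(\<And>f. lf A f \<Longrightarrow> f x = f y) \<Longrightarrow> x = y"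
proof -
  assume "\<And>f. lf A f \<Longrightarrow> f x = f y"
  then have "cf x $ i = cf y $ i" for i using lf_cf by blast
  then show ?thesis by (subst expand, subst (2) expand) (simp only:)
qed

lemma lin_counit: "lf A \<epsilon>"
  using hopf unfolding hopf_algebra_def lf_def Vector_Spaces.linear_iff by blast
lemma lin_antipode: "la A \<gamma>"
  using hopf unfolding hopf_algebra_def la_def Vector_Spaces.linear_iff by blast
lemma lin_comul: "Vector_Spaces.linear sc (*s) (comul A)"
  using hopf unfolding hopf_algebra_def by (elim conjE)
lemma comul_add: "comul A (x + y) = comul A x + comul A y"
  and comul_scale: "comul A (sc c x) = c *s comul A x"
  using lin_comul unfolding Vector_Spaces.linear_iff by simp_all

lemma gg' [simp]: "\<gamma> (g' x) = x" and g'g [simp]: "g' (\<gamma> x) = x"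
  using bij_antipode by (simp_all add: bij_is_surj surj_f_inv_f bij_is_inj)

lemma la_g': "la A g'"
  unfolding la_def
  by (metis gg' g'g lin_antipode la_add la_scale)

lemma la_id: "la A (\<lambda>x. x)" by (simp add: la_def)
lemma la_mult1: "la A G \<Longrightarrow> la A (\<lambda>x. G x * c)" by (simp add: la_def distrib_right sc_mult)
lemma la_mult2: "la A G \<Longrightarrow> la A (\<lambda>x. c * G x)" by (simp add: la_def distrib_left sc_mult)
lemma la_antipode: "la A G \<Longrightarrow> la A (\<lambda>x. \<gamma> (G x))"
  using lin_antipode by (simp add: la_def)
lemma la_antipode_inv: "la A G \<Longrightarrow> la A (\<lambda>x. g' (G x))"
  using la_g' by (simp add: la_def)

lemma lf_comp: "lf A f \<Longrightarrow> la A G \<Longrightarrow> lf A (\<lambda>x. f (G x))" by (simp add: la_def lf_def)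
lemma lf_mult1: "lf A f \<Longrightarrow> lf A (\<lambda>x. f x * c)" by (simp add: lf_def algebra_simps)
lemma lf_mult2: "lf A f \<Longrightarrow> lf A (\<lambda>x. c * f x)" by (simp add: lf_def algebra_simps)
lemma lf_counit: "la A G \<Longrightarrow> lf A (\<lambda>x. \<epsilon> (G x))" by (rule lf_comp[OF lin_counit])
lemma lf_coord: "la A G \<Longrightarrow> lf A (\<lambda>x. cf (G x) $ i)" by (rule lf_comp[OF lf_cf])
lemma lf_db: "la A G \<Longrightarrow> lf A (\<lambda>x. db i (G x))"
  unfolding dual_basis_def by (rule lf_coord)
lemma lf_sumI: "(\<And>i. lf A (F i)) \<Longrightarrow> lf A (\<lambda>x. \<Sum>i\<in>I. F i x)"
  by (simp add: lf_def sum.distrib sum_distrib_left)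
lemma lf_sw_body: "(\<And>a b. lf A (\<lambda>x. F x a b)) \<Longrightarrow> lf A (\<lambda>x. sw A y (F x))"
  unfolding sw_def by (intro lf_sumI lf_mult2)
lemma lf_sw_arg: "la A G \<Longrightarrow> lf A (\<lambda>x. sw A (G x) F)"
  by (simp add: la_def lf_def sw_def comul_add comul_scale distrib_right sum.distrib sum_distrib_left mult.assoc)

text \<open>Introduction rules that follow the syntax of a term; with them \<open>intro\<close>
  settles the linearity side conditions of the Sweedler rules.\<close>

lemmas lins = la_id la_mult1 la_mult2 la_antipode la_antipode_inv
  lf_mult1 lf_mult2 lf_counit lf_coord lf_db lf_sumI lf_sw_body lf_sw_arg lin_counit

text \<open>Both sides evaluate \<open>F\<close> at basis vectors only, with coefficients that agree
  by coassociativity. So the rule holds for every \<open>F\<close> and serves as a plain rewrite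
  rule.\<close>

lemma sw_coassoc: "sw A x (\<lambda>a b. sw A a (\<lambda>c d. F c d b)) = sw A x (\<lambda>a b. sw A b (\<lambda>c d. F a c d))"
proof -
  have c: "(\<Sum>m\<in>UNIV. comul A x $ (m, l) * comul A (e m) $ (i, j))
              = (\<Sum>m\<in>UNIV. comul A x $ (i, m) * comul A (e m) $ (j, l))" for i j l
    using hopf unfolding hopf_algebra_def by blast
  have "sw A x (\<lambda>a b. sw A a (\<lambda>c d. F c d b))
     = (\<Sum>m\<in>UNIV. \<Sum>l\<in>UNIV. \<Sum>i\<in>UNIV. \<Sum>j\<in>UNIV. comul A x $ (m, l) * comul A (e m) $ (i, j) * F (e i) (e j) (e l))"
    by (simp add: sw_def sum_distrib_left mult.assoc)
  also have "\<dots> = (\<Sum>l\<in>UNIV. \<Sum>i\<in>UNIV. \<Sum>j\<in>UNIV. \<Sum>m\<in>UNIV. comul A x $ (m, l) * comul A (e m) $ (i, j) * F (e i) (e j) (e l))"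
    by (subst sum.swap, rule sum.cong[OF refl], subst sum.swap, rule sum.cong[OF refl], rule sum.swap)
  also have "\<dots> = (\<Sum>l\<in>UNIV. \<Sum>i\<in>UNIV. \<Sum>j\<in>UNIV. \<Sum>m\<in>UNIV. comul A x $ (i, m) * comul A (e m) $ (j, l) * F (e i) (e j) (e l))"
    by (simp only: sum_distrib_right[symmetric] c)
  also have "\<dots> = (\<Sum>i\<in>UNIV. \<Sum>l\<in>UNIV. \<Sum>m\<in>UNIV. \<Sum>j\<in>UNIV. comul A x $ (i, m) * comul A (e m) $ (j, l) * F (e i) (e j) (e l))"
    by (subst sum.swap, rule sum.cong[OF refl], rule sum.cong[OF refl], rule sum.swap)
  also have "\<dots> = (\<Sum>i\<in>UNIV. \<Sum>m\<in>UNIV. \<Sum>j\<in>UNIV. \<Sum>l\<in>UNIV. comul A x $ (i, m) * comul A (e m) $ (j, l) * F (e i) (e j) (e l))"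
    by (rule sum.cong[OF refl], subst sum.swap, rule sum.cong[OF refl], rule sum.swap)
  also have "\<dots> = sw A x (\<lambda>a b. sw A b (\<lambda>c d. F a c d))"
    by (simp add: sw_def sum_distrib_left mult.assoc)
  finally show ?thesis .
qed

lemma sw_counit_l:
  assumes "lf A F"
  shows "sw A x (\<lambda>a b. \<epsilon> a * F b) = F x"
proof -
  have c: "(\<Sum>(i, j)\<in>UNIV. sc (comul A x $ (i, j) * \<epsilon> (e i)) (e j)) = x" for x
    using hopf unfolding hopf_algebra_def by blast
  show ?thesis
    by (subst (2) c[of x, symmetric]) (simp add: sum_pair lf_sum[OF assms] lf_scale[OF assms] sw_def mult.assoc)
qed

lemma sw_counit_r:
  assumes "lf A F"
  shows "sw A x (\<lambda>a b. \<epsilon> b * F a) = F x"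
proof -
  have c: "(\<Sum>(i, j)\<in>UNIV. sc (comul A x $ (i, j) * \<epsilon> (e j)) (e i)) = x" for x
    using hopf unfolding hopf_algebra_def by blast
  show ?thesis
    by (subst (2) c[of x, symmetric]) (simp add: sum_pair lf_sum[OF assms] lf_scale[OF assms] sw_def mult.assoc)
qed

lemma sw_counit_r': "lf A F \<Longrightarrow> sw A x (\<lambda>a b. F a * \<epsilon> b) = F x"
  using sw_counit_r[of F x] by (simp add: mult.commute)

lemma sw_antipode_l:
  assumes "lf A F"
  shows "sw A x (\<lambda>a b. F (\<gamma> a * b)) = \<epsilon> x * F 1"
proof -
  have c: "(\<Sum>(i, j)\<in>UNIV. sc (comul A x $ (i, j)) (\<gamma> (e i) * e j)) = sc (\<epsilon> x) 1"
    using hopf unfolding hopf_algebra_def by blast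
  then have "F (\<Sum>(i, j)\<in>UNIV. sc (comul A x $ (i, j)) (\<gamma> (e i) * e j)) = \<epsilon> x * F 1"
    by (simp add: lf_scale[OF assms])
  then show ?thesis
    by (simp add: sum_pair lf_sum[OF assms] lf_scale[OF assms] sw_def mult.assoc)
qed

lemma sw_antipode_r:
  assumes "lf A F"
  shows "sw A x (\<lambda>a b. F (a * \<gamma> b)) = \<epsilon> x * F 1"
proof -
  have c: "(\<Sum>(i, j)\<in>UNIV. sc (comul A x $ (i, j)) (e i * \<gamma> (e j))) = sc (\<epsilon> x) 1"
    using hopf unfolding hopf_algebra_def by blast
  then have "F (\<Sum>(i, j)\<in>UNIV. sc (comul A x $ (i, j)) (e i * \<gamma> (e j))) = \<epsilon> x * F 1"
    by (simp add: lf_scale[OF assms])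
  then show ?thesis
    by (simp add: sum_pair lf_sum[OF assms] lf_scale[OF assms] sw_def mult.assoc)
qed

lemma counit_mult [simp]: "\<epsilon> (x * y) = \<epsilon> x * \<epsilon> y" and counit_one [simp]: "\<epsilon> 1 = 1"
  using hopf unfolding hopf_algebra_def by blast+

lemma sw_cmult: "sw A x (\<lambda>a b. c * F a b) = c * sw A x F"
  by (simp add: sw_def sum_distrib_left mult.left_commute)
lemma sw_multc: "sw A x (\<lambda>a b. F a b * c) = sw A x F * c"
  by (simp add: sw_def sum_distrib_right mult.assoc)
lemma sw_sum: "sw A x (\<lambda>a b. \<Sum>i\<in>I. F i a b) = (\<Sum>i\<in>I. sw A x (F i))"
  unfolding sw_def by (simp add: sum_distrib_left sum.swap[of _ _ I])
lemma sw_swap: "sw A x (\<lambda>a b. sw A y (F a b)) = sw A y (\<lambda>c d. sw A x (\<lambda>a b. F a b c d))"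
  by (simp add: sw_def[of A y] sw_sum sw_cmult)

lemma bilin_coord:
  assumes "\<And>b. lf A (\<lambda>a. F a b)" "\<And>a. lf A (F a)"
  shows "(\<Sum>p\<in>UNIV. \<Sum>q\<in>UNIV. cf x $ p * cf y $ q * F (e p) (e q)) = F x y"
proof -
  have "(\<Sum>p\<in>UNIV. \<Sum>q\<in>UNIV. cf x $ p * cf y $ q * F (e p) (e q)) = (\<Sum>p\<in>UNIV. cf x $ p * F (e p) y)"
    using lf_expand[OF assms(2)] by (simp add: mult.assoc sum_distrib_left[symmetric])
  also have "\<dots> = F x y" using lf_expand[OF assms(1)] .
  finally show ?thesis .
qed

text \<open>The coproduct of a product is given through the coordinates of products of basis
  vectors. Linearity of \<open>F\<close> in both arguments lets \<open>bilin_coord\<close>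
  reassemble them.\<close>

lemma sw_mult:
  assumes "\<And>b. lf A (\<lambda>a. F a b)" "\<And>a. lf A (F a)"
  shows "sw A (x * y) F = sw A x (\<lambda>a b. sw A y (\<lambda>c d. F (a * c) (b * d)))"
proof -
  have c: "comul A (x * y) = (\<Sum>(i, j)\<in>UNIV. \<Sum>(l, m)\<in>UNIV. (comul A x $ (i, j) * comul A y $ (l, m))
         *s tens (cf (e i * e l)) (cf (e j * e m)))" for x y
    using hopf unfolding hopf_algebra_def by blast
  have "sw A (x * y) F = (\<Sum>p\<in>UNIV. \<Sum>q\<in>UNIV. \<Sum>i\<in>UNIV. \<Sum>j\<in>UNIV. \<Sum>l\<in>UNIV. \<Sum>m\<in>UNIV.
      comul A x $ (i, j) * (comul A y $ (l, m) * (cf (e i * e l) $ p * cf (e j * e m) $ q * F (e p) (e q))))"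
    by (simp add: sw_def c sum_pair sum_distrib_right mult.assoc)
  also have "\<dots> = (\<Sum>i\<in>UNIV. \<Sum>j\<in>UNIV. \<Sum>l\<in>UNIV. \<Sum>m\<in>UNIV. \<Sum>p\<in>UNIV. \<Sum>q\<in>UNIV.
      comul A x $ (i, j) * (comul A y $ (l, m) * (cf (e i * e l) $ p * cf (e j * e m) $ q * F (e p) (e q))))"
    by (rule sum_swap6)
  also have "\<dots> = sw A x (\<lambda>a b. sw A y (\<lambda>c d. F (a * c) (b * d)))"
    by (simp only: sum_distrib_left[symmetric] bilin_coord[OF assms] sw_def)
  finally show ?thesis .
qed

lemma sw_one:
  assumes "\<And>b. lf A (\<lambda>a. F a b)" "\<And>a. lf A (F a)"
  shows "sw A 1 F = F 1 1"
proof -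
  have "comul A 1 = tens (cf 1) (cf 1)" using hopf unfolding hopf_algebra_def by (elim conjE)
  then show ?thesis by (simp add: sw_def bilin_coord[OF assms])
qed

text \<open>A contraction inside a threefold coproduct: coassociativity brings the first two legs
  together, the antipode axiom leaves a counit, and the counit removes a leg.\<close>

lemma sw_al:
  assumes "\<And>d. lf A (\<lambda>u. F u d)" "lf A (F 1)"
  shows "sw A x (\<lambda>b y. sw A y (\<lambda>c d. F (\<gamma> b * c) d)) = F 1 x"
  unfolding sw_coassoc[symmetric] by (simp add: sw_antipode_l[OF assms(1)] sw_counit_l assms)

lemma sw_ar:
  assumes "\<And>d. lf A (\<lambda>u. F u d)" "lf A (F 1)"
  shows "sw A x (\<lambda>b y. sw A y (\<lambda>c d. F (b * \<gamma> c) d)) = F 1 x"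
  unfolding sw_coassoc[symmetric] by (simp add: sw_antipode_r[OF assms(1)] sw_counit_l assms)

lemma sw_ar_end:
  assumes "\<And>d. lf A (\<lambda>u. F d u)" "lf A (\<lambda>x. F x 1)"
  shows "sw A x (\<lambda>b y. sw A y (\<lambda>c d. F b (c * \<gamma> d))) = F x 1"
  by (simp add: sw_antipode_r[OF assms(1)] sw_counit_r assms(2))

section \<open>The antipode and its inverse reverse products and coproducts\<close>

lemma antipode_one [simp]: "\<gamma> 1 = 1"
proof (rule eqI)
  fix f assume f: "lf A f"
  show "f (\<gamma> 1) = f 1"
    using sw_antipode_l[OF f, of 1] sw_one[of "\<lambda>a b. f (\<gamma> a * b)"]
    by (simp add: lins lf_comp[OF f])
qed

lemma counit_antipode [simp]: "\<epsilon> (\<gamma> x) = \<epsilon> x"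
proof -
  have "\<epsilon> (\<gamma> x) = sw A x (\<lambda>a b. \<epsilon> (\<gamma> a) * \<epsilon> b)"
    by (rule sw_counit_r'[symmetric]) (simp add: lins)
  also have "\<dots> = \<epsilon> x" using sw_antipode_l[OF lin_counit, of x] by simp
  finally show ?thesis .
qed

text \<open>Uniqueness of convolution inverses: both sides invert the multiplication map.
  \<open>?S\<close> is the convolution of \<gamma>(xy), the product xy and \<gamma>(y)\<gamma>(x);
  cancelling the last two factors gives the left-hand side, cancelling the first two the right-hand
  side.\<close>

lemma antipode_mult: "\<gamma> (x * y) = \<gamma> y * \<gamma> x"
proof (rule eqI)
  fix f assume f: "lf A f"
  note l = lins lf_comp[OF f]
  let ?S = "sw A x (\<lambda>x1 x'. sw A x' (\<lambda>x2 x3. sw A y (\<lambda>y1 y'. sw A y' (\<lambda>y2 y3.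
     f (\<gamma> (x1 * y1) * ((x2 * y2) * (\<gamma> y3 * \<gamma> x3)))))))"
  have "?S = sw A x (\<lambda>x1 x'. sw A x' (\<lambda>x2 x3. sw A y (\<lambda>y1 y'. sw A y' (\<lambda>y2 y3.
     f (\<gamma> (x1 * y1) * (x2 * (y2 * \<gamma> y3) * \<gamma> x3))))))"
    by (simp add: mult.assoc)
  also have "\<dots> = sw A x (\<lambda>x1 x'. sw A x' (\<lambda>x2 x3. f (\<gamma> (x1 * y) * (x2 * 1 * \<gamma> x3))))"
    by (intro arg_cong[where f="sw A _"] ext sw_ar_end[of "\<lambda>y1 u. f (\<gamma> (_ * y1) * (_ * u * \<gamma> _))"]) (intro l)+
  also have "\<dots> = sw A x (\<lambda>x1 x'. sw A x' (\<lambda>x2 x3. f (\<gamma> (x1 * y) * (x2 * \<gamma> x3))))" by simp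
  also have "\<dots> = f (\<gamma> (x * y) * 1)"
    by (rule sw_ar_end[of "\<lambda>x1 u. f (\<gamma> (x1 * y) * u)"]) (intro l)+
  finally have 1: "?S = f (\<gamma> (x * y))" by simp
  have "?S = sw A x (\<lambda>x' x3. sw A x' (\<lambda>x1 x2. sw A y (\<lambda>y' y3. sw A y' (\<lambda>y1 y2.
     f (\<gamma> (x1 * y1) * ((x2 * y2) * (\<gamma> y3 * \<gamma> x3)))))))"
    by (simp only: sw_coassoc)
  also have "\<dots> = sw A x (\<lambda>x' x3. sw A y (\<lambda>y' y3. sw A x' (\<lambda>x1 x2. sw A y' (\<lambda>y1 y2.
     f (\<gamma> (x1 * y1) * (x2 * y2) * (\<gamma> y3 * \<gamma> x3))))))"
    by (simp add: sw_swap[of y] mult.assoc)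
  also have "\<dots> = sw A x (\<lambda>x' x3. sw A y (\<lambda>y' y3. sw A (x' * y') (\<lambda>p q. f (\<gamma> p * q * (\<gamma> y3 * \<gamma> x3)))))"
    by (intro arg_cong[where f="sw A _"] ext sw_mult[of "\<lambda>p q. f (\<gamma> p * q * _)", symmetric]) (intro l)+
  also have "\<dots> = sw A x (\<lambda>x' x3. sw A y (\<lambda>y' y3. \<epsilon> (x' * y') * f (1 * (\<gamma> y3 * \<gamma> x3))))"
    by (intro arg_cong[where f="sw A _"] ext sw_antipode_l[of "\<lambda>u. f (u * _)"]) (intro l)+
  also have "\<dots> = sw A x (\<lambda>x' x3. \<epsilon> x' * sw A y (\<lambda>y' y3. \<epsilon> y' * f (\<gamma> y3 * \<gamma> x3)))"
    by (simp add: sw_cmult mult.assoc)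
  also have "\<dots> = sw A x (\<lambda>x' x3. \<epsilon> x' * f (\<gamma> y * \<gamma> x3))"
    by (intro arg_cong[where f="sw A _"] ext arg_cong2[where f="(*)"] refl sw_counit_l) (intro l)+
  also have "\<dots> = f (\<gamma> y * \<gamma> x)"
    by (rule sw_counit_l) (intro l)+
  finally show "f (\<gamma> (x * y)) = f (\<gamma> y * \<gamma> x)" using 1 by simp
qed

text \<open>The dual argument: \<Delta>\<gamma> and the flipped (\<gamma> \<otimes>
  \<gamma>)\<Delta> both invert \<Delta> under convolution. In \<open>?S\<close> the leg x1 carries
  \<Delta>\<gamma>, x2 and x3 the two legs of \<Delta>, x4 and x5 the flipped antipodes.\<close>

lemma sw_antipode:
  assumes F: "\<And>b. lf A (\<lambda>a. F a b)" "\<And>a. lf A (F a)"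
  shows "sw A (\<gamma> x) F = sw A x (\<lambda>a b. F (\<gamma> b) (\<gamma> a))"
proof -
  note l = lins lf_comp[OF F(1)] lf_comp[OF F(2)]
  let ?S = "sw A x (\<lambda>x1 y. sw A y (\<lambda>x2 y. sw A y (\<lambda>x3 y. sw A y (\<lambda>x4 x5.
     sw A (\<gamma> x1) (\<lambda>p q. F (p * (x2 * \<gamma> x5)) (q * (x3 * \<gamma> x4)))))))"
  have "?S = sw A x (\<lambda>x1 y. sw A y (\<lambda>x2 y.
     sw A (\<gamma> x1) (\<lambda>p q. F (p * (x2 * \<gamma> y)) (q * 1))))"
    by (intro arg_cong[where f="sw A _"] ext
        sw_ar[of "\<lambda>u d. sw A (\<gamma> _) (\<lambda>p q. F (p * (_ * \<gamma> d)) (q * u))"]) (intro l)+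
  also have "\<dots> = sw A (\<gamma> x) (\<lambda>p q. F (p * 1) (q * 1))"
    by (rule sw_ar_end[of "\<lambda>b u. sw A (\<gamma> b) (\<lambda>p q. F (p * u) (q * 1))"]) (intro l)+
  finally have 1: "?S = sw A (\<gamma> x) F" by simp
  have "?S = sw A x (\<lambda>x1 y. sw A y (\<lambda>y y'. sw A y (\<lambda>x2 x3. sw A y' (\<lambda>x4 x5.
     sw A (\<gamma> x1) (\<lambda>p q. F (p * (x2 * \<gamma> x5)) (q * (x3 * \<gamma> x4)))))))"
    by (simp only: sw_coassoc)
  also have "\<dots> = sw A x (\<lambda>x1 y. sw A y (\<lambda>y y'. sw A y' (\<lambda>x4 x5.
     sw A (\<gamma> x1) (\<lambda>p q. sw A y (\<lambda>x2 x3. F (p * x2 * \<gamma> x5) (q * x3 * \<gamma> x4))))))"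
    apply (intro arg_cong[where f="sw A _"] ext)
    apply (subst sw_swap) apply (intro arg_cong[where f="sw A _"] ext)
    apply (subst sw_swap) apply (intro arg_cong[where f="sw A _"] ext)
    by (simp add: mult.assoc)
  also have "\<dots> = sw A x (\<lambda>x1 y. sw A y (\<lambda>y y'. sw A y' (\<lambda>x4 x5.
     sw A (\<gamma> x1 * y) (\<lambda>p q. F (p * \<gamma> x5) (q * \<gamma> x4)))))"
    by (intro arg_cong[where f="sw A _"] ext sw_mult[of "\<lambda>p q. F (p * \<gamma> _) (q * \<gamma> _)", symmetric]) (intro l)+
  also have "\<dots> = sw A x (\<lambda>x4 x5. sw A 1 (\<lambda>p q. F (p * \<gamma> x5) (q * \<gamma> x4)))"
    by (rule sw_al[of "\<lambda>u d. sw A d (\<lambda>x4 x5. sw A u (\<lambda>p q. F (p * \<gamma> x5) (q * \<gamma> x4)))"]) (intro l)+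
  also have "\<dots> = sw A x (\<lambda>x4 x5. F (1 * \<gamma> x5) (1 * \<gamma> x4))"
    by (intro arg_cong[where f="sw A _"] ext sw_one[of "\<lambda>p q. F (p * \<gamma> _) (q * \<gamma> _)"]) (intro l)+
  finally show ?thesis using 1 by simp
qed

lemma g'_one [simp]: "g' 1 = 1" by (metis antipode_one g'g)
lemma counit_g' [simp]: "\<epsilon> (g' x) = \<epsilon> x" by (metis counit_antipode gg')
lemma g'_mult: "g' (x * y) = g' y * g' x" by (metis antipode_mult gg' g'g)

text \<open>This is the rule for the antipode at the argument \<open>g' x\<close>, with the inverse
  antipode built into the form.\<close>

lemma sw_g':
  assumes F: "\<And>b. lf A (\<lambda>a. F a b)" "\<And>a. lf A (F a)"
  shows "sw A (g' x) F = sw A x (\<lambda>a b. F (g' b) (g' a))"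
proof -
  note l = lins lf_comp[OF F(1)] lf_comp[OF F(2)]
  have "sw A (\<gamma> (g' x)) (\<lambda>a b. F (g' b) (g' a)) = sw A (g' x) (\<lambda>a b. F (g' (\<gamma> a)) (g' (\<gamma> b)))"
    by (rule sw_antipode) (intro l)+
  then show ?thesis by simp
qed

text \<open>Applying the inverse antipode to the antipode axiom reverses the product, so the legs
  appear in the opposite order.\<close>

lemma sw_g'_l: assumes f: "lf A F" shows "sw A x (\<lambda>a b. F (g' b * a)) = \<epsilon> x * F 1"
proof -
  have "sw A x (\<lambda>a b. F (g' (\<gamma> a * b))) = \<epsilon> x * F (g' 1)"
    by (rule sw_antipode_l[of "\<lambda>x. F (g' x)"]) (intro lins lf_comp[OF f])+
  then show ?thesis by (simp add: g'_mult)
qed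

lemma sw_g'_r: assumes f: "lf A F" shows "sw A x (\<lambda>a b. F (b * g' a)) = \<epsilon> x * F 1"
proof -
  have "sw A x (\<lambda>a b. F (g' (a * \<gamma> b))) = \<epsilon> x * F (g' 1)"
    by (rule sw_antipode_r[of "\<lambda>x. F (g' x)"]) (intro lins lf_comp[OF f])+
  then show ?thesis by (simp add: g'_mult)
qed

lemma sw_g'r:
  assumes "\<And>d. lf A (\<lambda>u. F u d)" "lf A (F 1)"
  shows "sw A x (\<lambda>b y. sw A y (\<lambda>c d. F (c * g' b) d)) = F 1 x"
  unfolding sw_coassoc[symmetric] by (simp add: sw_g'_r[OF assms(1)] sw_counit_l assms)

lemma sw_g'l_end:
  assumes "\<And>d. lf A (\<lambda>u. F d u)" "lf A (\<lambda>x. F x 1)"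
  shows "sw A x (\<lambda>b y. sw A y (\<lambda>c d. F b (g' d * c))) = F x 1"
  by (simp add: sw_g'_l[OF assms(1)] sw_counit_r assms(2))

lemma sw_g'r_end:
  assumes "\<And>d. lf A (\<lambda>u. F d u)" "lf A (\<lambda>x. F x 1)"
  shows "sw A x (\<lambda>b y. sw A y (\<lambda>c d. F b (d * g' c))) = F x 1"
  by (simp add: sw_g'_r[OF assms(1)] sw_counit_r assms(2))

section \<open>Pairings and products of pure tensors in A* \<otimes> A\<close>

abbreviation dt where "dt \<equiv> dtens A"
abbreviation dm where "dm \<equiv> dual_mult A"
abbreviation hm where "hm \<equiv> heisenberg_mult A"
abbreviation Dm where "Dm \<equiv> drinfeld_mult A"

lemma db_e: "db i (e j) = (if i = j then 1 else 0)"
  by (auto simp: dual_basis_def cf_e)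

lemma lf_db': "lf A (db i)" using lf_db[OF la_id] .

lemma dm_eq: "dm f g = (\<lambda>x. sw A x (\<lambda>a b. f a * g b))"
  by (simp add: fun_eq_iff dual_mult_def sum_pair sw_def mult.assoc)

lemma lf_dm: "la A G \<Longrightarrow> lf A (\<lambda>x. dm f g (G x))"
  unfolding dm_eq by (rule lf_sw_arg)
lemma lf_dm': "lf A (dm f g)" using lf_dm[OF la_id] .

lemma dt_nth: "dt f a $ (i, j) = f (e i) * cf a $ j"
  by (simp add: dtens_def)

lemma axis_dt: "axis (i, j) 1 = dt (db i) (e j)"
  by (auto simp: vec_eq_iff dt_nth axis_nth' db_e cf_e)

lemma kfun_dt: "kfun L \<Longrightarrow> L (dt f a) = (\<Sum>i\<in>UNIV. \<Sum>j\<in>UNIV. f (e i) * (cf a $ j * L (axis (i, j) 1)))"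
  by (subst kfun_expand, assumption) (simp add: sum_pair' dt_nth mult.assoc)

text \<open>The pairing with \<open>y \<otimes> P\<close>: elements of \<open>A\<^sup>* \<otimes> A\<close> with the same pairings are equal, so identities
  between them become identities in the Sweedler calculus.\<close>

definition ev :: "('k, 'i) double \<Rightarrow> 'a \<Rightarrow> ('a \<Rightarrow> 'k) \<Rightarrow> 'k" where
  "ev v y P = (\<Sum>i\<in>UNIV. \<Sum>j\<in>UNIV. v $ (i, j) * (cf y $ i * P (e j)))"

lemma kfun_ev: "kfun (\<lambda>v. ev v y P)"
  unfolding ev_def by (intro kfun_sumI kfun_multc kfun_nth)

lemma ev_dt: "lf A f \<Longrightarrow> lf A P \<Longrightarrow> ev (dt f a) y P = f y * P a"
proof -
  assume f: "lf A f" and P: "lf A P"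
  have "ev (dt f a) y P = (\<Sum>i\<in>UNIV. cf y $ i * f (e i)) * (\<Sum>j\<in>UNIV. cf a $ j * P (e j))"
    unfolding ev_def dt_nth sum_product by (intro sum.cong refl) (simp add: mult_ac)
  then show ?thesis by (simp add: lf_expand f P)
qed

text \<open>Pairing with \<open>e i\<close> and the \<open>j\<close>-th coordinate functional
  returns the coefficient at \<open>(i, j)\<close>.\<close>

lemma evI: "(\<And>y P. lf A P \<Longrightarrow> ev v y P = ev w y P) \<Longrightarrow> v = w"
proof -
  assume h: "\<And>y P. lf A P \<Longrightarrow> ev v y P = ev w y P"
  have d: "ev v (e i) (\<lambda>x. cf x $ j) = v $ (i, j)" for v i j
    unfolding ev_def cf_e by (simp add: if_distrib[of "\<lambda>x. _ * x"] if_distrib[of "\<lambda>x. x * _"] cong: if_cong)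
  show ?thesis unfolding vec_eq_iff
  proof
    fix p show "v $ p = w $ p" using h[OF lf_cf[of "snd p"], of "e (fst p)"] by (simp add: d)
  qed
qed

text \<open>Linearity in the functional. Only linear functionals \<open>f\<close> matter, since \<^typ>\<open>'a \<Rightarrow> 'k\<close> also
  contains functions outside \<open>A\<^sup>*\<close>.\<close>

definition flin :: "(('a \<Rightarrow> 'k) \<Rightarrow> 'k) \<Rightarrow> bool" where
  "flin G \<longleftrightarrow> (\<forall>f. lf A f \<longrightarrow> (\<Sum>i\<in>UNIV. f (e i) * G (db i)) = G f)"

lemma flin_app: "flin (\<lambda>f. f x)"
  unfolding flin_def dual_basis_def using lf_expand by (simp add: mult.commute)
lemma flin_mult1: "flin F \<Longrightarrow> flin (\<lambda>f. F f * c)"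
  by (simp add: flin_def mult.assoc[symmetric] sum_distrib_right[symmetric])
lemma flin_mult2: "flin F \<Longrightarrow> flin (\<lambda>f. c * F f)"
  by (simp add: flin_def mult.left_commute[of _ c] sum_distrib_left[symmetric])
lemma flin_sum: "(\<And>i. flin (F i)) \<Longrightarrow> flin (\<lambda>f. \<Sum>i\<in>I. F i f)"
  by (simp add: flin_def sum_distrib_left sum.swap[of _ I])
lemma flin_sw: "(\<And>a b. flin (\<lambda>f. F f a b)) \<Longrightarrow> flin (\<lambda>f. sw A x (F f))"
  unfolding sw_def by (intro flin_sum flin_mult2)
lemma flin_dm1: "flin (\<lambda>f. dm f g x)"
  unfolding dm_eq by (intro flin_sw flin_mult1 flin_app)
lemma flin_dm2: "(\<And>x. flin (\<lambda>f. G f x)) \<Longrightarrow> flin (\<lambda>f. dm g (G f) x)"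
  unfolding dm_eq by (intro flin_sw flin_mult2)
lemma flin_dt: "kfun L \<Longrightarrow> (\<And>x. flin (\<lambda>f. G f x)) \<Longrightarrow> flin (\<lambda>f. L (dt (G f) a))"
  by (subst kfun_dt, assumption) (intro flin_sum flin_mult1)

lemmas flins = flin_app flin_mult1 flin_mult2 flin_sum flin_sw flin_dm1 flin_dm2 flin_dt

lemma flinD: "flin G \<Longrightarrow> lf A f \<Longrightarrow> (\<Sum>i\<in>UNIV. f (e i) * G (db i)) = G f"
  by (simp add: flin_def)

lemma lf_dt: "kfun L \<Longrightarrow> la A G \<Longrightarrow> lf A (\<lambda>a. L (dt f (G a)))"
  by (subst kfun_dt, assumption) (intro lf_sumI lf_mult2 lf_mult1 lf_coord)

lemma lf_dt_fun: "kfun L \<Longrightarrow> (\<And>y. lf A (\<lambda>x. F x y)) \<Longrightarrow> lf A (\<lambda>x. L (dt (F x) a))"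
  by (subst kfun_dt, assumption) (intro lf_sumI lf_mult1)

lemma lf_dm_fun1: "(\<And>y. lf A (\<lambda>x. F x y)) \<Longrightarrow> lf A (\<lambda>x. dm (F x) g y)"
  unfolding dm_eq by (intro lf_sw_body lf_mult1)
lemma lf_dm_fun2: "(\<And>y. lf A (\<lambda>x. F x y)) \<Longrightarrow> lf A (\<lambda>x. dm g (F x) y)"
  unfolding dm_eq by (intro lf_sw_body lf_mult2)

lemma collapse4:
  assumes f: "lf A f" and g: "lf A g"
    and T: "\<And>a g b. flin (\<lambda>f. T f a g b)" "\<And>f g b. lf A (\<lambda>a. T f a g b)"
      "\<And>f a b. flin (\<lambda>g. T f a g b)" "\<And>f a g. lf A (\<lambda>b. T f a g b)"
  shows "(\<Sum>i\<in>UNIV. \<Sum>j\<in>UNIV. \<Sum>l\<in>UNIV. \<Sum>m\<in>UNIV.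
     f (e i) * (cf a $ j * (g (e l) * (cf b $ m * T (db i) (e j) (db l) (e m))))) = T f a g b"
  by (simp only: sum_distrib_left[symmetric] lf_expand[OF T(4)] lf_expand[OF T(2)]
      flinD[OF T(1) f] flinD[OF T(3) g])

text \<open>Both doubles define their product on basis vectors. If the expected formula
  \<open>T\<close> is linear in its four entries, the sum over the bases collapses and the formula
  holds for all pure tensors with linear functionals.\<close>

lemma kfun_bilin_dt:
  assumes L: "kfun L" and f: "lf A f" and g: "lf A g"
    and P: "\<And>i j l m. L (P (i, j) (l, m)) = T (db i) (e j) (db l) (e m)"
    and T: "\<And>a g b. flin (\<lambda>f. T f a g b)" "\<And>f g b. lf A (\<lambda>a. T f a g b)"
      "\<And>f a b. flin (\<lambda>g. T f a g b)" "\<And>f a g. lf A (\<lambda>b. T f a g b)"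
  shows "L (bilin P (dt f a) (dt g b)) = T f a g b"
proof -
  have "L (bilin P (dt f a) (dt g b)) = (\<Sum>i\<in>UNIV. \<Sum>j\<in>UNIV. \<Sum>l\<in>UNIV. \<Sum>m\<in>UNIV.
     f (e i) * (cf a $ j * (g (e l) * (cf b $ m * T (db i) (e j) (db l) (e m)))))"
    by (simp add: bilin_def kfun_sum[OF L] kfun_scale[OF L] sum_pair' dt_nth P mult.assoc)
  also have "\<dots> = T f a g b" by (rule collapse4[OF f g T])
  finally show ?thesis .
qed

lemma hm_dt:
  assumes L: "kfun L" and f: "lf A f" and g: "lf A g"
  shows "L (hm (dt f a) (dt g b)) = sw A a (\<lambda>a1 a2. L (dt (dm f (\<lambda>x. g (x * a1))) (a2 * b)))"
  unfolding heisenberg_mult_def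
  apply (rule kfun_bilin_dt[OF L f g, where T="\<lambda>f a g b. sw A a (\<lambda>a1 a2. L (dt (dm f (\<lambda>x. g (x * a1))) (a2 * b)))"])
  subgoal by (simp add: heisenberg_pure_mult_def kfun_sum[OF L] kfun_scale[OF L] sum_pair sw_def)
  by (intro flins lins lf_dt[OF L] L)+

lemma Dm_dt:
  assumes L: "kfun L" and f: "lf A f" and g: "lf A g"
  shows "L (Dm (dt f a) (dt g b)) = sw A a (\<lambda>a1 a'. sw A a' (\<lambda>a2 a3. L (dt (dm f (\<lambda>x. g (g' a3 * x * a1))) (a2 * b))))"
proof -
  \<comment> \<open>\<open>comul3\<close> splits the first leg of the coproduct again, whereas the
    formula nests to the right; the last step is coassociativity.\<close>
  have comul3_sum: "(\<Sum>(p, q, r)\<in>UNIV. comul3 A a $ (p, q, r) * F (e p) (e q) (e r))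
     = sw A a (\<lambda>a1 a'. sw A a' (\<lambda>a2 a3. F a1 a2 a3))" for a F
  proof -
    have "(\<Sum>(p, q, r)\<in>UNIV. comul3 A a $ (p, q, r) * F (e p) (e q) (e r))
       = (\<Sum>p\<in>UNIV. \<Sum>q\<in>UNIV. \<Sum>r\<in>UNIV. \<Sum>m\<in>UNIV. comul A a $ (m, r) * (comul A (e m) $ (p, q) * F (e p) (e q) (e r)))"
      by (simp add: sum_pair' comul3_def sum_distrib_right mult.assoc)
    also have "\<dots> = (\<Sum>m\<in>UNIV. \<Sum>r\<in>UNIV. \<Sum>p\<in>UNIV. \<Sum>q\<in>UNIV. comul A a $ (m, r) * (comul A (e m) $ (p, q) * F (e p) (e q) (e r)))"
      using sum.swap[of "\<lambda>(p, q) (m, r). comul A a $ (m, r) * (comul A (e m) $ (p, q) * F (e p) (e q) (e r))" "UNIV::('i\<times>'i) set" "UNIV::('i\<times>'i) set"]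
      by (simp add: sum_pair' sum.swap[of "\<lambda>r m. comul A a $ (m, r) * _ m r"])
    also have "\<dots> = sw A a (\<lambda>m r. sw A m (\<lambda>p q. F p q r))"
      by (simp add: sw_def sum_distrib_left)
    finally show ?thesis by (simp only: sw_coassoc)
  qed
  show ?thesis
  unfolding drinfeld_mult_def
  apply (rule kfun_bilin_dt[OF L f g, where T="\<lambda>f a g b. sw A a (\<lambda>a1 a'. sw A a' (\<lambda>a2 a3. L (dt (dm f (\<lambda>x. g (g' a3 * x * a1))) (a2 * b))))"])
  subgoal
    by (simp add: drinfeld_pure_mult_def kfun_sum[OF L] kfun_scale[OF L] comul3_sum[symmetric] split_def)
  by (intro flins lins lf_dt[OF L] L)+
qed

section \<open>Associativity and units of the Heisenberg and Drinfeld doubles\<close>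

lemma sw_swap2: "sw A y (\<lambda>p q. sw A q (\<lambda>r s. sw A x (\<lambda>a b. G p q r s a b)))
   = sw A x (\<lambda>a b. sw A y (\<lambda>p q. sw A q (\<lambda>r s. G p q r s a b)))"
  by (simp add: sw_swap[of _ x])

lemma kbil_hm: "kbil hm" unfolding heisenberg_mult_def by (rule kbil_bilin)
lemma kbil_Dm: "kbil Dm" unfolding drinfeld_mult_def by (rule kbil_bilin)

lemma klin_dt_eqI:
  assumes "klin f" "klin g" "\<And>h a. lf A h \<Longrightarrow> f (dt h a) = g (dt h a)"
  shows "f x = g x"
  by (rule klin_eqI[OF assms(1,2)]) (metis assms(3) axis_dt lf_db' surj_pair)

lemma trilin_dt_eqI:
  assumes m: "kbil m"
    and h: "\<And>f a g b h c. lf A f \<Longrightarrow> lf A g \<Longrightarrow> lf A h \<Longrightarrow> m (m (dt f a) (dt g b)) (dt h c) = m (dt f a) (m (dt g b) (dt h c))"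
  shows "m (m x y) z = m x (m y z)"
proof -
  have l: "klin (\<lambda>x. m (m x y) z)" "klin (\<lambda>y. m (m x y) z)" "klin (\<lambda>z. m (m x y) z)"
   "klin (\<lambda>x. m x (m y z))" "klin (\<lambda>y. m x (m y z))" "klin (\<lambda>z. m x (m y z))" for x y z
    by (rule klin_comp[OF kbil1[OF m] kbil1[OF m]] klin_comp[OF kbil1[OF m] kbil2[OF m]] kbil2[OF m]
        kbil1[OF m] klin_comp[OF kbil2[OF m] kbil1[OF m]] klin_comp[OF kbil2[OF m] kbil2[OF m]])+
  show ?thesis
    apply (rule klin_dt_eqI[OF l(1) l(4)])
    apply (rule klin_dt_eqI[OF l(2) l(5)])
    apply (rule klin_dt_eqI[OF l(3) l(6)])
    by (rule h)
qed

lemma ev_dt_dm: "lf A P \<Longrightarrow> ev (dt (dm f g) a) y P = sw A y (\<lambda>y1 y2. f y1 * g y2) * P a"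
  by (simp add: ev_dt lf_dm' dm_eq[symmetric] lf_dm) (simp add: dm_eq)

text \<open>Paired with \<open>y\<close> and \<open>P\<close>, both bracketings become \<Sum> f(y')
  g(y'' a') h(y''' a'' b') P(a''' b'' c).\<close>

lemma hm_assoc: "hm (hm x y) z = hm x (hm y z)"
proof (rule trilin_dt_eqI[OF kbil_hm], rule evI)
  fix f a g b h c y P
  assume f: "lf A f" and g: "lf A g" and h: "lf A h" and P: "lf A P"
  note l = lins lf_comp[OF f] lf_comp[OF g] lf_comp[OF h] lf_comp[OF P] lf_dm'
  have L1: "kfun (\<lambda>v. ev (hm v (dt h c)) y P)"
    by (rule kfun_comp[OF kfun_ev kbil1[OF kbil_hm]])
  have L2: "kfun (\<lambda>v. ev (hm (dt f a) v) y P)"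
    by (rule kfun_comp[OF kfun_ev kbil2[OF kbil_hm]])
  have "ev (hm (hm (dt f a) (dt g b)) (dt h c)) y P
    = sw A a (\<lambda>a1 a2. sw A (a2 * b) (\<lambda>s t. ev (dt (dm (dm f (\<lambda>x. g (x * a1))) (\<lambda>x. h (x * s))) (t * c)) y P))"
    by (simp add: hm_dt[OF L1 f g] hm_dt[OF kfun_ev lf_dm' h])
  also have "\<dots> = sw A a (\<lambda>a1 a2. sw A (a2 * b) (\<lambda>s t. sw A y (\<lambda>y1 y2. sw A y2 (\<lambda>y2 y3. f y1 * g (y2 * a1) * h (y3 * s) * P (t * c)))))"
    by (simp add: ev_dt_dm[OF P]) (simp add: sw_multc[symmetric] dm_eq sw_coassoc)
  also have "\<dots> = sw A a (\<lambda>a1 a2. sw A a2 (\<lambda>a2 a3. sw A b (\<lambda>b1 b2.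
      sw A y (\<lambda>y1 y2. sw A y2 (\<lambda>y2 y3. f y1 * g (y2 * a1) * h (y3 * (a2 * b1)) * P (a3 * b2 * c))))))"
    by (intro arg_cong[where f="sw A _"] ext sw_mult[where F="\<lambda>s t. sw A y (\<lambda>y1 y2. sw A y2 (\<lambda>y2 y3. f y1 * g (y2 * _) * h (y3 * s) * P (t * c)))"])
      (intro l)+
  finally have 1: "ev (hm (hm (dt f a) (dt g b)) (dt h c)) y P = \<dots>" .
  have "ev (hm (dt f a) (hm (dt g b) (dt h c))) y P
    = sw A b (\<lambda>b1 b2. sw A a (\<lambda>a1 a2. ev (dt (dm f (\<lambda>x. dm g (\<lambda>x. h (x * b1)) (x * a1))) (a2 * (b2 * c))) y P))"
    by (simp add: hm_dt[OF L2 g h] hm_dt[OF kfun_ev f lf_dm'])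
  also have "\<dots> = sw A b (\<lambda>b1 b2. sw A a (\<lambda>a1 a2. sw A y (\<lambda>y1 y2.
       f y1 * sw A (y2 * a1) (\<lambda>y2 a1. g y2 * h (a1 * b1)) * P (a2 * (b2 * c)))))"
    by (simp add: ev_dt_dm[OF P]) (simp add: sw_multc[symmetric] dm_eq)
  also have "\<dots> = sw A b (\<lambda>b1 b2. sw A a (\<lambda>a1 a3. sw A y (\<lambda>y1 y2.
       f y1 * sw A y2 (\<lambda>y2 y3. sw A a1 (\<lambda>a1 a2. g (y2 * a1) * h (y3 * a2 * b1))) * P (a3 * (b2 * c)))))"
    by (intro arg_cong[where f="sw A _"] ext arg_cong2[where f="(*)"] refl sw_mult) (intro l)+
  also have "\<dots> = sw A b (\<lambda>b1 b2. sw A a (\<lambda>a1 a3. sw A a1 (\<lambda>a1 a2. sw A y (\<lambda>y1 y2.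
       sw A y2 (\<lambda>y2 y3. f y1 * g (y2 * a1) * h (y3 * (a2 * b1)) * P (a3 * b2 * c))))))"
    by (simp add: sw_cmult[symmetric] sw_multc[symmetric] sw_swap2 mult.assoc)
  also have "\<dots> = sw A a (\<lambda>a1 a2. sw A a2 (\<lambda>a2 a3. sw A b (\<lambda>b1 b2.
      sw A y (\<lambda>y1 y2. sw A y2 (\<lambda>y2 y3. f y1 * g (y2 * a1) * h (y3 * (a2 * b1)) * P (a3 * b2 * c))))))"
    by (simp add: sw_swap[of b] sw_coassoc)
  finally show "ev (hm (hm (dt f a) (dt g b)) (dt h c)) y P = ev (hm (dt f a) (hm (dt g b) (dt h c))) y P"
    using 1 by simp
qed

text \<open>In the Drinfeld product the argument of a functional is twisted on both sides. This is
  the coproduct of such an argument; the inverse antipode exchanges the two legs of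
  \<open>z\<close>.\<close>

lemma sw_adj:
  assumes F: "\<And>b. lf A (\<lambda>a. F a b)" "\<And>a. lf A (F a)"
  shows "sw A (g' z * y * x) F = sw A z (\<lambda>z1 z2. sw A x (\<lambda>x1 x2. sw A y (\<lambda>y1 y2. F (g' z2 * y1 * x1) (g' z1 * y2 * x2))))"
proof -
  note l = lins lf_comp[OF F(1)] lf_comp[OF F(2)]
  have "sw A (g' z * y * x) F = sw A (g' z * y) (\<lambda>r r'. sw A x (\<lambda>t t'. F (r * t) (r' * t')))"
    by (rule sw_mult) (intro l F)+
  also have "\<dots> = sw A (g' z) (\<lambda>m m'. sw A y (\<lambda>n n'. sw A x (\<lambda>t t'. F (m * n * t) (m' * n' * t'))))"
    by (rule sw_mult) (intro l F)+
  also have "\<dots> = sw A (g' z) (\<lambda>m m'. sw A x (\<lambda>t t'. sw A y (\<lambda>n n'. F (m * n * t) (m' * n' * t'))))"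
    by (simp add: sw_swap[of y])
  also have "\<dots> = sw A z (\<lambda>m m'. sw A x (\<lambda>t t'. sw A y (\<lambda>n n'. F (g' m' * n * t) (g' m * n' * t'))))"
    by (rule sw_g') (intro l F)+
  finally show ?thesis .
qed

lemma kfun_dt_sw: "kfun L \<Longrightarrow> L (dt (\<lambda>x. sw A z (\<lambda>u v. F u v x)) a) = sw A z (\<lambda>u v. L (dt (F u v) a))"
  by (simp add: kfun_dt sw_sum sw_multc)

lemma dm_sw: "dm f (\<lambda>x. sw A z (\<lambda>u v. F u v x)) = (\<lambda>x. sw A z (\<lambda>u v. dm f (F u v) x))"
  unfolding dm_eq sw_cmult[symmetric] by (subst sw_swap) (rule refl)

text \<open>Both bracketings reach \<open>?N\<close>, with five legs of \<open>a\<close> and three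
  of \<open>b\<close>. On the left they arise from the coproducts of a'' b, on the right from
  distributing the outer twist over \<open>g\<close> and \<open>h\<close> by
  \<open>sw_adj\<close>.\<close>

lemma Dm_assoc: "Dm (Dm x y) z = Dm x (Dm y z)"
proof (rule trilin_dt_eqI[OF kbil_Dm], rule vec_eq_kfunI)
  fix f a g b h c and L :: "('k, 'i) double \<Rightarrow> 'k"
  assume f: "lf A f" and g: "lf A g" and h: "lf A h" and L: "kfun L"
  note l = lins lf_comp[OF f] lf_comp[OF g] lf_comp[OF h] lf_dm' lf_dm_fun1 lf_dm_fun2 lf_dt_fun[OF L] lf_dt[OF L]
  have L1: "kfun (\<lambda>v. L (Dm v (dt h c)))"
    by (rule kfun_comp[OF L kbil1[OF kbil_Dm]])
  have L2: "kfun (\<lambda>v. L (Dm (dt f a) v))"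
    by (rule kfun_comp[OF L kbil2[OF kbil_Dm]])
  let ?G = "\<lambda>a1 a2 a3 a4 a5 b1 b2 b3. L (dt (dm (dm f (\<lambda>x. g (g' a5 * x * a1))) (\<lambda>x. h (g' (a4 * b3) * x * (a2 * b1)))) (a3 * b2 * c))"
  let ?N = "sw A a (\<lambda>a1 x. sw A x (\<lambda>a2 x. sw A x (\<lambda>a3 x. sw A x (\<lambda>a4 a5.
       sw A b (\<lambda>b1 x. sw A x (\<lambda>b2 b3. ?G a1 a2 a3 a4 a5 b1 b2 b3))))))"
  let ?H = "\<lambda>a1 a5 s1 s2 s3. L (dt (dm (dm f (\<lambda>x. g (g' a5 * x * a1))) (\<lambda>x. h (g' s3 * x * s1))) (s2 * c))"
  have "L (Dm (Dm (dt f a) (dt g b)) (dt h c))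
    = sw A a (\<lambda>a1 x. sw A x (\<lambda>a2 a5. sw A (a2 * b) (\<lambda>s1 x. sw A x (\<lambda>s2 s3. ?H a1 a5 s1 s2 s3))))"
    by (simp add: Dm_dt[OF L1 f g] Dm_dt[OF L lf_dm' h])
  also have "\<dots> = sw A a (\<lambda>a1 x. sw A x (\<lambda>a2 a5. sw A a2 (\<lambda>a2 p. sw A b (\<lambda>b1 q. sw A (p * q) (\<lambda>s2 s3. ?H a1 a5 (a2 * b1) s2 s3)))))"
    by (intro arg_cong[where f="sw A _"] ext sw_mult) (intro l)+
  also have "\<dots> = sw A a (\<lambda>a1 x. sw A x (\<lambda>a2 a5. sw A a2 (\<lambda>a2 p. sw A b (\<lambda>b1 q. sw A p (\<lambda>a3 a4. sw A q (\<lambda>b2 b3. ?H a1 a5 (a2 * b1) (a3 * b2) (a4 * b3)))))))"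
    by (intro arg_cong[where f="sw A _"] ext sw_mult) (intro l)+
  also have "\<dots> = ?N"
    by (simp only: sw_swap[of b] sw_coassoc)
  finally have 1: "L (Dm (Dm (dt f a) (dt g b)) (dt h c)) = ?N" .
  have reord: "dm f (\<lambda>x. sw A x (\<lambda>y1 y2. g (p * y1 * q) * h (r * (s * y2 * t) * u)))
     = dm (dm f (\<lambda>x. g (p * x * q))) (\<lambda>x. h ((r * s) * x * (t * u)))" for p q r s t u
    by (simp add: dm_eq sw_coassoc sw_cmult[symmetric] sw_multc[symmetric] mult.assoc)
  have "L (Dm (dt f a) (Dm (dt g b) (dt h c)))
    = sw A b (\<lambda>b1 x. sw A x (\<lambda>b2 b3. sw A a (\<lambda>a1 x. sw A x (\<lambda>a3 a5. L (dt (dm f (\<lambda>x. dm g (\<lambda>x. h (g' b3 * x * b1)) (g' a5 * x * a1))) (a3 * (b2 * c)))))))"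
    by (simp add: Dm_dt[OF L2 g h] Dm_dt[OF L f lf_dm'])
  also have "\<dots> = sw A b (\<lambda>b1 x. sw A x (\<lambda>b2 b3. sw A a (\<lambda>a1 x. sw A x (\<lambda>a3 a5. L (dt (dm f (\<lambda>x.
     sw A a5 (\<lambda>a4 a5. sw A a1 (\<lambda>a1 a2. sw A x (\<lambda>y1 y2. g (g' a5 * y1 * a1) * h (g' b3 * (g' a4 * y2 * a2) * b1)))))) (a3 * (b2 * c)))))))"
    unfolding dm_eq[of g]
    by (subst sw_adj) (intro l refl)+
  also have "\<dots> = sw A b (\<lambda>b1 x. sw A x (\<lambda>b2 b3. sw A a (\<lambda>a1 x. sw A x (\<lambda>a3 a5.
     sw A a5 (\<lambda>a4 a5. sw A a1 (\<lambda>a1 a2. L (dt (dm f (\<lambda>x. sw A x (\<lambda>y1 y2. g (g' a5 * y1 * a1) * h (g' b3 * (g' a4 * y2 * a2) * b1)))) (a3 * (b2 * c)))))))))"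
    by (simp add: dm_sw kfun_dt_sw[OF L])
  also have "\<dots> = sw A b (\<lambda>b1 x. sw A x (\<lambda>b2 b3. sw A a (\<lambda>a1 x. sw A a1 (\<lambda>a1 a2. sw A x (\<lambda>a3 a5.
     sw A a5 (\<lambda>a4 a5. ?G a1 a2 a3 a4 a5 b1 b2 b3))))))"
    unfolding reord unfolding g'_mult mult.assoc by (intro arg_cong[where f="sw A _"] ext sw_swap2)
  also have "\<dots> = ?N"
    by (simp only: sw_swap2[of b] sw_coassoc)
  finally show "L (Dm (Dm (dt f a) (dt g b)) (dt h c)) = L (Dm (dt f a) (Dm (dt g b) (dt h c)))"
    using 1 by (simp add: g'_mult mult.assoc)
qed

abbreviation one where "one \<equiv> double_one A"

lemma one_dt: "one = dt \<epsilon> 1" by (simp add: double_one_def)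

lemma dm_counit1: "lf A f \<Longrightarrow> dm \<epsilon> f = f"
  by (simp add: dm_eq sw_counit_l)
lemma dm_counit2: "lf A f \<Longrightarrow> dm f \<epsilon> = f"
  by (simp add: dm_eq sw_counit_r')
lemma dm_scale2: "dm f (\<lambda>x. c * h x) = (\<lambda>x. c * dm f h x)"
  by (simp add: dm_eq sw_cmult[symmetric] mult.left_commute)
lemma kfun_dt_scale: "kfun L \<Longrightarrow> L (dt (\<lambda>x. c * f x) a) = c * L (dt f a)"
  by (simp add: kfun_dt sum_distrib_left mult.assoc)

lemma Dm_one1: "Dm one x = x"
proof (rule klin_dt_eqI[OF kbil2[OF kbil_Dm] klin_id], rule vec_eq_kfunI)
  fix g b and L :: "('k, 'i) double \<Rightarrow> 'k"
  assume g: "lf A g" and L: "kfun L"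
  note l = lins lf_comp[OF g] lf_dm' lf_dm_fun1 lf_dm_fun2 lf_dt_fun[OF L] lf_dt[OF L]
  have "L (Dm one (dt g b)) = sw A 1 (\<lambda>a1 a'. sw A a' (\<lambda>a2 a3. L (dt (dm \<epsilon> (\<lambda>x. g (g' a3 * x * a1))) (a2 * b))))"
    by (simp add: one_dt Dm_dt[OF L lin_counit g])
  also have "\<dots> = sw A 1 (\<lambda>a2 a3. L (dt (dm \<epsilon> (\<lambda>x. g (g' a3 * x * 1))) (a2 * b)))"
    by (rule sw_one) (intro l)+
  also have "\<dots> = L (dt (dm \<epsilon> (\<lambda>x. g (g' 1 * x * 1))) (1 * b))"
    by (rule sw_one) (intro l)+
  finally show "L (Dm one (dt g b)) = L (dt g b)" by (simp add: dm_counit1[OF g])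
qed

lemma Dm_one2: "Dm x one = x"
proof (rule klin_dt_eqI[OF kbil1[OF kbil_Dm] klin_id], rule vec_eq_kfunI)
  fix g b and L :: "('k, 'i) double \<Rightarrow> 'k"
  assume g: "lf A g" and L: "kfun L"
  note l = lins lf_comp[OF g] lf_dm' lf_dm_fun1 lf_dm_fun2 lf_dt_fun[OF L] lf_dt[OF L]
  have "L (Dm (dt g b) one) = sw A b (\<lambda>a1 a'. sw A a' (\<lambda>a2 a3. L (dt (dm g (\<lambda>x. \<epsilon> (g' a3 * x * a1))) a2)))"
    by (simp add: one_dt Dm_dt[OF L g lin_counit])
  also have "\<dots> = sw A b (\<lambda>a1 a'. sw A a' (\<lambda>a2 a3. L (dt (dm g (\<lambda>x. (\<epsilon> a3 * \<epsilon> a1) * \<epsilon> x)) a2)))"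
    by (simp add: mult_ac)
  also have "\<dots> = sw A b (\<lambda>a1 a'. sw A a' (\<lambda>a2 a3. (\<epsilon> a3 * \<epsilon> a1) * L (dt g a2)))"
    by (simp only: dm_scale2 kfun_dt_scale[OF L] dm_counit2[OF g])
  also have "\<dots> = sw A b (\<lambda>a1 a'. \<epsilon> a1 * sw A a' (\<lambda>a2 a3. \<epsilon> a3 * L (dt g a2)))"
    by (simp add: sw_cmult[symmetric] mult_ac)
  also have "\<dots> = L (dt g b)"
    by (simp add: sw_counit_l sw_counit_r l)
  finally show "L (Dm (dt g b) one) = L (dt g b)" .
qed

lemma hm_one1: "hm one x = x"
proof (rule klin_dt_eqI[OF kbil2[OF kbil_hm] klin_id], rule vec_eq_kfunI)
  fix g b and L :: "('k, 'i) double \<Rightarrow> 'k"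
  assume g: "lf A g" and L: "kfun L"
  note l = lins lf_comp[OF g] lf_dm' lf_dm_fun1 lf_dm_fun2 lf_dt_fun[OF L] lf_dt[OF L]
  have "L (hm one (dt g b)) = sw A 1 (\<lambda>a1 a2. L (dt (dm \<epsilon> (\<lambda>x. g (x * a1))) (a2 * b)))"
    by (simp add: one_dt hm_dt[OF L lin_counit g])
  also have "\<dots> = L (dt (dm \<epsilon> (\<lambda>x. g (x * 1))) (1 * b))"
    by (rule sw_one) (intro l)+
  finally show "L (hm one (dt g b)) = L (dt g b)" by (simp add: dm_counit1[OF g])
qed

lemma hm_one2: "hm x one = x"
proof (rule klin_dt_eqI[OF kbil1[OF kbil_hm] klin_id], rule vec_eq_kfunI)
  fix g b and L :: "('k, 'i) double \<Rightarrow> 'k"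
  assume g: "lf A g" and L: "kfun L"
  note l = lins lf_comp[OF g] lf_dm' lf_dm_fun1 lf_dm_fun2 lf_dt_fun[OF L] lf_dt[OF L]
  have "L (hm (dt g b) one) = sw A b (\<lambda>a1 a2. L (dt (dm g (\<lambda>x. \<epsilon> (x * a1))) a2))"
    by (simp add: one_dt hm_dt[OF L g lin_counit])
  also have "\<dots> = sw A b (\<lambda>a1 a2. L (dt (dm g (\<lambda>x. \<epsilon> a1 * \<epsilon> x)) a2))"
    by (simp add: mult.commute)
  also have "\<dots> = sw A b (\<lambda>a1 a2. \<epsilon> a1 * L (dt g a2))"
    by (simp only: dm_scale2 kfun_dt_scale[OF L] dm_counit2[OF g])
  also have "\<dots> = L (dt g b)"
    by (simp add: sw_counit_l l)
  finally show "L (hm (dt g b) one) = L (dt g b)" .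
qed

section \<open>The homomorphism phi and its multiplicativity\<close>

lemma klin_phi: "klin (phi A)" unfolding phi_def by (rule klin_lin)

lemma comul3_sum: "(\<Sum>p\<in>UNIV. \<Sum>q\<in>UNIV. \<Sum>r\<in>UNIV. comul3 A a $ (p, q, r) * F (e p) (e q) (e r))
     = sw A a (\<lambda>a1 a'. sw A a' (\<lambda>a2 a3. F a1 a2 a3))" for a F
proof -
    have "(\<Sum>p\<in>UNIV. \<Sum>q\<in>UNIV. \<Sum>r\<in>UNIV. comul3 A a $ (p, q, r) * F (e p) (e q) (e r))
       = (\<Sum>p\<in>UNIV. \<Sum>q\<in>UNIV. \<Sum>r\<in>UNIV. \<Sum>m\<in>UNIV. comul A a $ (m, r) * (comul A (e m) $ (p, q) * F (e p) (e q) (e r)))"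
      by (simp add: comul3_def sum_distrib_right mult.assoc)
    also have "\<dots> = (\<Sum>m\<in>UNIV. \<Sum>r\<in>UNIV. \<Sum>p\<in>UNIV. \<Sum>q\<in>UNIV. comul A a $ (m, r) * (comul A (e m) $ (p, q) * F (e p) (e q) (e r)))"
      using sum.swap[of "\<lambda>(p, q) (m, r). comul A a $ (m, r) * (comul A (e m) $ (p, q) * F (e p) (e q) (e r))" "UNIV::('i\<times>'i) set" "UNIV::('i\<times>'i) set"]
      by (simp add: sum_pair' sum.swap[of "\<lambda>r m. comul A a $ (m, r) * _ m r"])
    also have "\<dots> = sw A a (\<lambda>m r. sw A m (\<lambda>p q. F p q r))"
      by (simp add: sw_def sum_distrib_left)
    finally show ?thesis by (simp only: sw_coassoc)
qed

text \<open>The leg f' is paired with x''' at once, which sums out its dual basis; only f'' (index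
  \<open>b\<close>) and f''' (index \<open>c\<close>) stay expanded.\<close>

lemma phi_dt:
  assumes L: "kfun L" and f: "lf A f"
  shows "L (phi A (dt f x)) = sw A x (\<lambda>x1 x'. sw A x' (\<lambda>x2 x3. \<Sum>b\<in>UNIV. \<Sum>c\<in>UNIV.
     f (x3 * e b * e c) * L (tens (dt (db c) x1) (dt (db b \<circ> g') (\<gamma> x2)))))"
proof -
  define T where "T f x = sw A x (\<lambda>x1 x'. sw A x' (\<lambda>x2 x3. \<Sum>b\<in>UNIV. \<Sum>c\<in>UNIV.
     f (x3 * e b * e c) * L (tens (dt (db c) x1) (dt (db b \<circ> g') (\<gamma> x2)))))" for f x
  have pure: "L (phi_pure A f x) = T f x" if f: "lf A f" for f x
  proof -
    have "L (phi_pure A f x) = (\<Sum>a\<in>UNIV. \<Sum>b\<in>UNIV. \<Sum>c\<in>UNIV. \<Sum>i\<in>UNIV. \<Sum>j\<in>UNIV. \<Sum>l\<in>UNIV.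
       comul3 A x $ (i, j, l) * (f (e a * e b * e c) * db a (e l) * L (tens (dt (db c) (e i)) (dt (db b \<circ> g') (\<gamma> (e j))))))"
      unfolding phi_pure_def by (simp add: sum_pair' kfun_sum[OF L] kfun_scale[OF L] mult_ac)
    also have "\<dots> = (\<Sum>a\<in>UNIV. \<Sum>b\<in>UNIV. \<Sum>c\<in>UNIV. sw A x (\<lambda>x1 x'. sw A x' (\<lambda>x2 x3.
       (f (e a * e b * e c) * db a x3 * L (tens (dt (db c) x1) (dt (db b \<circ> g') (\<gamma> x2)))))))"
      by (simp only: comul3_sum[of x "\<lambda>x1 x2 x3. f (e _ * e _ * e _) * db _ x3 * L (tens (dt (db _) x1) (dt (db _ \<circ> g') (\<gamma> x2)))"])
    also have "\<dots> = sw A x (\<lambda>x1 x'. sw A x' (\<lambda>x2 x3. \<Sum>a\<in>UNIV. \<Sum>b\<in>UNIV. \<Sum>c\<in>UNIV.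
       (f (e a * e b * e c) * db a x3 * L (tens (dt (db c) x1) (dt (db b \<circ> g') (\<gamma> x2))))))"
      by (simp only: sw_sum)
    also have "\<dots> = T f x"
    proof -
      have 1: "(\<Sum>a\<in>UNIV. f (e a * e b * e c) * db a z) = f (z * e b * e c)" for b c z
        using lf_expand[of "\<lambda>z. f (z * e b * e c)" z] by (simp add: dual_basis_def mult.commute lins lf_comp[OF f])
      have "(\<Sum>a\<in>UNIV. \<Sum>b\<in>UNIV. \<Sum>c\<in>UNIV. f (e a * e b * e c) * db a z * K b c)
        = (\<Sum>b\<in>UNIV. \<Sum>c\<in>UNIV. f (z * e b * e c) * K b c)" for z K
      proof -
        have "(\<Sum>a\<in>UNIV. \<Sum>b\<in>UNIV. \<Sum>c\<in>UNIV. f (e a * e b * e c) * db a z * K b c)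
           = (\<Sum>b\<in>UNIV. \<Sum>c\<in>UNIV. \<Sum>a\<in>UNIV. f (e a * e b * e c) * db a z * K b c)"
          by (subst sum.swap, rule sum.cong[OF refl], rule sum.swap)
        then show ?thesis by (simp only: sum_distrib_right[symmetric] 1)
      qed
      then show ?thesis unfolding T_def by simp
    qed
    finally show ?thesis .
  qed
  have "L (phi A (dt f x)) = (\<Sum>i\<in>UNIV. \<Sum>j\<in>UNIV. f (e i) * (cf x $ j * T (db i) (e j)))"
    unfolding phi_def lin_def by (simp add: kfun_sum[OF L] kfun_scale[OF L] sum_pair' dt_nth pure lf_db' mult.assoc)
  also have "\<dots> = (\<Sum>i\<in>UNIV. f (e i) * T (db i) x)"
  proof -
    have "lf A (T f)" for f unfolding T_def by (intro lins)
    then show ?thesis by (simp add: sum_distrib_left[symmetric] lf_expand)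
  qed
  also have "\<dots> = T f x"
    by (rule flinD[OF _ f]) (unfold T_def, intro flins)
  finally show ?thesis unfolding T_def .
qed

definition ev2 :: "('k, 'i) double2 \<Rightarrow> 'a \<Rightarrow> 'a \<Rightarrow> ('a \<Rightarrow> 'k) \<Rightarrow> ('a \<Rightarrow> 'k) \<Rightarrow> 'k" where
  "ev2 X y z P Q = (\<Sum>p\<in>UNIV. \<Sum>q\<in>UNIV. X $ (p, q) * (ev (axis p 1) y P * ev (axis q 1) z Q))"

lemma kfun_ev2: "kfun (\<lambda>X. ev2 X y z P Q)"
  unfolding ev2_def by (intro kfun_sumI kfun_multc kfun_nth)

lemma ev2_tens: "ev2 (tens v w) y z P Q = ev v y P * ev w z Q"
proof -
  have "ev2 (tens v w) y z P Q = (\<Sum>p\<in>UNIV. v $ p * ev (axis p 1) y P) * (\<Sum>q\<in>UNIV. w $ q * ev (axis q 1) z Q)"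
    unfolding ev2_def tens_nth sum_product by (intro sum.cong refl) (simp add: mult_ac)
  then show ?thesis by (simp only: kfun_expand[OF kfun_ev, symmetric])
qed

lemma ev2I: "(\<And>y z P Q. lf A P \<Longrightarrow> lf A Q \<Longrightarrow> ev2 X y z P Q = ev2 Y y z P Q) \<Longrightarrow> X = Y"
proof -
  assume h: "\<And>y z P Q. lf A P \<Longrightarrow> lf A Q \<Longrightarrow> ev2 X y z P Q = ev2 Y y z P Q"
  have d: "ev (axis p 1) (e i) (\<lambda>x. cf x $ j) = (if p = (i, j) then 1 else 0)" for p i j
    by (cases p) (auto simp: axis_dt ev_dt lf_db' lf_cf db_e cf_e)
  have d2: "ev2 X (e (fst p)) (e (fst q)) (\<lambda>x. cf x $ snd p) (\<lambda>x. cf x $ snd q) = X $ (p, q)" for X p q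
    unfolding ev2_def by (simp add: d if_distrib[of "\<lambda>x. _ * x"] if_distrib[of "\<lambda>x. x * _"] cong: if_cong)
  show ?thesis unfolding vec_eq_iff
  proof
    fix r show "X $ r = Y $ r" using h[OF lf_cf lf_cf] d2[of X "fst r" "snd r"] d2[of Y "fst r" "snd r"] by simp
  qed
qed

lemma db_collapse2: "lf A f \<Longrightarrow> (\<Sum>b\<in>UNIV. \<Sum>c\<in>UNIV. f (x * e b * e c) * (db c u * db b w * R)) = f (x * w * u) * R"
proof -
  assume f: "lf A f"
  note l = lins lf_comp[OF f]
  have "(\<Sum>b\<in>UNIV. \<Sum>c\<in>UNIV. f (x * e b * e c) * (db c u * db b w * R))
    = (\<Sum>b\<in>UNIV. \<Sum>c\<in>UNIV. cf w $ b * cf u $ c * f (x * e b * e c)) * R"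
    unfolding sum_distrib_right dual_basis_def by (intro sum.cong refl) (simp add: mult_ac)
  also have "\<dots> = f (x * w * u) * R"
    by (subst bilin_coord[of "\<lambda>w u. f (x * w * u)"]) (intro l refl)+
  finally show ?thesis .
qed

lemma db_collapse2': "lf A f \<Longrightarrow> (\<Sum>b\<in>UNIV. \<Sum>c\<in>UNIV. f (x * e b * e c) * (db c u * p * (db b w * q))) = f (x * w * u) * (p * q)"
  using db_collapse2[of f x u w "p * q"] by (simp add: mult_ac)

lemma db_collapse2'': "lf A f \<Longrightarrow> (\<Sum>b\<in>UNIV. \<Sum>c\<in>UNIV. f (x * e b * e c) * (r * (db c u * db b w * q))) = f (x * w * u) * (r * q)"
  using db_collapse2[of f x u w "r * q"] by (simp add: mult.left_commute[of r])

lemma sum2_sw: "(\<Sum>b\<in>UNIV. \<Sum>c\<in>UNIV. F b c * sw A z (K b c)) = sw A z (\<lambda>u v. \<Sum>b\<in>UNIV. \<Sum>c\<in>UNIV. F b c * K b c u v)"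
  by (simp add: sw_cmult sw_sum)

lemma sw_prod: "sw A x F * sw A y G = sw A x (\<lambda>a b. sw A y (\<lambda>c d. F a b * G c d))"
  by (simp add: sw_cmult sw_multc)
lemma sw_prod2: "(sw A x F * p) * (sw A y G * q) = sw A y (\<lambda>c d. sw A x (\<lambda>a b. (F a b * p) * (G c d * q)))"
  by (simp add: sw_cmult sw_multc)

text \<open>Pairing with \<open>y\<close> and \<open>z\<close> sums out the dual bases of f'' and
  f''' as well and leaves a closed form of \<phi>.\<close>

lemma phi_ev2:
  assumes f: "lf A f" and P: "lf A P" and Q: "lf A Q"
  shows "ev2 (phi A (dt f x)) y z P Q = sw A x (\<lambda>x1 x'. sw A x' (\<lambda>x2 x3. f (x3 * g' z * y) * (P x1 * Q (\<gamma> x2))))"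
proof -
  have d: "lf A (db b \<circ> g')" for b unfolding comp_def by (intro lins)
  show ?thesis
    by (simp add: phi_dt[OF kfun_ev2 f] ev2_tens ev_dt lf_db' d P Q db_collapse2'[OF f])
qed

abbreviation HH where "HH \<equiv> HHop_mult A"

lemma kbil_hop: "kbil (opp_mult hm)" by (rule kbil_opp[OF kbil_hm])
lemma kbil_HH: "kbil HH" unfolding HHop_mult_def by (rule kbil_tensor)
lemma HH_tens: "HH (tens v w) (tens v' w') = tens (hm v v') (hm w' w)"
  unfolding HHop_mult_def by (simp add: tensor_mult_tens kbil_hm kbil_hop opp_mult_def)
lemma HH_assoc: "HH (HH x y) z = HH x (HH y z)"
  unfolding HHop_mult_def
  by (rule tensor_mult_assoc[OF kbil_hm kbil_hop]) (simp_all add: opp_mult_def hm_assoc)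

text \<open>Pairings turn both sides into the Sweedler expression \<open>?N\<close>. On the Drinfeld
  side six legs of \<open>a\<close> occur; the inverse antipode of the twist meets its neighbour as
  \<open>g' a6 * a5\<close> and cancels. On the Heisenberg side the opposite product in the second
  factor reverses the order, as \<gamma> does with a product.\<close>

lemma phi_mult: "phi A (Dm v w) = HH (phi A v) (phi A w)"
proof -
  have main: "phi A (Dm (dt f a) (dt g b)) = HH (phi A (dt f a)) (phi A (dt g b))"
    if f: "lf A f" and g: "lf A g" for f g a b
  proof (rule ev2I)
    fix y z P Q assume P: "lf A P" and Q: "lf A Q"
    note l = lins lf_comp[OF f] lf_comp[OF g] lf_comp[OF P] lf_comp[OF Q] lf_dm' lf_dm_fun1 lf_dm_fun2
    have d: "lf A (db b \<circ> g')" for b unfolding comp_def by (intro lins)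
    have L1: "kfun (\<lambda>v. ev2 (phi A v) y z P Q)" by (rule kfun_comp[OF kfun_ev2 klin_phi])
    have L2: "kfun (\<lambda>v. ev2 (HH v w) y z P Q)" "kfun (\<lambda>v. ev2 (HH w v) y z P Q)" for w
      by (rule kfun_comp[OF kfun_ev2 kbil1[OF kbil_HH]] kfun_comp[OF kfun_ev2 kbil2[OF kbil_HH]])+
    have adj: "sw A (s * g' z * y) F = sw A s (\<lambda>s1 s2. sw A z (\<lambda>z1 z2. sw A y (\<lambda>y1 y2. F (s1 * g' z2 * y1) (s2 * g' z1 * y2))))"
      if F: "\<And>b. lf A (\<lambda>a. F a b)" "\<And>a. lf A (F a)" for s F
    proof -
      note l = lins lf_comp[OF F(1)] lf_comp[OF F(2)]
      have "sw A (s * g' z * y) F = sw A (s * g' z) (\<lambda>r r'. sw A y (\<lambda>t t'. F (r * t) (r' * t')))"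
        by (rule sw_mult) (intro l F)+
      also have "\<dots> = sw A s (\<lambda>s s'. sw A (g' z) (\<lambda>r r'. sw A y (\<lambda>t t'. F (s * r * t) (s' * r' * t'))))"
        by (rule sw_mult) (intro l F)+
      also have "\<dots> = sw A s (\<lambda>s s'. sw A z (\<lambda>r r'. sw A y (\<lambda>t t'. F (s * g' r' * t) (s' * g' r * t'))))"
        by (intro arg_cong[where f="sw A _"] ext sw_g') (intro l F)+
      finally show ?thesis .
    qed
    let ?G = "\<lambda>a1 a2 a3 a4 b1 b2 b3 b4 y1 y2 z1 z2. f (a4 * (b3 * g' z2) * y1) * (g (b4 * g' z1 * (y2 * a1)) * (P (a2 * b1) * Q (\<gamma> b2 * \<gamma> a3)))"
    let ?N = "sw A a (\<lambda>a1 x. sw A x (\<lambda>a2 x. sw A x (\<lambda>a3 a4. sw A b (\<lambda>b1 x. sw A x (\<lambda>b2 x. sw A x (\<lambda>b3 b4.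
      sw A z (\<lambda>z1 z2. sw A y (\<lambda>y1 y2. ?G a1 a2 a3 a4 b1 b2 b3 b4 y1 y2 z1 z2))))))))"
    have "ev2 (phi A (Dm (dt f a) (dt g b))) y z P Q
      = sw A a (\<lambda>a1 x. sw A x (\<lambda>a2 a6. sw A (a2 * b) (\<lambda>s1 x. sw A x (\<lambda>s2 s3.
          sw A (s3 * g' z * y) (\<lambda>u v. f u * g (g' a6 * v * a1)) * (P s1 * Q (\<gamma> s2))))))"
      by (simp add: Dm_dt[OF L1 f g] phi_ev2[OF lf_dm' P Q]) (simp add: dm_eq)
    also have "\<dots> = sw A a (\<lambda>a1 x. sw A x (\<lambda>a2 a6. sw A (a2 * b) (\<lambda>s1 x. sw A x (\<lambda>s2 s3.
          sw A s3 (\<lambda>s3 s4. sw A z (\<lambda>z1 z2. sw A y (\<lambda>y1 y2.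
           f (s3 * g' z2 * y1) * g (g' a6 * (s4 * g' z1 * y2) * a1) * (P s1 * Q (\<gamma> s2)))))))))"
      by (simp add: adj l sw_multc)
    also have "\<dots> = sw A a (\<lambda>a1 x. sw A x (\<lambda>a2 a6. sw A a2 (\<lambda>a2 p. sw A b (\<lambda>b1 q. sw A (p * q) (\<lambda>s2 s3.
          sw A s3 (\<lambda>s3 s4. sw A z (\<lambda>z1 z2. sw A y (\<lambda>y1 y2.
           f (s3 * g' z2 * y1) * g (g' a6 * (s4 * g' z1 * y2) * a1) * (P (a2 * b1) * Q (\<gamma> s2))))))))))"
      by (intro arg_cong[where f="sw A _"] ext sw_mult) (intro l)+
    also have "\<dots> = sw A a (\<lambda>a1 x. sw A x (\<lambda>a2 a6. sw A a2 (\<lambda>a2 p. sw A b (\<lambda>b1 q. sw A p (\<lambda>a3 p. sw A q (\<lambda>b2 q.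
          sw A (p * q) (\<lambda>s3 s4. sw A z (\<lambda>z1 z2. sw A y (\<lambda>y1 y2.
           f (s3 * g' z2 * y1) * g (g' a6 * (s4 * g' z1 * y2) * a1) * (P (a2 * b1) * Q (\<gamma> (a3 * b2))))))))))))"
      by (intro arg_cong[where f="sw A _"] ext sw_mult) (intro l)+
    also have "\<dots> = sw A a (\<lambda>a1 x. sw A x (\<lambda>a2 a6. sw A a2 (\<lambda>a2 p. sw A b (\<lambda>b1 q. sw A p (\<lambda>a3 p. sw A q (\<lambda>b2 q.
          sw A p (\<lambda>a4 a5. sw A q (\<lambda>b3 b4. sw A z (\<lambda>z1 z2. sw A y (\<lambda>y1 y2.
           f (a4 * b3 * g' z2 * y1) * g (g' a6 * (a5 * b4 * g' z1 * y2) * a1) * (P (a2 * b1) * Q (\<gamma> (a3 * b2)))))))))))))"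
      by (intro arg_cong[where f="sw A _"] ext sw_mult) (intro l)+
    also have "\<dots> = sw A a (\<lambda>a1 x. sw A x (\<lambda>a2 a6. sw A a2 (\<lambda>a2 p. sw A p (\<lambda>a3 p. sw A p (\<lambda>a4 a5. sw A b (\<lambda>b1 q. sw A q (\<lambda>b2 q.
          sw A q (\<lambda>b3 b4. sw A z (\<lambda>z1 z2. sw A y (\<lambda>y1 y2.
           f (a4 * b3 * g' z2 * y1) * g (g' a6 * (a5 * b4 * g' z1 * y2) * a1) * (P (a2 * b1) * Q (\<gamma> (a3 * b2)))))))))))))"
      by (simp only: sw_swap[of b] sw_swap2[of b])
    also have "\<dots> = sw A a (\<lambda>a1 x. sw A x (\<lambda>a2 x. sw A x (\<lambda>a3 x. sw A x (\<lambda>a4 x. sw A x (\<lambda>a5 a6. sw A b (\<lambda>b1 x. sw A x (\<lambda>b2 x. sw A x (\<lambda>b3 b4.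
      sw A z (\<lambda>z1 z2. sw A y (\<lambda>y1 y2. f (a4 * (b3 * g' z2) * y1) * (g ((g' a6 * a5) * (b4 * g' z1 * (y2 * a1))) * (P (a2 * b1) * Q (\<gamma> b2 * \<gamma> a3)))))))))))))"
      by (simp only: sw_coassoc antipode_mult mult.assoc)
    also have "\<dots> = sw A a (\<lambda>a1 x. sw A x (\<lambda>a2 x. sw A x (\<lambda>a3 a4. sw A b (\<lambda>b1 x. sw A x (\<lambda>b2 x. sw A x (\<lambda>b3 b4.
      sw A z (\<lambda>z1 z2. sw A y (\<lambda>y1 y2. f (a4 * (b3 * g' z2) * y1) * (g (1 * (b4 * g' z1 * (y2 * a1))) * (P (a2 * b1) * Q (\<gamma> b2 * \<gamma> a3)))))))))))"
      apply (intro arg_cong[where f="sw A _"] ext)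
      apply (rule sw_g'l_end[where F="\<lambda>a4 u. sw A b (\<lambda>b1 x. sw A x (\<lambda>b2 x. sw A x (\<lambda>b3 b4.
      sw A z (\<lambda>z1 z2. sw A y (\<lambda>y1 y2. f (a4 * (b3 * g' z2) * y1) * (g (u * (b4 * g' z1 * (y2 * _))) * (P (_ * b1) * Q (\<gamma> b2 * \<gamma> _))))))))"])
       apply (intro l)+
      done
    finally have 1: "ev2 (phi A (Dm (dt f a) (dt g b))) y z P Q = ?N" by simp
    have gs: "(db b' \<circ> g') (z * \<gamma> q) = db b' (q * g' z)" for b' z q by (simp add: g'_mult)
    have K: "ev (hm (dt (db c) a1) (dt (db c') b1)) y P * ev (hm (dt (db b' \<circ> g') (\<gamma> b2)) (dt (db b'' \<circ> g') (\<gamma> a2))) z Q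
      = sw A a1 (\<lambda>a1 a1'. sw A b2 (\<lambda>p q. sw A z (\<lambda>z1 z2. sw A y (\<lambda>y1 y2.
          db c' (y2 * a1) * db b' (g' z1) * (db c y1 * db b'' (q * g' z2) * (P (a1' * b1) * Q (\<gamma> p * \<gamma> a2)))))))" for c c' b' b'' a1 b1 b2 a2
    proof -
      have "ev (hm (dt (db b' \<circ> g') (\<gamma> b2)) (dt (db b'' \<circ> g') (\<gamma> a2))) z Q
        = sw A (\<gamma> b2) (\<lambda>p q. sw A z (\<lambda>z1 z2. (db b' \<circ> g') z1 * (db b'' \<circ> g') (z2 * p)) * Q (q * \<gamma> a2))"
        by (simp add: hm_dt[OF kfun_ev d d] ev_dt_dm[OF Q])
      also have "\<dots> = sw A b2 (\<lambda>p q. sw A z (\<lambda>z1 z2. (db b' \<circ> g') z1 * (db b'' \<circ> g') (z2 * \<gamma> q)) * Q (\<gamma> p * \<gamma> a2))"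
        unfolding comp_def by (rule sw_antipode) (intro l)+
      finally have 2: "ev (hm (dt (db b' \<circ> g') (\<gamma> b2)) (dt (db b'' \<circ> g') (\<gamma> a2))) z Q = \<dots>" .
      have 3: "ev (hm (dt (db c) a1) (dt (db c') b1)) y P = sw A a1 (\<lambda>a1 a1'. sw A y (\<lambda>y1 y2. db c y1 * db c' (y2 * a1)) * P (a1' * b1))"
        by (simp add: hm_dt[OF kfun_ev lf_db' lf_db'] ev_dt_dm[OF P])
      show ?thesis
        unfolding 2 3 unfolding gs unfolding comp_apply sw_prod sw_prod2
        by (intro arg_cong[where f="sw A _"] ext) (simp only: mult_ac)
    qed
    have "ev2 (HH (phi A (dt f a)) (phi A (dt g b))) y z P Q
      = sw A a (\<lambda>a1 x. sw A x (\<lambda>a2 a3. \<Sum>b''\<in>UNIV. \<Sum>c\<in>UNIV. f (a3 * e b'' * e c) *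
         sw A b (\<lambda>b1 x. sw A x (\<lambda>b2 b3. \<Sum>b'\<in>UNIV. \<Sum>c'\<in>UNIV. g (b3 * e b' * e c') *
          sw A a1 (\<lambda>a1 a1'. sw A b2 (\<lambda>p q. sw A z (\<lambda>z1 z2. sw A y (\<lambda>y1 y2.
          db c' (y2 * a1) * db b' (g' z1) * (db c y1 * db b'' (q * g' z2) * (P (a1' * b1) * Q (\<gamma> p * \<gamma> a2))))))))))) "
      by (simp only: phi_dt[OF L2(1) f]) (simp only: phi_dt[OF L2(2) g] HH_tens ev2_tens K)
    also have "\<dots> = sw A a (\<lambda>a1 x. sw A x (\<lambda>a2 a3.
         sw A b (\<lambda>b1 x. sw A x (\<lambda>b2 b3.
          sw A a1 (\<lambda>a1 a1'. sw A b2 (\<lambda>p q. sw A z (\<lambda>z1 z2. sw A y (\<lambda>y1 y2.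
          f (a3 * (q * g' z2) * y1) * (g (b3 * g' z1 * (y2 * a1)) * (P (a1' * b1) * Q (\<gamma> p * \<gamma> a2))))))))))) "
      by (simp only: sum2_sw db_collapse2[OF g]) (simp only: sum2_sw db_collapse2''[OF f])
    also have "\<dots> = sw A a (\<lambda>a1 x. sw A x (\<lambda>a2 a3. sw A a1 (\<lambda>a1 a1'.
         sw A b (\<lambda>b1 x. sw A x (\<lambda>b2 b3. sw A b2 (\<lambda>p q. sw A z (\<lambda>z1 z2. sw A y (\<lambda>y1 y2.
          f (a3 * (q * g' z2) * y1) * (g (b3 * g' z1 * (y2 * a1)) * (P (a1' * b1) * Q (\<gamma> p * \<gamma> a2))))))))))) "
      by (simp only: sw_swap2[of b])
    also have "\<dots> = sw A a (\<lambda>a1 x. sw A a1 (\<lambda>a1 a1'. sw A x (\<lambda>a2 a3.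
         sw A b (\<lambda>b1 x. sw A x (\<lambda>b2 b3. sw A b2 (\<lambda>p q. sw A z (\<lambda>z1 z2. sw A y (\<lambda>y1 y2.
          f (a3 * (q * g' z2) * y1) * (g (b3 * g' z1 * (y2 * a1)) * (P (a1' * b1) * Q (\<gamma> p * \<gamma> a2))))))))))) "
      by (intro arg_cong[where f="sw A _"] ext sw_swap)
    also have "\<dots> = ?N"
      by (simp only: sw_coassoc)
    finally have 2: "ev2 (HH (phi A (dt f a)) (phi A (dt g b))) y z P Q = ?N" .
    show "ev2 (phi A (Dm (dt f a) (dt g b))) y z P Q = ev2 (HH (phi A (dt f a)) (phi A (dt g b))) y z P Q"
      using 1 2 by simp
  qed
  have l: "klin (\<lambda>v. phi A (Dm v w))" "klin (\<lambda>v. HH (phi A v) (phi A w))"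
    "klin (\<lambda>w. phi A (Dm v w))" "klin (\<lambda>w. HH (phi A v) (phi A w))" for v w
    by (rule klin_comp[OF klin_phi kbil1[OF kbil_Dm]] klin_comp[OF kbil1[OF kbil_HH] klin_phi]
      klin_comp[OF klin_phi kbil2[OF kbil_Dm]] klin_comp[OF kbil2[OF kbil_HH] klin_phi])+
  show ?thesis
    apply (rule klin_dt_eqI[OF l(1) l(2)])
    apply (rule klin_dt_eqI[OF l(3) l(4)])
    by (rule main)
qed

end

lemma klin_tens_one:
  assumes "kbil m1" "kbil m2" "\<And>x. m1 o1 x = x" "\<And>x. m2 o2 x = x"
  shows "tensor_mult m1 m2 (tens o1 o2) x = x"
  by (rule klin_tens_eqI[OF kbil2[OF kbil_tensor] klin_id]) (simp add: tensor_mult_tens assms)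

lemma klin_tens_one':
  assumes "kbil m1" "kbil m2" "\<And>x. m1 x o1 = x" "\<And>x. m2 x o2 = x"
  shows "tensor_mult m1 m2 x (tens o1 o2) = x"
  by (rule klin_tens_eqI[OF kbil1[OF kbil_tensor] klin_id]) (simp add: tensor_mult_tens assms)

lemma lin_tens:
  assumes "kbil B"
  shows "lin (\<lambda>(p, q). B (axis p 1) (axis q 1)) (tens v w) = B v w"
proof -
  have b: "kbil (\<lambda>v w. lin (\<lambda>(p, q). B (axis p 1) (axis q 1)) (tens v w))"
    by (rule kbil_comp2[OF klin_lin kbil_tens])
  show ?thesis
    by (rule kbil_eqI[OF b assms]) (simp add: axis_pair[symmetric])
qed

context hopf begin

lemma phi_one: "phi A one = tens one one"
proof (rule ev2I)
  fix y z P Q assume P: "lf A P" and Q: "lf A Q"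
  note l = lins lf_comp[OF P] lf_comp[OF Q]
  have "ev2 (phi A one) y z P Q = sw A 1 (\<lambda>x1 x'. sw A x' (\<lambda>x2 x3. \<epsilon> (x3 * g' z * y) * (P x1 * Q (\<gamma> x2))))"
    by (simp add: one_dt phi_ev2[OF lin_counit P Q])
  also have "\<dots> = sw A 1 (\<lambda>x2 x3. \<epsilon> (x3 * g' z * y) * (P 1 * Q (\<gamma> x2)))"
    by (rule sw_one) (intro l)+
  also have "\<dots> = \<epsilon> (1 * g' z * y) * (P 1 * Q (\<gamma> 1))"
    by (rule sw_one) (intro l)+
  finally show "ev2 (phi A one) y z P Q = ev2 (tens one one) y z P Q"
    by (simp add: one_dt ev2_tens ev_dt lin_counit P Q mult_ac)
qed

section \<open>The R-matrix and its inverse\<close>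

lemma lf_L_Dm1: "kfun L \<Longrightarrow> kfun (\<lambda>v. L (Dm v w))" by (rule kfun_comp[OF _ kbil1[OF kbil_Dm]])
lemma lf_L_Dm2: "kfun L \<Longrightarrow> kfun (\<lambda>v. L (Dm w v))" by (rule kfun_comp[OF _ kbil2[OF kbil_Dm]])

lemma Dm_counit: assumes f: "lf A f" shows "Dm (dt f x) (dt \<epsilon> y) = dt f (x * y)"
proof (rule vec_eq_kfunI)
  fix L :: "('k, 'i) double \<Rightarrow> 'k" assume L: "kfun L"
  note l = lins lf_comp[OF f] lf_dm' lf_dm_fun1 lf_dm_fun2 lf_dt_fun[OF L] lf_dt[OF L]
  have "L (Dm (dt f x) (dt \<epsilon> y)) = sw A x (\<lambda>a1 a'. sw A a' (\<lambda>a2 a3. L (dt (dm f (\<lambda>x. \<epsilon> (g' a3 * x * a1))) (a2 * y))))"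
    by (simp add: Dm_dt[OF L f lin_counit])
  also have "\<dots> = sw A x (\<lambda>a1 a'. sw A a' (\<lambda>a2 a3. L (dt (dm f (\<lambda>x. (\<epsilon> a3 * \<epsilon> a1) * \<epsilon> x)) (a2 * y))))"
    by (simp add: mult_ac)
  also have "\<dots> = sw A x (\<lambda>a1 a'. sw A a' (\<lambda>a2 a3. (\<epsilon> a3 * \<epsilon> a1) * L (dt f (a2 * y))))"
    by (simp only: dm_scale2 kfun_dt_scale[OF L] dm_counit2[OF f])
  also have "\<dots> = sw A x (\<lambda>a1 a'. \<epsilon> a1 * sw A a' (\<lambda>a2 a3. \<epsilon> a3 * L (dt f (a2 * y))))"
    by (simp add: sw_cmult[symmetric] mult_ac)
  also have "\<dots> = L (dt f (x * y))"
    by (simp add: sw_counit_l sw_counit_r l)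
  finally show "L (Dm (dt f x) (dt \<epsilon> y)) = L (dt f (x * y))" .
qed

lemma Dm_unit: assumes f: "lf A f" and g: "lf A g" shows "Dm (dt f 1) (dt g y) = dt (dm f g) y"
proof (rule vec_eq_kfunI)
  fix L :: "('k, 'i) double \<Rightarrow> 'k" assume L: "kfun L"
  note l = lins lf_comp[OF f] lf_comp[OF g] lf_dm' lf_dm_fun1 lf_dm_fun2 lf_dt_fun[OF L] lf_dt[OF L]
  have "L (Dm (dt f 1) (dt g y)) = sw A 1 (\<lambda>a1 a'. sw A a' (\<lambda>a2 a3. L (dt (dm f (\<lambda>x. g (g' a3 * x * a1))) (a2 * y))))"
    by (simp add: Dm_dt[OF L f g])
  also have "\<dots> = sw A 1 (\<lambda>a2 a3. L (dt (dm f (\<lambda>x. g (g' a3 * x * 1))) (a2 * y)))"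
    by (rule sw_one) (intro l)+
  also have "\<dots> = L (dt (dm f (\<lambda>x. g (g' 1 * x * 1))) (1 * y))"
    by (rule sw_one) (intro l)+
  finally show "L (Dm (dt f 1) (dt g y)) = L (dt (dm f g) y)" by simp
qed

lemma hm_counit: assumes f: "lf A f" shows "hm (dt f x) (dt \<epsilon> y) = dt f (x * y)"
proof (rule vec_eq_kfunI)
  fix L :: "('k, 'i) double \<Rightarrow> 'k" assume L: "kfun L"
  note l = lins lf_comp[OF f] lf_dm' lf_dm_fun1 lf_dm_fun2 lf_dt_fun[OF L] lf_dt[OF L]
  have "L (hm (dt f x) (dt \<epsilon> y)) = sw A x (\<lambda>a1 a2. L (dt (dm f (\<lambda>x. \<epsilon> a1 * \<epsilon> x)) (a2 * y)))"
    by (simp add: hm_dt[OF L f lin_counit] mult.commute)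
  also have "\<dots> = sw A x (\<lambda>a1 a2. \<epsilon> a1 * L (dt f (a2 * y)))"
    by (simp only: dm_scale2 kfun_dt_scale[OF L] dm_counit2[OF f])
  also have "\<dots> = L (dt f (x * y))"
    by (simp add: sw_counit_l l)
  finally show "L (hm (dt f x) (dt \<epsilon> y)) = L (dt f (x * y))" .
qed

lemma hm_unit: assumes f: "lf A f" and g: "lf A g" shows "hm (dt f 1) (dt g y) = dt (dm f g) y"
proof (rule vec_eq_kfunI)
  fix L :: "('k, 'i) double \<Rightarrow> 'k" assume L: "kfun L"
  note l = lins lf_comp[OF f] lf_comp[OF g] lf_dm' lf_dm_fun1 lf_dm_fun2 lf_dt_fun[OF L] lf_dt[OF L]
  have "L (hm (dt f 1) (dt g y)) = sw A 1 (\<lambda>a1 a2. L (dt (dm f (\<lambda>x. g (x * a1))) (a2 * y)))"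
    by (simp add: hm_dt[OF L f g])
  also have "\<dots> = L (dt (dm f (\<lambda>x. g (x * 1))) (1 * y))"
    by (rule sw_one) (intro l)+
  finally show "L (hm (dt f 1) (dt g y)) = L (dt (dm f g) y)" by simp
qed

lemma db_collapse: "lf A F \<Longrightarrow> (\<Sum>a\<in>UNIV. db a x * F (e a)) = F x"
  unfolding dual_basis_def by (rule lf_expand)

lemma lf_g': "lf A f \<Longrightarrow> lf A (f \<circ> g')"
  unfolding comp_def by (rule lf_comp[OF _ la_g'])

lemma counit_comp_g': "\<epsilon> \<circ> g' = \<epsilon>" by (auto simp: fun_eq_iff)

abbreviation DD where "DD \<equiv> tensor_mult Dm Dm"

lemma DD_tens: "DD (tens a b) (tens c d) = tens (Dm a c) (Dm b d)"
  by (rule tensor_mult_tens[OF kbil_Dm kbil_Dm])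

text \<open>The classical candidate: R with the antipode applied to its first leg.\<close>

definition Rinv :: "('k, 'i) double2" where
  "Rinv = (\<Sum>a\<in>UNIV. tens (dt \<epsilon> (\<gamma> (e a))) (dt (db a) 1))"

lemma DD_sum: "DD (\<Sum>a\<in>I. x a) (\<Sum>b\<in>J. y b) = (\<Sum>a\<in>I. \<Sum>b\<in>J. DD (x a) (y b))"
  by (simp add: klin_sum[OF kbil1[OF kbil_tensor]] klin_sum[OF kbil2[OF kbil_tensor]]) (rule sum.swap)
lemma Dm_sum: "Dm (\<Sum>a\<in>I. x a) (\<Sum>b\<in>J. y b) = (\<Sum>a\<in>I. \<Sum>b\<in>J. Dm (x a) (y b))"
  by (simp add: klin_sum[OF kbil1[OF kbil_Dm]] klin_sum[OF kbil2[OF kbil_Dm]]) (rule sum.swap)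

text \<open>The elements \<Sum> F(e_a) \<otimes> e^a multiply like endomorphisms of A under
  convolution, so a convolution inverse of F yields an inverse element.\<close>

lemma R_gen:
  assumes F: "\<And>z P. lf A P \<Longrightarrow> sw A z (\<lambda>a b. P (F a * G b)) = \<epsilon> z * P 1"
    and l: "la A F" "la A G"
  shows "DD (\<Sum>a\<in>UNIV. tens (dt \<epsilon> (F (e a))) (dt (db a) 1)) (\<Sum>a\<in>UNIV. tens (dt \<epsilon> (G (e a))) (dt (db a) 1)) = tens one one"
proof (rule ev2I)
  fix y z P Q assume P: "lf A P" and Q: "lf A Q"
  have "(\<Sum>a\<in>UNIV. \<Sum>b\<in>UNIV. dm (db a) (db b) z * P (F (e a) * G (e b))) = sw A z (\<lambda>z1 z2. P (F z1 * G z2))"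
  proof -
    have 1: "(\<Sum>b\<in>UNIV. db b z * P (x * G (e b))) = P (x * G z)" for x z
      by (rule db_collapse) (intro lf_comp[OF P] la_mult2 l)
    have 2: "(\<Sum>a\<in>UNIV. db a z * P (F (e a) * x)) = P (F z * x)" for x z
      by (rule db_collapse) (intro lf_comp[OF P] la_mult1 l)
    have "(\<Sum>a\<in>UNIV. \<Sum>b\<in>UNIV. dm (db a) (db b) z * P (F (e a) * G (e b)))
      = sw A z (\<lambda>z1 z2. \<Sum>a\<in>UNIV. db a z1 * (\<Sum>b\<in>UNIV. db b z2 * P (F (e a) * G (e b))))"
      by (simp add: dm_eq sw_multc[symmetric] sw_sum sum_distrib_left mult.assoc)
    then show ?thesis by (simp add: 1 2)
  qed
  then have "(\<Sum>a\<in>UNIV. \<Sum>b\<in>UNIV. dm (db a) (db b) z * P (F (e a) * G (e b))) = \<epsilon> z * P 1"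
    by (simp add: F[OF P])
  then have "(\<Sum>a\<in>UNIV. \<Sum>b\<in>UNIV. (\<epsilon> y * Q 1) * (dm (db a) (db b) z * P (F (e a) * G (e b)))) = (\<epsilon> y * Q 1) * (\<epsilon> z * P 1)"
    by (simp add: sum_distrib_left[symmetric])
  then show "ev2 (DD (\<Sum>a\<in>UNIV. tens (dt \<epsilon> (F (e a))) (dt (db a) 1)) (\<Sum>a\<in>UNIV. tens (dt \<epsilon> (G (e a))) (dt (db a) 1))) y z P Q = ev2 (tens one one) y z P Q"
    by (simp add: DD_sum kfun_sum[OF kfun_ev2] DD_tens Dm_counit Dm_unit lin_counit lf_db' ev2_tens ev_dt lf_dm' P Q one_dt mult_ac)
qed

lemma R_inverse_eq: "R_inverse A = Rinv"
  unfolding R_inverse_def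
proof (rule mult_inverse_unique)
  show "DD (DD x y) z = DD x (DD y z)" for x y z
    by (rule tensor_mult_assoc[OF kbil_Dm kbil_Dm Dm_assoc Dm_assoc])
  show "DD (tens one one) x = x" "DD x (tens one one) = x" for x
    by (simp_all add: klin_tens_one klin_tens_one' kbil_Dm Dm_one1 Dm_one2)
  show "DD (R_matrix A) Rinv = tens one one"
    unfolding R_matrix_def Rinv_def using R_gen[of "\<lambda>x. x" \<gamma>] by (simp add: sw_antipode_r lin_antipode la_id)
  show "DD Rinv (R_matrix A) = tens one one"
    unfolding R_matrix_def Rinv_def using R_gen[of \<gamma> "\<lambda>x. x"] by (simp add: sw_antipode_l lin_antipode la_id)
qed

section \<open>The elements u and gamma(u) and their inverses\<close>

abbreviation Da where "Da \<equiv> drinfeld_antipode A"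

lemma klin_Da: "klin Da" unfolding drinfeld_antipode_def by (rule klin_lin)

lemma Da_dt: assumes f: "lf A f" shows "Da (dt f x) = Dm (dt \<epsilon> (\<gamma> x)) (dt (f \<circ> g') 1)"
proof (rule vec_eq_kfunI)
  fix L :: "('k, 'i) double \<Rightarrow> 'k" assume L: "kfun L"
  note K1 = lf_L_Dm1[OF L] and K2 = lf_L_Dm2[OF L]
  have fl: "flin (\<lambda>f. L (Dm (dt \<epsilon> (\<gamma> x)) (dt (f \<circ> g') 1)))" for x
    unfolding comp_def by (intro flins K2)
  have ll: "lf A (\<lambda>x. L (Dm (dt \<epsilon> (\<gamma> x)) (dt (f \<circ> g') 1)))" for f
    by (intro lf_dt[OF K1] lins)
  have "L (Da (dt f x)) = (\<Sum>i\<in>UNIV. f (e i) * (\<Sum>j\<in>UNIV. cf x $ j * L (Dm (dt \<epsilon> (\<gamma> (e j))) (dt (db i \<circ> g') 1))))"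
    unfolding drinfeld_antipode_def lin_def
    by (simp add: kfun_sum[OF L] kfun_scale[OF L] sum_pair' dt_nth sum_distrib_left mult.assoc)
  also have "\<dots> = L (Dm (dt \<epsilon> (\<gamma> x)) (dt (f \<circ> g') 1))"
    using lf_expand[OF ll] flinD[OF fl f] by simp
  finally show "L (Da (dt f x)) = L (Dm (dt \<epsilon> (\<gamma> x)) (dt (f \<circ> g') 1))" .
qed

lemma Da_counit: "Da (dt \<epsilon> x) = dt \<epsilon> (\<gamma> x)"
  by (simp add: Da_dt lin_counit counit_comp_g' Dm_counit)

lemma Da_unit: "lf A f \<Longrightarrow> Da (dt f 1) = dt (f \<circ> g') 1"
  by (simp add: Da_dt) (simp add: Dm_unit lin_counit lf_g' dm_counit1)

lemma u_eq: "drinfeld_u A = (\<Sum>a\<in>UNIV. dt (db a \<circ> g') (e a))"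
proof -
  have b: "kbil (\<lambda>x y. Dm (Da y) x)"
    unfolding kbil_def by (auto intro: kbil2[OF kbil_Dm] klin_comp[OF kbil1[OF kbil_Dm] klin_Da])
  have "drinfeld_u A = (\<Sum>a\<in>UNIV. Dm (Da (dt (db a) 1)) (dt \<epsilon> (e a)))"
    unfolding drinfeld_u_def R_matrix_def
    by (simp add: klin_sum[OF klin_lin] lin_tens[OF b])
  then show ?thesis
    by (simp add: Da_unit lf_db' Dm_counit lf_g')
qed

text \<open>The standard formula \<Sum> \<beta> \<gamma>(\<gamma>(\<alpha>)) for the inverse of
  u.\<close>

definition uinv :: "('k, 'i) double" where "uinv = (\<Sum>a\<in>UNIV. dt (db a) (\<gamma> (\<gamma> (e a))))"

lemma ev_one: "lf A P \<Longrightarrow> ev one y P = \<epsilon> y * P 1"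
  by (simp add: one_dt ev_dt lin_counit)

lemma ev_Dm_dt:
  assumes f: "lf A f" and g: "lf A g" and P: "lf A P"
  shows "ev (Dm (dt f a) (dt g b)) y P = sw A a (\<lambda>a1 a'. sw A a' (\<lambda>a2 a3. sw A y (\<lambda>y1 y2. f y1 * (g (g' a3 * y2 * a1) * P (a2 * b)))))"
  by (simp add: Dm_dt[OF kfun_ev f g] ev_dt_dm[OF P] sw_multc mult.assoc[symmetric])

text \<open>The sum \<open>\<Sum>\<^sub>a (e\<^sup>a \<circ> F) \<otimes> G(e\<^sub>a)\<close> is the linear map \<open>G \<circ> F\<close>, which makes products of such sums computable.\<close>

lemma ev_Dm_maps:
  assumes l: "la A F" "la A G" "la A H" "la A K" and P: "lf A P"
  shows "ev (Dm (\<Sum>a\<in>UNIV. dt (\<lambda>x. db a (F x)) (G (e a))) (\<Sum>a\<in>UNIV. dt (\<lambda>x. db a (H x)) (K (e a)))) y P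
    = sw A y (\<lambda>y1 y2. sw A (G (F y1)) (\<lambda>a1 a'. sw A a' (\<lambda>a2 a3. P (a2 * K (H (g' a3 * y2 * a1))))))"
proof -
  note ls = lins lf_comp[OF P]
  have d: "lf A (\<lambda>x. db i (F x))" "lf A (\<lambda>x. db i (H x))" for i by (intro lf_comp[OF lf_db'] l)+
  have la2: "la A (\<lambda>x. K (g x))" "la A (\<lambda>x. G (g x))" if "la A g" for g
    using l that by (auto simp: la_def)
  have 1: "(\<Sum>b\<in>UNIV. db b z * P (x * K (e b))) = P (x * K z)" for x z
    by (rule db_collapse) (intro lf_comp[OF P] la_mult2 l)
  have "ev (Dm (\<Sum>a\<in>UNIV. dt (\<lambda>x. db a (F x)) (G (e a))) (\<Sum>a\<in>UNIV. dt (\<lambda>x. db a (H x)) (K (e a)))) y P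
    = (\<Sum>a\<in>UNIV. \<Sum>b\<in>UNIV. sw A y (\<lambda>y1 y2. db a (F y1) * sw A (G (e a)) (\<lambda>a1 a'. sw A a' (\<lambda>a2 a3. db b (H (g' a3 * y2 * a1)) * P (a2 * K (e b))))))"
    by (simp add: Dm_sum kfun_sum[OF kfun_ev] ev_Dm_dt[OF d P] sw_cmult[symmetric] sw_swap[of _ y] sw_swap2[of _ y])
  also have "\<dots> = sw A y (\<lambda>y1 y2. \<Sum>a\<in>UNIV. db a (F y1) * sw A (G (e a)) (\<lambda>a1 a'. sw A a' (\<lambda>a2 a3. \<Sum>b\<in>UNIV. db b (H (g' a3 * y2 * a1)) * P (a2 * K (e b)))))"
    by (simp only: sw_sum sum_distrib_left)
  also have "\<dots> = sw A y (\<lambda>y1 y2. sw A (G (F y1)) (\<lambda>a1 a'. sw A a' (\<lambda>a2 a3. P (a2 * K (H (g' a3 * y2 * a1))))))"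
    unfolding 1 by (intro arg_cong[where f="sw A _"] ext db_collapse) (intro ls la2)+
  finally show ?thesis .
qed

lemma u_map: "drinfeld_u A = (\<Sum>a\<in>UNIV. dt (\<lambda>x. db a (g' x)) (e a))"
  by (simp add: u_eq comp_def)
lemma uinv_map: "uinv = (\<Sum>a\<in>UNIV. dt (\<lambda>x. db a x) (\<gamma> (\<gamma> (e a))))"
  by (simp add: uinv_def)

abbreviation u where "u \<equiv> drinfeld_u A"

lemma u_uinv: "Dm u uinv = one"
proof (rule evI)
  fix y P assume P: "lf A P"
  note l = lins lf_comp[OF P]
  have "ev (Dm u uinv) y P = sw A y (\<lambda>y1 y2. sw A (g' y1) (\<lambda>a1 a'. sw A a' (\<lambda>a2 a3. P (a2 * \<gamma> (\<gamma> (g' a3 * y2 * a1))))))"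
    unfolding u_map uinv_map by (rule ev_Dm_maps) (intro lins P)+
  also have "\<dots> = sw A y (\<lambda>y1 y2. sw A y1 (\<lambda>a' a1. sw A (g' a') (\<lambda>a2 a3. P (a2 * \<gamma> (\<gamma> (g' a3 * y2 * g' a1))))))"
    by (intro arg_cong[where f="sw A _"] ext sw_g') (intro l)+
  also have "\<dots> = sw A y (\<lambda>y1 y2. sw A y1 (\<lambda>a' a1. sw A a' (\<lambda>a3 a2. P (g' a2 * \<gamma> (\<gamma> (g' (g' a3) * y2 * g' a1))))))"
    by (intro arg_cong[where f="sw A _"] ext sw_g') (intro l)+
  also have "\<dots> = sw A y (\<lambda>y1 x. sw A x (\<lambda>y2 x. sw A x (\<lambda>y3 y4. P (g' y2 * y1 * \<gamma> (y3 * \<gamma> y4)))))"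
    by (simp add: sw_coassoc antipode_mult mult.assoc)
  also have "\<dots> = sw A y (\<lambda>y1 x. sw A x (\<lambda>y2 x. P (g' y2 * y1 * \<gamma> 1) * \<epsilon> x))"
    apply (intro arg_cong[where f="sw A _"] ext)
    using sw_antipode_r[of "\<lambda>u. P (_ * \<gamma> u)"] by (simp add: l mult.commute)
  also have "\<dots> = sw A y (\<lambda>y1 y2. P (g' y2 * y1))"
    by (intro arg_cong[where f="sw A _"] ext) (simp add: sw_counit_r' l)
  also have "\<dots> = \<epsilon> y * P 1" by (rule sw_g'_l[OF P])
  finally show "ev (Dm u uinv) y P = ev one y P" by (simp add: ev_one P)
qed

lemma sw_gg:
  assumes F: "\<And>b. lf A (\<lambda>a. F a b)" "\<And>a. lf A (F a)"
  shows "sw A (\<gamma> (\<gamma> x)) F = sw A x (\<lambda>a b. F (\<gamma> (\<gamma> a)) (\<gamma> (\<gamma> b)))"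
proof -
  have "sw A (\<gamma> (\<gamma> x)) F = sw A (\<gamma> x) (\<lambda>a b. F (\<gamma> b) (\<gamma> a))"
    by (rule sw_antipode) (intro F)+
  also have "\<dots> = sw A x (\<lambda>a b. F (\<gamma> (\<gamma> a)) (\<gamma> (\<gamma> b)))"
    by (rule sw_antipode) (intro lins lf_comp[OF F(1)] lf_comp[OF F(2)])+
  finally show ?thesis .
qed

lemma uinv_u: "Dm uinv u = one"
proof (rule evI)
  fix y P assume P: "lf A P"
  note l = lins lf_comp[OF P]
  have "ev (Dm uinv u) y P = sw A y (\<lambda>y1 y2. sw A (\<gamma> (\<gamma> y1)) (\<lambda>a1 a'. sw A a' (\<lambda>a2 a3. P (a2 * g' (g' a3 * y2 * a1)))))"
    unfolding u_map uinv_map by (rule ev_Dm_maps) (intro lins P)+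
  also have "\<dots> = sw A y (\<lambda>y1 y2. sw A y1 (\<lambda>a1 a'. sw A (\<gamma> (\<gamma> a')) (\<lambda>a2 a3. P (a2 * g' (g' a3 * y2 * \<gamma> (\<gamma> a1))))))"
    by (intro arg_cong[where f="sw A _"] ext sw_gg) (intro l)+
  also have "\<dots> = sw A y (\<lambda>y1 y2. sw A y1 (\<lambda>a1 a'. sw A a' (\<lambda>a2 a3. P (\<gamma> (\<gamma> a2) * g' (g' (\<gamma> (\<gamma> a3)) * y2 * \<gamma> (\<gamma> a1))))))"
    by (intro arg_cong[where f="sw A _"] ext sw_gg) (intro l)+
  also have "\<dots> = sw A y (\<lambda>y1 x. sw A x (\<lambda>y2 x. sw A x (\<lambda>y3 y4. P (\<gamma> (\<gamma> y2) * \<gamma> y1 * (g' y4 * y3)))))"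
    by (simp add: sw_coassoc g'_mult mult.assoc)
  also have "\<dots> = sw A y (\<lambda>y1 x. sw A x (\<lambda>y2 x. P (\<gamma> (y1 * \<gamma> y2)) * \<epsilon> x))"
    apply (intro arg_cong[where f="sw A _"] ext)
    using sw_g'_l[of "\<lambda>u. P (_ * u)"] by (simp add: l mult.commute antipode_mult)
  also have "\<dots> = sw A y (\<lambda>y1 y2. P (\<gamma> (y1 * \<gamma> y2)))"
    by (intro arg_cong[where f="sw A _"] ext) (simp add: sw_counit_r' l)
  also have "\<dots> = \<epsilon> y * P 1"
    using sw_antipode_r[of "\<lambda>u. P (\<gamma> u)" y] by (simp add: l)
  finally show "ev (Dm uinv u) y P = ev one y P" by (simp add: ev_one P)
qed

lemma mult_inverse_u: "mult_inverse Dm one u = uinv"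
  by (rule mult_inverse_unique) (simp_all add: Dm_assoc Dm_one1 Dm_one2 u_uinv uinv_u)

text \<open>The commutation rule of the double solved for the other order, with the factor from A in
  front. Expanding such a product by the defining rule brings in a second twist, and it cancels the
  twist by b''' and b'.\<close>

lemma dt_opposite_order:
  assumes L: "kfun L" and f: "lf A f"
  shows "L (dt f b) = sw A b (\<lambda>b1 x. sw A x (\<lambda>b2 b3. L (Dm (dt \<epsilon> b2) (dt (\<lambda>x. f (b3 * x * g' b1)) 1))))"
proof -
  note l = lins lf_comp[OF f] lf_dm' lf_dm_fun1 lf_dm_fun2 lf_dt_fun[OF L] lf_dt[OF L]
  have c: "dm \<epsilon> (\<lambda>x. f (p * x * q)) = (\<lambda>x. f (p * x * q))" for p q
    by (rule dm_counit1) (intro l)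
  have r: "L (Dm (dt \<epsilon> b2) (dt (\<lambda>x. f (b3 * x * g' b1)) 1)) = sw A b2 (\<lambda>p1 x. sw A x (\<lambda>p2 p3. L (dt (\<lambda>x. f ((b3 * g' p3) * x * (p1 * g' b1))) p2)))" for b1 b2 b3
  proof -
    have "L (Dm (dt \<epsilon> b2) (dt (\<lambda>x. f (b3 * x * g' b1)) 1)) = sw A b2 (\<lambda>p1 x. sw A x (\<lambda>p2 p3. L (dt (dm \<epsilon> (\<lambda>x. f ((b3 * g' p3) * x * (p1 * g' b1)))) (p2 * 1))))"
      by (subst Dm_dt[OF L lin_counit]) (intro l, simp add: mult.assoc)
    then show ?thesis by (simp add: c)
  qed
  have "sw A b (\<lambda>b1 x. sw A x (\<lambda>b2 b3. L (Dm (dt \<epsilon> b2) (dt (\<lambda>x. f (b3 * x * g' b1)) 1))))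
    = sw A b (\<lambda>b1 x. sw A x (\<lambda>p1 x. sw A x (\<lambda>p2 x. sw A x (\<lambda>p3 b3. L (dt (\<lambda>x. f ((b3 * g' p3) * x * (p1 * g' b1))) p2)))))"
    by (simp only: r sw_coassoc)
  also have "\<dots> = sw A b (\<lambda>b1 x. sw A x (\<lambda>p1 x. L (dt (\<lambda>x. f (1 * x * (p1 * g' b1))) x)))"
    by (intro arg_cong[where f="sw A _"] ext sw_g'r_end[of "\<lambda>p2 u. L (dt (\<lambda>x. f (u * x * (_ * g' _))) p2)"]) (intro l)+
  also have "\<dots> = L (dt (\<lambda>x. f (1 * x * 1)) b)"
    by (rule sw_g'r[of "\<lambda>u x. L (dt (\<lambda>y. f (1 * y * u)) x)"]) (intro l)+
  finally show ?thesis by simp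
qed

lemma Dm_flin:
  assumes L: "kfun L" and f: "lf A f"
  shows "L (Dm (dt \<epsilon> x) (dt f 1)) = (\<Sum>m\<in>UNIV. f (e m) * L (Dm (dt \<epsilon> x) (dt (db m) 1)))"
  by (rule flinD[symmetric, OF _ f]) (intro flins lf_L_Dm2[OF L])

lemma lf_Dm_x: "kfun L \<Longrightarrow> lf A (\<lambda>x. L (Dm (dt \<epsilon> x) w))"
  by (intro lf_dt[OF lf_L_Dm1] la_id)

text \<open>R is invariant under \<gamma> \<otimes> \<gamma>, so the antipode turns \<Sum>
  \<gamma>(\<beta>)\<alpha> into \<Sum> \<alpha>\<gamma>(\<beta>). In coordinates the invariance is
  a transfer of \<gamma> from e_a to e^a through the dual bases.\<close>

lemma Da_u: "Da u = (\<Sum>c\<in>UNIV. Dm (dt \<epsilon> (e c)) (dt (\<lambda>x. db c (g' x)) 1))"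
proof (rule vec_eq_kfunI)
  fix L :: "('k, 'i) double \<Rightarrow> 'k" assume L: "kfun L"
  have d: "lf A (\<lambda>x. db i (g' (g' x)))" "lf A (\<lambda>x. db i (g' x))" for i by (intro lins)+
  have "L (Da u) = (\<Sum>a\<in>UNIV. L (Dm (dt \<epsilon> (\<gamma> (e a))) (dt (\<lambda>x. db a (g' (g' x))) 1)))"
    unfolding u_eq using lf_g'[OF lf_db'] by (simp add: klin_sum[OF klin_Da] kfun_sum[OF L] Da_dt) (simp add: comp_def)
  also have "\<dots> = (\<Sum>a\<in>UNIV. \<Sum>m\<in>UNIV. db a (g' (g' (e m))) * L (Dm (dt \<epsilon> (\<gamma> (e a))) (dt (db m) 1)))"
    by (subst Dm_flin[OF L d(1)]) (rule refl)
  also have "\<dots> = (\<Sum>m\<in>UNIV. L (Dm (dt \<epsilon> (g' (e m))) (dt (db m) 1)))"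
  proof (subst sum.swap, rule sum.cong[OF refl])
    fix m
    have "lf A (\<lambda>x. L (Dm (dt \<epsilon> (\<gamma> x)) (dt (db m) 1)))"
      by (rule lf_comp[OF lf_Dm_x[OF L] lin_antipode])
    from db_collapse[OF this, of "g' (g' (e m))"]
    show "(\<Sum>a\<in>UNIV. db a (g' (g' (e m))) * L (Dm (dt \<epsilon> (\<gamma> (e a))) (dt (db m) 1))) = L (Dm (dt \<epsilon> (g' (e m))) (dt (db m) 1))"
      by simp
  qed
  also have "\<dots> = (\<Sum>c\<in>UNIV. \<Sum>m\<in>UNIV. db c (g' (e m)) * L (Dm (dt \<epsilon> (e c)) (dt (db m) 1)))"
    by (subst sum.swap) (simp add: db_collapse[OF lf_Dm_x[OF L]])
  also have "\<dots> = (\<Sum>c\<in>UNIV. L (Dm (dt \<epsilon> (e c)) (dt (\<lambda>x. db c (g' x)) 1)))"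
    by (simp only: Dm_flin[OF L d(2)])
  finally show "L (Da u) = L (\<Sum>c\<in>UNIV. Dm (dt \<epsilon> (e c)) (dt (\<lambda>x. db c (g' x)) 1))"
    by (simp add: kfun_sum[OF L])
qed

text \<open>The counterpart of \<open>ev_Dm_maps\<close> for sums with the factor from A in front,
  which is the shape of \<gamma>(u). \<open>dt_opposite_order\<close> straightens the inner factors,
  the dual bases sum out, and \<open>h\<close> is the Sweedler identity that is left.\<close>

lemma Dm_maps_one:
  assumes l: "la A F" "la A G" "la A H" "la A K"
    and h: "\<And>P y. lf A P \<Longrightarrow> sw A y (\<lambda>y1 y2. sw A (K (H y2)) (\<lambda>b1 x. sw A x (\<lambda>b2 b3. P (G (F (b3 * y1 * g' b1)) * b2)))) = \<epsilon> y * P 1"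
  shows "Dm (\<Sum>a\<in>UNIV. Dm (dt \<epsilon> (G (e a))) (dt (\<lambda>x. db a (F x)) 1)) (\<Sum>a\<in>UNIV. Dm (dt \<epsilon> (K (e a))) (dt (\<lambda>x. db a (H x)) 1)) = one"
proof (rule vec_eq_kfunI)
  fix L :: "('k, 'i) double \<Rightarrow> 'k" assume L: "kfun L"
  have d: "lf A (\<lambda>x. db i (F x))" "lf A (\<lambda>x. db i (H x))" for i by (intro lf_comp[OF lf_db'] l)+
  let ?p = "\<lambda>m x. L (Dm (dt \<epsilon> x) (dt (db m) 1))"
  have lp: "lf A (?p m)" for m by (rule lf_Dm_x[OF L])
  have trm: "L (Dm (Dm (dt \<epsilon> (G (e a))) (dt (\<lambda>x. db a (F x)) 1)) (Dm (dt \<epsilon> (K (e c))) (dt (\<lambda>x. db c (H x)) 1)))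
    = (\<Sum>m\<in>UNIV. sw A (e m) (\<lambda>y1 y2. db c (H y2) * sw A (K (e c)) (\<lambda>b1 x. sw A x (\<lambda>b2 b3. db a (F (b3 * y1 * g' b1)) * ?p m (G (e a) * b2)))))" for a c
  proof -
    have dF: "lf A (\<lambda>x. db a (F (p * x * q)))" for p q
      by (intro lf_comp[OF d(1)] lins)
    have L': "kfun (\<lambda>v. L (Dm (dt \<epsilon> (G (e a))) (Dm v (dt (\<lambda>x. db c (H x)) 1))))"
      by (rule kfun_comp[OF L klin_comp[OF kbil2[OF kbil_Dm] kbil1[OF kbil_Dm]]])
    have eq: "Dm (Dm (dt \<epsilon> (G (e a))) (dt (\<lambda>x. db a (F x)) 1)) (Dm (dt \<epsilon> (K (e c))) (dt (\<lambda>x. db c (H x)) 1))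
      = Dm (dt \<epsilon> (G (e a))) (Dm (dt (\<lambda>x. db a (F x)) (K (e c))) (dt (\<lambda>x. db c (H x)) 1))"
      by (simp add: Dm_assoc) (simp add: Dm_assoc[symmetric] Dm_counit d)
    have eq2: "Dm (dt \<epsilon> (G (e a))) (Dm (Dm (dt \<epsilon> b2) (dt (\<lambda>x. db a (F (b3 * x * g' b1))) 1)) (dt (\<lambda>x. db c (H x)) 1))
      = Dm (dt \<epsilon> (G (e a) * b2)) (dt (dm (\<lambda>x. db a (F (b3 * x * g' b1))) (\<lambda>x. db c (H x))) 1)" for b1 b2 b3
    proof -
      have "Dm (dt \<epsilon> (G (e a))) (Dm (Dm (dt \<epsilon> b2) (dt (\<lambda>x. db a (F (b3 * x * g' b1))) 1)) (dt (\<lambda>x. db c (H x)) 1))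
        = Dm (Dm (dt \<epsilon> (G (e a))) (dt \<epsilon> b2)) (Dm (dt (\<lambda>x. db a (F (b3 * x * g' b1))) 1) (dt (\<lambda>x. db c (H x)) 1))"
        by (simp only: Dm_assoc)
      then show ?thesis by (simp add: Dm_unit[OF dF d(2)] Dm_counit[OF lin_counit])
    qed
    have "L (Dm (dt \<epsilon> (G (e a))) (Dm (dt (\<lambda>x. db a (F x)) (K (e c))) (dt (\<lambda>x. db c (H x)) 1)))
      = sw A (K (e c)) (\<lambda>b1 x. sw A x (\<lambda>b2 b3. L (Dm (dt \<epsilon> (G (e a) * b2)) (dt (dm (\<lambda>x. db a (F (b3 * x * g' b1))) (\<lambda>x. db c (H x))) 1))))"
      by (simp only: dt_opposite_order[OF L' d(1)] eq2)
    also have "\<dots> = sw A (K (e c)) (\<lambda>b1 x. sw A x (\<lambda>b2 b3. \<Sum>m\<in>UNIV. sw A (e m) (\<lambda>y1 y2. db a (F (b3 * y1 * g' b1)) * db c (H y2)) * ?p m (G (e a) * b2)))"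
      by (simp only: Dm_flin[OF L lf_dm']) (simp only: dm_eq)
    also have "\<dots> = (\<Sum>m\<in>UNIV. sw A (K (e c)) (\<lambda>b1 x. sw A x (\<lambda>b2 b3. sw A (e m) (\<lambda>y1 y2. db c (H y2) * (db a (F (b3 * y1 * g' b1)) * ?p m (G (e a) * b2))))))"
      by (simp only: sw_sum sw_multc[symmetric]) (simp only: mult_ac)
    also have "\<dots> = (\<Sum>m\<in>UNIV. sw A (e m) (\<lambda>y1 y2. sw A (K (e c)) (\<lambda>b1 x. sw A x (\<lambda>b2 b3. db c (H y2) * (db a (F (b3 * y1 * g' b1)) * ?p m (G (e a) * b2))))))"
      by (intro sum.cong refl sw_swap2)
    finally show ?thesis unfolding eq by (simp add: sw_cmult)
  qed
  have "L (Dm (\<Sum>a\<in>UNIV. Dm (dt \<epsilon> (G (e a))) (dt (\<lambda>x. db a (F x)) 1)) (\<Sum>a\<in>UNIV. Dm (dt \<epsilon> (K (e a))) (dt (\<lambda>x. db a (H x)) 1)))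
    = (\<Sum>a\<in>UNIV. \<Sum>c\<in>UNIV. \<Sum>m\<in>UNIV. sw A (e m) (\<lambda>y1 y2. db c (H y2) * sw A (K (e c)) (\<lambda>b1 x. sw A x (\<lambda>b2 b3. db a (F (b3 * y1 * g' b1)) * ?p m (G (e a) * b2)))))"
    by (simp only: Dm_sum kfun_sum[OF L] trm)
  also have "\<dots> = (\<Sum>m\<in>UNIV. \<Sum>c\<in>UNIV. \<Sum>a\<in>UNIV. sw A (e m) (\<lambda>y1 y2. db c (H y2) * sw A (K (e c)) (\<lambda>b1 x. sw A x (\<lambda>b2 b3. db a (F (b3 * y1 * g' b1)) * ?p m (G (e a) * b2)))))"
    by (subst sum.swap, subst (2) sum.swap, subst sum.swap) (rule refl)
  also have "\<dots> = (\<Sum>m\<in>UNIV. sw A (e m) (\<lambda>y1 y2. \<Sum>c\<in>UNIV. db c (H y2) * sw A (K (e c)) (\<lambda>b1 x. sw A x (\<lambda>b2 b3. \<Sum>a\<in>UNIV. db a (F (b3 * y1 * g' b1)) * ?p m (G (e a) * b2)))))"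
    by (simp only: sw_sum sum_distrib_left)
  also have "\<dots> = (\<Sum>m\<in>UNIV. sw A (e m) (\<lambda>y1 y2. sw A (K (H y2)) (\<lambda>b1 x. sw A x (\<lambda>b2 b3. ?p m (G (F (b3 * y1 * g' b1)) * b2)))))"
  proof -
    have 1: "(\<Sum>a\<in>UNIV. db a z * ?p m (G (e a) * b)) = ?p m (G z * b)" for m z b
      by (rule db_collapse) (intro lf_comp[OF lp] la_mult1 l)
    have 2: "(\<Sum>c\<in>UNIV. db c z * sw A (K (e c)) X) = sw A (K z) X" for z X
      by (rule db_collapse) (intro lf_sw_arg l)
    show ?thesis unfolding 1 2 ..
  qed
  also have "\<dots> = (\<Sum>m\<in>UNIV. \<epsilon> (e m) * ?p m 1)"
    by (simp only: h[OF lp])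
  also have "\<dots> = L (Dm (dt \<epsilon> 1) (dt \<epsilon> 1))"
    by (rule Dm_flin[OF L lin_counit, symmetric])
  also have "\<dots> = L one" by (simp add: one_dt[symmetric] Dm_one1)
  finally show "L (Dm (\<Sum>a\<in>UNIV. Dm (dt \<epsilon> (G (e a))) (dt (\<lambda>x. db a (F x)) 1)) (\<Sum>a\<in>UNIV. Dm (dt \<epsilon> (K (e a))) (dt (\<lambda>x. db a (H x)) 1))) = L one" .
qed

text \<open>This is the antipode of the inverse of u, written as \<Sum>
  \<gamma>(\<gamma>(\<alpha>))\<beta> by the invariance of R.\<close>

definition vinv :: "('k, 'i) double" where
  "vinv = (\<Sum>a\<in>UNIV. Dm (dt \<epsilon> (\<gamma> (\<gamma> (e a)))) (dt (\<lambda>x. db a x) 1))"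

lemma Dau_vinv: "Dm (Da u) vinv = one"
  unfolding Da_u vinv_def
proof (rule Dm_maps_one)
  fix P y assume P: "lf A P"
  note l = lins lf_comp[OF P]
  have "sw A y (\<lambda>y1 y2. sw A (\<gamma> (\<gamma> y2)) (\<lambda>b1 x. sw A x (\<lambda>b2 b3. P (g' (b3 * y1 * g' b1) * b2))))
    = sw A y (\<lambda>y1 y2. sw A y2 (\<lambda>b1 x. sw A (\<gamma> (\<gamma> x)) (\<lambda>b2 b3. P (g' (b3 * y1 * g' (\<gamma> (\<gamma> b1))) * b2))))"
    by (intro arg_cong[where f="sw A _"] ext sw_gg) (intro l)+
  also have "\<dots> = sw A y (\<lambda>y1 y2. sw A y2 (\<lambda>b1 x. sw A x (\<lambda>b2 b3. P (g' (\<gamma> (\<gamma> b3) * y1 * g' (\<gamma> (\<gamma> b1))) * \<gamma> (\<gamma> b2)))))"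
    by (intro arg_cong[where f="sw A _"] ext sw_gg) (intro l)+
  also have "\<dots> = sw A y (\<lambda>y1 y2. sw A y2 (\<lambda>y2 x. sw A x (\<lambda>y3 y4. P ((y2 * g' y1) * \<gamma> (\<gamma> y3 * y4)))))"
    by (simp add: antipode_mult g'_mult mult.assoc)
  also have "\<dots> = sw A y (\<lambda>y1 y2. sw A y2 (\<lambda>y2 x. P (y2 * g' y1) * \<epsilon> x))"
    apply (intro arg_cong[where f="sw A _"] ext)
    using sw_antipode_l[of "\<lambda>u. P (_ * \<gamma> u)"] by (simp add: l mult.commute)
  also have "\<dots> = sw A y (\<lambda>y1 y2. P (y2 * g' y1))"
    by (intro arg_cong[where f="sw A _"] ext) (simp add: sw_counit_r' l)
  also have "\<dots> = \<epsilon> y * P 1" by (rule sw_g'_r[OF P])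
  finally show "sw A y (\<lambda>y1 y2. sw A (\<gamma> (\<gamma> y2)) (\<lambda>b1 x. sw A x (\<lambda>b2 b3. P (g' (b3 * y1 * g' b1) * b2)))) = \<epsilon> y * P 1" .
qed (intro lins)+

lemma vinv_Dau: "Dm vinv (Da u) = one"
  unfolding Da_u vinv_def
proof (rule Dm_maps_one)
  fix P y assume P: "lf A P"
  note l = lins lf_comp[OF P]
  have "sw A y (\<lambda>y1 y2. sw A (g' y2) (\<lambda>b1 x. sw A x (\<lambda>b2 b3. P (\<gamma> (\<gamma> (b3 * y1 * g' b1)) * b2))))
    = sw A y (\<lambda>y1 y2. sw A y2 (\<lambda>x b1. sw A (g' x) (\<lambda>b2 b3. P (\<gamma> (\<gamma> (b3 * y1 * g' (g' b1))) * b2))))"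
    by (intro arg_cong[where f="sw A _"] ext sw_g') (intro l)+
  also have "\<dots> = sw A y (\<lambda>y1 y2. sw A y2 (\<lambda>x b1. sw A x (\<lambda>b3 b2. P (\<gamma> (\<gamma> (g' b3 * y1 * g' (g' b1))) * g' b2))))"
    by (intro arg_cong[where f="sw A _"] ext sw_g') (intro l)+
  also have "\<dots> = sw A y (\<lambda>y1 y2. sw A y2 (\<lambda>y2 x. sw A x (\<lambda>y3 y4. P (\<gamma> (\<gamma> (g' y2 * y1)) * (y4 * g' y3)))))"
    by (simp add: sw_coassoc antipode_mult g'_mult mult.assoc)
  also have "\<dots> = sw A y (\<lambda>y1 y2. sw A y2 (\<lambda>y2 x. P (\<gamma> (\<gamma> (g' y2 * y1))) * \<epsilon> x))"
    apply (intro arg_cong[where f="sw A _"] ext)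
    using sw_g'_r[of "\<lambda>u. P (_ * u)"] by (simp add: l mult.commute)
  also have "\<dots> = sw A y (\<lambda>y1 y2. P (\<gamma> (\<gamma> (g' y2 * y1))))"
    by (intro arg_cong[where f="sw A _"] ext) (simp add: sw_counit_r' l)
  also have "\<dots> = \<epsilon> y * P 1"
    using sw_g'_l[of "\<lambda>u. P (\<gamma> (\<gamma> u))" y] by (simp add: l)
  finally show "sw A y (\<lambda>y1 y2. sw A (g' y2) (\<lambda>b1 x. sw A x (\<lambda>b2 b3. P (\<gamma> (\<gamma> (b3 * y1 * g' b1)) * b2)))) = \<epsilon> y * P 1" .
qed (intro lins)+

section \<open>The inverse of theta squared and its image under phi\<close>

abbreviation theta2 where "theta2 \<equiv> theta_square A"
definition winv :: "('k, 'i) double" where "winv = Dm vinv uinv"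

lemma w_winv: "Dm theta2 winv = one" "Dm winv theta2 = one"
proof -
  have "Dm theta2 winv = Dm u (Dm (Dm (Da u) vinv) uinv)"
    by (simp add: theta_square_def winv_def Dm_assoc)
  then show "Dm theta2 winv = one" by (simp add: Dau_vinv Dm_one1 u_uinv)
  have "Dm winv theta2 = Dm vinv (Dm (Dm uinv u) (Da u))"
    by (simp add: theta_square_def winv_def Dm_assoc)
  then show "Dm winv theta2 = one" by (simp add: vinv_Dau Dm_one1 uinv_u)
qed

lemma mult_inverse_w: "mult_inverse Dm one theta2 = winv"
  by (rule mult_inverse_unique) (simp_all add: Dm_assoc Dm_one1 Dm_one2 w_winv)

lemma HH_one: "HH (HHop_one A) x = x" "HH x (HHop_one A) = x"
  unfolding HHop_mult_def HHop_one_def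
  by (simp_all add: klin_tens_one klin_tens_one' kbil_hm kbil_hop hm_one1 hm_one2 opp_mult_def)

lemma phi_one': "phi A one = HHop_one A" by (simp add: phi_one HHop_one_def)

text \<open>A unital homomorphism preserves inverses. Hence the word for a negative power of theta
  in the target is the image of the one in the source.\<close>

lemma mult_inverse_phi_w: "mult_inverse HH (HHop_one A) (phi A theta2) = phi A winv"
  by (rule mult_inverse_unique)
    (simp_all add: HH_assoc HH_one phi_mult[symmetric] w_winv phi_one')

end

section \<open>The local identity at a crossing\<close>

text \<open>The copies of the over-strand met by each copy of the under-strand, in the order of the
  product, that is, against the orientation. \<open>over_order\<close> does the same with the
  strands exchanged.\<close>

fun under_order :: "xing \<Rightarrow> dir \<Rightarrow> dir \<Rightarrow> copy list" where
  "under_order XPlus Down d = [right_copy d, left_copy d]"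
| "under_order XPlus Up d = [left_copy d, right_copy d]"
| "under_order XMinus Down d = [left_copy d, right_copy d]"
| "under_order XMinus Up d = [right_copy d, left_copy d]"

fun over_order :: "xing \<Rightarrow> dir \<Rightarrow> dir \<Rightarrow> copy list" where
  "over_order XPlus Down d = [left_copy d, right_copy d]"
| "over_order XPlus Up d = [right_copy d, left_copy d]"
| "over_order XMinus Down d = [right_copy d, left_copy d]"
| "over_order XMinus Up d = [left_copy d, right_copy d]"

text \<open>The components follow the order of the factors in the image of R for two downward
  strands, S'' S~ S S', where S~ belongs to two thick strands.\<close>

fun sel :: "'i \<times> 'i \<times> 'i \<times> 'i \<Rightarrow> copy \<Rightarrow> copy \<Rightarrow> 'i" where
  "sel (a, b, c, d) Thin Thick = a"
| "sel (a, b, c, d) Thick Thick = b"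
| "sel (a, b, c, d) Thin Thin = c"
| "sel (a, b, c, d) Thick Thin = d"

context hopf begin

definition copy_mult :: "copy \<Rightarrow> ('k, 'i \<times> 'i) mult" where
  "copy_mult k = (if k = Thin then hm else opp_mult hm)"

definition under_label :: "xing \<Rightarrow> dir \<Rightarrow> copy \<Rightarrow> copy \<Rightarrow> 'i \<Rightarrow> ('k, 'i) double" where
  "under_label x d cu co i = dt \<epsilon> ((if d = Up then \<gamma> else id) (fst (crossing_term A x cu co i)))"

definition over_label :: "xing \<Rightarrow> dir \<Rightarrow> copy \<Rightarrow> copy \<Rightarrow> 'i \<Rightarrow> ('k, 'i) double" where
  "over_label x d cu co i = dt (let g = snd (crossing_term A x cu co i) in if d = Up then g \<circ> g' else g) 1"

definition cross_under :: "xing \<Rightarrow> dir \<Rightarrow> dir \<Rightarrow> copy \<Rightarrow> 'i \<times> 'i \<times> 'i \<times> 'i \<Rightarrow> ('k, 'i) double" where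
  "cross_under x du do k j =
     foldr (copy_mult k) (map (\<lambda>co. under_label x du k co (sel j k co)) (under_order x du do)) one"

definition cross_over :: "xing \<Rightarrow> dir \<Rightarrow> dir \<Rightarrow> copy \<Rightarrow> 'i \<times> 'i \<times> 'i \<times> 'i \<Rightarrow> ('k, 'i) double" where
  "cross_over x du do k j =
     foldr (copy_mult k) (map (\<lambda>cu. over_label x do cu k (sel j cu k)) (over_order x do du)) one"

fun R_of :: "xing \<Rightarrow> ('k, 'i) double2" where
  "R_of XPlus = R_matrix A"
| "R_of XMinus = R_inverse A"

definition ev4 where
  "ev4 X L1 L2 = (\<Sum>p\<in>UNIV. \<Sum>q\<in>UNIV. X $ (p, q) * (L1 (axis p 1) * L2 (axis q 1)))"

lemma kfun_ev4: "kfun (\<lambda>X. ev4 X L1 L2)"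
  unfolding ev4_def by (intro kfun_sumI kfun_multc kfun_nth)

lemma ev4_tens:
  assumes "kfun L1" "kfun L2" shows "ev4 (tens v w) L1 L2 = L1 v * L2 w"
proof -
  have "ev4 (tens v w) L1 L2 = (\<Sum>p\<in>UNIV. v $ p * L1 (axis p 1)) * (\<Sum>q\<in>UNIV. w $ q * L2 (axis q 1))"
    unfolding ev4_def tens_nth sum_product by (intro sum.cong refl) (simp add: mult_ac)
  then show ?thesis by (simp only: kfun_expand[OF assms(1), symmetric] kfun_expand[OF assms(2), symmetric])
qed

lemma ev4_ev2: "ev4 (tens v w) (\<lambda>v. ev2 v y y' P P') (\<lambda>v. ev2 v z z' Q Q') = ev2 v y y' P P' * ev2 w z z' Q Q'"
  by (rule ev4_tens[OF kfun_ev2 kfun_ev2])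

lemma ev4I:
  assumes "\<And>y y' z z' P P' Q Q'. lf A P \<Longrightarrow> lf A P' \<Longrightarrow> lf A Q \<Longrightarrow> lf A Q' \<Longrightarrow>
    ev4 X (\<lambda>v. ev2 v y y' P P') (\<lambda>v. ev2 v z z' Q Q') = ev4 Y (\<lambda>v. ev2 v y y' P P') (\<lambda>v. ev2 v z z' Q Q')"
  shows "X = Y"
proof -
  have d: "ev (axis p 1) (e i) (\<lambda>x. cf x $ j) = (if p = (i, j) then 1 else 0)" for p i j
    by (cases p) (auto simp: axis_dt ev_dt lf_db' lf_cf db_e cf_e)
  have d2: "ev2 (axis r 1) (e (fst p)) (e (fst q)) (\<lambda>x. cf x $ snd p) (\<lambda>x. cf x $ snd q) = (if r = (p, q) then 1 else 0)" for r p q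
  proof -
    obtain r1 r2 where r: "r = (r1, r2)" by (cases r)
    show ?thesis unfolding r by (subst axis_pair, subst ev2_tens) (auto simp: d)
  qed
  have d4: "ev4 X (\<lambda>v. ev2 v (e (fst p)) (e (fst q)) (\<lambda>x. cf x $ snd p) (\<lambda>x. cf x $ snd q))
     (\<lambda>v. ev2 v (e (fst p')) (e (fst q')) (\<lambda>x. cf x $ snd p') (\<lambda>x. cf x $ snd q')) = X $ ((p, q), (p', q'))" for X p q p' q'
    unfolding ev4_def by (simp add: d2 if_distrib[of "\<lambda>x. _ * x"] if_distrib[of "\<lambda>x. x * _"] cong: if_cong)
  show ?thesis unfolding vec_eq_iff
  proof
    fix r show "X $ r = Y $ r"
      using assms[OF lf_cf lf_cf lf_cf lf_cf] d4[of X "fst (fst r)" "snd (fst r)" "fst (snd r)" "snd (snd r)"]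
        d4[of Y "fst (fst r)" "snd (fst r)" "fst (snd r)" "snd (snd r)"] by simp
  qed
qed

lemma db_collapse4:
  assumes "\<And>b c d. lf A (\<lambda>a. K a b c d)" "\<And>a c d. lf A (\<lambda>b. K a b c d)" "\<And>a b d. lf A (\<lambda>c. K a b c d)" "\<And>a b c. lf A (\<lambda>d. K a b c d)"
  shows "(\<Sum>a\<in>UNIV. \<Sum>b\<in>UNIV. \<Sum>c\<in>UNIV. \<Sum>d\<in>UNIV. db a p * (db b q * (db c r * (db d s * K (e a) (e b) (e c) (e d))))) = K p q r s"
  by (simp only: sum_distrib_left[symmetric] db_collapse[OF assms(4)] db_collapse[OF assms(3)] db_collapse[OF assms(2)] db_collapse[OF assms(1)])

text \<open>In other words, \<phi>(x) = \<Sum> x' \<otimes> \<gamma>(x''): the third leg of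
  \<open>x\<close> meets only the counit.\<close>

lemma ev2_phi_A:
  assumes P: "lf A P" and P': "lf A P'"
  shows "ev2 (phi A (dt \<epsilon> x)) y y' P P' = \<epsilon> y * \<epsilon> y' * sw A x (\<lambda>x1 x2. P x1 * P' (\<gamma> x2))"
proof -
  note l = lins lf_comp[OF P] lf_comp[OF P']
  have "ev2 (phi A (dt \<epsilon> x)) y y' P P' = sw A x (\<lambda>x1 x'. sw A x' (\<lambda>x2 x3. \<epsilon> x3 * (\<epsilon> y * \<epsilon> y' * (P x1 * P' (\<gamma> x2)))))"
    by (simp add: phi_ev2[OF lin_counit P P'] mult_ac)
  also have "\<dots> = sw A x (\<lambda>x1 x'. \<epsilon> y * \<epsilon> y' * (P x1 * P' (\<gamma> x')))"
    by (intro arg_cong[where f="sw A _"] ext sw_counit_r) (intro l)+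
  finally show ?thesis by (simp add: sw_cmult)
qed

text \<open>In other words, \<phi>(f) = \<Sum> f'' \<otimes> (f' \<circ> \<open>g'\<close>).\<close>

lemma ev2_phi_dual:
  assumes f: "lf A f" and Q: "lf A Q" and Q': "lf A Q'"
  shows "ev2 (phi A (dt f 1)) z z' Q Q' = f (g' z' * z) * (Q 1 * Q' 1)"
proof -
  note l = lins lf_comp[OF f] lf_comp[OF Q] lf_comp[OF Q']
  have "ev2 (phi A (dt f 1)) z z' Q Q' = sw A 1 (\<lambda>x1 x'. sw A x' (\<lambda>x2 x3. f (x3 * g' z' * z) * (Q x1 * Q' (\<gamma> x2))))"
    by (rule phi_ev2[OF f Q Q'])
  also have "\<dots> = sw A 1 (\<lambda>x2 x3. f (x3 * g' z' * z) * (Q 1 * Q' (\<gamma> x2)))"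
    by (rule sw_one) (intro l)+
  also have "\<dots> = f (1 * g' z' * z) * (Q 1 * Q' (\<gamma> 1))"
    by (rule sw_one) (intro l)+
  finally show ?thesis by simp
qed

lemma la_comp: "la A G \<Longrightarrow> la A f \<Longrightarrow> la A (\<lambda>x. G (f x))"
  by (simp add: la_def)

text \<open>R and its inverse, with antipodes on upward strands, all have the form \<Sum> G(e_a)
  \<otimes> (e^a \<circ> H). The pairing shows that only the composite of \<open>G\<close> and
  \<open>H\<close> enters.\<close>

lemma ev4_cross:
  assumes l: "la A G" "la A H" and P: "lf A P" "lf A P'" "lf A Q" "lf A Q'"
  shows "ev4 (\<Sum>a\<in>UNIV. tens (phi A (dt \<epsilon> (G (e a)))) (phi A (dt (db a \<circ> H) 1))) (\<lambda>v. ev2 v y y' P P') (\<lambda>v. ev2 v z z' Q Q')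
    = (\<epsilon> y * \<epsilon> y' * (Q 1 * Q' 1)) * sw A (G (H (g' z' * z))) (\<lambda>x1 x2. P x1 * P' (\<gamma> x2))"
    (is "?E = _")
proof -
  have d: "lf A (db i \<circ> H)" for i
    unfolding comp_def by (intro lf_comp[OF lf_db'] l)
  have 1: "lf A (\<lambda>x. sw A (G x) (\<lambda>x1 x2. P x1 * P' (\<gamma> x2)))" by (intro lins la_comp[OF l(1)])
  have "?E
    = (\<epsilon> y * \<epsilon> y' * (Q 1 * Q' 1)) * (\<Sum>a\<in>UNIV. db a (H (g' z' * z)) * sw A (G (e a)) (\<lambda>x1 x2. P x1 * P' (\<gamma> x2)))"
    unfolding sum_distrib_left
    by (simp add: kfun_sum[OF kfun_ev4] ev4_ev2 ev2_phi_A ev2_phi_dual d P mult_ac)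
  then show ?thesis by (simp only: db_collapse[OF 1])
qed

text \<open>The composite of \<open>G\<close> and \<open>H\<close> preserves products and
  coproducts, so the coproduct of its value at \<open>g' z' * z\<close> splits into four factors.
  These are the labels at the four crossings, in the order a, b, c, d.\<close>

lemma cross_core_hom:
  assumes l: "la A G" "la A H" and Hg: "\<And>x. H (g' x) = g' (H x)"
    and hom: "\<And>x y. G (H (x * y)) = G (H x) * G (H y)"
    and co: "\<And>x F. (\<And>b. lf A (\<lambda>a. F a b)) \<Longrightarrow> (\<And>a. lf A (F a)) \<Longrightarrow> sw A (G (H x)) F = sw A x (\<lambda>a b. F (G (H a)) (G (H b)))"
  shows "(\<Sum>a\<in>UNIV. tens (phi A (dt \<epsilon> (G (e a)))) (phi A (dt (db a \<circ> H) 1))) =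
   (\<Sum>a\<in>UNIV. \<Sum>b\<in>UNIV. \<Sum>c\<in>UNIV. \<Sum>d\<in>UNIV. tens (tens (dt \<epsilon> (G (e a) * G (e c))) (dt \<epsilon> (\<gamma> (G (e d)) * \<gamma> (G (e b)))))
       (tens (dt (dm (db c \<circ> H) (db d \<circ> H)) 1) (dt (dm (db b \<circ> (g' \<circ> H)) (db a \<circ> (g' \<circ> H))) 1)))" (is "?L = ?R")
proof (rule ev4I)
  fix y y' z z' P P' Q Q' assume P: "lf A P" "lf A P'" "lf A Q" "lf A Q'"
  note ls = lins lf_comp[OF P(1)] lf_comp[OF P(2)] la_comp[OF l(1)] la_comp[OF l(2)]
  have d: "lf A (db i \<circ> H)" "lf A (db i \<circ> (g' \<circ> H))" for i
    unfolding comp_def by (intro ls)+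
  have "ev4 ?R (\<lambda>v. ev2 v y y' P P') (\<lambda>v. ev2 v z z' Q Q')
    = (\<epsilon> y * \<epsilon> y' * (Q 1 * Q' 1)) * sw A z' (\<lambda>z1' z2'. sw A z (\<lambda>z1 z2.
       (\<Sum>a\<in>UNIV. \<Sum>b\<in>UNIV. \<Sum>c\<in>UNIV. \<Sum>d\<in>UNIV. db a (g' (H z2')) * (db b (g' (H z1')) * (db c (H z1) * (db d (H z2) * (P (G (e a) * G (e c)) * P' (\<gamma> (G (e d)) * \<gamma> (G (e b))))))))))"
    unfolding sw_sum sum_distrib_left sw_cmult[symmetric]
    by (simp add: kfun_sum[OF kfun_ev4] ev4_ev2 ev2_tens ev_dt lin_counit lf_dm' d P)
      (simp add: dm_eq sw_cmult[symmetric] sw_multc[symmetric] sw_swap[of z] mult_ac)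
  also have "\<dots> = (\<epsilon> y * \<epsilon> y' * (Q 1 * Q' 1)) * sw A z' (\<lambda>z1' z2'. sw A z (\<lambda>z1 z2.
       P (G (g' (H z2')) * G (H z1)) * P' (\<gamma> (G (H z2)) * \<gamma> (G (g' (H z1'))))))"
    by (subst db_collapse4[where K="\<lambda>a b c d. P (G a * G c) * P' (\<gamma> (G d) * \<gamma> (G b))"]) (intro ls refl)+
  also have "\<dots> = (\<epsilon> y * \<epsilon> y' * (Q 1 * Q' 1)) * sw A (G (H (g' z' * z))) (\<lambda>x1 x2. P x1 * P' (\<gamma> x2))"
    by (simp add: co sw_mult sw_g' ls hom antipode_mult Hg[symmetric])
  finally show "ev4 ?L (\<lambda>v. ev2 v y y' P P') (\<lambda>v. ev2 v z z' Q Q') = ev4 ?R (\<lambda>v. ev2 v y y' P P') (\<lambda>v. ev2 v z z' Q Q')"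
    using ev4_cross[OF l P] by simp
qed

text \<open>For a composite that reverses products and coproducts the four factors come in the order
  d, c, b, a.\<close>

lemma cross_core_anti:
  assumes l: "la A G" "la A H" and Hg: "\<And>x. H (g' x) = g' (H x)"
    and hom: "\<And>x y. G (H (x * y)) = G (H y) * G (H x)"
    and co: "\<And>x F. (\<And>b. lf A (\<lambda>a. F a b)) \<Longrightarrow> (\<And>a. lf A (F a)) \<Longrightarrow> sw A (G (H x)) F = sw A x (\<lambda>a b. F (G (H b)) (G (H a)))"
  shows "(\<Sum>a\<in>UNIV. tens (phi A (dt \<epsilon> (G (e a)))) (phi A (dt (db a \<circ> H) 1))) =
   (\<Sum>a\<in>UNIV. \<Sum>b\<in>UNIV. \<Sum>c\<in>UNIV. \<Sum>d\<in>UNIV. tens (tens (dt \<epsilon> (G (e c) * G (e a))) (dt \<epsilon> (\<gamma> (G (e b)) * \<gamma> (G (e d)))))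
       (tens (dt (dm (db d \<circ> H) (db c \<circ> H)) 1) (dt (dm (db a \<circ> (g' \<circ> H)) (db b \<circ> (g' \<circ> H))) 1)))" (is "?L = ?R")
proof (rule ev4I)
  fix y y' z z' P P' Q Q' assume P: "lf A P" "lf A P'" "lf A Q" "lf A Q'"
  note ls = lins lf_comp[OF P(1)] lf_comp[OF P(2)] la_comp[OF l(1)] la_comp[OF l(2)]
  have d: "lf A (db i \<circ> H)" "lf A (db i \<circ> (g' \<circ> H))" for i
    unfolding comp_def by (intro ls)+
  have "ev4 ?R (\<lambda>v. ev2 v y y' P P') (\<lambda>v. ev2 v z z' Q Q')
    = (\<epsilon> y * \<epsilon> y' * (Q 1 * Q' 1)) * sw A z' (\<lambda>z1' z2'. sw A z (\<lambda>z1 z2.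
       (\<Sum>a\<in>UNIV. \<Sum>b\<in>UNIV. \<Sum>c\<in>UNIV. \<Sum>d\<in>UNIV. db a (g' (H z1')) * (db b (g' (H z2')) * (db c (H z2) * (db d (H z1) * (P (G (e c) * G (e a)) * P' (\<gamma> (G (e b)) * \<gamma> (G (e d))))))))))"
    unfolding sw_sum sum_distrib_left sw_cmult[symmetric]
    by (simp add: kfun_sum[OF kfun_ev4] ev4_ev2 ev2_tens ev_dt lin_counit lf_dm' d P)
      (simp add: dm_eq sw_cmult[symmetric] sw_multc[symmetric] sw_swap[of z] mult_ac)
  also have "\<dots> = (\<epsilon> y * \<epsilon> y' * (Q 1 * Q' 1)) * sw A z' (\<lambda>z1' z2'. sw A z (\<lambda>z1 z2.
       P (G (H z2) * G (g' (H z1'))) * P' (\<gamma> (G (g' (H z2'))) * \<gamma> (G (H z1)))))"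
    by (subst db_collapse4[where K="\<lambda>a b c d. P (G c * G a) * P' (\<gamma> (G b) * \<gamma> (G d))"]) (intro ls refl)+
  also have "\<dots> = (\<epsilon> y * \<epsilon> y' * (Q 1 * Q' 1)) * sw A (G (H (g' z' * z))) (\<lambda>x1 x2. P x1 * P' (\<gamma> x2))"
    by (simp add: co sw_mult sw_g' ls hom antipode_mult Hg[symmetric] sw_swap[of z])
  finally show "ev4 ?L (\<lambda>v. ev2 v y y' P P') (\<lambda>v. ev2 v z z' Q Q') = ev4 ?R (\<lambda>v. ev2 v y y' P P') (\<lambda>v. ev2 v z z' Q Q')"
    using ev4_cross[OF l P] by simp
qed

definition strand_antipode :: "dir \<Rightarrow> ('k, 'i) double \<Rightarrow> ('k, 'i) double" where
  "strand_antipode d = (if d = Up then Da else id)"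

lemma klin_strand_antipode: "klin (strand_antipode d)"
  by (simp add: strand_antipode_def klin_Da) (simp add: klin_def)

lemma R_of_sum:
  assumes B: "kbil B"
  shows "(\<Sum>\<sigma>\<in>UNIV. R_of x $ \<sigma> *s B (axis (fst \<sigma>) 1) (axis (snd \<sigma>) 1)) =
    (\<Sum>a\<in>UNIV. B (dt \<epsilon> ((case x of XPlus \<Rightarrow> id | XMinus \<Rightarrow> \<gamma>) (e a))) (dt (db a) 1))"
proof -
  have "(\<Sum>\<sigma>\<in>UNIV. R_of x $ \<sigma> *s B (axis (fst \<sigma>) 1) (axis (snd \<sigma>) 1)) = lin (\<lambda>(p, q). B (axis p 1) (axis q 1)) (R_of x)"
    by (simp add: lin_def split_def)
  moreover have "R_of x = (\<Sum>a\<in>UNIV. tens (dt \<epsilon> ((case x of XPlus \<Rightarrow> id | XMinus \<Rightarrow> \<gamma>) (e a))) (dt (db a) 1))"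
    by (cases x) (simp_all add: R_matrix_def R_inverse_eq Rinv_def)
  ultimately show ?thesis
    by (simp only: klin_sum[OF klin_lin] lin_tens[OF B])
qed

text \<open>The curl that replaces a maximum has its crossing of type \<open>XMinus\<close>, with
  the over-strand downward and the under-strand upward. One antipode comes from the inverse of R and
  one from the upward strand.\<close>

lemma uinv_eq: "(\<Sum>\<sigma>\<in>UNIV. R_of XMinus $ \<sigma> *s Dm (axis (snd \<sigma>) 1) (Da (axis (fst \<sigma>) 1))) = uinv"
proof -
  have b: "kbil (\<lambda>x y. Dm y (Da x))"
    unfolding kbil_def by (auto intro: kbil1[OF kbil_Dm] klin_comp[OF kbil2[OF kbil_Dm] klin_Da])
  show ?thesis
    by (subst R_of_sum[OF b]) (simp add: uinv_def Da_counit Dm_counit lf_db')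
qed

lemma u_eq': "(\<Sum>\<sigma>\<in>UNIV. R_of XPlus $ \<sigma> *s Dm (Da (axis (snd \<sigma>) 1)) (axis (fst \<sigma>) 1)) = u"
  unfolding drinfeld_u_def lin_def by (simp add: split_def)

lemma cross_sum:
  "(\<Sum>\<sigma>\<in>UNIV. R_of x $ \<sigma> *s tens (phi A (strand_antipode du (axis (fst \<sigma>) 1))) (phi A (strand_antipode do (axis (snd \<sigma>) 1))))
   = (\<Sum>j\<in>UNIV. tens (tens (cross_under x du do Thin j) (cross_under x du do Thick j))
        (tens (cross_over x du do Thin j) (cross_over x du do Thick j)))"
proof -
  have b: "kbil (\<lambda>p q. tens (phi A (strand_antipode du p)) (phi A (strand_antipode do q)))"
    by (intro kbil_comp[OF kbil_tens] klin_comp[OF klin_phi klin_strand_antipode])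
  have c0: "(\<Sum>a\<in>UNIV. F a) = (\<Sum>a\<in>UNIV. \<Sum>b\<in>UNIV. \<Sum>c\<in>UNIV. \<Sum>d\<in>UNIV. F (a, b, c, d))" for F :: "'i \<times> 'i \<times> 'i \<times> 'i \<Rightarrow> _"
    by (simp add: sum_pair')
  have lab: "cross_under x du do k j = foldr (copy_mult k) (map (\<lambda>co. under_label x du k co (sel j k co)) (under_order x du do)) one"
    for x k j du "do" by (rule cross_under_def)
  note defs = strand_antipode_def Da_counit Da_unit lf_db' c0 cross_under_def cross_over_def copy_mult_def opp_mult_def
      under_label_def over_label_def hm_one1 hm_one2 S_inv_term_def hm_counit hm_unit lin_counit lf_g' comp_assoc
  have lgg: "lf A (db b \<circ> (g' \<circ> g'))" for b
    unfolding comp_def by (intro lins)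
  have gg_mult: "\<gamma> (\<gamma> (x * y)) = \<gamma> (\<gamma> x) * \<gamma> (\<gamma> y)" for x y
    by (simp add: antipode_mult)
  \<comment> \<open>\<open>G\<close> collects an antipode from \<open>XMinus\<close> and one from an
    upward under-strand, \<open>H\<close> an inverse antipode from an upward over-strand. The eight
    cases need six pairs; those of \<open>c2\<close> and \<open>c4\<close> occur twice.\<close>
  note c1 = cross_core_hom[OF la_id la_id refl refl refl, unfolded comp_def]
    and c2 = cross_core_hom[OF lin_antipode la_g' refl, unfolded gg' comp_def, OF refl refl]
    and c3 = cross_core_hom[OF la_antipode[OF lin_antipode] la_id refl gg_mult sw_gg, unfolded comp_def]
    and c4 = cross_core_anti[OF lin_antipode la_id refl antipode_mult sw_antipode, unfolded comp_def]
    and c5 = cross_core_anti[OF la_id la_g' refl g'_mult sw_g', unfolded comp_def]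
    and c6 = cross_core_anti[OF la_antipode[OF lin_antipode] la_g' refl, unfolded gg' comp_def, OF antipode_mult sw_antipode]
  show ?thesis
    apply (subst R_of_sum[OF b])
    apply (cases x; cases du; cases "do"; simp add: defs lgg; unfold comp_def)
    by (rule c2 c4 c5 c1 c6 c3; assumption)+
qed

end

section \<open>Quotients of formal linear combinations\<close>

lemma lookup_pm_scale: "Poly_Mapping.lookup (pm_scale c x) v = c * Poly_Mapping.lookup x v"
  unfolding pm_scale_def by (simp add: Poly_Mapping.map.rep_eq when_def)

interpretation pm: vector_space "pm_scale :: 'k::field \<Rightarrow> ('w \<Rightarrow>\<^sub>0 'k) \<Rightarrow> _"
  by unfold_locales (auto simp: poly_mapping_eq_iff fun_eq_iff lookup_pm_scale lookup_add algebra_simps)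

lemma pm_scale_single: "pm_scale c (Poly_Mapping.single v d) = Poly_Mapping.single v (c * d)"
  by (auto simp: poly_mapping_eq_iff fun_eq_iff lookup_pm_scale lookup_single when_def)

lemma pm_push_superset:
  assumes "finite S" "Poly_Mapping.keys x \<subseteq> S"
  shows "pm_push g x = (\<Sum>v\<in>S. Poly_Mapping.single (g v) (Poly_Mapping.lookup x v))"
  unfolding pm_push_def
  by (rule sum.mono_neutral_left) (use assms in \<open>auto simp: in_keys_iff\<close>)

lemma pm_push_gen [simp]: "pm_push g (gen v :: _ \<Rightarrow>\<^sub>0 'k::field) = gen (g v)"
  unfolding pm_push_def by simp

lemma pm_push_zero [simp]: "pm_push g 0 = 0"
  unfolding pm_push_def by simp

lemma pm_push_add: "pm_push g (x + y) = pm_push g x + pm_push g y"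
proof -
  let ?S = "Poly_Mapping.keys x \<union> Poly_Mapping.keys y"
  have k: "Poly_Mapping.keys (x + y) \<subseteq> ?S" by (rule Poly_Mapping.keys_add)
  show ?thesis
    by (simp add: pm_push_superset[of ?S] k sum.distrib[symmetric] lookup_add single_add)
qed

lemma pm_push_scale: "pm_push g (pm_scale c x) = pm_scale c (pm_push g x)"
proof -
  have k: "Poly_Mapping.keys (pm_scale c x) \<subseteq> Poly_Mapping.keys x"
    by (auto simp: in_keys_iff lookup_pm_scale)
  show ?thesis
    by (subst pm_push_superset[OF _ k]) (simp_all add: pm_push_def lookup_pm_scale pm.scale_sum_right pm_scale_single)
qed

lemma pm_push_diff: "pm_push g (x - y) = pm_push g x - pm_push g y"
  by (metis add_diff_cancel diff_add_cancel pm_push_add)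

lemma pm_push_sum: "pm_push g (\<Sum>i\<in>I. f i) = (\<Sum>i\<in>I. pm_push g (f i))"
  by (induction I rule: infinite_finite_induct) (auto simp: pm_push_add)

lemma pm_push_single: "pm_push g (Poly_Mapping.single v c) = Poly_Mapping.single (g v) c"
  by (cases "c = 0") (simp_all add: pm_push_def)

lemma pm_push_comp: "pm_push g (pm_push h x) = pm_push (\<lambda>v. g (h v)) x"
proof -
  have "pm_push g (pm_push h x) = (\<Sum>v\<in>Poly_Mapping.keys x. pm_push g (pm_scale (Poly_Mapping.lookup x v) (gen (h v))))"
    by (simp add: pm_push_def[of h] pm_push_sum pm_scale_single)
  then show ?thesis by (simp add: pm_scale_single pm_push_single pm_push_def[of "\<lambda>v. g (h v)"])
qed

definition span_eq :: "('w \<Rightarrow>\<^sub>0 'k::field) set \<Rightarrow> ('w \<Rightarrow>\<^sub>0 'k) \<Rightarrow> ('w \<Rightarrow>\<^sub>0 'k) \<Rightarrow> bool" where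
  "span_eq S x y \<longleftrightarrow> x - y \<in> pm.span S"

lemma span_eq_refl [simp]: "span_eq S x x" by (simp add: span_eq_def pm.span_zero)
lemma span_eq_sym: "span_eq S x y \<Longrightarrow> span_eq S y x"
  unfolding span_eq_def by (metis minus_diff_eq pm.span_neg)
lemma span_eq_trans [trans]: "span_eq S x y \<Longrightarrow> span_eq S y z \<Longrightarrow> span_eq S x z"
  unfolding span_eq_def by (metis (no_types, opaque_lifting) diff_add_cancel add_diff_eq pm.span_add)
lemma span_eq_eq_trans1 [trans]: "x = y \<Longrightarrow> span_eq S y z \<Longrightarrow> span_eq S x z" by simp
lemma span_eq_eq_trans2 [trans]: "span_eq S x y \<Longrightarrow> y = z \<Longrightarrow> span_eq S x z" by simp
lemma span_eq_add: "span_eq S x y \<Longrightarrow> span_eq S x' y' \<Longrightarrow> span_eq S (x + x') (y + y')"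
  unfolding span_eq_def by (metis add_diff_add pm.span_add)
lemma span_eq_scale: "span_eq S x y \<Longrightarrow> span_eq S (pm_scale c x) (pm_scale c y)"
  unfolding span_eq_def by (metis pm.scale_right_diff_distrib pm.span_scale)
lemma span_eq_sum: "(\<And>i. i \<in> I \<Longrightarrow> span_eq S (f i) (g i)) \<Longrightarrow> span_eq S (\<Sum>i\<in>I. f i) (\<Sum>i\<in>I. g i)"
  by (induction I rule: infinite_finite_induct) (auto intro: span_eq_add)
lemma span_eq_base: "x - y \<in> S \<Longrightarrow> span_eq S x y"
  unfolding span_eq_def by (rule pm.span_base)
lemma span_eq_mono: "span_eq S x y \<Longrightarrow> S \<subseteq> T \<Longrightarrow> span_eq T x y"
  unfolding span_eq_def using pm.span_mono by blast

text \<open>A map of basis words that sends relations into the span of the new relations descends to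
  the quotients.\<close>

lemma span_eq_push:
  assumes r: "\<And>r. r \<in> S \<Longrightarrow> pm_push g r \<in> pm.span T" and "span_eq S x y"
  shows "span_eq T (pm_push g x) (pm_push g y)"
proof -
  have "pm_push g z \<in> pm.span T" if "z \<in> pm.span S" for z
    using that
    by (induction rule: pm.span_induct_alt)
      (auto simp: pm.span_zero pm_push_add pm_push_scale intro: pm.span_add pm.span_scale r)
  then show ?thesis using assms(2) unfolding span_eq_def pm_push_diff[symmetric] by blast
qed

lemma tensor_class_eq_iff: "tensor_class R cl x = tensor_class R cl y \<longleftrightarrow> span_eq (tensor_rels R cl) x y"
proof
  assume "tensor_class R cl x = tensor_class R cl y"
  moreover have "x \<in> tensor_class R cl x" unfolding tensor_class_def by (simp add: pm.span_zero)
  ultimately show "span_eq (tensor_rels R cl) x y"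
    unfolding tensor_class_def span_eq_def by simp
next
  assume "span_eq (tensor_rels R cl) x y"
  then show "tensor_class R cl x = tensor_class R cl y"
    unfolding tensor_class_def span_eq_def[symmetric]
    by (blast intro: span_eq_trans span_eq_sym)
qed

lemma tensor_slot:
  assumes "span_eq (R \<union> (if cl ! i then commutators else {})) x y" "i < length cl" "length ws = length cl"
  shows "span_eq (tensor_rels R cl) (pm_push (\<lambda>v. ws[i := v]) x) (pm_push (\<lambda>v. ws[i := v]) y)"
  by (rule span_eq_push[OF _ assms(1)], rule pm.span_base, unfold tensor_rels_def)
    (use assms(2,3) in blast)

lemma tensor_slot_gen:
  assumes "span_eq (R \<union> (if cl ! i then commutators else {})) (gen v) (gen v')" "i < length cl" "length ws = length cl"
  shows "span_eq (tensor_rels R cl) (gen (ws[i := v])) (gen (ws[i := v']))"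
  using tensor_slot[OF assms] by simp

text \<open>The words are exchanged one slot at a time; after \<open>k\<close> steps the first
  \<open>k\<close> entries come from \<open>ws'\<close>.\<close>

lemma tensor_gen_cong:
  assumes l: "length ws = length cl" "length ws' = length cl"
    and h: "\<And>i. i < length cl \<Longrightarrow> span_eq (R \<union> (if cl ! i then commutators else {})) (gen (ws ! i)) (gen (ws' ! i))"
  shows "span_eq (tensor_rels R cl) (gen ws) (gen ws')"
proof -
  have "k \<le> length cl \<Longrightarrow> span_eq (tensor_rels R cl) (gen ws) (gen (take k ws' @ drop k ws))" for k
  proof (induction k)
    case (Suc k)
    then have k: "k < length cl" by simp
    let ?v = "take k ws' @ drop k ws"
    have "?v = ?v[k := ws ! k]"
      using k l by (auto simp: list_update_append Cons_nth_drop_Suc[symmetric])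
    moreover have "take (Suc k) ws' @ drop (Suc k) ws = ?v[k := ws' ! k]"
      using k l by (auto simp: list_update_append Cons_nth_drop_Suc[symmetric] take_Suc_conv_app_nth)
    moreover have "span_eq (tensor_rels R cl) (gen (?v[k := ws ! k])) (gen (?v[k := ws' ! k]))"
      by (rule tensor_slot_gen[OF h[OF k] k]) (use k l in auto)
    ultimately show ?case using Suc by (metis Suc_leD span_eq_trans)
  qed simp
  from this[of "length cl"] show ?thesis using l by simp
qed

text \<open>Every family of relations carries an arbitrary context \<open>p\<close>,
  \<open>q\<close>, so its span is a two-sided ideal. Commutators carry no context: inside a longer
  word only congruences modulo the algebra relations may be used.\<close>

lemma adjoin_context:
  assumes "r \<in> adjoin_rels m one w C"
  shows "pm_push (\<lambda>v. P @ v @ Q) r \<in> adjoin_rels m one w C"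
proof -
  consider (1) p q c x y where "r = gen (p @ [Coeff (c *s x + y)] @ q) - pm_scale c (gen (p @ [Coeff x] @ q)) - gen (p @ [Coeff y] @ q)"
    | (2) p q x y where "r = gen (p @ [Coeff x, Coeff y] @ q) - gen (p @ [Coeff (m x y)] @ q)"
    | (3) p q where "r = gen (p @ [Coeff one] @ q) - gen (p @ q)"
    | (4) p q where "r = gen (p @ [Theta, Theta] @ q) - gen (p @ [Coeff w] @ q)"
    | (5) p q x where "r = gen (p @ [Theta, Coeff x] @ q) - gen (p @ [Coeff x, Theta] @ q)" "x \<in> C"
    using assms unfolding adjoin_rels_def by blast
  then show ?thesis
  proof cases
    case 1
    then have "pm_push (\<lambda>v. P @ v @ Q) r = gen ((P @ p) @ [Coeff (c *s x + y)] @ (q @ Q)) - pm_scale c (gen ((P @ p) @ [Coeff x] @ (q @ Q))) - gen ((P @ p) @ [Coeff y] @ (q @ Q))"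
      by (simp add: pm_push_diff pm_push_scale)
    then show ?thesis unfolding adjoin_rels_def by blast
  next
    case 2
    then have "pm_push (\<lambda>v. P @ v @ Q) r = gen ((P @ p) @ [Coeff x, Coeff y] @ (q @ Q)) - gen ((P @ p) @ [Coeff (m x y)] @ (q @ Q))"
      by (simp add: pm_push_diff)
    then show ?thesis unfolding adjoin_rels_def by blast
  next
    case 3
    then have "pm_push (\<lambda>v. P @ v @ Q) r = gen ((P @ p) @ [Coeff one] @ (q @ Q)) - gen ((P @ p) @ (q @ Q))"
      by (simp add: pm_push_diff)
    then show ?thesis unfolding adjoin_rels_def by blast
  next
    case 4
    then have "pm_push (\<lambda>v. P @ v @ Q) r = gen ((P @ p) @ [Theta, Theta] @ (q @ Q)) - gen ((P @ p) @ [Coeff w] @ (q @ Q))"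
      by (simp add: pm_push_diff)
    then show ?thesis unfolding adjoin_rels_def by blast
  next
    case 5
    then have "pm_push (\<lambda>v. P @ v @ Q) r = gen ((P @ p) @ [Theta, Coeff x] @ (q @ Q)) - gen ((P @ p) @ [Coeff x, Theta] @ (q @ Q))"
      by (simp add: pm_push_diff)
    then show ?thesis using 5(2) unfolding adjoin_rels_def by blast
  qed
qed

lemma adj_context:
  "span_eq (adjoin_rels m one w C) x y \<Longrightarrow>
    span_eq (adjoin_rels m one w C) (pm_push (\<lambda>v. P @ v @ Q) x) (pm_push (\<lambda>v. P @ v @ Q) y)"
  by (rule span_eq_push) (auto intro: pm.span_base adjoin_context)

lemma adj_context_gen:
  "span_eq (adjoin_rels m one w C) (gen x) (gen y) \<Longrightarrow>
    span_eq (adjoin_rels m one w C) (gen (P @ x @ Q)) (gen (P @ y @ Q))"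
  using adj_context[of m one w C "gen x" "gen y" P Q] by simp

lemma adj_append:
  "span_eq (adjoin_rels m one w C) (gen x) (gen x') \<Longrightarrow> span_eq (adjoin_rels m one w C) (gen y) (gen y') \<Longrightarrow>
    span_eq (adjoin_rels m one w C) (gen (x @ y)) (gen (x' @ y'))"
  using adj_context_gen[of m one w C x x' "[]" y] adj_context_gen[of m one w C y y' x' "[]"]
  by (auto intro: span_eq_trans)

lemma adj_mult: "span_eq (adjoin_rels m one w C) (gen [Coeff x, Coeff y]) (gen [Coeff (m x y)])"
proof (rule span_eq_base)
  have "gen ([] @ [Coeff x, Coeff y] @ []) - gen ([] @ [Coeff (m x y)] @ []) \<in> adjoin_rels m one w C"
    unfolding adjoin_rels_def by blast
  then show "gen [Coeff x, Coeff y] - gen [Coeff (m x y)] \<in> adjoin_rels m one w C" by simp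
qed

lemma adj_one: "span_eq (adjoin_rels m one w C) (gen [Coeff one]) (gen [])"
proof (rule span_eq_base)
  have "gen ([] @ [Coeff one] @ []) - gen ([] @ []) \<in> adjoin_rels m one w C"
    unfolding adjoin_rels_def by blast
  then show "gen [Coeff one] - gen [] \<in> adjoin_rels m one w C" by simp
qed

lemma adj_theta: "span_eq (adjoin_rels m one w C) (gen [Theta, Theta]) (gen [Coeff w])"
proof (rule span_eq_base)
  have "gen ([] @ [Theta, Theta] @ []) - gen ([] @ [Coeff w] @ []) \<in> adjoin_rels m one w C"
    unfolding adjoin_rels_def by blast
  then show "gen [Theta, Theta] - gen [Coeff w] \<in> adjoin_rels m one w C" by simp
qed

lemma adj_commute: "x \<in> C \<Longrightarrow> span_eq (adjoin_rels m one w C) (gen [Theta, Coeff x]) (gen [Coeff x, Theta])"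
proof (rule span_eq_base)
  assume "x \<in> C"
  then have "gen ([] @ [Theta, Coeff x] @ []) - gen ([] @ [Coeff x, Theta] @ []) \<in> adjoin_rels m one w C"
    unfolding adjoin_rels_def by blast
  then show "gen [Theta, Coeff x] - gen [Coeff x, Theta] \<in> adjoin_rels m one w C" by simp
qed

lemma adj_linear: "span_eq (adjoin_rels m one w C) (gen [Coeff (c *s x + y)]) (pm_scale c (gen [Coeff x]) + gen [Coeff y])"
proof (rule span_eq_base)
  have "gen ([] @ [Coeff (c *s x + y)] @ []) - pm_scale c (gen ([] @ [Coeff x] @ [])) - gen ([] @ [Coeff y] @ []) \<in> adjoin_rels m one w C"
    unfolding adjoin_rels_def by blast
  then show "gen [Coeff (c *s x + y)] - (pm_scale c (gen [Coeff x]) + gen [Coeff y]) \<in> adjoin_rels m one w C"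
    by (simp add: diff_diff_add)
qed

text \<open>Linearity with \<open>c = -1\<close> and zero arguments has a right-hand side that
  cancels.\<close>

lemma adj_zero: "span_eq (adjoin_rels m one w C) (gen [Coeff (0 :: 'k::field ^ 'm::finite)]) 0"
  using adj_linear[of m one w C "-1" 0 0] by (simp add: pm.scale_minus_left)

lemma adj_sum:
  "span_eq (adjoin_rels m one w C) (gen [Coeff (\<Sum>i\<in>I. c i *s x i)]) (\<Sum>i\<in>I. pm_scale (c i) (gen [Coeff (x i)]))"
proof (induction I rule: infinite_finite_induct)
  case (insert i I)
  have "span_eq (adjoin_rels m one w C) (gen [Coeff (c i *s x i + (\<Sum>i\<in>I. c i *s x i))])
      (pm_scale (c i) (gen [Coeff (x i)]) + (\<Sum>i\<in>I. pm_scale (c i) (gen [Coeff (x i)])))"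
    by (rule span_eq_trans[OF adj_linear]) (intro span_eq_add span_eq_refl insert)
  then show ?case using insert by simp
qed (simp_all add: adj_zero)

lemma adj_expand:
  "span_eq (adjoin_rels m one w C) (gen [Coeff x]) (\<Sum>p\<in>UNIV. pm_scale (x $ p) (gen [Coeff (axis p 1)]))"
  using adj_sum[of m one w C "\<lambda>p. x $ p" "\<lambda>p. axis p 1" UNIV] by (simp only: axis_expansion)

lemma adj_prod:
  "span_eq (adjoin_rels m one w C) (gen (map Coeff xs)) (gen [Coeff (foldr m xs one)])"
proof (induction xs)
  case Nil
  then show ?case using span_eq_sym[OF adj_one] by simp
next
  case (Cons x xs)
  have "span_eq (adjoin_rels m one w C) (gen (map Coeff (x # xs))) (gen ([Coeff x] @ [Coeff (foldr m xs one)]))"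
    using adj_append[OF span_eq_refl[of _ "gen [Coeff x]"] Cons] by simp
  also have "span_eq (adjoin_rels m one w C) \<dots> (gen [Coeff (foldr m (x # xs) one)])"
    using adj_mult[of m one w C x] by simp
  finally show ?case .
qed

section \<open>State sums\<close>

definition words :: "('b \<Rightarrow> 'l list) \<Rightarrow> 'b list list \<Rightarrow> 'l list list" where
  "words L cs = map (\<lambda>c. concat (map L (rev c))) cs"

lemma length_words [simp]: "length (words L cs) = length cs" by (simp add: words_def)

lemma words_cong: "(\<And>a. a \<in> set (concat cs) \<Longrightarrow> L a = L' a) \<Longrightarrow> words L cs = words L' cs"
proof -
  assume h: "\<And>a. a \<in> set (concat cs) \<Longrightarrow> L a = L' a"
  show ?thesis unfolding words_def
    by (intro map_cong refl arg_cong[where f=concat] h) auto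
qed

text \<open>The arc occurs once among all components, so its label sits in one tensorand, inside a
  context that does not depend on it.\<close>

lemma words_slot:
  assumes "a \<in> set (concat cs)" "distinct (concat cs)"
  obtains i p q where "i < length cs" "\<And>v. words (L(a := v)) cs = (words L cs)[i := p @ v @ q]"
proof -
  obtain c where c: "c \<in> set cs" "a \<in> set c" using assms(1) by auto
  obtain cs1 cs2 where cs: "cs = cs1 @ c # cs2" using split_list[OF c(1)] by auto
  obtain c1 c2 where c12: "c = c1 @ a # c2" using split_list[OF c(2)] by auto
  have na: "a \<notin> set c1" "a \<notin> set c2" "a \<notin> set (concat cs1)" "a \<notin> set (concat cs2)"
    using assms(2) unfolding cs c12 by auto
  have out: "words (L(a := v)) cs1 = words L cs1" "words (L(a := v)) cs2 = words L cs2" for v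
    using na by (auto intro!: words_cong)
  have inn: "concat (map (L(a := v)) (rev c1)) = concat (map L (rev c1))"
    "concat (map (L(a := v)) (rev c2)) = concat (map L (rev c2))" for v
    using na by (auto intro!: arg_cong[where f=concat])
  have "words (L(a := v)) cs = (words L cs)[length cs1 := concat (map L (rev c2)) @ v @ concat (map L (rev c1))]" for v
  proof -
    have "words (L(a := v)) cs = words (L(a := v)) cs1 @ (concat (map (L(a := v)) (rev c2)) @ v @ concat (map (L(a := v)) (rev c1))) # words (L(a := v)) cs2"
      by (simp add: cs words_def c12)
    then have "words (L(a := v)) cs = words L cs1 @ (concat (map L (rev c2)) @ v @ concat (map L (rev c1))) # words L cs2"
      by (simp only: out inn)
    then show ?thesis by (simp add: cs words_def list_update_append)
  qed
  from that[OF _ this] show ?thesis by (simp add: cs)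
qed

lemma words_span:
  assumes a: "a \<in> set (concat cs)" "distinct (concat cs)" and cl: "length cl = length cs"
    and h: "span_eq (adjoin_rels m one w C) x y"
  shows "span_eq (tensor_rels (adjoin_rels m one w C) cl)
    (pm_push (\<lambda>v. words (L(a := v)) cs) x) (pm_push (\<lambda>v. words (L(a := v)) cs) y)"
proof -
  obtain i p q where i: "i < length cs" and e: "\<And>v. words (L(a := v)) cs = (words L cs)[i := p @ v @ q]"
    using words_slot[OF a] by blast
  have "span_eq (tensor_rels (adjoin_rels m one w C) cl)
    (pm_push (\<lambda>v. (words L cs)[i := v]) (pm_push (\<lambda>v. p @ v @ q) x))
    (pm_push (\<lambda>v. (words L cs)[i := v]) (pm_push (\<lambda>v. p @ v @ q) y))"
    by (rule tensor_slot, rule span_eq_mono[OF adj_context[OF h]]) (use i cl in auto)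
  then show ?thesis unfolding e pm_push_comp .
qed

definition gw :: "('b \<Rightarrow> 'l list) \<Rightarrow> 'b list list \<Rightarrow> ('l list list \<Rightarrow>\<^sub>0 'k::field)" where
  "gw L cs = gen (words L cs)"

lemma gw_sum1:
  fixes c :: "'x \<Rightarrow> 'k::field"
  assumes a: "a \<in> set (concat cs)" "distinct (concat cs)" and cl: "length cl = length cs"
    and h: "span_eq (adjoin_rels m one w C) (\<Sum>i\<in>I. pm_scale (c i) (gen (v i))) (\<Sum>j\<in>J. pm_scale (c' j) (gen (v' j)))"
  shows "span_eq (tensor_rels (adjoin_rels m one w C) cl)
    (\<Sum>i\<in>I. pm_scale (c i) (gw (L(a := v i)) cs)) (\<Sum>j\<in>J. pm_scale (c' j) (gw (L(a := v' j)) cs))"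
  using words_span[OF a cl h, of L] by (simp add: pm_push_sum pm_push_scale gw_def)

lemma gw_expand2:
  fixes x y :: "'k::field ^ 'm::finite"
  assumes a: "a \<in> set (concat cs)" "b \<in> set (concat cs)" "a \<noteq> b" "distinct (concat cs)" and cl: "length cl = length cs"
  shows "span_eq (tensor_rels (adjoin_rels m one w C) cl)
    (gw (L(a := [Coeff x], b := [Coeff y])) cs)
    (\<Sum>p\<in>UNIV. \<Sum>q\<in>UNIV. pm_scale (tens x y $ (p, q)) (gw (L(a := [Coeff (axis p 1)], b := [Coeff (axis q 1)])) cs))"
proof -
  let ?eq = "span_eq (tensor_rels (adjoin_rels m one w C) cl)"
  have e1: "span_eq (adjoin_rels m one w C) (\<Sum>i\<in>{()}. pm_scale 1 (gen [Coeff x])) (\<Sum>p\<in>UNIV. pm_scale (x $ p) (gen [Coeff (axis p 1)]))" for x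
    using adj_expand[of m one w C x] by simp
  have s: "L(a := u, b := v) = L(b := v, a := u)" for u v using a(3) by (rule fun_upd_twist)
  have "?eq (gw (L(a := [Coeff x], b := [Coeff y])) cs) (\<Sum>p\<in>UNIV. pm_scale (x $ p) (gw (L(a := [Coeff (axis p 1)], b := [Coeff y])) cs))"
    unfolding s using gw_sum1[OF a(1,4) cl e1[of x], of "L(b := [Coeff y])"] by simp
  also have "?eq (\<Sum>p\<in>UNIV. pm_scale (x $ p) (gw (L(a := [Coeff (axis p 1)], b := [Coeff y])) cs))
     (\<Sum>p\<in>UNIV. pm_scale (x $ p) (\<Sum>q\<in>UNIV. pm_scale (y $ q) (gw (L(a := [Coeff (axis p 1)], b := [Coeff (axis q 1)])) cs)))"
    using gw_sum1[OF a(2,4) cl e1[of y]] by (intro span_eq_sum span_eq_scale) simp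
  also have "\<dots> = (\<Sum>p\<in>UNIV. \<Sum>q\<in>UNIV. pm_scale (tens x y $ (p, q)) (gw (L(a := [Coeff (axis p 1)], b := [Coeff (axis q 1)])) cs))"
    by (simp add: pm.scale_sum_right)
  finally show ?thesis .
qed

lemma gw_expand_sum:
  fixes x y :: "'x \<Rightarrow> 'k::field ^ 'm::finite"
  assumes a: "a \<in> set (concat cs)" "b \<in> set (concat cs)" "a \<noteq> b" "distinct (concat cs)" and cl: "length cl = length cs"
  shows "span_eq (tensor_rels (adjoin_rels m one w C) cl)
    (\<Sum>i\<in>I. pm_scale (c i) (gw (L(a := [Coeff (x i)], b := [Coeff (y i)])) cs))
    (\<Sum>p\<in>UNIV. \<Sum>q\<in>UNIV. pm_scale ((\<Sum>i\<in>I. c i *s tens (x i) (y i)) $ (p, q)) (gw (L(a := [Coeff (axis p 1)], b := [Coeff (axis q 1)])) cs))"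
proof -
  let ?eq = "span_eq (tensor_rels (adjoin_rels m one w C) cl)"
  let ?B = "\<lambda>p q. gw (L(a := [Coeff (axis p 1)], b := [Coeff (axis q 1)])) cs"
  have "?eq (\<Sum>i\<in>I. pm_scale (c i) (gw (L(a := [Coeff (x i)], b := [Coeff (y i)])) cs))
    (\<Sum>i\<in>I. pm_scale (c i) (\<Sum>p\<in>UNIV. \<Sum>q\<in>UNIV. pm_scale (tens (x i) (y i) $ (p, q)) (?B p q)))"
    by (intro span_eq_sum span_eq_scale gw_expand2 a cl)
  also have "\<dots> = (\<Sum>p\<in>UNIV. \<Sum>q\<in>UNIV. \<Sum>i\<in>I. pm_scale (c i * tens (x i) (y i) $ (p, q)) (?B p q))"
    by (simp only: pm.scale_sum_right pm.scale_scale) (subst sum.swap, rule sum.cong[OF refl], rule sum.swap)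
  also have "\<dots> = (\<Sum>p\<in>UNIV. \<Sum>q\<in>UNIV. pm_scale ((\<Sum>i\<in>I. c i *s tens (x i) (y i)) $ (p, q)) (?B p q))"
    by (simp add: pm.scale_sum_left)
  finally show ?thesis .
qed

text \<open>An identity in the tensor square may be used at two arcs wherever they lie: expanded in
  basis vectors, both sums have the coefficients of the same tensor. This covers self-crossings as
  well as crossings of two components.\<close>

lemma gw_sum2:
  fixes x y :: "'x \<Rightarrow> 'k::field ^ 'm::finite" and x' y' :: "'y \<Rightarrow> 'k ^ 'm"
  assumes a: "a \<in> set (concat cs)" "b \<in> set (concat cs)" "a \<noteq> b" "distinct (concat cs)" and cl: "length cl = length cs"
    and h: "(\<Sum>i\<in>I. c i *s tens (x i) (y i)) = (\<Sum>j\<in>J. c' j *s tens (x' j) (y' j))"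
  shows "span_eq (tensor_rels (adjoin_rels m one w C) cl)
    (\<Sum>i\<in>I. pm_scale (c i) (gw (L(a := [Coeff (x i)], b := [Coeff (y i)])) cs))
    (\<Sum>j\<in>J. pm_scale (c' j) (gw (L(a := [Coeff (x' j)], b := [Coeff (y' j)])) cs))"
  by (rule span_eq_trans[OF gw_expand_sum[OF a cl]], unfold h, rule span_eq_sym[OF gw_expand_sum[OF a cl]])

lemma sum_PiE_insert:
  assumes "s \<notin> S"
  shows "(\<Sum>\<sigma>\<in>Pi\<^sub>E (insert s S) X. f \<sigma>) = (\<Sum>i\<in>X s. \<Sum>\<sigma>\<in>Pi\<^sub>E S X. f (\<sigma>(s := i)))"
proof -
  have inj: "inj_on (\<lambda>(y, g). g(s := y)) (X s \<times> Pi\<^sub>E S X)"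
    by (rule inj_combinator[OF assms])
  show ?thesis
    by (subst PiE_insert_eq, subst sum.reindex[OF inj]) (simp add: sum.cartesian_product split_def)
qed

text \<open>\<open>key a\<close> is the site whose state governs the label of the arc \<open>a\<close>.\<close>

definition site_label :: "('b \<Rightarrow> 's option) \<Rightarrow> ('x \<Rightarrow> 'b \<Rightarrow> 'l list) \<Rightarrow> 's set \<Rightarrow> ('b \<Rightarrow> 'l list) \<Rightarrow> ('s \<Rightarrow> 'x) \<Rightarrow> 'b \<Rightarrow> 'l list" where
  "site_label key L S L0 \<sigma> = (\<lambda>a. case key a of Some s \<Rightarrow> if s \<in> S then L (\<sigma> s) a else L0 a | None \<Rightarrow> L0 a)"

lemma site_label_insert1:
  "s \<notin> S \<Longrightarrow> site_label key L (insert s S) L0 (\<sigma>(s := i)) = site_label key L S (\<lambda>a. if key a = Some s then L i a else L0 a) \<sigma>"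
  by (auto simp: site_label_def fun_eq_iff split: option.split)

lemma site_label_insert2:
  "s \<notin> S \<Longrightarrow> site_label key L (insert s S) L0 (\<sigma>(s := i)) = (\<lambda>a. if key a = Some s then L i a else site_label key L S L0 \<sigma> a)"
  by (auto simp: site_label_def fun_eq_iff split: option.split)

lemma site_label_outside:
  "s \<notin> S \<Longrightarrow> site_label key L S (\<lambda>a. if key a = Some s then M a else L0 a) \<sigma> = (\<lambda>a. if key a = Some s then M a else site_label key L S L0 \<sigma> a)"
  by (auto simp: site_label_def fun_eq_iff split: option.split)

lemma prod_update:
  "finite S \<Longrightarrow> s \<notin> S \<Longrightarrow> (\<Prod>t\<in>insert s S. k t ((\<sigma>(s := i)) t)) = k s i * (\<Prod>t\<in>S. k t (\<sigma> t))"
proof -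
  assume h: "finite S" "s \<notin> S"
  have "(\<Prod>t\<in>S. k t ((\<sigma>(s := i)) t)) = (\<Prod>t\<in>S. k t (\<sigma> t))" by (rule prod.cong) (use h in auto)
  then show ?thesis using h by simp
qed

text \<open>Sites are treated one after the other. The local congruence is required for every
  background \<open>L0\<close>, because the labels at the other sites, in whichever state, form the
  background for \<open>s\<close>. The state sets \<open>X\<close> and \<open>Y\<close> may differ,
  which permits summing out a site.\<close>

lemma state_sum_cong:
  fixes k1 :: "'s \<Rightarrow> 'x \<Rightarrow> 'k::field" and key :: "'b \<Rightarrow> 's option"
  assumes "finite S"
    and loc: "\<And>s L0. s \<in> S \<Longrightarrow> span_eq T
      (\<Sum>i\<in>X s. pm_scale (k1 s i) (gw (\<lambda>a. if key a = Some s then L1 i a else L0 a) cs))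
      (\<Sum>j\<in>Y s. pm_scale (k2 s j) (gw (\<lambda>a. if key a = Some s then L2 j a else L0 a) cs))"
  shows "span_eq T
    (\<Sum>\<sigma>\<in>Pi\<^sub>E S X. pm_scale (\<Prod>s\<in>S. k1 s (\<sigma> s)) (gw (site_label key L1 S L0 \<sigma>) cs))
    (\<Sum>\<sigma>\<in>Pi\<^sub>E S Y. pm_scale (\<Prod>s\<in>S. k2 s (\<sigma> s)) (gw (site_label key L2 S L0 \<sigma>) cs))"
  using assms
proof (induction S arbitrary: L0 rule: finite_induct)
  case empty
  then show ?case by (simp add: site_label_def cong: option.case_cong)
next
  case (insert s S)
  note P = prod_update[OF insert(1,2)]
  have "(\<Sum>\<sigma>\<in>Pi\<^sub>E (insert s S) X. pm_scale (\<Prod>s\<in>insert s S. k1 s (\<sigma> s)) (gw (site_label key L1 (insert s S) L0 \<sigma>) cs))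
    = (\<Sum>i\<in>X s. pm_scale (k1 s i) (\<Sum>\<sigma>\<in>Pi\<^sub>E S X. pm_scale (\<Prod>s\<in>S. k1 s (\<sigma> s)) (gw (site_label key L1 S (\<lambda>a. if key a = Some s then L1 i a else L0 a) \<sigma>) cs)))"
    unfolding sum_PiE_insert[OF insert(2)] P site_label_insert1[OF insert(2)] pm.scale_scale[symmetric] pm.scale_sum_right ..
  also have "span_eq T \<dots>
    (\<Sum>i\<in>X s. pm_scale (k1 s i) (\<Sum>\<sigma>\<in>Pi\<^sub>E S Y. pm_scale (\<Prod>s\<in>S. k2 s (\<sigma> s)) (gw (site_label key L2 S (\<lambda>a. if key a = Some s then L1 i a else L0 a) \<sigma>) cs)))"
    by (rule span_eq_sum, rule span_eq_scale, rule insert.IH, rule insert.prems, rule insertI2)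
  also have "\<dots> = (\<Sum>\<sigma>\<in>Pi\<^sub>E S Y. pm_scale (\<Prod>s\<in>S. k2 s (\<sigma> s)) (\<Sum>i\<in>X s. pm_scale (k1 s i) (gw (\<lambda>a. if key a = Some s then L1 i a else site_label key L2 S L0 \<sigma> a) cs)))"
    unfolding site_label_outside[OF insert(2)] pm.scale_sum_right pm.scale_scale by (subst sum.swap) (simp only: mult.commute)
  also have "span_eq T \<dots> (\<Sum>\<sigma>\<in>Pi\<^sub>E S Y. pm_scale (\<Prod>s\<in>S. k2 s (\<sigma> s)) (\<Sum>i\<in>Y s. pm_scale (k2 s i) (gw (\<lambda>a. if key a = Some s then L2 i a else site_label key L2 S L0 \<sigma> a) cs)))"
    by (rule span_eq_sum, rule span_eq_scale, rule insert.prems, rule insertI1)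
  also have "\<dots> = (\<Sum>\<sigma>\<in>Pi\<^sub>E (insert s S) Y. pm_scale (\<Prod>s\<in>insert s S. k2 s (\<sigma> s)) (gw (site_label key L2 (insert s S) L0 \<sigma>) cs))"
    unfolding sum_PiE_insert[OF insert(2)] P site_label_insert2[OF insert(2)] pm.scale_sum_right pm.scale_scale by (subst sum.swap) (simp only: mult.commute)
  finally show ?case .
qed

section \<open>Arcs and components of diagrams\<close>

abbreviation bottoms :: "'c piece list \<Rightarrow> (dir \<times> 'c) list" where
  "bottoms rw \<equiv> concat (map piece_bottom rw)"
abbreviation tops :: "'c piece list \<Rightarrow> (dir \<times> 'c) list" where
  "tops rw \<equiv> concat (map piece_top rw)"
abbreviation nbot :: "'c piece list \<Rightarrow> nat" where
  "nbot rw \<equiv> length (bottoms rw)"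
abbreviation ntop :: "'c piece list \<Rightarrow> nat" where
  "ntop rw \<equiv> length (tops rw)"

lemma row_arcs_append:
  "row_arcs h b t (xs @ ys) = row_arcs h b t xs \<union> row_arcs h (b + nbot xs) (t + ntop xs) ys"
  by (induction xs arbitrary: b t) (auto simp: add.assoc)

lemma ex_less_2: "(\<exists>i<Suc (Suc 0). P i) \<longleftrightarrow> P 0 \<or> P (Suc 0)"
  by (auto simp: less_Suc_eq)

text \<open>The direction stored with an endpoint decides its role: an upward strand has its tail at
  a bottom point, a downward one at a top point. Here lies the reason that two rows cannot both have
  a tail at a common point.\<close>

lemma piece_arcs_tail:
  assumes "a \<in> piece_arcs h b t p"
  shows "(\<exists>i<length (piece_bottom p). tail a = (h, b + i) \<and> fst (piece_bottom p ! i) = Up) \<or>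
    (\<exists>i<length (piece_top p). tail a = (Suc h, t + i) \<and> fst (piece_top p ! i) = Down)"
  using assms
proof (cases p)
  case (Vert d c)
  then show ?thesis using assms by (cases d) (auto simp: directed_arc_def)
next
  case (Cross x du cu "do" co)
  then show ?thesis using assms
    by (cases x; cases du; cases "do"; auto simp: directed_arc_def ex_less_2)
next
  case (Maximum e c)
  then show ?thesis using assms by (cases e; auto simp: directed_arc_def ex_less_2)
next
  case (Minimum e c)
  then show ?thesis using assms by (cases e; auto simp: directed_arc_def ex_less_2)
qed

lemma piece_arcs_head:
  assumes "a \<in> piece_arcs h b t p"
  shows "(\<exists>i<length (piece_bottom p). head a = (h, b + i) \<and> fst (piece_bottom p ! i) = Down) \<or>
    (\<exists>i<length (piece_top p). head a = (Suc h, t + i) \<and> fst (piece_top p ! i) = Up)"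
  using assms
proof (cases p)
  case (Vert d c)
  then show ?thesis using assms by (cases d) (auto simp: directed_arc_def)
next
  case (Cross x du cu "do" co)
  then show ?thesis using assms
    by (cases x; cases du; cases "do"; auto simp: directed_arc_def ex_less_2)
next
  case (Maximum e c)
  then show ?thesis using assms by (cases e; auto simp: directed_arc_def ex_less_2)
next
  case (Minimum e c)
  then show ?thesis using assms by (cases e; auto simp: directed_arc_def ex_less_2)
qed

lemma row_arcs_split:
  "row_arcs h b t rw = (\<Union>(pre, p)\<in>{(pre, p). \<exists>post. rw = pre @ p # post}. piece_arcs h (b + nbot pre) (t + ntop pre) p)"
proof (induction rw arbitrary: b t)
  case (Cons q rw)
  have s: "{(pre, p). \<exists>post. q # rw = pre @ p # post} = insert ([], q) ((\<lambda>(pre, p). (q # pre, p)) ` {(pre, p). \<exists>post. rw = pre @ p # post})"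
    by (auto simp: Cons_eq_append_conv image_iff)
  show ?case unfolding s by (simp add: Cons split_def add.assoc)
qed simp

lemma row_arcs_tail:
  assumes "a \<in> row_arcs h b t rw"
  shows "(\<exists>i<nbot rw. tail a = (h, b + i) \<and> fst (bottoms rw ! i) = Up) \<or>
    (\<exists>i<ntop rw. tail a = (Suc h, t + i) \<and> fst (tops rw ! i) = Down)"
proof -
  obtain pre p post where r: "rw = pre @ p # post" and a: "a \<in> piece_arcs h (b + nbot pre) (t + ntop pre) p"
    using assms unfolding row_arcs_split by blast
  from piece_arcs_tail[OF a] show ?thesis
  proof (elim disjE exE conjE)
    fix i assume i: "i < length (piece_bottom p)" "tail a = (h, b + nbot pre + i)" "fst (piece_bottom p ! i) = Up"
    show ?thesis by (rule disjI1, rule exI[of _ "nbot pre + i"]) (use i in \<open>simp add: r nth_append\<close>)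
  next
    fix i assume i: "i < length (piece_top p)" "tail a = (Suc h, t + ntop pre + i)" "fst (piece_top p ! i) = Down"
    show ?thesis by (rule disjI2, rule exI[of _ "ntop pre + i"]) (use i in \<open>simp add: r nth_append\<close>)
  qed
qed

lemma row_arcs_head:
  assumes "a \<in> row_arcs h b t rw"
  shows "(\<exists>i<nbot rw. head a = (h, b + i) \<and> fst (bottoms rw ! i) = Down) \<or>
    (\<exists>i<ntop rw. head a = (Suc h, t + i) \<and> fst (tops rw ! i) = Up)"
proof -
  obtain pre p post where r: "rw = pre @ p # post" and a: "a \<in> piece_arcs h (b + nbot pre) (t + ntop pre) p"
    using assms unfolding row_arcs_split by blast
  from piece_arcs_head[OF a] show ?thesis
  proof (elim disjE exE conjE)
    fix i assume i: "i < length (piece_bottom p)" "head a = (h, b + nbot pre + i)" "fst (piece_bottom p ! i) = Down"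
    show ?thesis by (rule disjI1, rule exI[of _ "nbot pre + i"]) (use i in \<open>simp add: r nth_append\<close>)
  next
    fix i assume i: "i < length (piece_top p)" "head a = (Suc h, t + ntop pre + i)" "fst (piece_top p ! i) = Up"
    show ?thesis by (rule disjI2, rule exI[of _ "ntop pre + i"]) (use i in \<open>simp add: r nth_append\<close>)
  qed
qed

lemma site_piece_arcs: "a \<in> piece_arcs h b t p \<Longrightarrow> site a = (h, b) \<and> part a = p"
  by (cases "(h, b, t, p)" rule: piece_arcs.cases) (auto simp: directed_arc_def)

lemma site_row_arcs: "a \<in> row_arcs h b t rw \<Longrightarrow> fst (site a) = h \<and> part a \<in> set rw"
  unfolding row_arcs_split by (auto dest!: site_piece_arcs)

text \<open>Arcs are told apart by their tails, whose positions lie in disjoint ranges.\<close>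

lemma row_arcs_disjoint: "row_arcs h b t xs \<inter> row_arcs h (b + nbot xs) (t + ntop xs) ys = {}"
proof -
  have "False" if "a \<in> row_arcs h b t xs" "a \<in> row_arcs h (b + nbot xs) (t + ntop xs) ys" for a
    using row_arcs_tail[OF that(1)] row_arcs_tail[OF that(2)] by auto
  then show ?thesis by blast
qed

text \<open>The placement \<open>(h, pre, p)\<close> is the piece \<open>p\<close> that follows the pieces \<open>pre\<close> in the row \<open>h\<close>.\<close>

definition placed :: "'c diagram \<Rightarrow> (nat \<times> 'c piece list \<times> 'c piece) set" where
  "placed D = {(h, pre, p). h < length D \<and> (\<exists>post. D ! h = pre @ p # post)}"

lemma arcs_placed: "arcs D = (\<Union>(h, pre, p)\<in>placed D. piece_arcs h (nbot pre) (ntop pre) p)"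
  unfolding arcs_def row_arcs_split placed_def by fastforce

lemma arcs_rowE:
  assumes "a \<in> arcs D"
  obtains h where "h < length D" "a \<in> row_arcs h 0 0 (D ! h)"
  using assms unfolding arcs_def by blast

lemma split_cases:
  assumes "rw = pre @ p # post" "rw = pre' @ p' # post'"
  obtains "pre = pre'" "p = p'" | mid where "pre' = pre @ p # mid" | mid where "pre = pre' @ p' # mid"
proof -
  have "pre @ p # post = pre' @ p' # post'" using assms by simp
  then consider us where "pre @ us = pre'" "p # post = us @ p' # post'" | us where "pre = pre' @ us" "us @ p # post = p' # post'"
    unfolding append_eq_append_conv2 by blast
  then show ?thesis
  proof cases
    case 1
    show ?thesis
    proof (cases us)
      case Nil
      then show ?thesis using 1 that(1) by simp
    next
      case (Cons q mid)
      then show ?thesis using 1 that(2)[of mid] by simp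
    qed
  next
    case 2
    show ?thesis
    proof (cases us)
      case Nil
      then show ?thesis using 2 that(1) by simp
    next
      case (Cons q mid)
      then show ?thesis using 2 that(3)[of mid] by simp
    qed
  qed
qed

lemma piece_arcs_unique_tail:
  assumes "a \<in> piece_arcs h b t p" "a' \<in> piece_arcs h b t p" "tail a = tail a'"
  shows "a = a'"
  using assms
proof (cases p)
  case (Cross x du cu "do" co)
  then show ?thesis using assms
    by (cases x; cases du; cases "do"; auto simp: directed_arc_def)
qed auto

lemma row_arcs_unique_tail:
  assumes "a \<in> row_arcs h b t rw" "a' \<in> row_arcs h b t rw" "tail a = tail a'"
  shows "a = a'"
  using assms
proof (induction rw arbitrary: b t)
  case (Cons p rw)
  have s: "row_arcs h b t (p # rw) = row_arcs h b t [p] \<union> row_arcs h (b + nbot [p]) (t + ntop [p]) rw"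
    by simp
  have "\<not> (x \<in> row_arcs h b t [p] \<and> y \<in> row_arcs h (b + nbot [p]) (t + ntop [p]) rw)" if "tail x = tail y" for x y
    using that row_arcs_tail[of x h b t "[p]"] row_arcs_tail[of y h "b + nbot [p]" "t + ntop [p]" rw] by auto
  then show ?case using Cons piece_arcs_unique_tail[of a h b t p a'] unfolding s
    by (metis UnE row_arcs.simps sup_bot.right_neutral)
qed simp

text \<open>On a shared level the two rows list the same directions. Tails of the upper row sit
  there at upward points and tails of the lower row at downward ones, so they never
  coincide.\<close>

lemma arcs_unique_tail:
  assumes D: "is_diagram D" and a: "a \<in> arcs D" "a' \<in> arcs D" "tail a = tail a'"
  shows "a = a'"
proof -
  obtain h where h: "h < length D" "a \<in> row_arcs h 0 0 (D ! h)" using a(1) by (rule arcs_rowE)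
  obtain h' where h': "h' < length D" "a' \<in> row_arcs h' 0 0 (D ! h')" using a(2) by (rule arcs_rowE)
  have no: False if "h' = Suc h" "h' < length D" "a \<in> row_arcs h 0 0 (D ! h)" "a' \<in> row_arcs h' 0 0 (D ! h')" "tail a = tail a'" for a a' h h'
  proof -
    have "tops (D ! h) = bottoms (D ! h')" using D that unfolding is_diagram_def by simp
    then show False using row_arcs_tail[OF that(3)] row_arcs_tail[OF that(4)] that(1,5) by auto
  qed
  have "h = h' \<or> h' = Suc h \<or> h = Suc h'"
    using row_arcs_tail[OF h(2)] row_arcs_tail[OF h'(2)] a(3) by auto
  then show ?thesis using no[of h' h a a'] no[of h h' a' a] h h' a(3) row_arcs_unique_tail[OF h(2)] by metis
qed

lemma succ_path_unique:
  assumes u: "\<And>a b. a \<in> S \<Longrightarrow> b \<in> S \<Longrightarrow> tail a = tail b \<Longrightarrow> a = b"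
    and "successively (\<lambda>a b. head a = tail b) c" "successively (\<lambda>a b. head a = tail b) c'"
    and "set c \<subseteq> S" "set c' \<subseteq> S" "c \<noteq> []" "c' \<noteq> []" "tail (hd c) = tail (hd c')" "length c \<le> length c'"
  shows "\<exists>d. c' = c @ d"
  using assms(2-)
proof (induction c arbitrary: c')
  case (Cons a c)
  obtain a' d where c': "c' = a' # d" using Cons.prems by (cases c') auto
  have aa: "a = a'" using u Cons.prems c' by auto
  show ?case
  proof (cases c)
    case Nil
    then show ?thesis using aa c' by simp
  next
    case (Cons b e)
    then obtain b' e' where d: "d = b' # e'" using Cons.prems c' by (cases d) auto
    have "\<exists>f. d = c @ f"
      by (rule Cons.IH) (use Cons.prems Cons c' d aa in auto)
    then show ?thesis using c' aa by auto
  qed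
qed simp

text \<open>The shorter list is a prefix of the longer one. A proper extension leaves the end of
  \<open>c\<close>, which forces \<open>c\<close> to be closed; then the next arc repeats the first,
  against distinctness.\<close>

lemma component_unique:
  assumes u: "\<And>a b. a \<in> arcs D \<Longrightarrow> b \<in> arcs D \<Longrightarrow> tail a = tail b \<Longrightarrow> a = b"
    and c: "is_component D c" and c': "is_component D c'" and t: "tail (hd c) = tail (hd c')"
  shows "c = c'"
proof -
  have no: "c = c'" if c: "is_component D c" and c': "is_component D c'" and t: "tail (hd c) = tail (hd c')" and l: "length c \<le> length c'" for c c'
  proof -
    obtain d where d: "c' = c @ d"
      using succ_path_unique[of "arcs D" c c'] u c c' t l unfolding is_component_def by blast
    show ?thesis
    proof (cases d)
      case Nil
      then show ?thesis using d by simp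
    next
      case (Cons b e)
      have b: "b \<in> arcs D" "head (last c) = tail b"
        using c' c unfolding is_component_def d Cons by (auto simp: successively_append_iff)
      have "is_closed c" using c b unfolding is_component_def by fastforce
      then have "tail b = tail (hd c)" using b by (simp add: is_closed_def)
      then have "b = hd c" using u b c unfolding is_component_def by (meson hd_in_set subsetD)
      then show ?thesis using c' c unfolding is_component_def d Cons by auto
    qed
  qed
  show ?thesis using no[of c c'] no[of c' c] c c' t by (metis nat_le_linear)
qed

lemma diagram_component_unique:
  "is_diagram D \<Longrightarrow> is_component D c \<Longrightarrow> is_component D c' \<Longrightarrow> tail (hd c) = tail (hd c') \<Longrightarrow> c = c'"
  by (rule component_unique[of D]) (rule arcs_unique_tail)

lemma component_from_eq:
  assumes D: "is_diagram D" and c: "is_component D c" and P: "tail (hd c) = P"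
  shows "component_from D P = c"
  unfolding component_from_def
  by (rule the_equality) (use assms diagram_component_unique[OF D] in auto)

lemma closed_rotate:
  assumes c: "is_component D (p @ q)" "is_closed (p @ q)" and ne: "p \<noteq> []" "q \<noteq> []"
  shows "is_component D (q @ p)" "is_closed (q @ p)"
proof -
  show cl: "is_closed (q @ p)"
    using c ne unfolding is_component_def is_closed_def by (auto simp: successively_append_iff)
  show "is_component D (q @ p)"
    using c ne cl unfolding is_component_def by (auto simp: successively_append_iff is_closed_def)
qed

text \<open>The first arc of \<open>c'\<close> splits \<open>c\<close>. If \<open>c\<close> is
  closed, it can be rotated to start there, and uniqueness applies; if both are open, no arc can
  precede the start of \<open>c'\<close>.\<close>

lemma component_rotation:
  assumes D: "is_diagram D" and c: "is_component D c" and c': "is_component D c'" and s: "set c = set c'"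
  shows "is_closed c = is_closed c'" "c = c' \<or> (\<exists>p q. is_closed c \<and> c = p @ q \<and> c' = q @ p)"
proof -
  note u = diagram_component_unique[OF D]
  have main: "c = c' \<or> (\<exists>p q. p \<noteq> [] \<and> q \<noteq> [] \<and> c = p @ q \<and> c' = q @ p)"
    if cl: "is_closed c" and c: "is_component D c" and c': "is_component D c'" and s: "set c = set c'" for c c'
  proof -
    have "hd c' \<in> set c" using c' s unfolding is_component_def by simp
    then obtain p q' where pq: "c = p @ hd c' # q'" using split_list by metis
    show ?thesis
    proof (cases "p = []")
      case True
      then show ?thesis using u[OF c c'] pq by simp
    next
      case False
      have "is_component D ((hd c' # q') @ p)"
        by (rule closed_rotate) (use c cl pq False in auto)
      then have "(hd c' # q') @ p = c'" by (rule u) (use c' in simp_all)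
      then show ?thesis using False pq by auto
    qed
  qed
  have op: "c = c'" if cl: "\<not> is_closed c" "\<not> is_closed c'" and c: "is_component D c" and c': "is_component D c'" and s: "set c = set c'"
  proof -
    have "hd c' \<in> set c" using c' s unfolding is_component_def by simp
    then obtain p q' where pq: "c = p @ hd c' # q'" using split_list by metis
    show ?thesis
    proof (cases "p = []")
      case True
      then show ?thesis using u[OF c c'] pq by simp
    next
      case False
      have "last p \<in> arcs D" "head (last p) = tail (hd c')"
        using c False unfolding is_component_def pq by (auto simp: successively_append_iff)
      then show ?thesis using c' cl unfolding is_component_def by blast
    qed
  qed
  show "is_closed c = is_closed c'"
  proof (rule ccontr)
    assume n: "is_closed c \<noteq> is_closed c'"
    show False
    proof (cases "is_closed c")
      case True
      from main[OF True c c' s] show False using n True closed_rotate(2) c by metis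
    next
      case False
      then have "is_closed c'" using n by simp
      from main[OF this c' c s[symmetric]] show False using n False closed_rotate(2) c' \<open>is_closed c'\<close> by metis
    qed
  qed
  then show "c = c' \<or> (\<exists>p q. is_closed c \<and> c = p @ q \<and> c' = q @ p)"
    using main[OF _ c c' s] op[OF _ _ c c' s] by metis
qed

section \<open>Refinements of diagrams\<close>

definition cols :: "('b piece \<Rightarrow> 'c diagram) \<Rightarrow> nat \<Rightarrow> 'b piece list \<Rightarrow> 'c piece list" where
  "cols f k rw = concat (map (\<lambda>p. f p ! k) rw)"

lemma cols_append [simp]: "cols f k (xs @ ys) = cols f k xs @ cols f k ys" by (simp add: cols_def)
lemma cols_Cons [simp]: "cols f k (p # ys) = f p ! k @ cols f k ys" by (simp add: cols_def)
lemma cols_Nil [simp]: "cols f k [] = []" by (simp add: cols_def)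

lemma refine_Nil [simp]: "refine n f [] = []" by (simp add: refine_def)
lemma refine_Cons: "refine n f (r # D) = map (\<lambda>k. cols f k r) [0..<n] @ refine n f D"
  by (simp add: refine_def cols_def)

lemma length_refine [simp]: "length (refine n f D) = n * length D"
  by (induction D) (simp_all add: refine_Cons)

lemma refine_nth: "h < length D \<Longrightarrow> k < n \<Longrightarrow> refine n f D ! (n * h + k) = cols f k (D ! h)"
proof (induction D arbitrary: h)
  case (Cons r D)
  then show ?case
    by (cases h) (auto simp: refine_Cons nth_append)
qed simp

text \<open>The arcs that replace one placed piece. In each of the \<open>n\<close> rows the
  starting positions are those reached after the refined pieces to its left.\<close>

definition frag :: "nat \<Rightarrow> ('b piece \<Rightarrow> 'c diagram) \<Rightarrow> nat \<Rightarrow> 'b piece list \<Rightarrow> 'b piece \<Rightarrow> 'c arc set" where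
  "frag n f h pre p = (\<Union>k<n. row_arcs (n * h + k) (nbot (cols f k pre)) (ntop (cols f k pre)) (f p ! k))"

lemma row_arcs_cols:
  "row_arcs h b t (cols f k rw) = (\<Union>(pre, p)\<in>{(pre, p). \<exists>post. rw = pre @ p # post}.
     row_arcs h (b + nbot (cols f k pre)) (t + ntop (cols f k pre)) (f p ! k))"
proof (induction rw arbitrary: b t)
  case (Cons q rw)
  have s: "{(pre, p). \<exists>post. q # rw = pre @ p # post} = insert ([], q) ((\<lambda>(pre, p). (q # pre, p)) ` {(pre, p). \<exists>post. rw = pre @ p # post})"
    by (auto simp: Cons_eq_append_conv image_iff)
  show ?case unfolding s by (simp add: Cons row_arcs_append split_def add.assoc)
qed simp

lemma div_mod_lt: "k < n \<Longrightarrow> (n * h + k) div n = h \<and> (n * h + k) mod n = (k::nat)"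
  by simp

lemma refine_index:
  assumes "j < n * m" shows "\<exists>h k. h < m \<and> k < n \<and> j = n * h + (k::nat)"
proof -
  have "n > 0" using assms by (cases n) auto
  then have "j div n < m" "j mod n < n" "j = n * (j div n) + j mod n"
    using assms by (auto simp: div_less_iff_less_mult mult.commute)
  then show ?thesis by blast
qed

lemma arcs_refine: "arcs (refine n f D) = (\<Union>(h, pre, p)\<in>placed D. frag n f h pre p)"
proof -
  have "arcs (refine n f D) = (\<Union>h<length D. \<Union>k<n. row_arcs (n * h + k) 0 0 (cols f k (D ! h)))"
  proof (rule set_eqI)
    fix a
    have "a \<in> arcs (refine n f D) \<longleftrightarrow> (\<exists>j<n * length D. a \<in> row_arcs j 0 0 (refine n f D ! j))"
      by (auto simp: arcs_def)
    also have "\<dots> \<longleftrightarrow> (\<exists>h<length D. \<exists>k<n. a \<in> row_arcs (n * h + k) 0 0 (refine n f D ! (n * h + k)))"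
    proof
      assume "\<exists>j<n * length D. a \<in> row_arcs j 0 0 (refine n f D ! j)"
      then obtain j where j: "j < n * length D" "a \<in> row_arcs j 0 0 (refine n f D ! j)" by blast
      obtain h k where "h < length D" "k < n" "j = n * h + k" using refine_index[OF j(1)] by blast
      then show "\<exists>h<length D. \<exists>k<n. a \<in> row_arcs (n * h + k) 0 0 (refine n f D ! (n * h + k))" using j(2) by blast
    next
      assume "\<exists>h<length D. \<exists>k<n. a \<in> row_arcs (n * h + k) 0 0 (refine n f D ! (n * h + k))"
      then obtain h k where hk: "h < length D" "k < n" "a \<in> row_arcs (n * h + k) 0 0 (refine n f D ! (n * h + k))" by blast
      have "n * h + k < n * Suc h" using hk by simp
      also have "\<dots> \<le> n * length D" by (rule mult_le_mono2) (use hk in simp)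
      finally show "\<exists>j<n * length D. a \<in> row_arcs j 0 0 (refine n f D ! j)" using hk(3) by blast
    qed
    also have "\<dots> \<longleftrightarrow> a \<in> (\<Union>h<length D. \<Union>k<n. row_arcs (n * h + k) 0 0 (cols f k (D ! h)))"
      by (force simp: refine_nth)
    finally show "a \<in> arcs (refine n f D) \<longleftrightarrow> a \<in> (\<Union>h<length D. \<Union>k<n. row_arcs (n * h + k) 0 0 (cols f k (D ! h)))" .
  qed
  also have "\<dots> = (\<Union>(h, pre, p)\<in>placed D. frag n f h pre p)"
    unfolding row_arcs_cols frag_def placed_def by fastforce
  finally show ?thesis .
qed

text \<open>The row index determines \<open>h\<close> and \<open>k\<close> by division with
  remainder, and within a row the fragments of different pieces have disjoint sets of arcs.\<close>

lemma frag_disjoint: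
  assumes x: "(h, pre, p) \<in> placed D" "(h', pre', p') \<in> placed D"
    and a: "a \<in> frag n f h pre p" "a \<in> frag n f h' pre' p'"
  shows "(h, pre, p) = (h', pre', p')"
proof -
  obtain k where k: "k < n" "a \<in> row_arcs (n * h + k) (nbot (cols f k pre)) (ntop (cols f k pre)) (f p ! k)"
    using a(1) unfolding frag_def by blast
  obtain k' where k': "k' < n" "a \<in> row_arcs (n * h' + k') (nbot (cols f k' pre')) (ntop (cols f k' pre')) (f p' ! k')"
    using a(2) unfolding frag_def by blast
  have "n * h + k = n * h' + k'" using site_row_arcs[OF k(2)] site_row_arcs[OF k'(2)] by simp
  then have e: "h = h'" "k = k'" using div_mod_lt[OF k(1), of h] div_mod_lt[OF k'(1), of h'] by metis+
  have no: False if "pre' = pre @ p # mid"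
    "a \<in> row_arcs (n * h + k) (nbot (cols f k pre)) (ntop (cols f k pre)) (f p ! k)"
    "a \<in> row_arcs (n * h + k) (nbot (cols f k pre')) (ntop (cols f k pre')) (f p' ! k)" for pre pre' p p' mid
  proof -
    have "a \<in> row_arcs (n * h + k) (nbot (cols f k pre) + nbot (f p ! k)) (ntop (cols f k pre) + ntop (f p ! k)) (cols f k mid @ f p' ! k)"
      using that(3) unfolding that(1) row_arcs_append by (simp add: add.assoc)
    then show False using that(2) row_arcs_disjoint by blast
  qed
  obtain post post' where "D ! h = pre @ p # post" "D ! h = pre' @ p' # post'"
    using x e unfolding placed_def by auto
  then show ?thesis
    by (rule split_cases) (use no k(2) k'(2) e in blast)+
qed

text \<open>The refinement by one row that keeps every piece is a special case of
  \<open>frag_disjoint\<close>.\<close>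

lemma parcs_disjoint:
  assumes x: "(h, pre, p) \<in> placed D" "(h', pre', p') \<in> placed D"
    and a: "a \<in> piece_arcs h (nbot pre) (ntop pre) p" "a \<in> piece_arcs h' (nbot pre') (ntop pre') p'"
  shows "(h, pre, p) = (h', pre', p')"
proof -
  have c: "cols (\<lambda>p. [[p]]) 0 rw = rw" for rw :: "'a piece list" by (induction rw) auto
  have f: "frag 1 (\<lambda>p. [[p]]) h pre p = piece_arcs h (nbot pre) (ntop pre) p" for h pre and p :: "'a piece"
    by (simp add: frag_def c lessThan_Suc)
  show ?thesis by (rule frag_disjoint[OF x, of a 1 "\<lambda>p. [[p]]"]) (use a f in auto)
qed

text \<open>\<open>ex\<close> lists the points that replace one point of a level: two copies in the
  doubled diagram, the point itself in the leftward one. The conditions make consecutive refined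
  rows fit together.\<close>

locale refinement =
  fixes n :: nat and f :: "'b piece \<Rightarrow> 'c diagram" and ex :: "dir \<times> 'b \<Rightarrow> (dir \<times> 'c) list"
  assumes n: "n > 0"
    and inner: "\<And>p k. Suc k < n \<Longrightarrow> tops (f p ! k) = bottoms (f p ! Suc k)"
    and bot: "\<And>p. bottoms (f p ! 0) = concat (map ex (piece_bottom p))"
    and top: "\<And>p. tops (f p ! (n - 1)) = concat (map ex (piece_top p))"
begin

lemma cols_inner: "Suc k < n \<Longrightarrow> tops (cols f k rw) = bottoms (cols f (Suc k) rw)"
  by (induction rw) (simp_all add: inner)
lemma cols_bot: "bottoms (cols f 0 rw) = concat (map ex (bottoms rw))"
  by (induction rw) (simp_all add: bot)
lemma cols_top: "tops (cols f (n - 1) rw) = concat (map ex (tops rw))"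
  by (induction rw) (simp_all add: top[unfolded One_nat_def])

lemma is_diagram_refine:
  assumes D: "is_diagram D" shows "is_diagram (refine n f D)"
  unfolding is_diagram_def
proof (intro allI impI)
  fix j assume j: "Suc j < length (refine n f D)"
  then have "j < n * length D" by simp
  then obtain h k where hk: "h < length D" "k < n" "j = n * h + k" using refine_index by blast
  show "tops (refine n f D ! j) = bottoms (refine n f D ! Suc j)"
  proof (cases "Suc k < n")
    case True
    have "refine n f D ! Suc j = cols f (Suc k) (D ! h)" using refine_nth[OF hk(1) True, of f] hk by simp
    then show ?thesis using hk True by (simp add: refine_nth cols_inner)
  next
    case False
    then have k: "k = n - 1" using hk by simp
    have s: "Suc j = n * Suc h + 0" using hk k n by simp
    have h: "Suc h < length D" using j n unfolding s length_refine
      by (simp only: add_0_right mult_less_cancel1)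
    have "refine n f D ! Suc j = cols f 0 (D ! Suc h)" unfolding s using refine_nth[OF h n, of f] .
    moreover have "tops (D ! h) = bottoms (D ! Suc h)" using D h unfolding is_diagram_def by simp
    moreover have "refine n f D ! j = cols f (n - 1) (D ! h)"
      using refine_nth[OF hk(1,2), of f] unfolding hk(3) k .
    ultimately show ?thesis by (simp only: cols_top cols_bot)
  qed
qed

end

text \<open>Concatenating paths preserves the chain of endpoints and distinctness. The conditions
  \<open>ends\<close> transfer maximality of open components: an arc of \<open>D'\<close> enters or
  leaves the image of a point only where some arc of \<open>D\<close> does so.\<close>

lemma component_refine:
  fixes path :: "'c arc \<Rightarrow> 'd arc list" and pt :: "point \<Rightarrow> point"
  assumes P: "\<And>a. a \<in> arcs D \<Longrightarrow> path a \<noteq> [] \<and> successively (\<lambda>a b. head a = tail b) (path a)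
        \<and> tail (hd (path a)) = pt (tail a) \<and> head (last (path a)) = pt (head a)"
    and sub: "\<And>a. a \<in> arcs D \<Longrightarrow> set (path a) \<subseteq> arcs D'"
    and dist: "\<And>a. a \<in> arcs D \<Longrightarrow> distinct (path a)"
    and disj: "\<And>a b. a \<in> arcs D \<Longrightarrow> b \<in> arcs D \<Longrightarrow> a \<noteq> b \<Longrightarrow> set (path a) \<inter> set (path b) = {}"
    and ends: "\<And>b P. b \<in> arcs D' \<Longrightarrow> head b = pt P \<Longrightarrow> \<exists>a\<in>arcs D. head a = P"
      "\<And>b P. b \<in> arcs D' \<Longrightarrow> tail b = pt P \<Longrightarrow> \<exists>a\<in>arcs D. tail a = P"
    and c: "is_component D c"
  shows "is_component D' (concat (map path c))" "tail (hd (concat (map path c))) = pt (tail (hd c))"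
proof -
  have c': "c \<noteq> []" "distinct c" "set c \<subseteq> arcs D" "successively (\<lambda>a b. head a = tail b) c"
    using c unfolding is_component_def by auto
  have ne: "concat (map path c) \<noteq> []" using c' P by (cases c) auto
  have hd: "tail (hd (concat (map path c))) = pt (tail (hd c))" using c' P by (cases c) auto
  have last: "head (last (concat (map path c))) = pt (head (last c))"
  proof -
    have c0: "c = butlast c @ [last c]" using c'(1) by simp
    have "last c \<in> arcs D" using c' by auto
    then show ?thesis using P[of "last c"] by (subst c0) simp
  qed
  have succ: "successively (\<lambda>a b. head a = tail b) (concat (map path c))"
    using c'(3,4)
  proof (induction c)
    case (Cons a c)
    show ?case
    proof (cases c)
      case Nil
      then show ?thesis using P[of a] Cons.prems by simp
    next
      case (Cons b d)
      then show ?thesis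
        using P[of a] P[of b] Cons.IH Cons.prems \<open>c = b # d\<close>
        by (simp add: successively_append_iff)
    qed
  qed simp
  have dis: "distinct (concat (map path c))"
    using c'(2,3)
  proof (induction c)
    case (Cons a c)
    have "set (path a) \<inter> set (concat (map path c)) = {}"
      using Cons.prems disj[of a] by fastforce
    then show ?case using Cons dist[of a] by simp
  qed simp
  have sb: "set (concat (map path c)) \<subseteq> arcs D'" using sub c' by fastforce
  show "tail (hd (concat (map path c))) = pt (tail (hd c))" by (rule hd)
  have "is_closed (concat (map path c)) \<or> (\<forall>a\<in>arcs D'. head a \<noteq> tail (hd (concat (map path c))) \<and> tail a \<noteq> head (last (concat (map path c))))"
  proof (cases "is_closed c")
    case True
    then show ?thesis using hd last by (simp add: is_closed_def)
  next
    case False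
    then have "\<forall>a\<in>arcs D. head a \<noteq> tail (hd c) \<and> tail a \<noteq> head (last c)" using c unfolding is_component_def by blast
    then show ?thesis unfolding hd last using ends by blast
  qed
  then show "is_component D' (concat (map path c))"
    unfolding is_component_def using ne dis sb succ by blast
qed

section \<open>The doubled diagram\<close>

definition orient :: "dir \<Rightarrow> 'c list \<Rightarrow> 'c list" where
  "orient d xs = (if d = Up then xs else rev xs)"

definition offset :: "dir \<Rightarrow> copy \<Rightarrow> nat" where
  "offset d k = (if left_copy d = k then 0 else 1)"

text \<open>The path of the copy \<open>k\<close> of the arc (over-strand if \<open>ov\<close>) of the piece \<open>p\<close> through the three rows of
  \<open>double_piece p\<close>; the four levels start at the positions \<open>2b\<close>, \<open>r\<close>, \<open>s\<close> and \<open>2t\<close>.\<close>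

fun zpath :: "nat \<Rightarrow> nat \<Rightarrow> nat \<Rightarrow> nat \<Rightarrow> nat \<Rightarrow> unit piece \<Rightarrow> bool \<Rightarrow> copy \<Rightarrow> copy arc list" where
  "zpath h b t r s (Vert d _) ov k = (let i = offset d k; q = Vert d k in orient d
     [directed_arc d (3*h, 2*b+i) (3*h+1, r+i) (3*h, 2*b+i) q False,
      directed_arc d (3*h+1, r+i) (3*h+2, s+i) (3*h+1, r+i) q False,
      directed_arc d (3*h+2, s+i) (3*h+3, 2*t+i) (3*h+2, s+i) q False])"
| "zpath h b t r s (Cross XPlus du _ do _) False k = orient du (if left_copy du = k then
     [directed_arc du (3*h, 2*b+2) (3*h+1, r+1) (3*h, 2*b+1) (Cross XPlus du k do (right_copy do)) False,
      directed_arc du (3*h+1, r+1) (3*h+2, s) (3*h+1, r) (Cross XPlus du k do (left_copy do)) False,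
      directed_arc du (3*h+2, s) (3*h+3, 2*t) (3*h+2, s) (Vert du k) False] else
     [directed_arc du (3*h, 2*b+3) (3*h+1, r+3) (3*h, 2*b+3) (Vert du k) False,
      directed_arc du (3*h+1, r+3) (3*h+2, s+2) (3*h+1, r+2) (Cross XPlus du k do (right_copy do)) False,
      directed_arc du (3*h+2, s+2) (3*h+3, 2*t+1) (3*h+2, s+1) (Cross XPlus du k do (left_copy do)) False])"
| "zpath h b t r s (Cross XPlus du _ do _) True k = orient do (if left_copy do = k then
     [directed_arc do (3*h, 2*b) (3*h+1, r) (3*h, 2*b) (Vert do k) False,
      directed_arc do (3*h+1, r) (3*h+2, s+1) (3*h+1, r) (Cross XPlus du (left_copy du) do k) True,
      directed_arc do (3*h+2, s+1) (3*h+3, 2*t+2) (3*h+2, s+1) (Cross XPlus du (right_copy du) do k) True] else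
     [directed_arc do (3*h, 2*b+1) (3*h+1, r+2) (3*h, 2*b+1) (Cross XPlus du (left_copy du) do k) True,
      directed_arc do (3*h+1, r+2) (3*h+2, s+3) (3*h+1, r+2) (Cross XPlus du (right_copy du) do k) True,
      directed_arc do (3*h+2, s+3) (3*h+3, 2*t+3) (3*h+2, s+3) (Vert do k) False])"
| "zpath h b t r s (Cross XMinus du _ do _) False k = orient du (if left_copy du = k then
     [directed_arc du (3*h, 2*b) (3*h+1, r) (3*h, 2*b) (Vert du k) False,
      directed_arc du (3*h+1, r) (3*h+2, s+1) (3*h+1, r) (Cross XMinus du k do (left_copy do)) False,
      directed_arc du (3*h+2, s+1) (3*h+3, 2*t+2) (3*h+2, s+1) (Cross XMinus du k do (right_copy do)) False] else
     [directed_arc du (3*h, 2*b+1) (3*h+1, r+2) (3*h, 2*b+1) (Cross XMinus du k do (left_copy do)) False,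
      directed_arc du (3*h+1, r+2) (3*h+2, s+3) (3*h+1, r+2) (Cross XMinus du k do (right_copy do)) False,
      directed_arc du (3*h+2, s+3) (3*h+3, 2*t+3) (3*h+2, s+3) (Vert du k) False])"
| "zpath h b t r s (Cross XMinus du _ do _) True k = orient do (if left_copy do = k then
     [directed_arc do (3*h, 2*b+2) (3*h+1, r+1) (3*h, 2*b+1) (Cross XMinus du (right_copy du) do k) True,
      directed_arc do (3*h+1, r+1) (3*h+2, s) (3*h+1, r) (Cross XMinus du (left_copy du) do k) True,
      directed_arc do (3*h+2, s) (3*h+3, 2*t) (3*h+2, s) (Vert do k) False] else
     [directed_arc do (3*h, 2*b+3) (3*h+1, r+3) (3*h, 2*b+3) (Vert do k) False,
      directed_arc do (3*h+1, r+3) (3*h+2, s+2) (3*h+1, r+2) (Cross XMinus du (right_copy du) do k) True,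
      directed_arc do (3*h+2, s+2) (3*h+3, 2*t+1) (3*h+2, s+1) (Cross XMinus du (left_copy du) do k) True])"
| "zpath h b t r s (Maximum e _) ov k = (let d = max_left e in if left_copy d = k then orient d
     [directed_arc d (3*h, 2*b) (3*h+1, r) (3*h, 2*b) (Vert d k) False,
      directed_arc d (3*h+1, r) (3*h+1, r+1) (3*h+1, r) (Maximum e k) False,
      directed_arc (flip d) (3*h, 2*b+3) (3*h+1, r+1) (3*h, 2*b+3) (Vert (flip d) k) False]
     else [directed_arc d (3*h, 2*b+1) (3*h, 2*b+2) (3*h, 2*b+1) (Maximum e k) False])"
| "zpath h b t r s (Minimum e _) ov k = (let d = min_left e in if left_copy d = k then orient (flip d)
     [directed_arc d (3*h+2, s) (3*h+3, 2*t) (3*h+2, s) (Vert d k) False,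
      directed_arc (flip d) (3*h+2, s) (3*h+2, s+1) (3*h+1, r) (Minimum e k) False,
      directed_arc (flip d) (3*h+2, s+1) (3*h+3, 2*t+3) (3*h+2, s+1) (Vert (flip d) k) False]
     else [directed_arc (flip d) (3*h+3, 2*t+1) (3*h+3, 2*t+2) (3*h+2, s+1) (Minimum e k) False])"

definition dfrag :: "nat \<Rightarrow> nat \<Rightarrow> nat \<Rightarrow> nat \<Rightarrow> nat \<Rightarrow> unit piece \<Rightarrow> copy arc set" where
  "dfrag h b t r s p = row_arcs (3*h) (2*b) r (double_piece p ! 0) \<union> row_arcs (3*h+1) r s (double_piece p ! 1)
     \<union> row_arcs (3*h+2) s (2*t) (double_piece p ! 2)"

lemma copy_ex: "(\<exists>k. P k) \<longleftrightarrow> P Thick \<or> P Thin" for P by (metis copy.exhaust)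

lemmas zsimps = orient_def offset_def directed_arc_def numeral_2_eq_2 numeral_3_eq_3 Let_def

lemma unit_piece_exhaust:
  fixes p :: "unit piece"
  obtains "p = Vert Up ()" | "p = Vert Down ()"
  | "p = Cross XPlus Up () Up ()" | "p = Cross XPlus Up () Down ()"
  | "p = Cross XPlus Down () Up ()" | "p = Cross XPlus Down () Down ()"
  | "p = Cross XMinus Up () Up ()" | "p = Cross XMinus Up () Down ()"
  | "p = Cross XMinus Down () Up ()" | "p = Cross XMinus Down () Down ()"
  | "p = Maximum LeftRight ()" | "p = Maximum RightLeft ()"
  | "p = Minimum LeftRight ()" | "p = Minimum RightLeft ()"
proof (cases p)
  case (Vert d c)
  then show ?thesis using that by (cases d) auto
next
  case (Cross x du cu "do" co)
  then show ?thesis using that by (cases x; cases du; cases "do") auto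
next
  case (Maximum d c)
  then show ?thesis using that by (cases d) auto
next
  case (Minimum d c)
  then show ?thesis using that by (cases d) auto
qed

text \<open>The conditionals recover the direction of the strand at an endpoint: on the lower level
  a tail belongs to an upward strand and a head to a downward one.\<close>

lemma zpath_path:
  assumes "a \<in> piece_arcs h b t p"
  shows "zpath h b t r s p (over a) k \<noteq> [] \<and>
    successively (\<lambda>a b. head a = tail b) (zpath h b t r s p (over a) k) \<and>
    tail (hd (zpath h b t r s p (over a) k)) =
      (3 * fst (tail a), 2 * snd (tail a) + offset (if fst (tail a) = h then Up else Down) k) \<and>
    head (last (zpath h b t r s p (over a) k)) =
      (3 * fst (head a), 2 * snd (head a) + offset (if fst (head a) = h then Down else Up) k) \<and>
    distinct (zpath h b t r s p (over a) k)"
  using assms by (cases p rule: unit_piece_exhaust; cases k; auto simp: zsimps)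

lemma zpath_ends_aux:
  assumes "a \<in> piece_arcs h b t p" "x \<in> set (zpath h b t r s p (over a) k)"
  shows "(fst (head x) = 3 * h \<or> fst (head x) = 3 * h + 3 \<longrightarrow> x = last (zpath h b t r s p (over a) k)) \<and>
    (fst (tail x) = 3 * h \<or> fst (tail x) = 3 * h + 3 \<longrightarrow> x = hd (zpath h b t r s p (over a) k)) \<and>
    fst (head x) \<in> {3 * h .. 3 * h + 3} \<and> fst (tail x) \<in> {3 * h .. 3 * h + 3}"
  using assms by (cases p rule: unit_piece_exhaust; cases k; auto simp: zsimps)

text \<open>The levels 3h+1 and 3h+2 are not multiples of 3, so a path touches the levels inherited
  from the original diagram only at its two ends.\<close>

lemma zpath_ends:
  assumes "a \<in> piece_arcs h b t p" "x \<in> set (zpath h b t r s p (over a) k)"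
  shows "fst (head x) = 3 * q \<Longrightarrow> x = last (zpath h b t r s p (over a) k)"
    "fst (tail x) = 3 * q \<Longrightarrow> x = hd (zpath h b t r s p (over a) k)"
proof -
  have q: "l = 3 * h \<or> l = 3 * h + 3" if "l \<in> {3 * h .. 3 * h + 3}" "l = 3 * q" for l :: nat
    using that by auto
  show "fst (head x) = 3 * q \<Longrightarrow> x = last (zpath h b t r s p (over a) k)"
    "fst (tail x) = 3 * q \<Longrightarrow> x = hd (zpath h b t r s p (over a) k)"
    using zpath_ends_aux[OF assms] q by blast+
qed

lemma UN_copy: "(\<Union>k. F k) = F Thick \<union> F Thin"
proof (rule set_eqI)
  fix x show "x \<in> (\<Union>k. F k) \<longleftrightarrow> x \<in> F Thick \<union> F Thin"
    using copy_ex[of "\<lambda>k. x \<in> F k"] by simp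
qed

lemma zpath_frag:
  "(\<Union>a\<in>piece_arcs h b t p. \<Union>k. set (zpath h b t r s p (over a) k)) = dfrag h b t r s p"
proof
  have "set (zpath h b t r s p (over a) k) \<subseteq> dfrag h b t r s p" if "a \<in> piece_arcs h b t p" for a k
    using that by (cases p rule: unit_piece_exhaust; cases k; auto simp: dfrag_def zsimps)
  then show "(\<Union>a\<in>piece_arcs h b t p. \<Union>k. set (zpath h b t r s p (over a) k)) \<subseteq> dfrag h b t r s p"
    by blast
  show "dfrag h b t r s p \<subseteq> (\<Union>a\<in>piece_arcs h b t p. \<Union>k. set (zpath h b t r s p (over a) k))"
    by (cases p rule: unit_piece_exhaust; simp add: dfrag_def UN_copy zsimps)
qed

lemma zpath_disjoint:
  assumes "a \<in> piece_arcs h b t p" "a' \<in> piece_arcs h b t p" "(a, k) \<noteq> (a', k')"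
  shows "set (zpath h b t r s p (over a) k) \<inter> set (zpath h b t r s p (over a') k') = {}"
  using assms by (cases p rule: unit_piece_exhaust; cases k; cases k'; auto simp: zsimps)

definition place :: "'c diagram \<Rightarrow> 'c arc \<Rightarrow> nat \<times> 'c piece list \<times> 'c piece" where
  "place D a = (THE x. x \<in> placed D \<and> (case x of (h, pre, p) \<Rightarrow> a \<in> piece_arcs h (nbot pre) (ntop pre) p))"

lemma place_eq:
  assumes "(h, pre, p) \<in> placed D" "a \<in> piece_arcs h (nbot pre) (ntop pre) p"
  shows "place D a = (h, pre, p)"
  unfolding place_def
proof (rule the_equality)
  fix x assume x: "x \<in> placed D \<and> (case x of (h, pre, p) \<Rightarrow> a \<in> piece_arcs h (nbot pre) (ntop pre) p)"
  obtain h' pre' p' where "x = (h', pre', p')" by (cases x)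
  then show "x = (h, pre, p)" using parcs_disjoint[OF _ assms(1) _ assms(2), of h' pre' p'] x by simp
qed (use assms in simp)

lemma arc_placeE:
  assumes "a \<in> arcs D"
  obtains h pre p where "(h, pre, p) \<in> placed D" "a \<in> piece_arcs h (nbot pre) (ntop pre) p" "place D a = (h, pre, p)"
proof -
  obtain h pre p where x: "(h, pre, p) \<in> placed D" "a \<in> piece_arcs h (nbot pre) (ntop pre) p"
    using assms unfolding arcs_placed by blast
  show ?thesis by (rule that[OF x place_eq[OF x]])
qed

lemma placed_row: "(h, pre, p) \<in> placed D \<Longrightarrow> a \<in> piece_arcs h (nbot pre) (ntop pre) p \<Longrightarrow> h < length D \<and> a \<in> row_arcs h 0 0 (D ! h)"
  unfolding placed_def row_arcs_split by fastforce

lemma level_below: "h < length D \<Longrightarrow> level D h = bottoms (D ! h)" by (simp add: level_def)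

lemma level_above:
  assumes "is_diagram D" "h < length D" shows "level D (Suc h) = tops (D ! h)"
proof (cases "Suc h < length D")
  case True
  then show ?thesis using assms unfolding level_def is_diagram_def by simp
next
  case False
  then have "last D = D ! h" using assms(2) by (metis Suc_lessI diff_Suc_1 last_conv_nth list.size(3) not_less_zero)
  then show ?thesis using False unfolding level_def by simp
qed

lemma level_tail:
  assumes D: "is_diagram D" and x: "(h, pre, p) \<in> placed D" "a \<in> piece_arcs h (nbot pre) (ntop pre) p"
  shows "fst (level D (fst (tail a)) ! snd (tail a)) = (if fst (tail a) = h then Up else Down)"
proof -
  have h: "h < length D" "a \<in> row_arcs h 0 0 (D ! h)" using placed_row[OF x] by auto
  from row_arcs_tail[OF h(2)] show ?thesis
    by (elim disjE exE conjE) (simp_all add: level_below h level_above[OF D])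
qed

lemma level_head:
  assumes D: "is_diagram D" and x: "(h, pre, p) \<in> placed D" "a \<in> piece_arcs h (nbot pre) (ntop pre) p"
  shows "fst (level D (fst (head a)) ! snd (head a)) = (if fst (head a) = h then Down else Up)"
proof -
  have h: "h < length D" "a \<in> row_arcs h 0 0 (D ! h)" using placed_row[OF x] by auto
  from row_arcs_head[OF h(2)] show ?thesis
    by (elim disjE exE conjE) (simp_all add: level_below h level_above[OF D])
qed

fun is_cross :: "'c piece \<Rightarrow> bool" where
  "is_cross (Cross x du cu do co) = True"
| "is_cross p = False"

lemma is_cross_iff: "is_cross p \<longleftrightarrow> (\<exists>x du cu do co. p = Cross x du cu do co)"
  by (cases p) auto

definition all_crossings :: "'c diagram \<Rightarrow> point set" where
  "all_crossings D = crossings D XPlus \<union> crossings D XMinus"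

lemma all_crossings_eq: "all_crossings D = {site a | a. a \<in> arcs D \<and> is_cross (part a)}"
  unfolding all_crossings_def crossings_def is_cross_iff by (auto; metis xing.exhaust)

lemma finite_arcs: "finite (arcs D)"
proof -
  have "finite (piece_arcs h b t p)" for h b t and p :: "'a piece"
    by (cases "(h, b, t, p)" rule: piece_arcs.cases) auto
  then have "finite (row_arcs h b t rw)" for h b t and rw :: "'a piece list"
    by (induction rw arbitrary: b t) auto
  then show ?thesis unfolding arcs_def by blast
qed

lemma finite_all_crossings: "finite (all_crossings D)"
  unfolding all_crossings_eq by (rule finite_subset[of _ "site ` arcs D"]) (auto simp: finite_arcs)

text \<open>A minimum has no bottom points and shares its site with a piece to its right, so a site
  need not determine a piece. Crossings have positive width at the bottom, which makes the piece
  unique among them.\<close>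

lemma cross_site_place:
  assumes x: "(h, pre, p) \<in> placed D" "(h', pre', p') \<in> placed D" and c: "is_cross p" "is_cross p'"
    and s: "(h, nbot pre) = (h', nbot pre')"
  shows "(h, pre, p) = (h', pre', p')"
proof -
  have n: "nbot [q] > 0" if "is_cross q" for q :: "'a piece" using that by (cases q rule: piece_bottom.cases) auto
  obtain post post' where "D ! h = pre @ p # post" "D ! h = pre' @ p' # post'"
    using x s unfolding placed_def by auto
  then show ?thesis
    by (rule split_cases) (use n[OF c(1)] n[OF c(2)] s in auto)
qed

lemma cross_arc_unique:
  assumes a: "a \<in> arcs D" "a' \<in> arcs D" and c: "is_cross (part a)" "is_cross (part a')"
    and s: "site a = site a'" "over a = over a'"
  shows "a = a'"
proof -
  obtain h pre p where x: "(h, pre, p) \<in> placed D" "a \<in> piece_arcs h (nbot pre) (ntop pre) p" using a(1) by (rule arc_placeE)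
  obtain h' pre' p' where x': "(h', pre', p') \<in> placed D" "a' \<in> piece_arcs h' (nbot pre') (ntop pre') p'" using a(2) by (rule arc_placeE)
  have e: "(h, pre, p) = (h', pre', p')"
    by (rule cross_site_place[OF x(1) x'(1)]) (use site_piece_arcs[OF x(2)] site_piece_arcs[OF x'(2)] c s in auto)
  have "a' \<in> piece_arcs h (nbot pre) (ntop pre) p" using x'(2) e by simp
  then show ?thesis using x(2) s(2) c(1) site_piece_arcs[OF x(2)]
    by (cases "(h, nbot pre, ntop pre, p)" rule: piece_arcs.cases) (auto simp: directed_arc_def split: if_splits)
qed

lemma cross_arcs:
  assumes "s \<in> all_crossings D"
  obtains h pre x du cu "do" co au ao where "(h, pre, Cross x du cu do co) \<in> placed D" "s = (h, nbot pre)"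
    "au \<in> piece_arcs h (nbot pre) (ntop pre) (Cross x du cu do co)" "ao \<in> piece_arcs h (nbot pre) (ntop pre) (Cross x du cu do co)"
    "\<not> over au" "over ao"
proof -
  obtain a where a: "a \<in> arcs D" "is_cross (part a)" "s = site a" using assms unfolding all_crossings_eq by blast
  obtain h pre p where x: "(h, pre, p) \<in> placed D" "a \<in> piece_arcs h (nbot pre) (ntop pre) p" using a(1) by (rule arc_placeE)
  have p: "part a = p" "s = (h, nbot pre)" using site_piece_arcs[OF x(2)] a(3) by auto
  obtain x' du cu "do" co where pe: "p = Cross x' du cu do co" using a(2) p is_cross_iff by metis
  have "\<exists>au\<in>piece_arcs h (nbot pre) (ntop pre) p. \<not> over au" "\<exists>ao\<in>piece_arcs h (nbot pre) (ntop pre) p. over ao"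
    unfolding pe by (cases x'; simp add: directed_arc_def)+
  then show ?thesis using that x(1) p(2) unfolding pe by blast
qed

section \<open>Components of the doubled diagram\<close>

interpretation zr: refinement 3 double_piece "\<lambda>(d, c). [(d, left_copy d), (d, right_copy d)]"
proof unfold_locales
  show "Suc k < 3 \<Longrightarrow> tops (double_piece p ! k) = bottoms (double_piece p ! Suc k)" for p k
    by (cases p rule: unit_piece_exhaust) (auto simp: less_Suc_eq numeral_3_eq_3 numeral_2_eq_2)
  show "bottoms (double_piece p ! 0) = concat (map (\<lambda>(d, c). [(d, left_copy d), (d, right_copy d)]) (piece_bottom p))" for p
    by (cases p rule: unit_piece_exhaust) (auto simp: numeral_3_eq_3)
  show "tops (double_piece p ! (3 - 1)) = concat (map (\<lambda>(d, c). [(d, left_copy d), (d, right_copy d)]) (piece_top p))" for p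
    by (cases p rule: unit_piece_exhaust) (auto simp: numeral_3_eq_3)
qed simp

lemma is_diagram_zeta: "is_diagram D \<Longrightarrow> is_diagram (zeta D)"
  unfolding zeta_def by (rule zr.is_diagram_refine)

lemma length_double: "length (concat (map (\<lambda>(d, c). [(d, left_copy d), (d, right_copy d)]) xs)) = 2 * length xs"
  by (induction xs) auto

abbreviation lev1 where "lev1 pre \<equiv> nbot (cols double_piece 1 pre)"
abbreviation lev2 where "lev2 pre \<equiv> nbot (cols double_piece 2 pre)"

lemma frag_zeta: "frag 3 double_piece h pre p = dfrag h (nbot pre) (ntop pre) (lev1 pre) (lev2 pre) p"
proof -
  have l: "{..<3} = {0, 1, 2::nat}" by auto
  have "nbot (cols double_piece 0 pre) = 2 * nbot pre" "ntop (cols double_piece 2 pre) = 2 * ntop pre"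
    using zr.cols_bot[of pre] zr.cols_top[of pre] by (simp_all add: length_double del: length_concat)
  moreover have "ntop (cols double_piece 0 pre) = lev1 pre" "ntop (cols double_piece 1 pre) = lev2 pre"
    using zr.cols_inner[of 0 pre] zr.cols_inner[of 1 pre] by (simp_all add: numeral_2_eq_2)
  ultimately show ?thesis unfolding frag_def dfrag_def l by (simp add: Un_assoc)
qed

definition zeta_path :: "unit diagram \<Rightarrow> copy \<Rightarrow> unit arc \<Rightarrow> copy arc list" where
  "zeta_path D k a = (case place D a of (h, pre, p) \<Rightarrow> zpath h (nbot pre) (ntop pre) (lev1 pre) (lev2 pre) p (over a) k)"

lemma zeta_path_eq:
  "(h, pre, p) \<in> placed D \<Longrightarrow> a \<in> piece_arcs h (nbot pre) (ntop pre) p \<Longrightarrow>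
    zeta_path D k a = zpath h (nbot pre) (ntop pre) (lev1 pre) (lev2 pre) p (over a) k"
  by (simp add: zeta_path_def place_eq)

lemma arcs_zeta: "arcs (zeta D) = (\<Union>(h, pre, p)\<in>placed D. dfrag h (nbot pre) (ntop pre) (lev1 pre) (lev2 pre) p)"
  unfolding zeta_def arcs_refine frag_zeta ..

lemma arcs_zetaE:
  assumes "b \<in> arcs (zeta D)"
  obtains h pre p a k where "(h, pre, p) \<in> placed D" "a \<in> piece_arcs h (nbot pre) (ntop pre) p"
    "b \<in> set (zpath h (nbot pre) (ntop pre) (lev1 pre) (lev2 pre) p (over a) k)"
  using assms unfolding arcs_zeta zpath_frag[symmetric] by blast

lemma arcs_zetaI:
  "(h, pre, p) \<in> placed D \<Longrightarrow> a \<in> piece_arcs h (nbot pre) (ntop pre) p \<Longrightarrow>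
    b \<in> set (zpath h (nbot pre) (ntop pre) (lev1 pre) (lev2 pre) p (over a) k) \<Longrightarrow> b \<in> arcs (zeta D)"
  unfolding arcs_zeta zpath_frag[symmetric] by blast

lemma copy_point_offset: "copy_point D k P = (3 * fst P, 2 * snd P + offset (fst (level D (fst P) ! snd P)) k)"
  by (cases P) (simp add: copy_point_def offset_def)

text \<open>The offset is at most 1, so the doubled position still determines the original
  one.\<close>

lemma copy_point_inj: "copy_point D k P = copy_point D k' P' \<Longrightarrow> P = P'"
proof -
  assume h: "copy_point D k P = copy_point D k' P'"
  have o: "offset d k \<le> 1" for d k by (simp add: offset_def)
  have "fst P = fst P'" using h by (simp add: copy_point_offset)
  moreover have "snd P = snd P'"
  proof -
    have "m = n" if "2 * m + i = 2 * n + j" "i \<le> 1" "j \<le> 1" for m n i j :: nat using that by presburger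
    then show ?thesis using h o unfolding copy_point_offset by (metis prod.inject)
  qed
  ultimately show ?thesis by (simp add: prod_eq_iff)
qed

lemma zeta_path_ends:
  assumes D: "is_diagram D" and x: "(h, pre, p) \<in> placed D" "a \<in> piece_arcs h (nbot pre) (ntop pre) p"
  shows "tail (hd (zpath h (nbot pre) (ntop pre) (lev1 pre) (lev2 pre) p (over a) k)) = copy_point D k (tail a)"
    "head (last (zpath h (nbot pre) (ntop pre) (lev1 pre) (lev2 pre) p (over a) k)) = copy_point D k (head a)"
  using zpath_path[OF x(2), of "lev1 pre" "lev2 pre" k] level_tail[OF D x] level_head[OF D x]
  by (simp_all add: copy_point_offset)

lemma zeta_component:
  assumes D: "is_diagram D" and c: "is_component D c"
  shows "component_from (zeta D) (copy_point D k (tail (hd c))) = concat (map (zeta_path D k) c)"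
proof -
  note cr = component_refine[where path = "zeta_path D k" and pt = "copy_point D k" and D = D and D' = "zeta D" and c = c]
  have 1: "zeta_path D k a \<noteq> [] \<and> successively (\<lambda>a b. head a = tail b) (zeta_path D k a)
        \<and> tail (hd (zeta_path D k a)) = copy_point D k (tail a) \<and> head (last (zeta_path D k a)) = copy_point D k (head a)"
    "set (zeta_path D k a) \<subseteq> arcs (zeta D)" "distinct (zeta_path D k a)" if a: "a \<in> arcs D" for a
  proof -
    obtain h pre p where x: "(h, pre, p) \<in> placed D" "a \<in> piece_arcs h (nbot pre) (ntop pre) p" using a by (rule arc_placeE)
    show "zeta_path D k a \<noteq> [] \<and> successively (\<lambda>a b. head a = tail b) (zeta_path D k a)
        \<and> tail (hd (zeta_path D k a)) = copy_point D k (tail a) \<and> head (last (zeta_path D k a)) = copy_point D k (head a)"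
      "distinct (zeta_path D k a)"
      using zpath_path[OF x(2), of "lev1 pre" "lev2 pre" k] zeta_path_ends[OF D x] unfolding zeta_path_eq[OF x] by blast+
    show "set (zeta_path D k a) \<subseteq> arcs (zeta D)"
      using arcs_zetaI[OF x] unfolding zeta_path_eq[OF x] by blast
  qed
  have 2: "set (zeta_path D k a) \<inter> set (zeta_path D k b) = {}" if ab: "a \<in> arcs D" "b \<in> arcs D" "a \<noteq> b" for a b
  proof -
    obtain h pre p where x: "(h, pre, p) \<in> placed D" "a \<in> piece_arcs h (nbot pre) (ntop pre) p" using ab(1) by (rule arc_placeE)
    obtain h' pre' p' where x': "(h', pre', p') \<in> placed D" "b \<in> piece_arcs h' (nbot pre') (ntop pre') p'" using ab(2) by (rule arc_placeE)
    show ?thesis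
    proof (cases "(h, pre, p) = (h', pre', p')")
      case True
      then show ?thesis using zpath_disjoint[OF x(2), of b k k "lev1 pre" "lev2 pre"] x'(2) ab(3)
        unfolding zeta_path_eq[OF x] zeta_path_eq[OF x'] by simp
    next
      case False
      have "set (zeta_path D k a) \<subseteq> frag 3 double_piece h pre p" "set (zeta_path D k b) \<subseteq> frag 3 double_piece h' pre' p'"
        unfolding zeta_path_eq[OF x] zeta_path_eq[OF x'] frag_zeta zpath_frag[symmetric] using x(2) x'(2) by blast+
      then show ?thesis using frag_disjoint[OF x(1) x'(1)] False by blast
    qed
  qed
  \<comment> \<open>The level of the point is a multiple of 3, so the new arc is the last of its
    path, and the path ends at a copy of the head of an old arc.\<close>
  have 3: "\<exists>a\<in>arcs D. head a = P" if b: "b \<in> arcs (zeta D)" "head b = copy_point D k P" for b P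
  proof -
    obtain h pre p a k' where x: "(h, pre, p) \<in> placed D" "a \<in> piece_arcs h (nbot pre) (ntop pre) p"
      and bz: "b \<in> set (zpath h (nbot pre) (ntop pre) (lev1 pre) (lev2 pre) p (over a) k')"
      using b(1) by (rule arcs_zetaE)
    have "fst (head b) = 3 * fst P" using b(2) by (simp add: copy_point_offset)
    then have "b = last (zpath h (nbot pre) (ntop pre) (lev1 pre) (lev2 pre) p (over a) k')" by (rule zpath_ends(1)[OF x(2) bz])
    then have "head b = copy_point D k' (head a)" using zeta_path_ends(2)[OF D x] by simp
    then have "head a = P" using b(2) copy_point_inj by metis
    then show ?thesis using x unfolding arcs_placed by blast
  qed
  have 4: "\<exists>a\<in>arcs D. tail a = P" if b: "b \<in> arcs (zeta D)" "tail b = copy_point D k P" for b P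
  proof -
    obtain h pre p a k' where x: "(h, pre, p) \<in> placed D" "a \<in> piece_arcs h (nbot pre) (ntop pre) p"
      and bz: "b \<in> set (zpath h (nbot pre) (ntop pre) (lev1 pre) (lev2 pre) p (over a) k')"
      using b(1) by (rule arcs_zetaE)
    have "fst (tail b) = 3 * fst P" using b(2) by (simp add: copy_point_offset)
    then have "b = hd (zpath h (nbot pre) (ntop pre) (lev1 pre) (lev2 pre) p (over a) k')" by (rule zpath_ends(2)[OF x(2) bz])
    then have "tail b = copy_point D k' (tail a)" using zeta_path_ends(1)[OF D x] by simp
    then have "tail a = P" using b(2) copy_point_inj by metis
    then show ?thesis using x unfolding arcs_placed by blast
  qed
  show ?thesis
    by (rule component_from_eq[OF is_diagram_zeta[OF D]]; rule cr; fact 1 2 3 4 c)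
qed

section \<open>The leftward diagram\<close>

text \<open>The arcs through the two rows that replace \<open>p\<close>; the middle level starts at
  position \<open>r\<close>. Crossing types disregard orientation: the positive crossing of the curl
  for a maximum is an \<open>XMinus\<close>, the negative one for a minimum an
  \<open>XPlus\<close>.\<close>

fun lpath :: "nat \<Rightarrow> nat \<Rightarrow> nat \<Rightarrow> nat \<Rightarrow> unit piece \<Rightarrow> bool \<Rightarrow> unit arc list" where
  "lpath h b t r (Vert d c) ov = orient d
     [directed_arc d (2*h, b) (2*h+1, r) (2*h, b) (Vert d c) False,
      directed_arc d (2*h+1, r) (2*h+2, t) (2*h+1, r) (Vert d c) False]"
| "lpath h b t r (Cross XPlus du cu do co) False = orient du
     [directed_arc du (2*h, b+1) (2*h+1, r) (2*h, b) (Cross XPlus du cu do co) False,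
      directed_arc du (2*h+1, r) (2*h+2, t) (2*h+1, r) (Vert du cu) False]"
| "lpath h b t r (Cross XPlus du cu do co) True = orient do
     [directed_arc do (2*h, b) (2*h+1, r+1) (2*h, b) (Cross XPlus du cu do co) True,
      directed_arc do (2*h+1, r+1) (2*h+2, t+1) (2*h+1, r+1) (Vert do co) False]"
| "lpath h b t r (Cross XMinus du cu do co) False = orient du
     [directed_arc du (2*h, b) (2*h+1, r+1) (2*h, b) (Cross XMinus du cu do co) False,
      directed_arc du (2*h+1, r+1) (2*h+2, t+1) (2*h+1, r+1) (Vert du cu) False]"
| "lpath h b t r (Cross XMinus du cu do co) True = orient do
     [directed_arc do (2*h, b+1) (2*h+1, r) (2*h, b) (Cross XMinus du cu do co) True,
      directed_arc do (2*h+1, r) (2*h+2, t) (2*h+1, r) (Vert do co) False]"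
| "lpath h b t r (Maximum RightLeft c) ov =
     [directed_arc Down (2*h, b) (2*h, b+1) (2*h, b) (Maximum RightLeft c) False]"
| "lpath h b t r (Maximum LeftRight c) ov =
     [directed_arc Up (2*h, b) (2*h+1, r+1) (2*h, b) (Cross XMinus Up c Down c) False,
      directed_arc Down (2*h+1, r) (2*h+1, r+1) (2*h+1, r) (Maximum RightLeft c) False,
      directed_arc Down (2*h, b+1) (2*h+1, r) (2*h, b) (Cross XMinus Up c Down c) True]"
| "lpath h b t r (Minimum RightLeft c) ov =
     [directed_arc Down (2*h+1, r+1) (2*h+2, t+1) (2*h+1, r+1) (Vert Down c) False,
      directed_arc Down (2*h+1, r) (2*h+1, r+1) (2*h, b) (Minimum RightLeft c) False,
      directed_arc Up (2*h+1, r) (2*h+2, t) (2*h+1, r) (Vert Up c) False]"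
| "lpath h b t r (Minimum LeftRight c) ov =
     [directed_arc Down (2*h+1, r+1) (2*h+2, t) (2*h+1, r) (Cross XPlus Down c Up c) False,
      directed_arc Down (2*h+1, r) (2*h+1, r+1) (2*h, b) (Minimum RightLeft c) False,
      directed_arc Up (2*h+1, r) (2*h+2, t+1) (2*h+1, r) (Cross XPlus Down c Up c) True]"

definition lfrag :: "nat \<Rightarrow> nat \<Rightarrow> nat \<Rightarrow> nat \<Rightarrow> unit piece \<Rightarrow> unit arc set" where
  "lfrag h b t r p = row_arcs (2*h) b r (curl_piece p ! 0) \<union> row_arcs (2*h+1) r t (curl_piece p ! 1)"

lemma lpath_path:
  assumes "a \<in> piece_arcs h b t p"
  shows "lpath h b t r p (over a) \<noteq> [] \<and>
    successively (\<lambda>a b. head a = tail b) (lpath h b t r p (over a)) \<and>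
    tail (hd (lpath h b t r p (over a))) = (2 * fst (tail a), snd (tail a)) \<and>
    head (last (lpath h b t r p (over a))) = (2 * fst (head a), snd (head a)) \<and>
    distinct (lpath h b t r p (over a))"
  using assms by (cases p rule: unit_piece_exhaust; auto simp: zsimps)

lemma lpath_ends_aux:
  assumes "a \<in> piece_arcs h b t p" "x \<in> set (lpath h b t r p (over a))"
  shows "(fst (head x) = 2 * h \<or> fst (head x) = 2 * h + 2 \<longrightarrow> x = last (lpath h b t r p (over a))) \<and>
    (fst (tail x) = 2 * h \<or> fst (tail x) = 2 * h + 2 \<longrightarrow> x = hd (lpath h b t r p (over a))) \<and>
    fst (head x) \<in> {2 * h .. 2 * h + 2} \<and> fst (tail x) \<in> {2 * h .. 2 * h + 2}"
  using assms by (cases p rule: unit_piece_exhaust; auto simp: zsimps)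

lemma lpath_ends:
  assumes "a \<in> piece_arcs h b t p" "x \<in> set (lpath h b t r p (over a))"
  shows "fst (head x) = 2 * q \<Longrightarrow> x = last (lpath h b t r p (over a))"
    "fst (tail x) = 2 * q \<Longrightarrow> x = hd (lpath h b t r p (over a))"
proof -
  have q: "l = 2 * h \<or> l = 2 * h + 2" if "l \<in> {2 * h .. 2 * h + 2}" "l = 2 * q" for l :: nat
    using that by auto
  show "fst (head x) = 2 * q \<Longrightarrow> x = last (lpath h b t r p (over a))"
    "fst (tail x) = 2 * q \<Longrightarrow> x = hd (lpath h b t r p (over a))"
    using lpath_ends_aux[OF assms] q by blast+
qed

lemma lpath_frag:
  "(\<Union>a\<in>piece_arcs h b t p. set (lpath h b t r p (over a))) = lfrag h b t r p"
proof
  have "set (lpath h b t r p (over a)) \<subseteq> lfrag h b t r p" if "a \<in> piece_arcs h b t p" for a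
    using that by (cases p rule: unit_piece_exhaust; auto simp: lfrag_def zsimps)
  then show "(\<Union>a\<in>piece_arcs h b t p. set (lpath h b t r p (over a))) \<subseteq> lfrag h b t r p"
    by blast
  show "lfrag h b t r p \<subseteq> (\<Union>a\<in>piece_arcs h b t p. set (lpath h b t r p (over a)))"
    by (cases p rule: unit_piece_exhaust; simp add: lfrag_def zsimps)
qed

lemma lpath_disjoint:
  assumes "a \<in> piece_arcs h b t p" "a' \<in> piece_arcs h b t p" "a \<noteq> a'"
  shows "set (lpath h b t r p (over a)) \<inter> set (lpath h b t r p (over a')) = {}"
  using assms by (cases p rule: unit_piece_exhaust; auto simp: zsimps)

interpretation lr: refinement 2 curl_piece "\<lambda>x. [x]"
proof unfold_locales
  show "Suc k < 2 \<Longrightarrow> tops (curl_piece p ! k) = bottoms (curl_piece p ! Suc k)" for p k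
    by (cases p rule: unit_piece_exhaust) (auto simp: less_Suc_eq numeral_2_eq_2)
  show "bottoms (curl_piece p ! 0) = concat (map (\<lambda>x. [x]) (piece_bottom p))" for p
    by (cases p rule: unit_piece_exhaust) auto
  show "tops (curl_piece p ! (2 - 1)) = concat (map (\<lambda>x. [x]) (piece_top p))" for p
    by (cases p rule: unit_piece_exhaust) auto
qed simp

lemma is_diagram_leftward: "is_diagram D \<Longrightarrow> is_diagram (leftward D)"
  unfolding leftward_def by (rule lr.is_diagram_refine)

abbreviation lev where "lev pre \<equiv> nbot (cols curl_piece 1 pre)"

lemma frag_leftward: "frag 2 curl_piece h pre p = lfrag h (nbot pre) (ntop pre) (lev pre) p"
proof -
  have l: "{..<2} = {0, 1::nat}" by auto
  have c: "concat (map (\<lambda>x. [x]) xs) = xs" for xs :: "'z list" by (induction xs) auto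
  have "nbot (cols curl_piece 0 pre) = nbot pre" "ntop (cols curl_piece 1 pre) = ntop pre"
    using lr.cols_bot[of pre] lr.cols_top[of pre] by (simp_all add: c del: length_concat)
  moreover have "ntop (cols curl_piece 0 pre) = lev pre"
    using lr.cols_inner[of 0 pre] by simp
  ultimately show ?thesis unfolding frag_def lfrag_def l by simp
qed

definition left_path :: "unit diagram \<Rightarrow> unit arc \<Rightarrow> unit arc list" where
  "left_path D a = (case place D a of (h, pre, p) \<Rightarrow> lpath h (nbot pre) (ntop pre) (lev pre) p (over a))"

lemma left_path_eq:
  "(h, pre, p) \<in> placed D \<Longrightarrow> a \<in> piece_arcs h (nbot pre) (ntop pre) p \<Longrightarrow>
    left_path D a = lpath h (nbot pre) (ntop pre) (lev pre) p (over a)"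
  by (simp add: left_path_def place_eq)

lemma arcs_leftward: "arcs (leftward D) = (\<Union>(h, pre, p)\<in>placed D. lfrag h (nbot pre) (ntop pre) (lev pre) p)"
  unfolding leftward_def arcs_refine frag_leftward ..

lemma arcs_leftwardE:
  assumes "b \<in> arcs (leftward D)"
  obtains h pre p a where "(h, pre, p) \<in> placed D" "a \<in> piece_arcs h (nbot pre) (ntop pre) p"
    "b \<in> set (lpath h (nbot pre) (ntop pre) (lev pre) p (over a))"
  using assms unfolding arcs_leftward lpath_frag[symmetric] by blast

lemma arcs_leftwardI:
  "(h, pre, p) \<in> placed D \<Longrightarrow> a \<in> piece_arcs h (nbot pre) (ntop pre) p \<Longrightarrow>
    b \<in> set (lpath h (nbot pre) (ntop pre) (lev pre) p (over a)) \<Longrightarrow> b \<in> arcs (leftward D)"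
  unfolding arcs_leftward lpath_frag[symmetric] by blast

lemma left_path_subset: "a \<in> arcs D \<Longrightarrow> set (left_path D a) \<subseteq> arcs (leftward D)"
proof -
  assume "a \<in> arcs D"
  then obtain h pre p where x: "(h, pre, p) \<in> placed D" "a \<in> piece_arcs h (nbot pre) (ntop pre) p" by (rule arc_placeE)
  show ?thesis unfolding left_path_eq[OF x] using arcs_leftwardI[OF x] by (rule subsetI)
qed

lemma left_path_disjoint:
  assumes ab: "a \<in> arcs D" "b \<in> arcs D" "a \<noteq> b"
  shows "set (left_path D a) \<inter> set (left_path D b) = {}"
proof -
  obtain h pre p where x: "(h, pre, p) \<in> placed D" "a \<in> piece_arcs h (nbot pre) (ntop pre) p" using ab(1) by (rule arc_placeE)
  obtain h' pre' p' where x': "(h', pre', p') \<in> placed D" "b \<in> piece_arcs h' (nbot pre') (ntop pre') p'" using ab(2) by (rule arc_placeE)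
  show ?thesis
  proof (cases "(h, pre, p) = (h', pre', p')")
    case True
    then show ?thesis using lpath_disjoint[OF x(2), of b "lev pre"] x'(2) ab(3)
      unfolding left_path_eq[OF x] left_path_eq[OF x'] by simp
  next
    case False
    have "set (left_path D a) \<subseteq> frag 2 curl_piece h pre p" "set (left_path D b) \<subseteq> frag 2 curl_piece h' pre' p'"
      unfolding left_path_eq[OF x] left_path_eq[OF x'] frag_leftward lpath_frag[symmetric] using x(2) x'(2) by blast+
    then show ?thesis using frag_disjoint[OF x(1) x'(1)] False by blast
  qed
qed

lemma left_path_distinct: "a \<in> arcs D \<Longrightarrow> distinct (left_path D a)"
proof -
  assume "a \<in> arcs D"
  then obtain h pre p where x: "(h, pre, p) \<in> placed D" "a \<in> piece_arcs h (nbot pre) (ntop pre) p" by (rule arc_placeE)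
  show ?thesis unfolding left_path_eq[OF x] using lpath_path[OF x(2), of "lev pre"] by (elim conjE)
qed

lemma left_component:
  assumes D: "is_diagram D" and c: "is_component D c"
  shows "leftward_component D c = concat (map (left_path D) c)" "is_component (leftward D) (leftward_component D c)"
proof -
  let ?pt = "\<lambda>P :: point. (2 * fst P, snd P)"
  note cr = component_refine[where path = "left_path D" and pt = ?pt and D = D and D' = "leftward D" and c = c]
  have 1: "left_path D a \<noteq> [] \<and> successively (\<lambda>a b. head a = tail b) (left_path D a)
        \<and> tail (hd (left_path D a)) = ?pt (tail a) \<and> head (last (left_path D a)) = ?pt (head a)" if a: "a \<in> arcs D" for a
  proof -
    obtain h pre p where x: "(h, pre, p) \<in> placed D" "a \<in> piece_arcs h (nbot pre) (ntop pre) p" using a by (rule arc_placeE)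
    show ?thesis using lpath_path[OF x(2), of "lev pre"] unfolding left_path_eq[OF x] by blast
  qed
  have inj: "P = P'" if "?pt P = ?pt P'" for P P' using that by (simp add: prod_eq_iff)
  have 3: "\<exists>a\<in>arcs D. head a = P" if b: "b \<in> arcs (leftward D)" "head b = ?pt P" for b P
  proof -
    obtain h pre p a where x: "(h, pre, p) \<in> placed D" "a \<in> piece_arcs h (nbot pre) (ntop pre) p"
      and bz: "b \<in> set (lpath h (nbot pre) (ntop pre) (lev pre) p (over a))"
      using b(1) by (rule arcs_leftwardE)
    have "fst (head b) = 2 * fst P" using b(2) by simp
    then have "b = last (lpath h (nbot pre) (ntop pre) (lev pre) p (over a))" by (rule lpath_ends(1)[OF x(2) bz])
    then have "?pt P = ?pt (head a)" using lpath_path[OF x(2), of "lev pre"] b(2) by simp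
    then have "P = head a" by (rule inj)
    then show ?thesis using x unfolding arcs_placed by blast
  qed
  have 4: "\<exists>a\<in>arcs D. tail a = P" if b: "b \<in> arcs (leftward D)" "tail b = ?pt P" for b P
  proof -
    obtain h pre p a where x: "(h, pre, p) \<in> placed D" "a \<in> piece_arcs h (nbot pre) (ntop pre) p"
      and bz: "b \<in> set (lpath h (nbot pre) (ntop pre) (lev pre) p (over a))"
      using b(1) by (rule arcs_leftwardE)
    have "fst (tail b) = 2 * fst P" using b(2) by simp
    then have "b = hd (lpath h (nbot pre) (ntop pre) (lev pre) p (over a))" by (rule lpath_ends(2)[OF x(2) bz])
    then have "?pt P = ?pt (tail a)" using lpath_path[OF x(2), of "lev pre"] b(2) by simp
    then have "P = tail a" by (rule inj)
    then show ?thesis using x unfolding arcs_placed by blast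
  qed
  have comp: "is_component (leftward D) (concat (map (left_path D) c))"
    by (rule cr(1)) (fact 1 3 4 c left_path_subset left_path_distinct left_path_disjoint)+
  have tl: "tail (hd (concat (map (left_path D) c))) = ?pt (tail (hd c))"
    by (rule cr(2)) (fact 1 3 4 c left_path_subset left_path_distinct left_path_disjoint)+
  show eq: "leftward_component D c = concat (map (left_path D) c)"
    unfolding leftward_component_def by (rule component_from_eq[OF is_diagram_leftward[OF D] comp tl])
  show "is_component (leftward D) (leftward_component D c)" unfolding eq by (rule comp)
qed

lemma concat_concat_map: "concat (map (\<lambda>c. concat (map f c)) cs) = concat (map f (concat cs))"
  by (induction cs) auto

lemma leftward_ordered:
  assumes D: "is_diagram D" and cs: "ordered_components D cs"
  shows "distinct (concat (map (leftward_component D) cs))"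
    "set (concat (map (leftward_component D) cs)) = arcs (leftward D)"
proof -
  have c: "is_component D c" if "c \<in> set cs" for c using cs that unfolding ordered_components_def by blast
  have s: "set (concat cs) = arcs D" "distinct (concat cs)" using cs unfolding ordered_components_def by auto
  have eq: "concat (map (leftward_component D) cs) = concat (map (left_path D) (concat cs))"
  proof -
    have "map (leftward_component D) cs = map (\<lambda>c. concat (map (left_path D) c)) cs"
      using left_component(1)[OF D c] by simp
    then show ?thesis by (simp only: concat_concat_map)
  qed
  have "distinct xs \<Longrightarrow> set xs \<subseteq> arcs D \<Longrightarrow> distinct (concat (map (left_path D) xs))" for xs
  proof (induction xs)
    case (Cons a xs)
    have "set (left_path D a) \<inter> set (left_path D b) = {}" if "b \<in> set xs" for b
      by (rule left_path_disjoint) (use Cons.prems that in auto)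
    then have "set (left_path D a) \<inter> set (concat (map (left_path D) xs)) = {}"
      by auto
    then show ?case using Cons left_path_distinct[of a D] by simp
  qed simp
  then show "distinct (concat (map (leftward_component D) cs))"
    unfolding eq using s by simp
  have "set (concat (map (leftward_component D) cs)) = (\<Union>a\<in>arcs D. set (left_path D a))"
    unfolding eq using s by simp
  also have "\<dots> = arcs (leftward D)"
  proof
    show "(\<Union>a\<in>arcs D. set (left_path D a)) \<subseteq> arcs (leftward D)" using left_path_subset by blast
    show "arcs (leftward D) \<subseteq> (\<Union>a\<in>arcs D. set (left_path D a))"
    proof
      fix b assume "b \<in> arcs (leftward D)"
      then obtain h pre p a where x: "(h, pre, p) \<in> placed D" "a \<in> piece_arcs h (nbot pre) (ntop pre) p"
        "b \<in> set (lpath h (nbot pre) (ntop pre) (lev pre) p (over a))" by (rule arcs_leftwardE)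
      have "a \<in> arcs D" using x(1,2) unfolding arcs_placed by blast
      then show "b \<in> (\<Union>a\<in>arcs D. set (left_path D a))"
        by (rule UN_I) (simp only: left_path_eq[OF x(1,2)] x(3))
    qed
  qed
  finally show "set (concat (map (leftward_component D) cs)) = arcs (leftward D)" .
qed

lemma leftward_parts:
  assumes "b \<in> arcs (leftward D)"
  shows "part b \<noteq> Maximum LeftRight ()" "part b \<noteq> Minimum LeftRight ()"
proof -
  obtain h pre p a where x: "(h, pre, p) \<in> placed D" "a \<in> piece_arcs h (nbot pre) (ntop pre) p"
    and b: "b \<in> set (lpath h (nbot pre) (ntop pre) (lev pre) p (over a))" using assms by (rule arcs_leftwardE)
  have "part b \<noteq> Maximum LeftRight () \<and> part b \<noteq> Minimum LeftRight ()"
    using x(2) b by (cases p rule: unit_piece_exhaust; auto simp: zsimps)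
  then show "part b \<noteq> Maximum LeftRight ()" "part b \<noteq> Minimum LeftRight ()" by auto
qed

section \<open>\<open>J'\<close> as a state sum over the original crossings\<close>

text \<open>The site, in the doubled diagram, of the crossing of the copy \<open>cu\<close> of the under-strand and the copy
  \<open>co\<close> of the over-strand.\<close>

definition zsite :: "nat \<Rightarrow> nat \<Rightarrow> nat \<Rightarrow> nat \<Rightarrow> xing \<Rightarrow> dir \<Rightarrow> dir \<Rightarrow> copy \<Rightarrow> copy \<Rightarrow> point" where
  "zsite h b r s x du do cu co = (if left_copy du = cu then
      (if left_copy do = co then (3*h+1, r) else if x = XPlus then (3*h, 2*b+1) else (3*h+2, s+1))
    else (if left_copy do \<noteq> co then (3*h+1, r+2) else if x = XPlus then (3*h+2, s+1) else (3*h, 2*b+1)))"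

lemma zsite_inj: "zsite h b r s x du do cu co = zsite h b r s x du do cu' co' \<Longrightarrow> cu = cu' \<and> co = co'"
  by (cases cu; cases co; cases cu'; cases co'; cases du; cases "do"; cases x) (simp_all add: zsite_def)

text \<open>Each of the four crossings is seen from its over-strand, so that a single arc identifies
  the site.\<close>

lemma zsite_arc:
  "\<exists>y\<in>set (zpath h b t r s (Cross x du () do ()) True co). is_cross (part y) \<and> over y \<and> site y = zsite h b r s x du do cu co"
  by (cases x; cases du; cases "do"; cases cu; cases co; simp add: zsite_def zsimps)

lemma zpath_cross:
  assumes "a \<in> piece_arcs h b t p" "y \<in> set (zpath h b t r s p (over a) k)" "is_cross (part y)"
  shows "\<exists>x du do cu co. p = Cross x du () do () \<and> site y = zsite h b r s x du do cu co"
proof -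
  have "\<exists>x du do. p = Cross x du () do ()" using assms
    by (cases p rule: unit_piece_exhaust; cases k) (auto simp: zsimps)
  then obtain x du "do" where p: "p = Cross x du () do ()" by blast
  have "\<exists>cu co. site y = zsite h b r s x du do cu co"
    using assms unfolding p copy_ex by (cases x; cases du; cases "do"; cases k) (auto simp: zsite_def zsimps)
  then show ?thesis using p by blast
qed

definition cross_place :: "'c diagram \<Rightarrow> point \<Rightarrow> nat \<times> 'c piece list \<times> 'c piece" where
  "cross_place D s = (THE x. x \<in> placed D \<and> (case x of (h, pre, p) \<Rightarrow> is_cross p \<and> s = (h, nbot pre)))"

lemma cross_place_eq:
  assumes "(h, pre, p) \<in> placed D" "is_cross p" "s = (h, nbot pre)"
  shows "cross_place D s = (h, pre, p)"
  unfolding cross_place_def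
proof (rule the_equality)
  fix x assume x: "x \<in> placed D \<and> (case x of (h, pre, p) \<Rightarrow> is_cross p \<and> s = (h, nbot pre))"
  obtain h' pre' p' where e: "x = (h', pre', p')" by (cases x)
  have "(h', pre', p') = (h, pre, p)"
    by (rule cross_site_place[OF _ assms(1) _ assms(2)]) (use x assms(3) in \<open>auto simp: e\<close>)
  then show "x = (h, pre, p)" by (simp add: e)
next
  show "(h, pre, p) \<in> placed D \<and> (case (h, pre, p) of (h, pre, p) \<Rightarrow> is_cross p \<and> s = (h, nbot pre))"
    using assms by simp
qed

definition zeta_site :: "unit diagram \<Rightarrow> point \<Rightarrow> copy \<Rightarrow> copy \<Rightarrow> point" where
  "zeta_site D s cu co = (case cross_place D s of (h, pre, p) \<Rightarrow>
     (case p of Cross x du _ do _ \<Rightarrow> zsite h (nbot pre) (lev1 pre) (lev2 pre) x du do cu co))"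

lemma zeta_site_eq:
  "(h, pre, Cross x du () do ()) \<in> placed D \<Longrightarrow> s = (h, nbot pre) \<Longrightarrow>
    zeta_site D s cu co = zsite h (nbot pre) (lev1 pre) (lev2 pre) x du do cu co"
proof -
  assume x: "(h, pre, Cross x du () do ()) \<in> placed D" "s = (h, nbot pre)"
  have "cross_place D s = (h, pre, Cross x du () do ())" by (rule cross_place_eq[OF x(1) _ x(2)]) simp
  then show ?thesis by (simp add: zeta_site_def)
qed

lemma all_crossingsI: "a \<in> arcs D \<Longrightarrow> is_cross (part a) \<Longrightarrow> site a \<in> all_crossings D"
  unfolding all_crossings_eq by (rule CollectI, rule exI, rule conjI, rule refl, rule conjI)

text \<open>A crossing of the doubled diagram is recognised by its over-arc. This arc lies in the
  fragment of one placed piece, which gives back the original crossing, and the four sites within a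
  fragment are distinct.\<close>

lemma zeta_site_bij: "bij_betw (\<lambda>(s, cu, co). zeta_site D s cu co) (all_crossings D \<times> UNIV) (all_crossings (zeta D))"
  unfolding bij_betw_def
proof
  have arc: "\<exists>h pre x du do ao y. (h, pre, Cross x du () do ()) \<in> placed D \<and> s = (h, nbot pre) \<and>
     ao \<in> piece_arcs h (nbot pre) (ntop pre) (Cross x du () do ()) \<and>
     y \<in> set (zpath h (nbot pre) (ntop pre) (lev1 pre) (lev2 pre) (Cross x du () do ()) (over ao) co) \<and>
     is_cross (part y) \<and> over y \<and> site y = zeta_site D s cu co" if s: "s \<in> all_crossings D" for s cu co
  proof -
    obtain h pre x du c1 "do" c2 au ao where x: "(h, pre, Cross x du c1 do c2) \<in> placed D" "s = (h, nbot pre)"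
      "ao \<in> piece_arcs h (nbot pre) (ntop pre) (Cross x du c1 do c2)" "over ao"
      using s by (rule cross_arcs)
    have u: "c1 = ()" "c2 = ()" by simp_all
    show ?thesis
    proof -
      obtain y where y: "y \<in> set (zpath h (nbot pre) (ntop pre) (lev1 pre) (lev2 pre) (Cross x du () do ()) True co)"
        "is_cross (part y)" "over y" "site y = zsite h (nbot pre) (lev1 pre) (lev2 pre) x du do cu co"
        using zsite_arc[of h "nbot pre" "ntop pre" "lev1 pre" "lev2 pre" x du "do" co cu] by (elim bexE conjE)
      show ?thesis
        by (rule exI[of _ h], rule exI[of _ pre], rule exI[of _ x], rule exI[of _ du], rule exI[of _ "do"], rule exI[of _ ao], rule exI[of _ y])
          (use x y zeta_site_eq[OF x(1)[unfolded u] x(2)] in \<open>simp add: u\<close>)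
    qed
  qed
  show "inj_on (\<lambda>(s, cu, co). zeta_site D s cu co) (all_crossings D \<times> UNIV)"
  proof (rule inj_onI)
    fix q q' :: "point \<times> copy \<times> copy"
    assume qq: "q \<in> all_crossings D \<times> UNIV" "q' \<in> all_crossings D \<times> UNIV"
      "(\<lambda>(s, cu, co). zeta_site D s cu co) q = (\<lambda>(s, cu, co). zeta_site D s cu co) q'"
    obtain h0 b0 cu co where q: "q = ((h0, b0), cu, co)" by (metis surj_pair)
    obtain h0' b0' cu' co' where q': "q' = ((h0', b0'), cu', co')" by (metis surj_pair)
    have s: "(h0, b0) \<in> all_crossings D" "(h0', b0') \<in> all_crossings D" and e: "zeta_site D (h0, b0) cu co = zeta_site D (h0', b0') cu' co'"
      using qq unfolding q q' by simp_all
    obtain h pre x du "do" ao y where x: "(h, pre, Cross x du () do ()) \<in> placed D" "(h0, b0) = (h, nbot pre)"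
     "ao \<in> piece_arcs h (nbot pre) (ntop pre) (Cross x du () do ())"
     "y \<in> set (zpath h (nbot pre) (ntop pre) (lev1 pre) (lev2 pre) (Cross x du () do ()) (over ao) co)"
     "is_cross (part y)" "over y" "site y = zeta_site D (h0, b0) cu co"
      using arc[OF s(1), of co cu] by (elim exE conjE)
    obtain h' pre' x' du' do' ao' y' where x': "(h', pre', Cross x' du' () do' ()) \<in> placed D" "(h0', b0') = (h', nbot pre')"
     "ao' \<in> piece_arcs h' (nbot pre') (ntop pre') (Cross x' du' () do' ())"
     "y' \<in> set (zpath h' (nbot pre') (ntop pre') (lev1 pre') (lev2 pre') (Cross x' du' () do' ()) (over ao') co')"
     "is_cross (part y')" "over y'" "site y' = zeta_site D (h0', b0') cu' co'"
      using arc[OF s(2), of co' cu'] by (elim exE conjE)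
    have "y = y'"
      by (rule cross_arc_unique[OF arcs_zetaI[OF x(1,3,4)] arcs_zetaI[OF x'(1,3,4)]]) (use x x' e in simp_all)
    moreover have "y \<in> frag 3 double_piece h pre (Cross x du () do ())" "y' \<in> frag 3 double_piece h' pre' (Cross x' du' () do' ())"
      unfolding frag_zeta zpath_frag[symmetric] using x(3,4) x'(3,4) by blast+
    ultimately have eq: "(h, pre, Cross x du () do ()) = (h', pre', Cross x' du' () do' ())"
      using frag_disjoint[OF x(1) x'(1)] by blast
    have "zsite h (nbot pre) (lev1 pre) (lev2 pre) x du do cu co = zsite h (nbot pre) (lev1 pre) (lev2 pre) x du do cu' co'"
      using e zeta_site_eq[OF x(1,2)] zeta_site_eq[OF x'(1,2)] eq by simp
    then have "cu = cu' \<and> co = co'" by (rule zsite_inj)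
    then show "q = q'" unfolding q q' using x(2) x'(2) eq by simp
  qed
  show "(\<lambda>(s, cu, co). zeta_site D s cu co) ` (all_crossings D \<times> UNIV) = all_crossings (zeta D)"
  proof
    show "(\<lambda>(s, cu, co). zeta_site D s cu co) ` (all_crossings D \<times> UNIV) \<subseteq> all_crossings (zeta D)"
    proof
      fix q assume "q \<in> (\<lambda>(s, cu, co). zeta_site D s cu co) ` (all_crossings D \<times> UNIV)"
      then obtain s cu co where q: "s \<in> all_crossings D" "q = zeta_site D s cu co" by auto
      obtain h pre x du "do" ao y where x: "(h, pre, Cross x du () do ()) \<in> placed D"
       "ao \<in> piece_arcs h (nbot pre) (ntop pre) (Cross x du () do ())"
       "y \<in> set (zpath h (nbot pre) (ntop pre) (lev1 pre) (lev2 pre) (Cross x du () do ()) (over ao) co)"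
       "is_cross (part y)" "site y = zeta_site D s cu co"
        using arc[OF q(1), of co cu] by (elim exE conjE)
      show "q \<in> all_crossings (zeta D)"
        using all_crossingsI[OF arcs_zetaI[OF x(1,2,3)] x(4)] x(5) q(2) by simp
    qed
    show "all_crossings (zeta D) \<subseteq> (\<lambda>(s, cu, co). zeta_site D s cu co) ` (all_crossings D \<times> UNIV)"
    proof
      fix q assume "q \<in> all_crossings (zeta D)"
      then obtain y where y: "y \<in> arcs (zeta D)" "is_cross (part y)" "q = site y" unfolding all_crossings_eq by blast
      obtain h pre p a k where x: "(h, pre, p) \<in> placed D" "a \<in> piece_arcs h (nbot pre) (ntop pre) p"
        "y \<in> set (zpath h (nbot pre) (ntop pre) (lev1 pre) (lev2 pre) p (over a) k)" using y(1) by (rule arcs_zetaE)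
      obtain x' du "do" cu co where p: "p = Cross x' du () do ()" "site y = zsite h (nbot pre) (lev1 pre) (lev2 pre) x' du do cu co"
        using zpath_cross[OF x(2,3) y(2)] by (elim exE conjE)
      have "a \<in> arcs D" using x(1,2) unfolding arcs_placed by blast
      then have "(h, nbot pre) \<in> all_crossings D"
        using all_crossingsI[of a D] site_piece_arcs[OF x(2)] p(1) by simp
      moreover have "q = zeta_site D (h, nbot pre) cu co"
        using y(3) p(2) zeta_site_eq[OF x(1)[unfolded p(1)] refl] by simp
      ultimately show "q \<in> (\<lambda>(s, cu, co). zeta_site D s cu co) ` (all_crossings D \<times> UNIV)"
        by (intro image_eqI[of _ _ "((h, nbot pre), cu, co)"]) auto
    qed
  qed
qed

definition quad :: "(copy \<Rightarrow> copy \<Rightarrow> 'i) \<Rightarrow> 'i \<times> 'i \<times> 'i \<times> 'i" where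
  "quad f = (f Thin Thick, f Thick Thick, f Thin Thin, f Thick Thin)"

lemma sel_quad [simp]: "sel (quad f) cu co = f cu co"
  by (cases cu; cases co) (simp_all add: quad_def)
lemma quad_sel [simp]: "quad (sel j) = j"
  by (cases j) (simp add: quad_def)

text \<open>A state of the doubled diagram amounts to a quadruple of indices at each original
  crossing. The hypothesis relates \<open>F\<close> and \<open>G\<close> through values at
  crossings, so later uses never see the bijection itself.\<close>

lemma sum_zeta_states:
  fixes F :: "(point \<Rightarrow> 'i::finite) \<Rightarrow> 'z::comm_monoid_add" and G :: "(point \<Rightarrow> 'i \<times> 'i \<times> 'i \<times> 'i) \<Rightarrow> 'z"
  assumes FG: "\<And>\<sigma> \<tau>. (\<And>s cu co. s \<in> all_crossings D \<Longrightarrow> \<sigma> (zeta_site D s cu co) = sel (\<tau> s) cu co) \<Longrightarrow> F \<sigma> = G \<tau>"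
  shows "(\<Sum>\<sigma>\<in>all_crossings (zeta D) \<rightarrow>\<^sub>E UNIV. F \<sigma>) = (\<Sum>\<tau>\<in>all_crossings D \<rightarrow>\<^sub>E UNIV. G \<tau>)"
proof -
  let ?g = "\<lambda>(s, cu, co). zeta_site D s cu co"
  let ?S = "all_crossings D" and ?S' = "all_crossings (zeta D)"
  define gi where "gi = inv_into (?S \<times> UNIV) ?g"
  define i where "i \<tau> = restrict (\<lambda>q. case gi q of (s, cu, co) \<Rightarrow> sel (\<tau> s) cu co) ?S'" for \<tau> :: "point \<Rightarrow> 'i \<times> 'i \<times> 'i \<times> 'i"
  let ?j = "\<lambda>\<sigma> :: point \<Rightarrow> 'i. restrict (\<lambda>s. quad (\<lambda>cu co. \<sigma> (zeta_site D s cu co))) ?S"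
  have gi: "gi (zeta_site D s cu co) = (s, cu, co)" if "s \<in> ?S" for s cu co
    using inv_into_f_f[OF bij_betw_imp_inj_on[OF zeta_site_bij[of D]], of "(s, cu, co)"] that by (simp add: gi_def)
  have mem: "zeta_site D s cu co \<in> ?S'" if "s \<in> ?S" for s cu co
    using bij_betw_apply[OF zeta_site_bij[of D], of "(s, cu, co)"] that by simp
  have gi2: "\<exists>s cu co. s \<in> ?S \<and> gi q = (s, cu, co) \<and> q = zeta_site D s cu co" if "q \<in> ?S'" for q
  proof -
    have "q \<in> ?g ` (?S \<times> UNIV)" using that by (simp only: bij_betw_imp_surj_on[OF zeta_site_bij[of D]])
    then obtain s cu co where q: "s \<in> ?S" "q = zeta_site D s cu co" by auto
    show ?thesis by (intro exI conjI) (rule q(1), simp only: q(2) gi[OF q(1)], rule q(2))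
  qed
  have i: "i \<tau> (zeta_site D s cu co) = sel (\<tau> s) cu co" if "s \<in> ?S" for \<tau> s cu co
    using that by (simp add: i_def mem gi)
  show ?thesis
  proof (rule sum.reindex_bij_witness[where i = i and j = ?j])
    fix \<sigma> assume s: "\<sigma> \<in> ?S' \<rightarrow>\<^sub>E (UNIV :: 'i set)"
    show "i (?j \<sigma>) = \<sigma>"
    proof (rule ext)
      fix q show "i (?j \<sigma>) q = \<sigma> q"
      proof (cases "q \<in> ?S'")
        case True
        obtain s cu co where q: "s \<in> ?S" "gi q = (s, cu, co)" "q = zeta_site D s cu co" using gi2[OF True] by (elim exE conjE)
        then show ?thesis using i[OF q(1), of "?j \<sigma>" cu co] by simp
      next
        case False
        then show ?thesis using PiE_arb[OF s False] by (simp add: i_def)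
      qed
    qed
    show "?j \<sigma> \<in> ?S \<rightarrow>\<^sub>E UNIV" by simp
    show "G (?j \<sigma>) = F \<sigma>" by (rule FG[symmetric]) simp
  next
    fix \<tau> assume t: "\<tau> \<in> ?S \<rightarrow>\<^sub>E (UNIV :: ('i \<times> 'i \<times> 'i \<times> 'i) set)"
    show "?j (i \<tau>) = \<tau>"
    proof (rule ext)
      fix s show "?j (i \<tau>) s = \<tau> s"
      proof (cases "s \<in> ?S")
        case True
        then show ?thesis by (simp add: i)
      next
        case False
        then show ?thesis using PiE_arb[OF t False] by simp
      qed
    qed
    show "i \<tau> \<in> ?S' \<rightarrow>\<^sub>E UNIV" by (simp add: i_def)
  qed
qed

section \<open>Labels along the doubled strands\<close>

context hopf begin

abbreviation zlabel :: "(point \<Rightarrow> 'i) \<Rightarrow> copy arc \<Rightarrow> ('k, 'i) double" where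
  "zlabel \<sigma> y \<equiv> J'_label A \<sigma> (site y) (part y) (over y)"

lemma J'_under [simp]: "J'_label A \<sigma> s (Cross x du cu do co) False = under_label x du cu co (\<sigma> s)"
  by (simp add: under_label_def)
lemma J'_over [simp]: "J'_label A \<sigma> s (Cross x du cu do co) True = over_label x do cu co (\<sigma> s)"
  by (simp add: over_label_def)

lemma J'_vert: "J'_label A \<sigma> s (Vert d c) ov = one" by simp
lemmas J'_simps = J'_under J'_over J'_vert

lemma copy_mult_one [simp]: "copy_mult k one x = x" "copy_mult k x one = x"
  by (simp_all add: copy_mult_def opp_mult_def hm_one1 hm_one2)

lemma copy_mult_assoc: "copy_mult k (copy_mult k x y) z = copy_mult k x (copy_mult k y z)"
  by (simp add: copy_mult_def opp_mult_def hm_assoc)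

definition path_value :: "copy \<Rightarrow> (point \<Rightarrow> 'i) \<Rightarrow> copy arc list \<Rightarrow> ('k, 'i) double" where
  "path_value k \<sigma> ys = foldr (copy_mult k) (map (zlabel \<sigma>) (rev ys)) one"

text \<open>Here the geometric order of the crossings along a path is matched with the list
  \<open>under_order\<close>; the vertical segments contribute units.\<close>

lemma path_value_under:
  assumes "\<And>cu co. \<sigma> (zsite h b r s x du do cu co) = sel j cu co"
  shows "path_value k \<sigma> (zpath h b t r s (Cross x du () do ()) False k) = cross_under x du do k j"
  using assms[of Thin Thin] assms[of Thin Thick] assms[of Thick Thin] assms[of Thick Thick]
  by (cases x; cases du; cases "do"; cases k; simp add: path_value_def cross_under_def zsite_def orient_def directed_arc_def J'_simps del: J'_label.simps)

lemma path_value_over: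
  assumes "\<And>cu co. \<sigma> (zsite h b r s x du do cu co) = sel j cu co"
  shows "path_value k \<sigma> (zpath h b t r s (Cross x du () do ()) True k) = cross_over x du do k j"
  using assms[of Thin Thin] assms[of Thin Thick] assms[of Thick Thin] assms[of Thick Thick]
  by (cases x; cases du; cases "do"; cases k; simp add: path_value_def cross_over_def zsite_def orient_def directed_arc_def J'_simps del: J'_label.simps)

lemma path_value_no_cross:
  assumes "\<not> is_cross p"
  shows "path_value k \<sigma> (zpath h b t r s p ov k) = one"
  using assms
  by (cases p rule: unit_piece_exhaust; cases k; simp add: path_value_def orient_def directed_arc_def Let_def)

end

lemma adj_concat:
  assumes "\<And>a. a \<in> set xs \<Longrightarrow> span_eq (adjoin_rels m one W C) (gen (L a)) (gen (L' a))"
  shows "span_eq (adjoin_rels m one W C) (gen (concat (map L xs))) (gen (concat (map L' xs)))"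
  using assms by (induction xs) (auto intro: adj_append)

lemma gw_cong:
  assumes cl: "length cl = length cs"
    and h: "\<And>a. a \<in> set (concat cs) \<Longrightarrow> span_eq (adjoin_rels m one W C) (gen (L a)) (gen (L' a))"
  shows "span_eq (tensor_rels (adjoin_rels m one W C) cl) (gw L cs) (gw L' cs)"
  unfolding gw_def
proof (rule tensor_gen_cong)
  fix i assume i: "i < length cl"
  have "span_eq (adjoin_rels m one W C) (gen (concat (map L (rev (cs ! i))))) (gen (concat (map L' (rev (cs ! i)))))"
    by (rule adj_concat, rule h) (use i cl in auto)
  then have "span_eq (adjoin_rels m one W C) (gen (words L cs ! i)) (gen (words L' cs ! i))"
    using i cl by (simp add: words_def)
  then show "span_eq (adjoin_rels m one W C \<union> (if cl ! i then commutators else {})) (gen (words L cs ! i)) (gen (words L' cs ! i))"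
    by (rule span_eq_mono) simp
qed (simp_all add: cl)

definition ckey :: "'c arc \<Rightarrow> point option" where
  "ckey a = (if is_cross (part a) then Some (site a) else None)"

definition xtype :: "'c diagram \<Rightarrow> point \<Rightarrow> xing" where
  "xtype D s = (if s \<in> crossings D XPlus then XPlus else XMinus)"

lemma crossingsI: "a \<in> arcs D \<Longrightarrow> part a = Cross y du cu do co \<Longrightarrow> site a \<in> crossings D y"
  unfolding crossings_def by (intro CollectI exI[of _ a] conjI exI refl)

lemma crossings_placed:
  assumes "(h, pre, Cross x du cu do co) \<in> placed D"
  shows "(h, nbot pre) \<in> crossings D y \<longleftrightarrow> x = y"
proof
  assume "x = y"
  obtain a where a: "a \<in> piece_arcs h (nbot pre) (ntop pre) (Cross x du cu do co)" by (cases x) auto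
  then have "a \<in> arcs D" using assms unfolding arcs_placed by blast
  then show "(h, nbot pre) \<in> crossings D y"
    using site_piece_arcs[OF a] \<open>x = y\<close> crossingsI[of a D y] by simp
next
  assume "(h, nbot pre) \<in> crossings D y"
  then obtain a du' cu' do' co' where a: "a \<in> arcs D" "part a = Cross y du' cu' do' co'" "site a = (h, nbot pre)"
    unfolding crossings_def by auto
  obtain h' pre' p where x: "(h', pre', p) \<in> placed D" "a \<in> piece_arcs h' (nbot pre') (ntop pre') p" using a(1) by (rule arc_placeE)
  have p: "p = Cross y du' cu' do' co'" "(h, nbot pre) = (h', nbot pre')" using site_piece_arcs[OF x(2)] a by auto
  have "(h, pre, Cross x du cu do co) = (h', pre', p)"
    by (rule cross_site_place[OF assms x(1)]) (use p in simp_all)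
  then show "x = y" using p by simp
qed

lemma xtype_placed: "(h, pre, Cross x du cu do co) \<in> placed D \<Longrightarrow> xtype D (h, nbot pre) = x"
  unfolding xtype_def by (cases x) (simp_all add: crossings_placed)

lemma crossings_disjoint: "crossings D XPlus \<inter> crossings D XMinus = {}"
proof -
  have "False" if "s \<in> crossings D XPlus" "s \<in> crossings D XMinus" for s
  proof -
    have "s \<in> all_crossings D" using that unfolding all_crossings_def by simp
    then obtain h pre x du cu "do" co au ao where x: "(h, pre, Cross x du cu do co) \<in> placed D" "s = (h, nbot pre)"
      by (rule cross_arcs)
    show False using that crossings_placed[OF x(1), of XPlus] crossings_placed[OF x(1), of XMinus] x(2) by simp
  qed
  then show ?thesis by blast
qed

lemma prod_all_crossings:
  "(\<Prod>s\<in>all_crossings D. F (xtype D s) s) = (\<Prod>s\<in>crossings D XPlus. F XPlus s) * (\<Prod>s\<in>crossings D XMinus. F XMinus s)"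
proof -
  have "finite (crossings D XPlus)" "finite (crossings D XMinus)" using finite_all_crossings[of D] unfolding all_crossings_def by auto
  then have "(\<Prod>s\<in>all_crossings D. F (xtype D s) s) = (\<Prod>s\<in>crossings D XPlus. F (xtype D s) s) * (\<Prod>s\<in>crossings D XMinus. F (xtype D s) s)"
    unfolding all_crossings_def by (rule prod.union_disjoint) (rule crossings_disjoint)
  moreover have "(\<Prod>s\<in>crossings D XMinus. F (xtype D s) s) = (\<Prod>s\<in>crossings D XMinus. F XMinus s)"
    using crossings_disjoint[of D] by (intro prod.cong) (auto simp: xtype_def)
  ultimately show ?thesis by (simp add: xtype_def)
qed

lemma crossing_pair:
  assumes "s \<in> all_crossings D"
  obtains x du cu "do" co au ao where "xtype D s = x" "au \<in> arcs D" "ao \<in> arcs D" "au \<noteq> ao"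
    "part au = Cross x du cu do co" "part ao = Cross x du cu do co" "\<not> over au" "over ao" "site au = s" "site ao = s"
proof -
  obtain h pre x du cu "do" co au ao where x: "(h, pre, Cross x du cu do co) \<in> placed D" "s = (h, nbot pre)"
    "au \<in> piece_arcs h (nbot pre) (ntop pre) (Cross x du cu do co)" "ao \<in> piece_arcs h (nbot pre) (ntop pre) (Cross x du cu do co)"
    "\<not> over au" "over ao" using assms by (rule cross_arcs)
  have m: "au \<in> arcs D" "ao \<in> arcs D" using x(1,3,4) unfolding arcs_placed by blast+
  show ?thesis
    by (rule that[of x au ao du cu "do" co])
      (use xtype_placed[OF x(1)] m x(2,5,6) site_piece_arcs[OF x(3)] site_piece_arcs[OF x(4)] in auto)
qed

lemma words_crossing:
  assumes au: "au \<in> arcs D" "is_cross (part au)" "site au = s" "\<not> over au"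
    and ao: "ao \<in> arcs D" "is_cross (part ao)" "site ao = s" "over ao"
    and cs: "set (concat cs) = arcs D"
  shows "words (\<lambda>a. if ckey a = Some s then L a else L0 a) cs = words (L0(au := L au, ao := L ao)) cs"
proof (rule words_cong)
  fix a assume "a \<in> set (concat cs)"
  then have a: "a \<in> arcs D" by (simp only: cs)
  show "(if ckey a = Some s then L a else L0 a) = (L0(au := L au, ao := L ao)) a"
  proof (cases "ckey a = Some s")
    case True
    then have c: "is_cross (part a)" "site a = s" by (auto simp: ckey_def split: if_splits)
    have "a = au \<or> a = ao"
      using cross_arc_unique[OF a au(1) c(1)] cross_arc_unique[OF a ao(1) c(1)] au ao c(2) by auto
    then show ?thesis using True au(4) ao(4) by auto
  next
    case False
    then have "a \<noteq> au" "a \<noteq> ao" using au ao by (auto simp: ckey_def)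
    then show ?thesis using False by simp
  qed
qed

context hopf begin

text \<open>The labelling to be exchanged for \<open>pair_label\<close>: this one is the image under
  \<phi> of the crossing labels of J, the other combines the thin and thick labels of J'.\<close>

definition phi_label :: "('i \<times> 'i) \<times> ('i \<times> 'i) \<Rightarrow> unit arc \<Rightarrow> ('k, 'i) double2 letter list" where
  "phi_label i a = (case part a of Cross x du cu do co \<Rightarrow>
     (if over a then [Coeff (phi A (strand_antipode do (axis (snd i) 1)))]
      else [Coeff (phi A (strand_antipode du (axis (fst i) 1)))]) | _ \<Rightarrow> [])"

definition pair_label :: "'i \<times> 'i \<times> 'i \<times> 'i \<Rightarrow> unit arc \<Rightarrow> ('k, 'i) double2 letter list" where
  "pair_label j a = (case part a of Cross x du cu do co \<Rightarrow>
     (if over a then [Coeff (tens (cross_over x du do Thin j) (cross_over x du do Thick j))]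
      else [Coeff (tens (cross_under x du do Thin j) (cross_under x du do Thick j))]) | _ \<Rightarrow> [])"

abbreviation HHone where "HHone \<equiv> HHop_one A"

text \<open>At each crossing \<open>cross_sum\<close> trades states weighted by the entries of R or
  its inverse for quadruples of weight 1.\<close>

lemma crossing_sums:
  assumes cs: "set (concat cs) = arcs D" "distinct (concat cs)" and cl: "length cl = length cs"
  shows "span_eq (tensor_rels (adjoin_rels HH HHone W C) cl)
    (\<Sum>\<sigma>\<in>all_crossings D \<rightarrow>\<^sub>E UNIV. pm_scale (\<Prod>s\<in>all_crossings D. R_of (xtype D s) $ \<sigma> s)
       (gw (site_label ckey phi_label (all_crossings D) L0 \<sigma>) cs))
    (\<Sum>\<tau>\<in>all_crossings D \<rightarrow>\<^sub>E UNIV. gw (site_label ckey pair_label (all_crossings D) L0 \<tau>) cs)"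
proof -
  have "span_eq (tensor_rels (adjoin_rels HH HHone W C) cl)
    (\<Sum>\<sigma>\<in>Pi\<^sub>E (all_crossings D) (\<lambda>_. UNIV). pm_scale (\<Prod>s\<in>all_crossings D. R_of (xtype D s) $ \<sigma> s)
       (gw (site_label ckey phi_label (all_crossings D) L0 \<sigma>) cs))
    (\<Sum>\<tau>\<in>Pi\<^sub>E (all_crossings D) (\<lambda>_. UNIV). pm_scale (\<Prod>s\<in>all_crossings D. 1)
       (gw (site_label ckey pair_label (all_crossings D) L0 \<tau>) cs))"
  proof (rule state_sum_cong[OF finite_all_crossings])
    fix s L0 assume s: "s \<in> all_crossings D"
    obtain x du cu "do" co au ao where x: "xtype D s = x" "au \<in> arcs D" "ao \<in> arcs D" "au \<noteq> ao"
      "part au = Cross x du cu do co" "part ao = Cross x du cu do co" "\<not> over au" "over ao" "site au = s" "site ao = s"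
      using s by (rule crossing_pair)
    have g: "gw (\<lambda>a. if ckey a = Some s then L a else L0 a) cs = (gw (L0(au := L au, ao := L ao)) cs :: _ \<Rightarrow>\<^sub>0 'k)"
      for L :: "unit arc \<Rightarrow> ('k, 'i) double2 letter list" and L0
      unfolding gw_def using words_crossing[OF x(2) _ x(9,7) x(3) _ x(10,8) cs(1), of L L0] x(5,6) by simp
    have m: "au \<in> set (concat cs)" "ao \<in> set (concat cs)" using x(2,3) by (simp_all only: cs)
    have l: "phi_label i au = [Coeff (phi A (strand_antipode du (axis (fst i) 1)))]"
      "phi_label i ao = [Coeff (phi A (strand_antipode do (axis (snd i) 1)))]"
      "pair_label j au = [Coeff (tens (cross_under x du do Thin j) (cross_under x du do Thick j))]"
      "pair_label j ao = [Coeff (tens (cross_over x du do Thin j) (cross_over x du do Thick j))]" for i j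
      using x by (simp_all add: phi_label_def pair_label_def)
    show "span_eq (tensor_rels (adjoin_rels HH HHone W C) cl)
       (\<Sum>i\<in>UNIV. pm_scale (R_of (xtype D s) $ i) (gw (\<lambda>a. if ckey a = Some s then phi_label i a else L0 a) cs))
       (\<Sum>j\<in>UNIV. pm_scale 1 (gw (\<lambda>a. if ckey a = Some s then pair_label j a else L0 a) cs))"
      unfolding g l x(1)
      by (rule gw_sum2[OF m x(4) cs(2) cl]) (simp add: cross_sum)
  qed
  then show ?thesis by simp
qed

lemma foldr_copy_mult: "foldr (copy_mult k) xs z = copy_mult k (foldr (copy_mult k) xs one) z"
  by (induction xs) (simp_all add: copy_mult_assoc)

lemma path_value_append: "path_value k \<sigma> (xs @ ys) = copy_mult k (path_value k \<sigma> ys) (path_value k \<sigma> xs)"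
  unfolding path_value_def rev_append map_append foldr_append by (rule foldr_copy_mult)

lemma path_value_concat:
  "path_value k \<sigma> (concat (map f c)) = foldr (copy_mult k) (map (\<lambda>a. path_value k \<sigma> (f a)) (rev c)) one"
proof (induction c)
  case Nil
  then show ?case by (simp add: path_value_def)
next
  case (Cons a c)
  have "foldr (copy_mult k) (map (\<lambda>a. path_value k \<sigma> (f a)) (rev (a # c))) one
    = foldr (copy_mult k) (map (\<lambda>a. path_value k \<sigma> (f a)) (rev c)) (path_value k \<sigma> (f a))"
    by simp
  also have "\<dots> = copy_mult k (foldr (copy_mult k) (map (\<lambda>a. path_value k \<sigma> (f a)) (rev c)) one) (path_value k \<sigma> (f a))"
    by (rule foldr_copy_mult)
  finally show ?case by (simp only: list.map concat.simps path_value_append Cons.IH)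
qed

text \<open>The thin and thick labels collected along one arc form one letter. An arc without
  crossing yields the letter of the unit, which equals the empty word only modulo the
  relations.\<close>

lemma path_value_zeta:
  assumes a: "a \<in> arcs D"
    and st: "\<And>s cu co. s \<in> all_crossings D \<Longrightarrow> \<sigma> (zeta_site D s cu co) = sel (\<tau> s) cu co"
  shows "[Coeff (tens (path_value Thin \<sigma> (zeta_path D Thin a)) (path_value Thick \<sigma> (zeta_path D Thick a)))]
    = site_label ckey pair_label (all_crossings D) (\<lambda>_. [Coeff HHone]) \<tau> a"
proof -
  obtain h pre p where x: "(h, pre, p) \<in> placed D" "a \<in> piece_arcs h (nbot pre) (ntop pre) p" using a by (rule arc_placeE)
  note sp = site_piece_arcs[OF x(2)]
  show ?thesis
  proof (cases "is_cross p")
    case False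
    then show ?thesis using sp
      by (simp add: zeta_path_eq[OF x] path_value_no_cross site_label_def ckey_def HHop_one_def)
  next
    case True
    then obtain x' du "do" where p: "p = Cross x' du () do ()" by (cases p) auto
    have s: "site a = (h, nbot pre)" "(h, nbot pre) \<in> all_crossings D"
      using sp all_crossingsI[OF a] True by auto
    have z: "\<sigma> (zsite h (nbot pre) (lev1 pre) (lev2 pre) x' du do cu co) = sel (\<tau> (h, nbot pre)) cu co" for cu co
      using st[OF s(2), of cu co] zeta_site_eq[OF x(1)[unfolded p] refl] by simp
    show ?thesis
      using sp s True
      by (cases "over a") (simp_all add: zeta_path_eq[OF x] p path_value_under[OF z] path_value_over[OF z] site_label_def ckey_def pair_label_def del: One_nat_def)
  qed
qed

text \<open>J' multiplies the thin labels in H(A) and the thick ones in the opposite algebra, each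
  along a whole component. The product of the tensor product algebra is componentwise, so the pair
  of products is the product of the pairs, arc by arc; the relations split it into letters, to which
  the exchange at crossings applies.\<close>

lemma heis_J'_state_sum:
  assumes D: "is_diagram D" and comp: "\<And>c. c \<in> set cs \<Longrightarrow> is_component D c"
    and cs: "set (concat cs) = arcs D" "distinct (concat cs)" and cl: "length cl = length cs"
  shows "span_eq (tensor_rels (adjoin_rels HH HHone W C) cl) (heis_J' A D cs)
    (\<Sum>\<sigma>\<in>all_crossings D \<rightarrow>\<^sub>E UNIV. pm_scale (\<Prod>s\<in>all_crossings D. R_of (xtype D s) $ \<sigma> s)
       (gw (site_label ckey phi_label (all_crossings D) (\<lambda>_. []) \<sigma>) cs))"
proof -
  let ?eq = "span_eq (tensor_rels (adjoin_rels HH HHone W C) cl)"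
  let ?L = "\<lambda>\<sigma> a. [Coeff (tens (path_value Thin \<sigma> (zeta_path D Thin a)) (path_value Thick \<sigma> (zeta_path D Thick a)))]"
  have fold: "tens (foldr hm (map f xs) one) (foldr (opp_mult hm) (map g xs) one) = foldr HH (map (\<lambda>a. tens (f a) (g a)) xs) HHone" for f g and xs :: "'z list"
  proof (induction xs)
    case (Cons a xs)
    then show ?case by (simp add: HH_tens opp_mult_def[of hm "g a"] flip: Cons.IH)
  qed (simp add: HHop_one_def)
  have base: "span_eq (adjoin_rels HH HHone W C) (gen (site_label ckey pair_label (all_crossings D) (\<lambda>_. [Coeff HHone]) \<tau> a))
      (gen (site_label ckey pair_label (all_crossings D) (\<lambda>_. []) \<tau> a))" for \<tau> a
    unfolding site_label_def by (cases "ckey a") (auto intro: adj_one)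
  have st: "strand_product A hm \<sigma> c = path_value Thin \<sigma> c" "strand_product A (opp_mult hm) \<sigma> c = path_value Thick \<sigma> c" for \<sigma> c
    by (simp_all add: strand_product_def path_value_def copy_mult_def)
  have "heis_J' A D cs = (\<Sum>\<sigma> \<in> all_crossings (zeta D) \<rightarrow>\<^sub>E UNIV. gen (map (\<lambda>c. [Coeff (tens
      (path_value Thin \<sigma> (concat (map (zeta_path D Thin) c))) (path_value Thick \<sigma> (concat (map (zeta_path D Thick) c))))]) cs))"
    unfolding heis_J'_def all_crossings_def st Let_def
    by (rule sum.cong[OF refl], rule arg_cong[where f=gen], rule map_cong[OF refl])
      (simp only: zeta_component[OF D comp])
  also have "?eq \<dots> (\<Sum>\<sigma> \<in> all_crossings (zeta D) \<rightarrow>\<^sub>E UNIV. gw (?L \<sigma>) cs)"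
  proof (rule span_eq_sum)
    fix \<sigma> :: "point \<Rightarrow> 'i"
    show "?eq (gen (map (\<lambda>c. [Coeff (tens (path_value Thin \<sigma> (concat (map (zeta_path D Thin) c)))
       (path_value Thick \<sigma> (concat (map (zeta_path D Thick) c))))]) cs)) (gw (?L \<sigma>) cs)"
      unfolding gw_def
    proof (rule tensor_gen_cong)
      fix i assume i: "i < length cl"
      let ?v = "\<lambda>a. tens (path_value Thin \<sigma> (zeta_path D Thin a)) (path_value Thick \<sigma> (zeta_path D Thick a))"
      have w: "words (?L \<sigma>) cs ! i = map Coeff (map ?v (rev (cs ! i)))"
        using i cl by (simp add: words_def concat_map_singleton rev_map)
      have v: "tens (path_value Thin \<sigma> (concat (map (zeta_path D Thin) c))) (path_value Thick \<sigma> (concat (map (zeta_path D Thick) c)))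
         = foldr HH (map ?v (rev c)) HHone" for c
        unfolding path_value_concat by (simp add: copy_mult_def fold)
      have "span_eq (adjoin_rels HH HHone W C) (gen [Coeff (foldr HH (map ?v (rev (cs ! i))) HHone)]) (gen (words (?L \<sigma>) cs ! i))"
        unfolding w by (rule span_eq_sym[OF adj_prod])
      then show "span_eq (adjoin_rels HH HHone W C \<union> (if cl ! i then commutators else {}))
         (gen (map (\<lambda>c. [Coeff (tens (path_value Thin \<sigma> (concat (map (zeta_path D Thin) c)))
       (path_value Thick \<sigma> (concat (map (zeta_path D Thick) c))))]) cs ! i)) (gen (words (?L \<sigma>) cs ! i))"
        unfolding nth_map[OF i[unfolded cl]] v by (rule span_eq_mono[OF _ Un_upper1])
    qed (simp_all add: cl)
  qed
  also have "(\<Sum>\<sigma> \<in> all_crossings (zeta D) \<rightarrow>\<^sub>E UNIV. gw (?L \<sigma>) cs)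
    = (\<Sum>\<tau>\<in>all_crossings D \<rightarrow>\<^sub>E UNIV. (gw (site_label ckey pair_label (all_crossings D) (\<lambda>_. [Coeff HHone]) \<tau>) cs :: _ \<Rightarrow>\<^sub>0 'k))"
  proof (rule sum_zeta_states)
    fix \<sigma> :: "point \<Rightarrow> 'i" and \<tau> assume st: "\<And>s cu co. s \<in> all_crossings D \<Longrightarrow> \<sigma> (zeta_site D s cu co) = sel (\<tau> s) cu co"
    show "gw (?L \<sigma>) cs = gw (site_label ckey pair_label (all_crossings D) (\<lambda>_. [Coeff HHone]) \<tau>) cs"
      unfolding gw_def by (rule arg_cong[where f=gen], rule words_cong, rule path_value_zeta[OF _ st]) (simp_all only: cs)
  qed
  also have "?eq \<dots> (\<Sum>\<tau>\<in>all_crossings D \<rightarrow>\<^sub>E UNIV. gw (site_label ckey pair_label (all_crossings D) (\<lambda>_. []) \<tau>) cs)"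
    by (rule span_eq_sum, rule gw_cong[OF cl], rule base)
  also have "?eq \<dots> (\<Sum>\<sigma>\<in>all_crossings D \<rightarrow>\<^sub>E UNIV. pm_scale (\<Prod>s\<in>all_crossings D. R_of (xtype D s) $ \<sigma> s)
       (gw (site_label ckey phi_label (all_crossings D) (\<lambda>_. []) \<sigma>) cs))"
    by (rule span_eq_sym[OF crossing_sums[OF cs cl]])
  finally show ?thesis .
qed

end

section \<open>Powers of \<open>\<theta>\<close> and the choice of base points\<close>

lemma words_map: "map (map f) (words L cs) = words (\<lambda>a. map f (L a)) cs"
  by (simp add: words_def map_concat rev_map comp_def)

text \<open>Moving the base point of a closed component exchanges the two parts of its word, which
  changes it by a commutator.\<close>

lemma base_change:
  fixes R :: "('k::field, 'l) free_algebra set"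
  assumes D: "is_diagram D" and cs: "\<And>c. c \<in> set cs \<Longrightarrow> is_component D c" and cs': "\<And>c. c \<in> set cs' \<Longrightarrow> is_component D c"
    and s: "map set cs' = map set cs"
  shows "map is_closed cs' = map is_closed cs"
    "span_eq (tensor_rels R (map is_closed cs)) (gw L cs) (gw L cs')"
proof -
  have len: "length cs' = length cs" using arg_cong[OF s, of length] by simp
  have i: "set (cs' ! i) = set (cs ! i)" "is_component D (cs ! i)" "is_component D (cs' ! i)" if "i < length cs" for i
    using arg_cong[OF s, of "\<lambda>xs. xs ! i"] that len cs cs' by simp_all
  note rot = component_rotation[OF D i(2) i(3) i(1)[symmetric]]
  show "map is_closed cs' = map is_closed cs"
    by (rule nth_equalityI) (simp_all add: len rot(1))
  show "span_eq (tensor_rels R (map is_closed cs)) (gw L cs) (gw L cs')"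
    unfolding gw_def
  proof (rule tensor_gen_cong)
    fix j assume "j < length (map is_closed cs)"
    then have j: "j < length cs" by simp
    let ?S = "R \<union> (if map is_closed cs ! j then commutators else {})"
    have w: "words L cs ! j = concat (map L (rev (cs ! j)))" "words L cs' ! j = concat (map L (rev (cs' ! j)))"
      using j len by (simp_all add: words_def)
    consider "cs ! j = cs' ! j" | p q where "is_closed (cs ! j)" "cs ! j = p @ q" "cs' ! j = q @ p"
      using rot(2)[OF j j j] by blast
    then show "span_eq ?S (gen (words L cs ! j)) (gen (words L cs' ! j))"
    proof cases
      case 1
      then show ?thesis by (simp add: w)
    next
      case 2
      have "gen (words L cs ! j) - gen (words L cs' ! j) \<in> (commutators :: ('k, 'l) free_algebra set)"
        unfolding commutators_def w 2 by auto
      then show ?thesis using 2(1) j by (intro span_eq_base) simp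
    qed
  qed (simp_all add: len)
qed

text \<open>The exponent of theta in the label that J puts on the arc.\<close>

definition arc_degree :: "unit arc \<Rightarrow> int" where
  "arc_degree a = (if part a = Maximum LeftRight () then 1 else if part a = Minimum LeftRight () then - 1 else 0)"

lemma rotation_degree_Cons: "rotation_degree (a # c) = rotation_degree c + arc_degree a"
  by (simp add: rotation_degree_def arc_degree_def)

lemma theta_power_simps: "theta_power winv 0 = []" "theta_power winv 1 = [Theta]" "theta_power winv (- 1) = [Coeff winv, Theta]"
  by (simp_all add: theta_power_def)

context
  fixes m :: "('k::field, 'm::finite) mult" and one w winv
  assumes w: "m w winv = one" "m winv w = one"
begin

abbreviation (input) "arel \<equiv> adjoin_rels m one w UNIV"

text \<open>The word \<open>[Coeff winv, Theta]\<close> represents the inverse of theta. To the left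
  of theta it cancels by the relation for the square; to the right, \<open>winv\<close> is first
  moved past theta.\<close>

lemma theta_cancel:
  "span_eq arel (gen [Theta, Coeff winv, Theta]) (gen [])" "span_eq arel (gen [Coeff winv, Theta, Theta]) (gen [])"
proof -
  show 2: "span_eq arel (gen [Coeff winv, Theta, Theta]) (gen [])"
  proof -
    have "span_eq arel (gen ([Coeff winv] @ [Theta, Theta])) (gen ([Coeff winv] @ [Coeff w]))"
      by (rule adj_append[OF span_eq_refl adj_theta])
    also have "span_eq arel \<dots> (gen [Coeff one])" using adj_mult[of m one w UNIV winv w] by (simp add: w)
    also have "span_eq arel \<dots> (gen [])" by (rule adj_one)
    finally show ?thesis by simp
  qed
  have "span_eq arel (gen ([Theta, Coeff winv] @ [Theta])) (gen ([Coeff winv, Theta] @ [Theta]))"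
    by (rule adj_append[OF adj_commute span_eq_refl]) simp
  with 2 show "span_eq arel (gen [Theta, Coeff winv, Theta]) (gen [])" by (auto intro: span_eq_trans)
qed

lemma theta_central1: "span_eq arel (gen (Theta # v)) (gen (v @ [Theta]))"
proof (induction v)
  case (Cons l v)
  have "span_eq arel (gen ([Theta, l] @ v)) (gen ([l, Theta] @ v))"
    by (rule adj_append[OF _ span_eq_refl]) (cases l, auto intro: adj_commute)
  also have "span_eq arel (gen ([l, Theta] @ v)) (gen ([l] @ v @ [Theta]))"
    using adj_append[OF span_eq_refl[of _ "gen [l]"] Cons] by simp
  finally show ?case by simp
qed simp

text \<open>With t for the inverse of theta, v t = t theta v t = t v theta t = t v. The detour
  derives centrality of t from that of theta; the relations say nothing directly about
  \<open>winv\<close> commuting with other coefficients.\<close>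

lemma theta_inv_central1: "span_eq arel (gen (v @ [Coeff winv, Theta])) (gen ([Coeff winv, Theta] @ v))"
proof -
  let ?i = "[Coeff winv, Theta]"
  have "span_eq arel (gen ([] @ v @ ?i)) (gen (?i @ [Theta] @ v @ ?i))"
    using adj_append[OF span_eq_sym[OF theta_cancel(2)] span_eq_refl[of _ "gen (v @ ?i)"]] by simp
  also have "span_eq arel \<dots> (gen (?i @ v @ [Theta] @ ?i))"
    using adj_append[OF span_eq_refl[of _ "gen ?i"] adj_append[OF theta_central1[of v] span_eq_refl[of _ "gen ?i"]]] by simp
  also have "span_eq arel \<dots> (gen ((?i @ v) @ []))"
    using adj_append[OF span_eq_refl[of _ "gen (?i @ v)"] theta_cancel(1)] by simp
  finally show ?thesis by simp
qed

lemma theta_power_step: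
  "span_eq arel (gen (theta_power winv d @ [Theta])) (gen (theta_power winv (d + 1)))"
  "span_eq arel (gen (theta_power winv d @ [Coeff winv, Theta])) (gen (theta_power winv (d - 1)))"
proof -
  have r: "replicate (Suc n) x = replicate n x @ [x]" for n and x :: 'z by (simp add: replicate_append_same)
  show "span_eq arel (gen (theta_power winv d @ [Theta])) (gen (theta_power winv (d + 1)))"
  proof (cases "d \<ge> 0")
    case True
    then have "nat (d + 1) = Suc (nat d)" by simp
    then show ?thesis using True by (simp add: theta_power_def replicate_append_same)
  next
    case False
    then have n: "nat (- d) = Suc (nat (- (d + 1)))" by simp
    have "theta_power winv d @ [Theta] = concat (replicate (nat (- (d + 1))) [Coeff winv, Theta]) @ [Coeff winv, Theta, Theta]"
      using False unfolding theta_power_def n r by simp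
    moreover have "theta_power winv (d + 1) = concat (replicate (nat (- (d + 1))) [Coeff winv, Theta]) @ []"
      using False by (auto simp: theta_power_def)
    ultimately show ?thesis by (simp only: adj_append[OF span_eq_refl theta_cancel(2)])
  qed
  show "span_eq arel (gen (theta_power winv d @ [Coeff winv, Theta])) (gen (theta_power winv (d - 1)))"
  proof (cases "d > 0")
    case True
    then have n: "nat d = Suc (nat (d - 1))" by simp
    have "theta_power winv d @ [Coeff winv, Theta] = replicate (nat (d - 1)) Theta @ [Theta, Coeff winv, Theta]"
      using True unfolding theta_power_def n r by simp
    moreover have "theta_power winv (d - 1) = replicate (nat (d - 1)) Theta @ []"
      using True by (auto simp: theta_power_def)
    ultimately show ?thesis by (simp only: adj_append[OF span_eq_refl theta_cancel(1)])
  next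
    case False
    have n: "nat (- (d - 1)) = Suc (nat (- d))" using False by simp
    have "theta_power winv (d - 1) = concat (replicate (nat (- d)) [Coeff winv, Theta]) @ [Coeff winv, Theta]"
      using False unfolding theta_power_def n r by simp
    moreover have "theta_power winv d = concat (replicate (nat (- d)) [Coeff winv, Theta])"
      using False by (auto simp: theta_power_def)
    ultimately show ?thesis by simp
  qed
qed

lemma theta_collect:
  assumes L: "\<And>a. a \<in> set c \<Longrightarrow> span_eq arel (gen (L a)) (gen (K a @ theta_power winv (arc_degree a)))"
  shows "span_eq arel (gen (concat (map L (rev c)))) (gen (theta_power winv (rotation_degree c) @ concat (map K (rev c))))"
  using L
proof (induction c)
  case Nil
  then show ?case by (simp add: rotation_degree_def theta_power_def)
next
  case (Cons a c)
  let ?t = "theta_power winv" and ?K = "concat (map K (rev c)) @ K a"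
  have "span_eq arel (gen (concat (map L (rev c)) @ L a))
     (gen ((?t (rotation_degree c) @ concat (map K (rev c))) @ (K a @ ?t (arc_degree a))))"
    by (rule adj_append) (use Cons in auto)
  also have "span_eq arel \<dots> (gen (?t (rotation_degree c) @ (?t (arc_degree a) @ ?K)))"
  proof -
    have "span_eq arel (gen (?K @ ?t (arc_degree a))) (gen (?t (arc_degree a) @ ?K))"
      using theta_inv_central1[of ?K] span_eq_sym[OF theta_central1[of ?K]]
      by (simp add: arc_degree_def theta_power_simps)
    from adj_append[OF span_eq_refl[of _ "gen (?t (rotation_degree c))"] this] show ?thesis by simp
  qed
  also have "span_eq arel \<dots> (gen (?t (rotation_degree (a # c)) @ ?K))"
  proof -
    have "span_eq arel (gen (?t (rotation_degree c) @ ?t (arc_degree a))) (gen (?t (rotation_degree c + arc_degree a)))"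
      using theta_power_step[of "rotation_degree c"] by (simp add: arc_degree_def theta_power_simps)
    from adj_append[OF this span_eq_refl[of _ "gen ?K"]] show ?thesis unfolding rotation_degree_Cons by simp
  qed
  finally show ?case by simp
qed

end

text \<open>All components count as open here: left multiplication by a word preserves the ideal of
  relations, but not the span of the commutators.\<close>

lemma tensor_rels_prefix:
  assumes r: "r \<in> tensor_rels (adjoin_rels m one w C) (replicate n False)" and ts: "length ts = n"
  shows "pm_push (map2 (@) ts) r \<in> tensor_rels (adjoin_rels m one w C) (replicate n False)"
proof -
  obtain ws i r0 where r0: "r = pm_push (\<lambda>v. ws[i := v]) r0" "length ws = n" "i < n" "r0 \<in> adjoin_rels m one w C"
    using r unfolding tensor_rels_def by auto
  have e: "map2 (@) ts (ws[i := v]) = (map2 (@) ts ws)[i := ts ! i @ v @ []]" for v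
    using ts r0(2,3) by (intro nth_equalityI) (auto simp: nth_list_update)
  have "pm_push (map2 (@) ts) r = pm_push (\<lambda>v. (map2 (@) ts ws)[i := v]) (pm_push (\<lambda>v. ts ! i @ v @ []) r0)"
    unfolding r0(1) pm_push_comp e ..
  moreover have "pm_push (\<lambda>v. ts ! i @ v @ []) r0 \<in> adjoin_rels m one w C" by (rule adjoin_context[OF r0(4)])
  ultimately show ?thesis unfolding tensor_rels_def using ts r0(2,3) by fastforce
qed

lemma tensor_rels_mono:
  assumes l: "length cl = n"
  shows "tensor_rels R (replicate n False) \<subseteq> tensor_rels R cl"
  unfolding tensor_rels_def using l by fastforce

section \<open>\<open>J\<close> of the leftward diagram\<close>

lemma xtype_arc: "a \<in> arcs D \<Longrightarrow> part a = Cross x du cu do co \<Longrightarrow> xtype D (site a) = x"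
  using crossingsI[of a D x] crossings_disjoint[of D] by (cases x) (auto simp: xtype_def)

text \<open>The crossing of \<open>leftward D\<close> that governs the label of an arc of \<open>D\<close>.\<close>

definition left_key :: "unit diagram \<Rightarrow> unit arc \<Rightarrow> point option" where
  "left_key D a = (case place D a of (h, pre, p) \<Rightarrow>
     (if is_cross p \<or> p = Maximum LeftRight () then Some (2 * h, nbot pre)
      else if p = Minimum LeftRight () then Some (2 * h + 1, lev pre) else None))"

lemma left_key_eq:
  assumes "(h, pre, p) \<in> placed D" "a \<in> piece_arcs h (nbot pre) (ntop pre) p"
  shows "left_key D a = (if is_cross p \<or> p = Maximum LeftRight () then Some (2 * h, nbot pre)
      else if p = Minimum LeftRight () then Some (2 * h + 1, lev pre) else None)"
  by (simp add: left_key_def place_eq[OF assms])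

lemma left_key_cross: "a \<in> arcs D \<Longrightarrow> is_cross (part a) \<Longrightarrow> left_key D a = Some (2 * fst (site a), snd (site a))"
proof -
  assume a: "a \<in> arcs D" "is_cross (part a)"
  obtain h pre p where x: "(h, pre, p) \<in> placed D" "a \<in> piece_arcs h (nbot pre) (ntop pre) p" using a(1) by (rule arc_placeE)
  show ?thesis using site_piece_arcs[OF x(2)] a(2) by (simp add: left_key_eq[OF x])
qed

text \<open>The type of the crossing of the leftward diagram attached to \<open>p\<close>: its own
  type for a crossing, the type in the curl for an extremum from left to right.\<close>

definition left_xing :: "unit piece \<Rightarrow> xing" where
  "left_xing p = (case p of Cross x du cu do co \<Rightarrow> x | Maximum e c \<Rightarrow> XMinus | _ \<Rightarrow> XPlus)"

lemma left_key_lfrag: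
  assumes k: "(if is_cross p \<or> p = Maximum LeftRight () then Some (2 * h, b)
      else if p = Minimum LeftRight () then Some (2 * h + 1, r) else None) = Some s"
  shows "\<exists>y\<in>lfrag h b t r p. is_cross (part y) \<and> over y \<and> site y = s \<and>
    (\<exists>du cu do co. part y = Cross (left_xing p) du cu do co)"
  using k by (cases p rule: unit_piece_exhaust; simp add: lfrag_def zsimps left_xing_def)

lemma left_key_arc:
  assumes x: "(h, pre, p) \<in> placed D" "a \<in> piece_arcs h (nbot pre) (ntop pre) p" and k: "left_key D a = Some s"
  obtains y where "y \<in> arcs (leftward D)" "y \<in> frag 2 curl_piece h pre p" "is_cross (part y)" "over y" "site y = s"
    "xtype (leftward D) s = left_xing p"
proof -
  obtain y du cu "do" co where y: "y \<in> lfrag h (nbot pre) (ntop pre) (lev pre) p" "is_cross (part y)" "over y" "site y = s"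
    "part y = Cross (left_xing p) du cu do co"
    using left_key_lfrag[OF k[unfolded left_key_eq[OF x]], of "ntop pre"] by blast
  have m: "y \<in> arcs (leftward D)" unfolding arcs_leftward using x(1) y(1) by blast
  show ?thesis by (rule that[OF m y(1)[folded frag_leftward] y(2-4)]) (use xtype_arc[OF m y(5)] y(4) in simp)
qed

text \<open>The key is the site of a crossing of the leftward diagram, whose over-arc lies in the
  fragment of a single piece.\<close>

lemma left_key_place:
  assumes a: "(h, pre, p) \<in> placed D" "a \<in> piece_arcs h (nbot pre) (ntop pre) p"
    and b: "(h', pre', p') \<in> placed D" "b \<in> piece_arcs h' (nbot pre') (ntop pre') p'"
    and k: "left_key D a = Some s" "left_key D b = Some s"
  shows "(h, pre, p) = (h', pre', p')"
proof -
  obtain y where y: "y \<in> arcs (leftward D)" "y \<in> frag 2 curl_piece h pre p" "is_cross (part y)" "over y" "site y = s"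
    using a k(1) by (rule left_key_arc)
  obtain z where z: "z \<in> arcs (leftward D)" "z \<in> frag 2 curl_piece h' pre' p'" "is_cross (part z)" "over z" "site z = s"
    using b k(2) by (rule left_key_arc)
  have "y = z" by (rule cross_arc_unique[OF y(1) z(1) y(3) z(3)]) (use y z in simp_all)
  then show ?thesis using frag_disjoint[OF a(1) b(1)] y(2) z(2) by blast
qed

lemma left_key_crossings: "left_key D a = Some s \<Longrightarrow> a \<in> arcs D \<Longrightarrow> s \<in> all_crossings (leftward D)"
proof -
  assume k: "left_key D a = Some s" and a: "a \<in> arcs D"
  obtain h pre p where x: "(h, pre, p) \<in> placed D" "a \<in> piece_arcs h (nbot pre) (ntop pre) p" using a by (rule arc_placeE)
  obtain y where "y \<in> arcs (leftward D)" "is_cross (part y)" "site y = s" using x k by (rule left_key_arc)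
  then show ?thesis using all_crossingsI by blast
qed

lemma lpath_key:
  assumes "a \<in> piece_arcs h b t p" "y \<in> set (lpath h b t r p (over a))" "is_cross (part y)"
  shows "(if is_cross p \<or> p = Maximum LeftRight () then Some (2 * h, b)
      else if p = Minimum LeftRight () then Some (2 * h + 1, r) else None) = Some (site y)"
  using assms by (cases p rule: unit_piece_exhaust; auto simp: zsimps)

lemma all_crossings_leftwardE:
  assumes "s \<in> all_crossings (leftward D)"
  obtains h pre p a where "(h, pre, p) \<in> placed D" "a \<in> piece_arcs h (nbot pre) (ntop pre) p" "a \<in> arcs D" "left_key D a = Some s"
proof -
  obtain y where y: "y \<in> arcs (leftward D)" "is_cross (part y)" "s = site y" using assms unfolding all_crossings_eq by blast
  obtain h pre p a where x: "(h, pre, p) \<in> placed D" "a \<in> piece_arcs h (nbot pre) (ntop pre) p"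
    "y \<in> set (lpath h (nbot pre) (ntop pre) (lev pre) p (over a))" using y(1) by (rule arcs_leftwardE)
  have m: "a \<in> arcs D" using x(1,2) unfolding arcs_placed by blast
  show ?thesis
    by (rule that[OF x(1,2) m]) (simp only: left_key_eq[OF x(1,2)] lpath_key[OF x(2,3) y(2)] y(3))
qed

lemma sum_PiE_inj:
  assumes inj: "inj_on g S"
    and FG: "\<And>\<sigma> \<tau>. (\<And>s. s \<in> S \<Longrightarrow> \<sigma> (g s) = \<tau> s) \<Longrightarrow> F \<sigma> = G \<tau>"
  shows "(\<Sum>\<sigma>\<in>g ` S \<rightarrow>\<^sub>E X. F \<sigma>) = (\<Sum>\<tau>\<in>S \<rightarrow>\<^sub>E X. G \<tau>)"
proof (rule sum.reindex_bij_witness[where i = "\<lambda>\<tau>. restrict (\<lambda>q. \<tau> (inv_into S g q)) (g ` S)" and j = "\<lambda>\<sigma>. restrict (\<lambda>s. \<sigma> (g s)) S"])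
  fix \<sigma> assume s: "\<sigma> \<in> g ` S \<rightarrow>\<^sub>E X"
  show "restrict (\<lambda>q. restrict (\<lambda>s. \<sigma> (g s)) S (inv_into S g q)) (g ` S) = \<sigma>"
  proof (rule ext)
    fix q show "restrict (\<lambda>q. restrict (\<lambda>s. \<sigma> (g s)) S (inv_into S g q)) (g ` S) q = \<sigma> q"
    proof (cases "q \<in> g ` S")
      case True
      then show ?thesis by (simp add: inv_into_into f_inv_into_f)
    next
      case False
      then show ?thesis using PiE_arb[OF s False] by (simp only: restrict_apply if_False)
    qed
  qed
  show "restrict (\<lambda>s. \<sigma> (g s)) S \<in> S \<rightarrow>\<^sub>E X"
    using PiE_mem[OF s] by (intro restrict_PiE_iff[THEN iffD2] ballI) simp
  show "G (restrict (\<lambda>s. \<sigma> (g s)) S) = F \<sigma>" by (rule FG[symmetric]) simp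
next
  fix \<tau> assume t: "\<tau> \<in> S \<rightarrow>\<^sub>E X"
  show "restrict (\<lambda>s. restrict (\<lambda>q. \<tau> (inv_into S g q)) (g ` S) (g s)) S = \<tau>"
  proof (rule ext)
    fix s show "restrict (\<lambda>s. restrict (\<lambda>q. \<tau> (inv_into S g q)) (g ` S) (g s)) S s = \<tau> s"
    proof (cases "s \<in> S")
      case True
      then show ?thesis by (simp add: inv_into_f_f[OF inj])
    next
      case False
      then show ?thesis using PiE_arb[OF t False] by (simp only: restrict_apply if_False)
    qed
  qed
  show "restrict (\<lambda>q. \<tau> (inv_into S g q)) (g ` S) \<in> g ` S \<rightarrow>\<^sub>E X"
    using PiE_mem[OF t] by (intro restrict_PiE_iff[THEN iffD2] ballI) (simp add: inv_into_into)
qed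

section \<open>Elimination of the curls\<close>

context hopf begin

abbreviation arc_J :: "(point \<Rightarrow> ('i \<times> 'i) \<times> ('i \<times> 'i)) \<Rightarrow> unit arc \<Rightarrow> ('k, 'i) double letter list" where
  "arc_J \<sigma> a \<equiv> J_label A \<sigma> (site a) (part a) (over a)"

definition J_sum :: "unit diagram \<Rightarrow> unit arc list list \<Rightarrow> (('k, 'i) double letter list list \<Rightarrow>\<^sub>0 'k)" where
  "J_sum D cs = (\<Sum>\<sigma>\<in>all_crossings D \<rightarrow>\<^sub>E UNIV.
     pm_scale (\<Prod>s\<in>all_crossings D. R_of (xtype D s) $ \<sigma> s) (gw (arc_J \<sigma>) cs))"

lemma univ_J_eq: "univ_J A D cs = tensor_class (drinfeld_theta_rels A) (map is_closed cs) (J_sum D cs)"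
proof -
  have "(\<Prod>s\<in>all_crossings D. R_of (xtype D s) $ \<sigma> s) = (\<Prod>s\<in>crossings D XPlus. R_matrix A $ \<sigma> s) * (\<Prod>s\<in>crossings D XMinus. R_inverse A $ \<sigma> s)"
    for \<sigma> :: "point \<Rightarrow> ('i \<times> 'i) \<times> ('i \<times> 'i)"
    using prod_all_crossings[of "\<lambda>x s. R_of x $ \<sigma> s" D] by simp
  then show ?thesis unfolding univ_J_def J_sum_def gw_def words_def all_crossings_def by simp
qed

text \<open>What an arc of \<open>D\<close> contributes when its path through the leftward diagram
  is read. In a curl the over-strand is passed last, so against the orientation its label comes
  first.\<close>

definition curl_label :: "('i \<times> 'i) \<times> ('i \<times> 'i) \<Rightarrow> unit arc \<Rightarrow> ('k, 'i) double letter list" where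
  "curl_label i a = (case part a of
     Cross x du cu do co \<Rightarrow> (if over a then [Coeff (strand_antipode do (axis (snd i) 1))]
        else [Coeff (strand_antipode du (axis (fst i) 1))])
   | Maximum LeftRight c \<Rightarrow> [Coeff (axis (snd i) 1), Coeff (Da (axis (fst i) 1))]
   | Minimum LeftRight c \<Rightarrow> [Coeff (Da (axis (snd i) 1)), Coeff (axis (fst i) 1)]
   | _ \<Rightarrow> [])"

text \<open>The labels once the states of the curls are summed out; at extrema they are the parts of
  the labels of J without theta.\<close>

definition turn_label :: "('i \<times> 'i) \<times> ('i \<times> 'i) \<Rightarrow> unit arc \<Rightarrow> ('k, 'i) double letter list" where
  "turn_label i a = (case part a of Maximum LeftRight c \<Rightarrow> [Coeff uinv]
   | Minimum LeftRight c \<Rightarrow> [Coeff u] | _ \<Rightarrow> curl_label i a)"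

lemma lpath_label:
  assumes "a \<in> piece_arcs h b t p" "(if is_cross p \<or> p = Maximum LeftRight () then Some (2 * h, b)
      else if p = Minimum LeftRight () then Some (2 * h + 1, r) else None) = k"
  shows "concat (map (arc_J \<sigma>) (rev (lpath h b t r p (over a)))) = (case k of None \<Rightarrow> [] | Some s \<Rightarrow> curl_label (\<sigma> s) a)"
  using assms by (cases p rule: unit_piece_exhaust; auto simp: zsimps curl_label_def strand_antipode_def)

lemma left_label:
  assumes a: "a \<in> arcs D"
  shows "concat (map (arc_J \<sigma>) (rev (left_path D a))) = site_label (left_key D) curl_label (all_crossings (leftward D)) (\<lambda>_. []) \<sigma> a"
proof -
  obtain h pre p where x: "(h, pre, p) \<in> placed D" "a \<in> piece_arcs h (nbot pre) (ntop pre) p" using a by (rule arc_placeE)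
  show ?thesis unfolding left_path_eq[OF x] lpath_label[OF x(2) left_key_eq[OF x, symmetric]] site_label_def
    using left_key_crossings[OF _ a] by (cases "left_key D a") auto
qed

end

lemma is_cross_cases:
  fixes p :: "unit piece"
  assumes "(if is_cross p \<or> p = Maximum LeftRight () then Some z else if p = Minimum LeftRight () then Some z' else None) = Some s" "\<not> is_cross p"
  shows "p = Maximum LeftRight () \<or> p = Minimum LeftRight ()"
  using assms by (cases "p = Maximum LeftRight ()"; cases "p = Minimum LeftRight ()") simp_all

lemma words_key:
  assumes cs: "set (concat cs) = arcs D"
    and u: "\<And>a'. a' \<in> arcs D \<Longrightarrow> key a' = Some s \<longleftrightarrow> a' = a"
  shows "words (\<lambda>a. if key a = Some s then L a else L0 a) cs = words (L0(a := L a)) cs"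
proof (rule words_cong)
  fix a' assume "a' \<in> set (concat cs)"
  then have "a' \<in> arcs D" by (simp only: cs)
  from u[OF this] show "(if key a' = Some s then L a' else L0 a') = (L0(a := L a)) a'" by simp
qed

definition cross_emb :: "point \<Rightarrow> point" where
  "cross_emb s = (2 * fst s, snd s)"

lemma inj_cross_emb: "inj_on cross_emb S"
  by (rule inj_onI) (simp add: cross_emb_def prod_eq_iff)

lemma left_key_None:
  assumes "left_key D a = None" "a \<in> arcs D"
  shows "\<not> is_cross (part a)" "part a \<noteq> Maximum LeftRight ()" "part a \<noteq> Minimum LeftRight ()"
proof -
  obtain h pre p where x: "(h, pre, p) \<in> placed D" "a \<in> piece_arcs h (nbot pre) (ntop pre) p" using assms(2) by (rule arc_placeE)
  show "\<not> is_cross (part a)" "part a \<noteq> Maximum LeftRight ()" "part a \<noteq> Minimum LeftRight ()"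
    using assms(1) unfolding left_key_eq[OF x] using site_piece_arcs[OF x(2)] by (auto split: if_splits)
qed

lemma cross_emb_crossing:
  assumes "s \<in> all_crossings D"
  shows "cross_emb s \<in> all_crossings (leftward D)" "xtype (leftward D) (cross_emb s) = xtype D s"
    "\<exists>a\<in>arcs D. is_cross (part a) \<and> left_key D a = Some (cross_emb s)"
proof -
  obtain a where a: "a \<in> arcs D" "is_cross (part a)" "s = site a" using assms unfolding all_crossings_eq by blast
  have k: "left_key D a = Some (cross_emb s)" using left_key_cross[OF a(1,2)] a(3) by (simp add: cross_emb_def)
  obtain h pre p where x: "(h, pre, p) \<in> placed D" "a \<in> piece_arcs h (nbot pre) (ntop pre) p" using a(1) by (rule arc_placeE)
  have p: "part a = p" using site_piece_arcs[OF x(2)] by simp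
  obtain x' du cu "do" co where pe: "p = Cross x' du cu do co" using a(2) p is_cross_iff by metis
  show "cross_emb s \<in> all_crossings (leftward D)" by (rule left_key_crossings[OF k a(1)])
  obtain y where y: "xtype (leftward D) (cross_emb s) = left_xing p" using x k by (rule left_key_arc)
  then show "xtype (leftward D) (cross_emb s) = xtype D s"
    using xtype_arc[OF a(1)] p pe a(3) by (simp add: left_xing_def)
  show "\<exists>a\<in>arcs D. is_cross (part a) \<and> left_key D a = Some (cross_emb s)" using a(1,2) k by blast
qed

context hopf begin

abbreviation "drel \<equiv> adjoin_rels Dm one theta2 UNIV"

lemma turn_label_cross: "is_cross (part a) \<Longrightarrow> turn_label i a = curl_label i a"
  by (cases "part a") (simp_all add: turn_label_def)

lemma turn_label_const: "\<not> is_cross (part a) \<Longrightarrow> turn_label i a = turn_label j a"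
  by (cases "part a" rule: unit_piece_exhaust) (simp_all add: turn_label_def curl_label_def)

lemma turn_label_plain:
  "\<not> is_cross (part a) \<Longrightarrow> part a \<noteq> Maximum LeftRight () \<Longrightarrow> part a \<noteq> Minimum LeftRight () \<Longrightarrow> turn_label i a = []"
  by (cases "part a" rule: unit_piece_exhaust) (simp_all add: turn_label_def curl_label_def)

text \<open>The right-hand side is a sum over one dummy state, the form that
  \<open>state_sum_cong\<close> expects when a site is summed out.\<close>

lemma curl_sum:
  assumes "p = Maximum LeftRight () \<or> p = Minimum LeftRight ()" "part a = p"
  shows "span_eq drel (\<Sum>i\<in>UNIV. pm_scale (R_of (left_xing p) $ i) (gen (curl_label i a)))
    (\<Sum>j\<in>{undefined}. pm_scale 1 (gen (turn_label j a)))"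
proof -
  have main: "span_eq drel (\<Sum>i\<in>UNIV. pm_scale (c i) (gen [Coeff (f i), Coeff (g i)])) (gen [Coeff (\<Sum>i\<in>UNIV. c i *s Dm (f i) (g i))])"
    for c :: "('i \<times> 'i) \<times> ('i \<times> 'i) \<Rightarrow> 'k" and f g
  proof -
    have "span_eq drel (\<Sum>i\<in>UNIV. pm_scale (c i) (gen [Coeff (f i), Coeff (g i)])) (\<Sum>i\<in>UNIV. pm_scale (c i) (gen [Coeff (Dm (f i) (g i))]))"
      by (rule span_eq_sum, rule span_eq_scale, rule adj_mult)
    also have "span_eq drel \<dots> (gen [Coeff (\<Sum>i\<in>UNIV. c i *s Dm (f i) (g i))])" by (rule span_eq_sym[OF adj_sum])
    finally show ?thesis .
  qed
  from assms(1) show ?thesis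
  proof
    assume p: "p = Maximum LeftRight ()"
    show ?thesis
      using main[of "\<lambda>i. R_of XMinus $ i" "\<lambda>i. axis (snd i) 1" "\<lambda>i. Da (axis (fst i) 1)", unfolded uinv_eq] assms(2)
      by (simp add: p curl_label_def turn_label_def left_xing_def)
  next
    assume p: "p = Minimum LeftRight ()"
    show ?thesis
      using main[of "\<lambda>i. R_of XPlus $ i" "\<lambda>i. Da (axis (snd i) 1)" "\<lambda>i. axis (fst i) 1", unfolded u_eq'] assms(2)
      by (simp add: p curl_label_def turn_label_def left_xing_def)
  qed
qed

definition turn_sum :: "unit diagram \<Rightarrow> unit arc list list \<Rightarrow> (('k, 'i) double letter list list \<Rightarrow>\<^sub>0 'k)" where
  "turn_sum D cs = (\<Sum>\<sigma>\<in>all_crossings D \<rightarrow>\<^sub>E UNIV.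
     pm_scale (\<Prod>s\<in>all_crossings D. R_of (xtype D s) $ \<sigma> s) (gw (\<lambda>a. turn_label (\<sigma> (site a)) a) cs))"

lemma leftward_sum:
  assumes D: "is_diagram D" and comp: "\<And>c. c \<in> set cs \<Longrightarrow> is_component D c" and cs: "set (concat cs) = arcs D"
  shows "J_sum (leftward D) (map (leftward_component D) cs) = (\<Sum>\<sigma>\<in>all_crossings (leftward D) \<rightarrow>\<^sub>E UNIV.
     pm_scale (\<Prod>s\<in>all_crossings (leftward D). R_of (xtype (leftward D) s) $ \<sigma> s)
       (gw (site_label (left_key D) curl_label (all_crossings (leftward D)) (\<lambda>_. []) \<sigma>) cs))"
proof -
  have "words (arc_J \<sigma>) (map (leftward_component D) cs) = words (\<lambda>a. concat (map (arc_J \<sigma>) (rev (left_path D a)))) cs" for \<sigma>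
  proof -
    have "concat (map (arc_J \<sigma>) (rev (leftward_component D c))) = concat (map (\<lambda>a. concat (map (arc_J \<sigma>) (rev (left_path D a)))) (rev c))"
      if "c \<in> set cs" for c
      unfolding left_component(1)[OF D comp[OF that]] by (induction c) simp_all
    then show ?thesis by (simp add: words_def)
  qed
  moreover have "words (\<lambda>a. concat (map (arc_J \<sigma>) (rev (left_path D a)))) cs
     = words (site_label (left_key D) curl_label (all_crossings (leftward D)) (\<lambda>_. []) \<sigma>) cs" for \<sigma>
    by (rule words_cong, rule left_label) (simp only: cs)
  ultimately show ?thesis unfolding J_sum_def gw_def by simp
qed

text \<open>The two labels that the crossing of a curl puts on its strand sum up to \<open>u\<close> or \<open>u\<^sup>-\<^sup>1\<close>. The
  remaining states take the value \<^term>\<open>undefined\<close> at the curls, as extensional functions on the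
  other crossings do.\<close>

lemma curl_elimination:
  assumes cs: "set (concat cs) = arcs D" "distinct (concat cs)" and cl: "length cl = length cs"
  defines "S' \<equiv> all_crossings (leftward D)" and "Sc \<equiv> cross_emb ` all_crossings D"
  shows "span_eq (tensor_rels drel cl)
    (\<Sum>\<sigma>\<in>Pi\<^sub>E S' (\<lambda>_. UNIV). pm_scale (\<Prod>s\<in>S'. R_of (xtype (leftward D) s) $ \<sigma> s) (gw (site_label (left_key D) curl_label S' L0 \<sigma>) cs))
    (\<Sum>\<sigma>\<in>Pi\<^sub>E S' (\<lambda>s. if s \<in> Sc then UNIV else {undefined}).
      pm_scale (\<Prod>s\<in>S'. if s \<in> Sc then R_of (xtype (leftward D) s) $ \<sigma> s else 1) (gw (site_label (left_key D) turn_label S' L0 \<sigma>) cs))"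
proof (rule state_sum_cong)
  show "finite S'" unfolding S'_def by (rule finite_all_crossings)
  fix s L0 assume "s \<in> S'"
  then obtain h pre p a where x: "(h, pre, p) \<in> placed D" "a \<in> piece_arcs h (nbot pre) (ntop pre) p" "a \<in> arcs D" "left_key D a = Some s"
    unfolding S'_def by (rule all_crossings_leftwardE)
  have pa: "part a = p" "site a = (h, nbot pre)" using site_piece_arcs[OF x(2)] by simp_all
  have same: "b \<in> piece_arcs h (nbot pre) (ntop pre) p" if b: "b \<in> arcs D" "left_key D b = Some s" for b
  proof -
    obtain h' pre' p' where y: "(h', pre', p') \<in> placed D" "b \<in> piece_arcs h' (nbot pre') (ntop pre') p'" using b(1) by (rule arc_placeE)
    show ?thesis using left_key_place[OF x(1,2) y x(4) b(2)] y(2) by simp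
  qed
  show "span_eq (tensor_rels drel cl)
     (\<Sum>i\<in>UNIV. pm_scale (R_of (xtype (leftward D) s) $ i) (gw (\<lambda>a. if left_key D a = Some s then curl_label i a else L0 a) cs))
     (\<Sum>j\<in>(if s \<in> Sc then UNIV else {undefined}). pm_scale (if s \<in> Sc then R_of (xtype (leftward D) s) $ j else 1)
        (gw (\<lambda>a. if left_key D a = Some s then turn_label j a else L0 a) cs))"
  proof (cases "is_cross p")
    case True
    have "site a \<in> all_crossings D" by (rule all_crossingsI[OF x(3)]) (simp add: pa True)
    moreover have "s = cross_emb (site a)" using left_key_cross[OF x(3)] x(4) True pa(1) by (simp add: cross_emb_def)
    ultimately have sc: "s \<in> Sc" unfolding Sc_def by blast
    have "words (\<lambda>a. if left_key D a = Some s then curl_label i a else L0 a) cs = words (\<lambda>a. if left_key D a = Some s then turn_label i a else L0 a) cs" for i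
    proof (rule words_cong)
      fix b assume "b \<in> set (concat cs)"
      then have b: "b \<in> arcs D" by (simp only: cs)
      show "(if left_key D b = Some s then curl_label i b else L0 b) = (if left_key D b = Some s then turn_label i b else L0 b)"
      proof (cases "left_key D b = Some s")
        case k: True
        have "part b = p" using site_piece_arcs[OF same[OF b k]] by simp
        then show ?thesis using True by (simp add: turn_label_cross)
      qed simp
    qed
    then show ?thesis using sc by (simp add: gw_def)
  next
    case False
    have p: "p = Maximum LeftRight () \<or> p = Minimum LeftRight ()"
      using x(4) unfolding left_key_eq[OF x(1,2)] by (rule is_cross_cases) (rule False)
    have nsc: "s \<notin> Sc"
    proof
      assume "s \<in> Sc"
      then obtain s0 where s0: "s0 \<in> all_crossings D" "s = cross_emb s0" unfolding Sc_def by blast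
      obtain b where b: "b \<in> arcs D" "is_cross (part b)" "left_key D b = Some s"
        using cross_emb_crossing(3)[OF s0(1)] s0(2) by blast
      show False using site_piece_arcs[OF same[OF b(1,3)]] b(2) False by simp
    qed
    \<comment> \<open>An extremum consists of a single arc, so the crossing of a curl governs that
      arc alone.\<close>
    have u: "left_key D b = Some s \<longleftrightarrow> b = a" if b: "b \<in> arcs D" for b
    proof
      assume "left_key D b = Some s"
      from same[OF b this] x(2) p show "b = a" by auto
    qed (simp add: x(4))
    have w: "gw (\<lambda>b. if left_key D b = Some s then L b else L0 b) cs = (gw (L0(a := L a)) cs :: _ \<Rightarrow>\<^sub>0 'k)"
      for L :: "unit arc \<Rightarrow> ('k, 'i) double letter list"
      unfolding gw_def using words_key[OF cs(1) u, where L = L and ?L0.0 = L0] by simp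
    obtain y where y: "xtype (leftward D) s = left_xing p" using x(1,2,4) by (rule left_key_arc)
    have m: "a \<in> set (concat cs)" using x(3) by (simp only: cs)
    show ?thesis unfolding w y if_not_P[OF nsc]
      by (rule gw_sum1[OF m cs(2) cl curl_sum[OF p pa(1)]])
  qed
qed

lemma turn_sum_eq:
  assumes cs: "set (concat cs) = arcs D"
  defines "S' \<equiv> all_crossings (leftward D)" and "Sc \<equiv> cross_emb ` all_crossings D"
  shows "(\<Sum>\<sigma>\<in>Pi\<^sub>E S' (\<lambda>s. if s \<in> Sc then UNIV else {undefined}).
      pm_scale (\<Prod>s\<in>S'. if s \<in> Sc then R_of (xtype (leftward D) s) $ \<sigma> s else 1) (gw (site_label (left_key D) turn_label S' (\<lambda>_. []) \<sigma>) cs))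
    = turn_sum D cs"
proof -
  have fin: "finite S'" unfolding S'_def by (rule finite_all_crossings)
  have sub: "Sc \<subseteq> S'" unfolding S'_def Sc_def using cross_emb_crossing(1) by blast
  have "Pi\<^sub>E S' (\<lambda>s. if s \<in> Sc then UNIV else {undefined}) = (Pi\<^sub>E Sc (\<lambda>_. UNIV) :: (point \<Rightarrow> ('i \<times> 'i) \<times> 'i \<times> 'i) set)"
    using sub by (auto simp: PiE_iff extensional_def split: if_splits)
  moreover have "(\<Prod>s\<in>S'. if s \<in> Sc then R_of (xtype (leftward D) s) $ \<sigma> s else 1) = (\<Prod>s\<in>Sc. R_of (xtype (leftward D) s) $ \<sigma> s)"
    for \<sigma> :: "point \<Rightarrow> ('i \<times> 'i) \<times> 'i \<times> 'i"
    using prod.inter_restrict[OF fin, of "\<lambda>s. R_of (xtype (leftward D) s) $ \<sigma> s" Sc] sub by (simp add: Int_absorb1)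
  ultimately have "(\<Sum>\<sigma>\<in>Pi\<^sub>E S' (\<lambda>s. if s \<in> Sc then UNIV else {undefined}).
      pm_scale (\<Prod>s\<in>S'. if s \<in> Sc then R_of (xtype (leftward D) s) $ \<sigma> s else 1) (gw (site_label (left_key D) turn_label S' (\<lambda>_. []) \<sigma>) cs))
    = (\<Sum>\<sigma>\<in>Pi\<^sub>E Sc (\<lambda>_. UNIV). pm_scale (\<Prod>s\<in>Sc. R_of (xtype (leftward D) s) $ \<sigma> s)
       (gw (site_label (left_key D) turn_label S' (\<lambda>_. []) \<sigma>) cs :: _ \<Rightarrow>\<^sub>0 'k))" by simp
  also have "\<dots> = turn_sum D cs"
    unfolding turn_sum_def Sc_def
  proof (rule sum_PiE_inj[OF inj_cross_emb])
    fix \<sigma> \<tau> :: "point \<Rightarrow> ('i \<times> 'i) \<times> 'i \<times> 'i"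
    assume st: "\<And>s. s \<in> all_crossings D \<Longrightarrow> \<sigma> (cross_emb s) = \<tau> s"
    have "(\<Prod>s\<in>cross_emb ` all_crossings D. R_of (xtype (leftward D) s) $ \<sigma> s) = (\<Prod>s\<in>all_crossings D. R_of (xtype D s) $ \<tau> s)"
      by (subst prod.reindex[OF inj_cross_emb]) (simp add: st cross_emb_crossing(2) cong: prod.cong)
    moreover have "words (site_label (left_key D) turn_label S' (\<lambda>_. []) \<sigma>) cs = words (\<lambda>a. turn_label (\<tau> (site a)) a) cs"
    proof (rule words_cong)
      fix a assume "a \<in> set (concat cs)"
      then have a: "a \<in> arcs D" by (simp only: cs)
      show "site_label (left_key D) turn_label S' (\<lambda>_. []) \<sigma> a = turn_label (\<tau> (site a)) a"
      proof (cases "left_key D a")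
        case None
        then show ?thesis using turn_label_plain[OF left_key_None[OF None a]] by (simp add: site_label_def)
      next
        case (Some s)
        have "s \<in> S'" unfolding S'_def by (rule left_key_crossings[OF Some a])
        moreover have "turn_label (\<sigma> s) a = turn_label (\<tau> (site a)) a"
        proof (cases "is_cross (part a)")
          case True
          then have "s = cross_emb (site a)" using left_key_cross[OF a True] Some by (simp add: cross_emb_def)
          then show ?thesis using st[OF all_crossingsI[OF a True]] by simp
        next
          case False
          then show ?thesis by (rule turn_label_const)
        qed
        ultimately show ?thesis using Some by (simp add: site_label_def)
      qed
    qed
    ultimately show "pm_scale (\<Prod>s\<in>cross_emb ` all_crossings D. R_of (xtype (leftward D) s) $ \<sigma> s) (gw (site_label (left_key D) turn_label S' (\<lambda>_. []) \<sigma>) cs)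
      = pm_scale (\<Prod>s\<in>all_crossings D. R_of (xtype D s) $ \<tau> s) (gw (\<lambda>a. turn_label (\<tau> (site a)) a) cs)"
      by (simp add: gw_def)
  qed
  finally show ?thesis .
qed

text \<open>The inverses that the labels of J take through \<open>mult_inverse\<close> are the
  explicit elements \<open>uinv\<close> and \<open>winv\<close>.\<close>

lemma arc_J_turn: "arc_J \<sigma> a = turn_label (\<sigma> (site a)) a @ theta_power winv (arc_degree a)"
  by (cases "part a" rule: unit_piece_exhaust; cases "over a")
    (simp_all add: turn_label_def curl_label_def arc_degree_def theta_power_simps strand_antipode_def mult_inverse_u mult_inverse_w)

lemma J_turn_sum:
  assumes cl: "length cl = length cs"
  shows "span_eq (tensor_rels drel cl) (J_sum D cs)
    (pm_push (map2 (@) (map (\<lambda>c. theta_power winv (rotation_degree c)) cs)) (turn_sum D cs))"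
  unfolding J_sum_def turn_sum_def pm_push_sum pm_push_scale gw_def pm_push_gen
proof (rule span_eq_sum, rule span_eq_scale, rule tensor_gen_cong)
  fix \<sigma> :: "point \<Rightarrow> ('i \<times> 'i) \<times> 'i \<times> 'i" and i assume i: "i < length cl"
  have "span_eq drel (gen (concat (map (arc_J \<sigma>) (rev (cs ! i)))))
    (gen (theta_power winv (rotation_degree (cs ! i)) @ concat (map (\<lambda>a. turn_label (\<sigma> (site a)) a) (rev (cs ! i)))))"
    by (rule theta_collect[where m=Dm, OF w_winv]) (simp only: arc_J_turn span_eq_refl)
  then have "span_eq drel (gen (words (arc_J \<sigma>) cs ! i))
    (gen (map2 (@) (map (\<lambda>c. theta_power winv (rotation_degree c)) cs) (words (\<lambda>a. turn_label (\<sigma> (site a)) a) cs) ! i))"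
    using i cl by (simp add: words_def)
  then show "span_eq (drel \<union> (if cl ! i then commutators else {})) (gen (words (arc_J \<sigma>) cs ! i))
    (gen (map2 (@) (map (\<lambda>c. theta_power winv (rotation_degree c)) cs) (words (\<lambda>a. turn_label (\<sigma> (site a)) a) cs) ! i))"
    by (rule span_eq_mono[OF _ Un_upper1])
qed (simp_all add: cl)

lemma span_eq_prefix:
  assumes "span_eq (tensor_rels (adjoin_rels m o' w C) (replicate n False)) x y" "length ts = n" "length cl = n"
  shows "span_eq (tensor_rels (adjoin_rels m o' w C) cl) (pm_push (map2 (@) ts) x) (pm_push (map2 (@) ts) y)"
  by (rule span_eq_mono[OF _ tensor_rels_mono[OF assms(3)]], rule span_eq_push[OF _ assms(1)])
    (rule pm.span_base, rule tensor_rels_prefix, assumption, rule assms(2))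

lemma J_leftward:
  assumes D: "is_diagram D" and comp: "\<And>c. c \<in> set cs \<Longrightarrow> is_component D c"
    and cs: "set (concat cs) = arcs D" "distinct (concat cs)" and cl: "length cl = length cs"
  shows "span_eq (tensor_rels drel cl) (J_sum D cs)
    (pm_push (map2 (@) (map (\<lambda>c. theta_power winv (rotation_degree c)) cs)) (J_sum (leftward D) (map (leftward_component D) cs)))"
proof -
  have "span_eq (tensor_rels drel (replicate (length cs) False)) (J_sum (leftward D) (map (leftward_component D) cs)) (turn_sum D cs)"
    unfolding turn_sum_eq[OF cs(1), symmetric]
    by (subst leftward_sum[OF D comp cs(1)], assumption, rule curl_elimination[OF cs]) simp
  from span_eq_prefix[OF span_eq_sym[OF this] _ cl] show ?thesis
    by (intro span_eq_trans[OF J_turn_sum[OF cl]]) simp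
qed

end

section \<open>Transport along \<open>\<phi>\<close>\<close>

context hopf begin

abbreviation phi_words :: "('k, 'i) double letter list \<Rightarrow> ('k, 'i) double2 letter list" where
  "phi_words \<equiv> map (map_letter (phi A))"

lemma phi_adjoin_rels:
  assumes C: "range (phi A) \<subseteq> C" and r: "r \<in> drel"
  shows "pm_push phi_words r \<in> adjoin_rels HH HHone (phi A theta2) C"
proof -
  have lin: "phi A (c *s x + y) = c *s phi A x + phi A y" for c x y
    using klin_phi unfolding klin_def by simp
  consider (1) p q c x y where "r = gen (p @ [Coeff (c *s x + y)] @ q) - pm_scale c (gen (p @ [Coeff x] @ q)) - gen (p @ [Coeff y] @ q)"
    | (2) p q x y where "r = gen (p @ [Coeff x, Coeff y] @ q) - gen (p @ [Coeff (Dm x y)] @ q)"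
    | (3) p q where "r = gen (p @ [Coeff one] @ q) - gen (p @ q)"
    | (4) p q where "r = gen (p @ [Theta, Theta] @ q) - gen (p @ [Coeff theta2] @ q)"
    | (5) p q x where "r = gen (p @ [Theta, Coeff x] @ q) - gen (p @ [Coeff x, Theta] @ q)"
    using r unfolding adjoin_rels_def by blast
  then show ?thesis
  proof cases
    case 1
    then have "pm_push phi_words r = gen (phi_words p @ [Coeff (c *s phi A x + phi A y)] @ phi_words q)
      - pm_scale c (gen (phi_words p @ [Coeff (phi A x)] @ phi_words q)) - gen (phi_words p @ [Coeff (phi A y)] @ phi_words q)"
      by (simp add: pm_push_diff pm_push_scale lin)
    then show ?thesis unfolding adjoin_rels_def by blast
  next
    case 2
    then have "pm_push phi_words r = gen (phi_words p @ [Coeff (phi A x), Coeff (phi A y)] @ phi_words q)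
      - gen (phi_words p @ [Coeff (HH (phi A x) (phi A y))] @ phi_words q)"
      by (simp add: pm_push_diff phi_mult)
    then show ?thesis unfolding adjoin_rels_def by blast
  next
    case 3
    then have "pm_push phi_words r = gen (phi_words p @ [Coeff HHone] @ phi_words q) - gen (phi_words p @ phi_words q)"
      by (simp add: pm_push_diff phi_one')
    then show ?thesis unfolding adjoin_rels_def by blast
  next
    case 4
    then have "pm_push phi_words r = gen (phi_words p @ [Theta, Theta] @ phi_words q) - gen (phi_words p @ [Coeff (phi A theta2)] @ phi_words q)"
      by (simp add: pm_push_diff)
    then show ?thesis unfolding adjoin_rels_def by blast
  next
    case 5
    then have "pm_push phi_words r = gen (phi_words p @ [Theta, Coeff (phi A x)] @ phi_words q) - gen (phi_words p @ [Coeff (phi A x), Theta] @ phi_words q)"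
      by (simp add: pm_push_diff)
    \<comment> \<open>Theta commutes in the source with every coefficient, so its image must commute
      with every value of \<phi>.\<close>
    moreover have "phi A x \<in> C" using C by blast
    ultimately show ?thesis unfolding adjoin_rels_def by blast
  qed
qed

lemma phi_tensor_rels:
  assumes C: "range (phi A) \<subseteq> C" and r: "r \<in> tensor_rels drel cl"
  shows "pm_push (map phi_words) r \<in> tensor_rels (adjoin_rels HH HHone (phi A theta2) C) cl"
proof -
  obtain ws i r0 where r0: "r = pm_push (\<lambda>v. ws[i := v]) r0" "length ws = length cl" "i < length cl"
    "r0 \<in> drel \<union> (if cl ! i then commutators else {})"
    using r unfolding tensor_rels_def by blast
  have "pm_push (map phi_words) r = pm_push (\<lambda>v. (map phi_words ws)[i := v]) (pm_push phi_words r0)"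
    unfolding r0(1) pm_push_comp map_update ..
  moreover have "pm_push phi_words r0 \<in> adjoin_rels HH HHone (phi A theta2) C \<union> (if cl ! i then commutators else {})"
  proof (cases "r0 \<in> drel")
    case True
    then show ?thesis using phi_adjoin_rels[OF C] by blast
  next
    case False
    then have c: "cl ! i" "r0 \<in> commutators" using r0(4) by (auto split: if_splits)
    then obtain p q where "r0 = gen (p @ q) - gen (q @ p)" unfolding commutators_def by blast
    then have "pm_push phi_words r0 = gen (phi_words p @ phi_words q) - gen (phi_words q @ phi_words p)"
      by (simp add: pm_push_diff)
    then have "pm_push phi_words r0 \<in> commutators" unfolding commutators_def by blast
    then show ?thesis using c(1) by simp
  qed
  moreover have "length (map phi_words ws) = length cl" using r0(2) by simp
  ultimately show ?thesis using r0(3) unfolding tensor_rels_def by blast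
qed

text \<open>Since \<phi> maps relations to relations, all representatives give the same coset, and
  the union that defines \<open>phi_tensor\<close> is this single coset.\<close>

lemma phi_tensor_class:
  assumes C: "range (phi A) \<subseteq> C"
  shows "phi_tensor A C cl (tensor_class (drinfeld_theta_rels A) cl x)
    = tensor_class (HHop_theta_rels A C) cl (pm_push (map phi_words) x)"
proof -
  have "tensor_class (HHop_theta_rels A C) cl (pm_push (map phi_words) y) = tensor_class (HHop_theta_rels A C) cl (pm_push (map phi_words) x)"
    if "y \<in> tensor_class (drinfeld_theta_rels A) cl x" for y
    unfolding tensor_class_eq_iff HHop_theta_rels_def
  proof (rule span_eq_push)
    show "pm_push (map phi_words) r \<in> pm.span (tensor_rels (adjoin_rels HH HHone (phi A theta2) C) cl)" if "r \<in> tensor_rels drel cl" for r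
      by (rule pm.span_base, rule phi_tensor_rels[OF C that])
    show "span_eq (tensor_rels drel cl) y x"
      using that unfolding tensor_class_def span_eq_def drinfeld_theta_rels_def by simp
  qed
  moreover have "x \<in> tensor_class (drinfeld_theta_rels A) cl x" unfolding tensor_class_def by (simp add: pm.span_zero)
  ultimately show ?thesis unfolding phi_tensor_def by blast
qed

text \<open>Without extrema from left to right no label involves theta or u, so only crossing labels
  have to be mapped.\<close>

lemma phi_J_sum:
  assumes cs: "set (concat cs) = arcs D"
    and LR: "\<And>a. a \<in> arcs D \<Longrightarrow> part a \<noteq> Maximum LeftRight () \<and> part a \<noteq> Minimum LeftRight ()"
  shows "pm_push (map phi_words) (J_sum D cs) = (\<Sum>\<sigma>\<in>all_crossings D \<rightarrow>\<^sub>E UNIV. pm_scale (\<Prod>s\<in>all_crossings D. R_of (xtype D s) $ \<sigma> s)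
       (gw (site_label ckey phi_label (all_crossings D) (\<lambda>_. []) \<sigma>) cs))"
proof -
  have "words (\<lambda>a. phi_words (arc_J \<sigma> a)) cs = words (site_label ckey phi_label (all_crossings D) (\<lambda>_. []) \<sigma>) cs" for \<sigma>
  proof (rule words_cong)
    fix a assume "a \<in> set (concat cs)"
    then have a: "a \<in> arcs D" by (simp only: cs)
    show "phi_words (arc_J \<sigma> a) = site_label ckey phi_label (all_crossings D) (\<lambda>_. []) \<sigma> a"
    proof (cases "is_cross (part a)")
      case True
      then show ?thesis using all_crossingsI[OF a True]
        by (cases "part a"; cases "over a") (simp_all add: site_label_def ckey_def phi_label_def strand_antipode_def)
    next
      case False
      then show ?thesis using LR[OF a] by (cases "part a" rule: unit_piece_exhaust) (simp_all add: site_label_def ckey_def)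
    qed
  qed
  then show ?thesis unfolding J_sum_def pm_push_sum pm_push_scale gw_def pm_push_gen words_map by simp
qed

lemma phi_theta_power: "phi_words (theta_power winv d) = theta_power (phi A winv) d"
  by (simp add: theta_power_def map_concat)

lemma phi_prefix: "map phi_words (map2 (@) ts ws) = map2 (@) (map phi_words ts) (map phi_words ws)"
  by (rule nth_equalityI) simp_all

lemma phi_J:
  assumes D: "is_diagram D" and cs: "ordered_components D cs" and cs': "ordered_components D cs'"
    and s: "map set cs' = map set cs" and C: "range (phi A) \<subseteq> C"
  shows "phi_tensor A C (map is_closed cs) (univ_J A D cs) = heis_J'' A C D cs'"
proof -
  let ?cl = "map is_closed cs" and ?D = "leftward D" and ?cs = "map (leftward_component D) cs'"
  let ?ts = "map (\<lambda>c. theta_power winv (rotation_degree c)) cs'"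
  have c: "is_component D c" if "c \<in> set cs" for c using cs that unfolding ordered_components_def by blast
  have c': "is_component D c" if "c \<in> set cs'" for c using cs' that unfolding ordered_components_def by blast
  have o: "set (concat cs') = arcs D" "distinct (concat cs')" using cs' unfolding ordered_components_def by auto
  have len: "length cs' = length cs" using arg_cong[OF s, of length] by simp
  note bc = base_change[OF D c c' s]
  have cl: "map is_closed cs' = ?cl" by (rule bc(1))
  \<comment> \<open>The base points change while the words carry no prefix, so that rotating a word
    is a commutator.\<close>
  have "span_eq (tensor_rels drel ?cl) (J_sum D cs) (J_sum D cs')"
    unfolding J_sum_def by (rule span_eq_sum, rule span_eq_scale, rule bc(2))
  also have "span_eq (tensor_rels drel ?cl) (J_sum D cs') (pm_push (map2 (@) ?ts) (J_sum ?D ?cs))"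
    by (rule J_leftward[OF D c' o]) (simp_all add: len)
  finally have "univ_J A D cs = tensor_class (drinfeld_theta_rels A) ?cl (pm_push (map2 (@) ?ts) (J_sum ?D ?cs))"
    unfolding univ_J_eq tensor_class_eq_iff drinfeld_theta_rels_def .
  then have "phi_tensor A C ?cl (univ_J A D cs)
    = tensor_class (HHop_theta_rels A C) ?cl (pm_push (map phi_words) (pm_push (map2 (@) ?ts) (J_sum ?D ?cs)))"
    by (simp only: phi_tensor_class[OF C])
  also have "pm_push (map phi_words) (pm_push (map2 (@) ?ts) (J_sum ?D ?cs))
    = pm_push (map2 (@) (map phi_words ?ts)) (pm_push (map phi_words) (J_sum ?D ?cs))"
    unfolding pm_push_comp phi_prefix ..
  also have "map phi_words ?ts = map (\<lambda>c. theta_power (phi A winv) (rotation_degree c)) cs'"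
    by (simp add: phi_theta_power)
  \<comment> \<open>Behind the fixed powers of theta, the image of J of the leftward diagram is
    replaced by J', modulo the algebra relations only.\<close>
  also have "tensor_class (HHop_theta_rels A C) ?cl
      (pm_push (map2 (@) (map (\<lambda>c. theta_power (phi A winv) (rotation_degree c)) cs')) (pm_push (map phi_words) (J_sum ?D ?cs)))
    = tensor_class (HHop_theta_rels A C) ?cl
      (pm_push (map2 (@) (map (\<lambda>c. theta_power (phi A winv) (rotation_degree c)) cs')) (heis_J' A ?D ?cs))"
    unfolding tensor_class_eq_iff HHop_theta_rels_def
  proof (rule span_eq_prefix)
    have set': "set (concat ?cs) = arcs ?D" "distinct (concat ?cs)" by (rule leftward_ordered[OF D cs'])+
    have comp: "is_component ?D d" if "d \<in> set ?cs" for d using that left_component(2)[OF D c'] by auto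
    show "span_eq (tensor_rels (adjoin_rels HH HHone (phi A theta2) C) (replicate (length cs) False))
       (pm_push (map phi_words) (J_sum ?D ?cs)) (heis_J' A ?D ?cs)"
      by (subst phi_J_sum[OF set'(1)], rule conjI, erule leftward_parts, erule leftward_parts, rule span_eq_sym, rule heis_J'_state_sum[OF is_diagram_leftward[OF D] comp set']) (simp_all add: len)
  qed (simp_all add: len)
  finally show ?thesis unfolding heis_J''_def mult_inverse_phi_w cl .
qed

end

theorem theorem4p1:
  fixes A :: "('k::field, 'a::ring_1, 'i::finite) hopf_data"
    and D :: "unit diagram"
    and cs cs' :: "unit arc list list"
    and C :: "('k, 'i) double2 set"
  assumes "hopf_algebra A"
    and "bij (antipode A)"
    and "is_diagram D"
    and "ordered_components D cs"
    and "ordered_components D cs'"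
    and "map set cs' = map set cs"
    and "range (phi A) \<subseteq> C"
  shows "phi_tensor A C (map is_closed cs) (univ_J A D cs) = heis_J'' A C D cs'"
proof -
  interpret hopf A by unfold_locales fact+
  show ?thesis by (rule phi_J) fact+
qed

end
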